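(* Let $n$ be a non-negative integer. Let $A = \Bbbk Q_A/I_A$ and $B = \Bbbk Q_B/I_B$ be finite dimensional algebras, and let $C = \Bbbk Q_C/I_C$ be a finite dimensional algebra satisfying the following conditions: (1) $(Q_C)_0 = (Q_A)_0 \cup (Q_B)_0$ (disjoint union); (2) $(Q_C)_1 = (Q_A)_1 \cup (Q_B)_1 \cup \{\alpha_j\}_{j\in J} \cup \{\beta_k\}_{k\in K}$ (disjoint union), where each arrow $\alpha_j$ starts at a vertex of $Q_A$ and ends at a vertex of $Q_B$, and each arrow $\beta_k$ starts at a vertex of $Q_B$ and ends at a vertex of $Q_A$; (3) $I_C$ equals the ideal of $\Bbbk Q_C$ generated by $I_A$, $I_B$, all $\alpha\alpha_j$ and $\beta\beta_k$ with $\alpha\in (Q_A)_1$, $\beta\in (Q_B)_1$, and all $\alpha_j\beta_k$ and $\beta_k\alpha_j$, with $j\in J$, $k\in K$. If $A^{op}$ and $B^{op}$ are $n$-Igusa-Todorov algebras, then $C^{op}$ is an $(n+1)$-Igusa-Todorov algebra. Likewise, if $A^{op}$ and $B^{op}$ are $n$-LIT algebras, then $C^{op}$ is an $(n+1)$-LIT algebra.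
   Context: $\Bbbk$ is a field; quivers are finite and connected; $I_A, I_B, I_C$ are admissible ideals (an ideal $I$ of $\Bbbk Q$ is admissible if $J_Q^m\subset I\subset J_Q^2$ for some $m\ge 2$, $J_Q$ being the ideal generated by the arrows). Paths are composed from left to right. For an algebra $\Lambda$, $\Lambda^{op}$ is the opposite algebra, $\mathrm{mod}\,\Lambda$ is the category of finitely generated right $\Lambda$-modules (identified for a bound quiver algebra $\Bbbk Q/I$ with finite dimensional representations of $Q$ bound by $I$), and $\Omega(M)$ is the syzygy of $M$ (kernel of the projective cover). For a class $\mathcal{C}$ of modules, $\mathrm{add}\,\mathcal{C}$ is the full subcategory of finite direct sums of direct summands of modules in $\mathcal{C}$. $K_0(\Lambda)$ is the abelian group generated by the symbols $[M]$, $M\in\mathrm{mod}\,\Lambda$, modulo the relations $[M]=[M']+[M'']$ if $M\cong M'\oplus M''$ and $[P]=0$ for $P$ projective. $\langle\mathrm{add}\,M\rangle$ is the subgroup generated by the classes of indecomposable summands of $M$. $\bar\Omega:K_0(\Lambda)\to K_0(\Lambda)$ is the endomorphism $\bar\Omega([M])=[\Omega(M)]$. The Igusa-Todorov function is $\phi(M)=\min\{k\ge 0: \bar\Omega \text{ restricted to } \bar\Omega^m(\langle \mathrm{add}\,M\rangle) \text{ is injective for all } m\ge k\}$, and $\phi\dim(\mathcal{D})=\sup\{\phi(M): M\in\mathcal{D}\}$. A $0$-Igusa-Todorov subcategory of $\mathrm{mod}\,\Lambda$ is a subcategory $\mathcal{D}$ with $\mathcal{D}=\mathrm{add}(\mathcal{D})$,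 $\Omega(\mathcal{D})\subset\mathcal{D}$ and $\phi\dim(\mathcal{D})=0$. $\Lambda$ is an $n$-LIT (Lat-Igusa-Todorov) algebra if there are a $0$-Igusa-Todorov subcategory $\mathcal{D}\subset \mathrm{mod}\,\Lambda$ and a module $V\in\mathrm{mod}\,\Lambda$ such that every $M\in\mathrm{mod}\,\Lambda$ admits an exact sequence $0\to V_1\oplus D_1\to V_0\oplus D_0\to\Omega^n(M)\to 0$ with $V_0,V_1\in\mathrm{add}(V)$ and $D_0,D_1\in\mathcal{D}$. It is $n$-Igusa-Todorov if this holds with $\mathcal{D}=\{0\}$. *)

theory Defs
  imports
    "HOL-Algebra.Algebra"
    "HOL-Algebra.Free_Abelian_Groups"
    "HOL-Library.Extended_Nat"
    "Graph_Theory.Graph_Theory"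
begin

section \<open>Bound quiver algebras\<close>

text \<open>A quiver is a directed multigraph. A path is a pair of its initial vertex and its list of
  arrows, so \<open>(v, [])\<close> is the trivial path at \<open>v\<close>. An element of the path algebra is a finitely
  supported function from paths to the field. Paths of a subquiver are therefore paths of the larger
  quiver, and elements of its path algebra are elements of the larger path algebra.\<close>

type_synonym ('v, 'e) quiver = "('v, 'e) pre_digraph"
type_synonym ('v, 'e) qpath = "'v \<times> 'e list"
type_synonym ('v, 'e, 'k) qelem = "('v, 'e) qpath \<Rightarrow>\<^sub>0 'k"

definition qpaths :: "('v, 'e) quiver \<Rightarrow> ('v, 'e) qpath set" where
  "qpaths Q = {(u, p) | u p. \<exists>v. pre_digraph.awalk Q u p v}"

definition qpath_end :: "('v, 'e) quiver \<Rightarrow> ('v, 'e) qpath \<Rightarrow> 'v" where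
  "qpath_end Q p = pre_digraph.awlast Q (fst p) (snd p)"

definition path_algebra :: "('v, 'e) quiver \<Rightarrow> ('v, 'e, 'k::field) qelem ring" where
  "path_algebra Q =
    \<lparr>carrier = {f. Poly_Mapping.keys f \<subseteq> qpaths Q},
     monoid.mult = (\<lambda>f g. \<Sum>p\<in>Poly_Mapping.keys f. \<Sum>q\<in>Poly_Mapping.keys g.
       if qpath_end Q p = fst q
       then Poly_Mapping.single (fst p, snd p @ snd q)
              (Poly_Mapping.lookup f p * Poly_Mapping.lookup g q)
       else 0),
     one = (\<Sum>v\<in>verts Q. Poly_Mapping.single (v, []) 1),
     ring.zero = 0,
     add = (+)\<rparr>"

definition arrow :: "('v, 'e) quiver \<Rightarrow> 'e \<Rightarrow> ('v, 'e, 'k::field) qelem" where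
  "arrow Q a = Poly_Mapping.single (tail Q a, [a]) 1"

definition arrow_ideal :: "('v, 'e) quiver \<Rightarrow> ('v, 'e, 'k::field) qelem set" where
  "arrow_ideal Q = Idl\<^bsub>path_algebra Q\<^esub> (arrow Q ` arcs Q)"

definition admissible :: "('v, 'e) quiver \<Rightarrow> ('v, 'e, 'k::field) qelem set \<Rightarrow> bool" where
  "admissible Q I \<longleftrightarrow> ideal I (path_algebra Q) \<and>
    (\<exists>m::nat. m \<ge> 2 \<and>
      arrow_ideal Q [^]\<^bsub>ideals_set (path_algebra Q)\<^esub> m \<subseteq> I \<and>
      I \<subseteq> arrow_ideal Q [^]\<^bsub>ideals_set (path_algebra Q)\<^esub> (2::nat))"

text \<open>That \<^const>\<open>path_algebra\<close> of a finite quiver is a ring is proved at the end of this theory.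
  \<^const>\<open>connected\<close> is connectedness of the underlying undirected graph (and includes that there
  is at least one vertex).\<close>

definition bound_quiver :: "('v, 'e) quiver \<Rightarrow> ('v, 'e, 'k::field) qelem set \<Rightarrow> bool" where
  "bound_quiver Q I \<longleftrightarrow> fin_digraph Q \<and> connected Q \<and> admissible Q I"

definition bound_quiver_algebra ::
  "('v, 'e) quiver \<Rightarrow> ('v, 'e, 'k::field) qelem set \<Rightarrow> ('v, 'e, 'k) qelem set ring" where
  "bound_quiver_algebra Q I = path_algebra Q Quot I"

definition op_ring :: "'a ring \<Rightarrow> 'a ring" where
  "op_ring R = R\<lparr>monoid.mult := (\<lambda>x y. y \<otimes>\<^bsub>R\<^esub> x)\<rparr>"


section \<open>Finitely generated right modules\<close>

text \<open>The record of \<^theory>\<open>HOL-Algebra.Module\<close> is reused for right modules over a ring that need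
  not be commutative: \<open>r \<odot>\<^bsub>M\<^esub> x\<close> stands for \<open>x r\<close>. The fields \<^const>\<open>monoid.mult\<close> and \<^const>\<open>one\<close> of the
  record carry no information.\<close>

locale right_module = R?: ring R + M?: abelian_group M
  for R :: "'a ring" (structure) and M :: "('a, 'm) module" (structure) +
  assumes act_closed: "\<lbrakk>r \<in> carrier R; x \<in> carrier M\<rbrakk> \<Longrightarrow> r \<odot>\<^bsub>M\<^esub> x \<in> carrier M"
    and act_add_ring: "\<lbrakk>r \<in> carrier R; s \<in> carrier R; x \<in> carrier M\<rbrakk> \<Longrightarrow>
      (r \<oplus>\<^bsub>R\<^esub> s) \<odot>\<^bsub>M\<^esub> x = r \<odot>\<^bsub>M\<^esub> x \<oplus>\<^bsub>M\<^esub> s \<odot>\<^bsub>M\<^esub> x"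
    and act_add_module: "\<lbrakk>r \<in> carrier R; x \<in> carrier M; y \<in> carrier M\<rbrakk> \<Longrightarrow>
      r \<odot>\<^bsub>M\<^esub> (x \<oplus>\<^bsub>M\<^esub> y) = r \<odot>\<^bsub>M\<^esub> x \<oplus>\<^bsub>M\<^esub> r \<odot>\<^bsub>M\<^esub> y"
    and act_mult: "\<lbrakk>r \<in> carrier R; s \<in> carrier R; x \<in> carrier M\<rbrakk> \<Longrightarrow>
      (r \<otimes>\<^bsub>R\<^esub> s) \<odot>\<^bsub>M\<^esub> x = s \<odot>\<^bsub>M\<^esub> (r \<odot>\<^bsub>M\<^esub> x)"
    and act_one: "x \<in> carrier M \<Longrightarrow> \<one>\<^bsub>R\<^esub> \<odot>\<^bsub>M\<^esub> x = x"

definition submod :: "'a ring \<Rightarrow> 'm set \<Rightarrow> ('a, 'm) module \<Rightarrow> bool" where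
  "submod R N M \<longleftrightarrow> additive_subgroup N M \<and> (\<forall>r\<in>carrier R. \<forall>x\<in>N. r \<odot>\<^bsub>M\<^esub> x \<in> N)"

definition fin_gen :: "'a ring \<Rightarrow> ('a, 'm) module \<Rightarrow> bool" where
  "fin_gen R M \<longleftrightarrow>
    (\<exists>S. finite S \<and> S \<subseteq> carrier M \<and> (\<forall>N. submod R N M \<and> S \<subseteq> N \<longrightarrow> N = carrier M))"

definition mod_hom :: "'a ring \<Rightarrow> ('a, 'm) module \<Rightarrow> ('a, 'n) module \<Rightarrow> ('m \<Rightarrow> 'n) set" where
  "mod_hom R M N = {f. f ` carrier M \<subseteq> carrier N \<and>
    (\<forall>x\<in>carrier M. \<forall>y\<in>carrier M. f (x \<oplus>\<^bsub>M\<^esub> y) = f x \<oplus>\<^bsub>N\<^esub> f y) \<and>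
    (\<forall>r\<in>carrier R. \<forall>x\<in>carrier M. f (r \<odot>\<^bsub>M\<^esub> x) = r \<odot>\<^bsub>N\<^esub> f x)}"

definition mod_iso :: "'a ring \<Rightarrow> ('a, 'm) module \<Rightarrow> ('a, 'n) module \<Rightarrow> bool" where
  "mod_iso R M N \<longleftrightarrow> (\<exists>f\<in>mod_hom R M N. bij_betw f (carrier M) (carrier N))"

definition dsum :: "('a, 'm) module \<Rightarrow> ('a, 'n) module \<Rightarrow> ('a, 'm \<times> 'n) module" where
  "dsum M N =
    \<lparr>carrier = carrier M \<times> carrier N,
     monoid.mult = undefined,
     one = undefined,
     ring.zero = (\<zero>\<^bsub>M\<^esub>, \<zero>\<^bsub>N\<^esub>),
     add = (\<lambda>(x, y) (x', y'). (x \<oplus>\<^bsub>M\<^esub> x', y \<oplus>\<^bsub>N\<^esub> y')),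
     smult = (\<lambda>r (x, y). (r \<odot>\<^bsub>M\<^esub> x, r \<odot>\<^bsub>N\<^esub> y))\<rparr>"

definition dsum_family :: "nat \<Rightarrow> (nat \<Rightarrow> ('a, 'm) module) \<Rightarrow> ('a, nat \<Rightarrow> 'm) module" where
  "dsum_family n N =
    \<lparr>carrier = (\<Pi>\<^sub>E i\<in>{..<n}. carrier (N i)),
     monoid.mult = undefined,
     one = undefined,
     ring.zero = (\<lambda>i\<in>{..<n}. \<zero>\<^bsub>N i\<^esub>),
     add = (\<lambda>x y. \<lambda>i\<in>{..<n}. x i \<oplus>\<^bsub>N i\<^esub> y i),
     smult = (\<lambda>r x. \<lambda>i\<in>{..<n}. r \<odot>\<^bsub>N i\<^esub> x i)\<rparr>"

text \<open>The objects of the category of finitely generated right modules over \<open>R\<close>. To form this class, the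
  elements of the modules have to be taken from one type. Lists over the elements of \<open>R\<close> suffice,
  because an element of a module with \<open>n\<close> generators can be named by a list of \<open>n\<close> coefficients; the
  lemma \<open>fg_modules_universal\<close> below shows that no finitely generated module, over whatever type,
  is lost up to isomorphism.\<close>

definition fg_modules :: "'a ring \<Rightarrow> ('a, 'a list) module set" where
  "fg_modules R = {M. right_module R M \<and> fin_gen R M}"

text \<open>A full subcategory is given by its class of objects.\<close>

definition zero_modules :: "'a ring \<Rightarrow> ('a, 'a list) module set" where
  "zero_modules R = {M \<in> fg_modules R. carrier M = {\<zero>\<^bsub>M\<^esub>}}"

definition dir_summand :: "'a ring \<Rightarrow> ('a, 'a list) module \<Rightarrow> ('a, 'a list) module \<Rightarrow> bool" where
  "dir_summand R N M \<longleftrightarrow>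
    N \<in> fg_modules R \<and> (\<exists>N'\<in>fg_modules R. mod_iso R M (dsum N N'))"

definition indecomposable :: "'a ring \<Rightarrow> ('a, 'a list) module \<Rightarrow> bool" where
  "indecomposable R M \<longleftrightarrow> M \<in> fg_modules R \<and> M \<notin> zero_modules R \<and>
    (\<forall>N\<in>fg_modules R. \<forall>N'\<in>fg_modules R. mod_iso R M (dsum N N') \<longrightarrow>
      N \<in> zero_modules R \<or> N' \<in> zero_modules R)"

definition add_closure ::
  "'a ring \<Rightarrow> ('a, 'a list) module set \<Rightarrow> ('a, 'a list) module set" where
  "add_closure R C = {M \<in> fg_modules R. \<exists>n N.
    (\<forall>i<n. \<exists>Y\<in>C. dir_summand R (N i) Y) \<and> mod_iso R M (dsum_family n N)}"

definition short_exact :: "'a ring \<Rightarrow> ('a, 'l) module \<Rightarrow> ('a, 'm) module \<Rightarrow> ('a, 'n) module \<Rightarrow>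
    ('l \<Rightarrow> 'm) \<Rightarrow> ('m \<Rightarrow> 'n) \<Rightarrow> bool" where
  "short_exact R L M N f g \<longleftrightarrow> f \<in> mod_hom R L M \<and> g \<in> mod_hom R M N \<and>
    inj_on f (carrier L) \<and> f ` carrier L = a_kernel M N g \<and> g ` carrier M = carrier N"

definition projective :: "'a ring \<Rightarrow> ('a, 'a list) module \<Rightarrow> bool" where
  "projective R P \<longleftrightarrow> P \<in> fg_modules R \<and>
    (\<forall>M\<in>fg_modules R. \<forall>N\<in>fg_modules R. \<forall>g\<in>mod_hom R M N. \<forall>h\<in>mod_hom R P N.
      g ` carrier M = carrier N \<longrightarrow>
      (\<exists>h'\<in>mod_hom R P M. \<forall>x\<in>carrier P. g (h' x) = h x))"

definition superfluous :: "'a ring \<Rightarrow> 'm set \<Rightarrow> ('a, 'm) module \<Rightarrow> bool" where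
  "superfluous R K P \<longleftrightarrow> submod R K P \<and>
    (\<forall>L. submod R L P \<and> K <+>\<^bsub>P\<^esub> L = carrier P \<longrightarrow> L = carrier P)"

definition projective_cover :: "'a ring \<Rightarrow> ('a, 'a list) module \<Rightarrow> ('a, 'a list) module \<Rightarrow>
    ('a list \<Rightarrow> 'a list) \<Rightarrow> bool" where
  "projective_cover R M P f \<longleftrightarrow> projective R P \<and> f \<in> mod_hom R P M \<and>
    f ` carrier P = carrier M \<and> superfluous R (a_kernel P M f) P"

text \<open>The projective cover of a finitely generated module over a finite dimensional algebra exists and
  is unique up to isomorphism; one is chosen.\<close>

definition syzygy :: "'a ring \<Rightarrow> ('a, 'a list) module \<Rightarrow> ('a, 'a list) module" where
  "syzygy R M =
    (SOME K. \<exists>P f. projective_cover R M P f \<and> K = P\<lparr>carrier := a_kernel P M f\<rparr>)"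


section \<open>The Igusa--Todorov function\<close>

definition K0_relations :: "'a ring \<Rightarrow> (('a, 'a list) module \<Rightarrow>\<^sub>0 int) set" where
  "K0_relations R =
    {frag_of M - (frag_of M' + frag_of M'') | M M' M''.
      M \<in> fg_modules R \<and> M' \<in> fg_modules R \<and> M'' \<in> fg_modules R \<and> mod_iso R M (dsum M' M'')} \<union>
    {frag_of P | P. projective R P}"

definition K0 :: "'a ring \<Rightarrow> (('a, 'a list) module \<Rightarrow>\<^sub>0 int) set monoid" where
  "K0 R = free_Abelian_group (fg_modules R) Mod
    generate (free_Abelian_group (fg_modules R)) (K0_relations R)"

definition K0_class :: "'a ring \<Rightarrow> ('a, 'a list) module \<Rightarrow> (('a, 'a list) module \<Rightarrow>\<^sub>0 int) set" where
  "K0_class R M = generate (free_Abelian_group (fg_modules R)) (K0_relations R)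
    #>\<^bsub>free_Abelian_group (fg_modules R)\<^esub> frag_of M"

text \<open>An endomorphism of \<^const>\<open>K0\<close> is determined on the carrier by its values on the classes of
  modules; its values off the carrier are irrelevant.\<close>

definition Omega_bar :: "'a ring \<Rightarrow> (('a, 'a list) module \<Rightarrow>\<^sub>0 int) set \<Rightarrow>
    (('a, 'a list) module \<Rightarrow>\<^sub>0 int) set" where
  "Omega_bar R = (SOME h. h \<in> hom (K0 R) (K0 R) \<and>
    (\<forall>M\<in>fg_modules R. h (K0_class R M) = K0_class R (syzygy R M)))"

definition add_subgroup :: "'a ring \<Rightarrow> ('a, 'a list) module \<Rightarrow>
    (('a, 'a list) module \<Rightarrow>\<^sub>0 int) set set" where
  "add_subgroup R M =
    generate (K0 R) {K0_class R N | N. indecomposable R N \<and> dir_summand R N M}"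

text \<open>Over a finite dimensional algebra the set below is nonempty, so that the infimum is a minimum
  and finite.\<close>

definition IT_phi :: "'a ring \<Rightarrow> ('a, 'a list) module \<Rightarrow> enat" where
  "IT_phi R M = Inf {enat k | k. \<forall>m\<ge>k. inj_on (Omega_bar R) ((Omega_bar R ^^ m) ` add_subgroup R M)}"

definition IT_phi_dim :: "'a ring \<Rightarrow> ('a, 'a list) module set \<Rightarrow> enat" where
  "IT_phi_dim R D = (SUP M\<in>D. IT_phi R M)"


section \<open>Igusa--Todorov and Lat--Igusa--Todorov algebras\<close>

definition zero_IT_subcategory :: "'a ring \<Rightarrow> ('a, 'a list) module set \<Rightarrow> bool" where
  "zero_IT_subcategory R D \<longleftrightarrow> D \<subseteq> fg_modules R \<and> D = add_closure R D \<and>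
    syzygy R ` D \<subseteq> D \<and> IT_phi_dim R D = 0"

definition syzygies_resolved_by :: "nat \<Rightarrow> 'a ring \<Rightarrow> ('a, 'a list) module set \<Rightarrow> bool" where
  "syzygies_resolved_by n R D \<longleftrightarrow> (\<exists>V\<in>fg_modules R. \<forall>M\<in>fg_modules R.
    \<exists>V0\<in>add_closure R {V}. \<exists>V1\<in>add_closure R {V}. \<exists>D0\<in>D. \<exists>D1\<in>D. \<exists>f g.
      short_exact R (dsum V1 D1) (dsum V0 D0) ((syzygy R ^^ n) M) f g)"

definition n_LIT :: "nat \<Rightarrow> 'a ring \<Rightarrow> bool" where
  "n_LIT n R \<longleftrightarrow> (\<exists>D. zero_IT_subcategory R D \<and> syzygies_resolved_by n R D)"

definition n_Igusa_Todorov :: "nat \<Rightarrow> 'a ring \<Rightarrow> bool" where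
  "n_Igusa_Todorov n R \<longleftrightarrow> syzygies_resolved_by n R (zero_modules R)"


section \<open>Adequacy of the encodings\<close>

lemma path_algebra_sum_mono: "(f :: 'a \<Rightarrow>\<^sub>0 'b::comm_monoid_add) = (\<Sum>p\<in>Poly_Mapping.keys f. Poly_Mapping.single p (Poly_Mapping.lookup f p))"
proof (rule poly_mapping_eqI)
  fix k
  show "Poly_Mapping.lookup f k = Poly_Mapping.lookup (\<Sum>p\<in>Poly_Mapping.keys f. Poly_Mapping.single p (Poly_Mapping.lookup f p)) k"
    by (auto simp: lookup_sum lookup_single when_def sum.delta not_in_keys_iff_lookup_eq_zero)
qed

lemma path_algebra_induct:
  assumes "P 0" "\<And>p c. p \<in> Poly_Mapping.keys f \<Longrightarrow> P (Poly_Mapping.single p c)" "\<And>a b. P a \<Longrightarrow> P b \<Longrightarrow> P (a + b)"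
  shows "P (f :: 'a \<Rightarrow>\<^sub>0 'b::comm_monoid_add)"
proof -
  have "finite A \<Longrightarrow> A \<subseteq> Poly_Mapping.keys f \<Longrightarrow> P (\<Sum>p\<in>A. Poly_Mapping.single p (Poly_Mapping.lookup f p))" for A
    by (induction A rule: finite_induct) (auto intro: assms)
  then show ?thesis using path_algebra_sum_mono[of f] by (metis finite_keys order_refl)
qed

definition path_term where
  "path_term Q p q x = (if qpath_end Q p = fst q then Poly_Mapping.single (fst p, snd p @ snd q) x else 0)"

lemma path_algebra_mult_sup:
  assumes "finite S" "finite T" "Poly_Mapping.keys f \<subseteq> S" "Poly_Mapping.keys g \<subseteq> T"
  shows "f \<otimes>\<^bsub>path_algebra Q\<^esub> g = (\<Sum>p\<in>S. \<Sum>q\<in>T. path_term Q p q (Poly_Mapping.lookup f p * Poly_Mapping.lookup g q))"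
proof -
  have "(\<Sum>p\<in>S. \<Sum>q\<in>T. path_term Q p q (Poly_Mapping.lookup f p * Poly_Mapping.lookup g q))
     = (\<Sum>p\<in>Poly_Mapping.keys f. \<Sum>q\<in>T. path_term Q p q (Poly_Mapping.lookup f p * Poly_Mapping.lookup g q))"
    by (rule sum.mono_neutral_right)
       (use assms in \<open>auto simp: not_in_keys_iff_lookup_eq_zero path_term_def intro!: sum.neutral\<close>)
  also have "\<dots> = (\<Sum>p\<in>Poly_Mapping.keys f. \<Sum>q\<in>Poly_Mapping.keys g. path_term Q p q (Poly_Mapping.lookup f p * Poly_Mapping.lookup g q))"
    by (rule sum.cong[OF refl], rule sum.mono_neutral_right) (use assms in \<open>auto simp: not_in_keys_iff_lookup_eq_zero path_term_def\<close>)
  finally show ?thesis by (simp add: path_algebra_def path_term_def)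
qed

lemma path_term_add: "path_term Q p q (x + y) = path_term Q p q x + path_term Q p q y"
  by (simp add: path_term_def single_add)

lemma path_algebra_distl: "(f + g) \<otimes>\<^bsub>path_algebra Q\<^esub> h = f \<otimes>\<^bsub>path_algebra Q\<^esub> h + g \<otimes>\<^bsub>path_algebra Q\<^esub> h"
proof -
  let ?S = "Poly_Mapping.keys f \<union> Poly_Mapping.keys g"
  have "Poly_Mapping.keys (f + g) \<subseteq> ?S" by (rule Poly_Mapping.keys_add)
  then show ?thesis
    by (subst (1 2 3) path_algebra_mult_sup[of ?S "Poly_Mapping.keys h"])
       (auto simp: lookup_add distrib_right path_term_add sum.distrib)
qed

lemma path_algebra_distr: "h \<otimes>\<^bsub>path_algebra Q\<^esub> (f + g) = h \<otimes>\<^bsub>path_algebra Q\<^esub> f + h \<otimes>\<^bsub>path_algebra Q\<^esub> g"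
proof -
  let ?S = "Poly_Mapping.keys f \<union> Poly_Mapping.keys g"
  have "Poly_Mapping.keys (f + g) \<subseteq> ?S" by (rule Poly_Mapping.keys_add)
  then show ?thesis
    by (subst (1 2 3) path_algebra_mult_sup[of "Poly_Mapping.keys h" ?S])
       (auto simp: lookup_add distrib_left path_term_add sum.distrib)
qed

lemma path_algebra_zero: "0 \<otimes>\<^bsub>path_algebra Q\<^esub> h = 0" "h \<otimes>\<^bsub>path_algebra Q\<^esub> 0 = 0"
  by (simp_all add: path_algebra_def)

lemma path_algebra_single: "Poly_Mapping.single p c \<otimes>\<^bsub>path_algebra Q\<^esub> Poly_Mapping.single q d = path_term Q p q (c * d)"
  by (subst path_algebra_mult_sup[of "{p}" "{q}"]) auto

lemma path_algebra_end_append: "qpath_end Q (u, p @ q) = qpath_end Q (qpath_end Q (u, p), q)"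
proof -
  have ne: "pre_digraph.awalk_verts Q u p \<noteq> []" for u p
    by (cases p) (auto simp: pre_digraph.awalk_verts.simps)
  show ?thesis
  unfolding qpath_end_def by (induction p arbitrary: u) (auto simp: pre_digraph.awalk_verts.simps ne)
qed

lemma path_algebra_assoc: "(f \<otimes>\<^bsub>path_algebra Q\<^esub> g) \<otimes>\<^bsub>path_algebra Q\<^esub> h = f \<otimes>\<^bsub>path_algebra Q\<^esub> (g \<otimes>\<^bsub>path_algebra Q\<^esub> h)"
proof (induction f rule: path_algebra_induct)
  case (2 p c)
  show ?case
  proof (induction g rule: path_algebra_induct)
    case (2 q d)
    show ?case
    proof (induction h rule: path_algebra_induct)
      case (2 r e)
      obtain p1 p2 where p: "p = (p1, p2)" by (cases p)
      obtain q1 q2 where q: "q = (q1, q2)" by (cases q)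
      obtain r1 r2 where r: "r = (r1, r2)" by (cases r)
      show ?case unfolding p q r
        by (auto simp: path_algebra_single path_term_def path_algebra_end_append mult.assoc path_algebra_zero)
    qed (simp_all add: path_algebra_zero path_algebra_distr)
  qed (simp_all add: path_algebra_zero path_algebra_distl path_algebra_distr)
qed (simp_all add: path_algebra_zero path_algebra_distl)

lemma path_algebra_path_append:
  assumes "p \<in> qpaths Q" "q \<in> qpaths Q" "qpath_end Q p = fst q" "wf_digraph Q"
  shows "(fst p, snd p @ snd q) \<in> qpaths Q"
proof -
  interpret wf_digraph Q by fact
  obtain v where v: "awalk (fst p) (snd p) v" using assms(1) by (auto simp: qpaths_def)
  obtain w where w: "awalk (fst q) (snd q) w" using assms(2) by (auto simp: qpaths_def)
  have "v = fst q" using v assms(3) by (auto simp: qpath_end_def)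
  then have "awalk (fst p) (snd p @ snd q) w" using v w by (simp add: awalk_appendI)
  then show ?thesis by (auto simp: qpaths_def)
qed

lemma path_algebra_ring:
  assumes "fin_digraph Q"
  shows "ring (path_algebra Q :: ('v, 'e, 'k::field) qelem ring)"
proof -
  interpret fin_digraph Q by fact
  let ?R = "path_algebra Q :: ('v, 'e, 'k::field) qelem ring"
  have c: "carrier ?R = {f. Poly_Mapping.keys f \<subseteq> qpaths Q}" and a: "add ?R = (+)" and z: "\<zero>\<^bsub>?R\<^esub> = 0"
    by (simp_all add: path_algebra_def)
  have trivial_path: "(v, []) \<in> qpaths Q" if "v \<in> verts Q" for v
    using that by (auto simp: qpaths_def awalk_Nil_iff)
  have one_sum: "\<one>\<^bsub>?R\<^esub> = (\<Sum>v\<in>verts Q. Poly_Mapping.single (v, []) 1)" by (simp add: path_algebra_def)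
  have suml: "(\<Sum>v\<in>V. F v) \<otimes>\<^bsub>?R\<^esub> x = (\<Sum>v\<in>V. F v \<otimes>\<^bsub>?R\<^esub> x)" if "finite V" for V F and x :: "('v,'e,'k) qelem"
    using that by (induction V rule: finite_induct) (simp_all add: path_algebra_zero path_algebra_distl)
  have sumr: "x \<otimes>\<^bsub>?R\<^esub> (\<Sum>v\<in>V. F v) = (\<Sum>v\<in>V. x \<otimes>\<^bsub>?R\<^esub> F v)" if "finite V" for V F and x :: "('v,'e,'k) qelem"
    using that by (induction V rule: finite_induct) (simp_all add: path_algebra_zero path_algebra_distr)
  have start: "fst p \<in> verts Q" "qpath_end Q p \<in> verts Q" if "p \<in> qpaths Q" for p
    using that by (auto simp: qpaths_def qpath_end_def dest: awalk_last_in_verts)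
  have e1: "qpath_end Q (v, []) = v" for v by (simp add: qpath_end_def pre_digraph.awalk_verts.simps)
  have l1: "\<one>\<^bsub>?R\<^esub> \<otimes>\<^bsub>?R\<^esub> x = x" if "x \<in> carrier ?R" for x
  proof (induction x rule: path_algebra_induct)
    case (2 p c)
    then have "fst p \<in> verts Q" using that start c by blast
    then show ?case
      by (simp add: one_sum suml path_algebra_single path_term_def e1 sum.delta)
  qed (simp_all add: path_algebra_zero path_algebra_distr)
  have r1: "x \<otimes>\<^bsub>?R\<^esub> \<one>\<^bsub>?R\<^esub> = x" if "x \<in> carrier ?R" for x
  proof (induction x rule: path_algebra_induct)
    case (2 p c)
    then have "qpath_end Q p \<in> verts Q" using that start c by blast
    then show ?case
      by (simp add: one_sum sumr path_algebra_single path_term_def sum.delta')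
  qed (simp_all add: path_algebra_zero path_algebra_distl)
  show ?thesis
  proof (rule ringI)
    show "abelian_group ?R"
    proof (rule abelian_groupI)
      show "\<exists>y\<in>carrier ?R. y \<oplus>\<^bsub>?R\<^esub> x = \<zero>\<^bsub>?R\<^esub>" if "x \<in> carrier ?R" for x
        using that by (intro bexI[of _ "-x"]) (auto simp: c a z)
      show "x \<oplus>\<^bsub>?R\<^esub> y \<in> carrier ?R" if "x \<in> carrier ?R" "y \<in> carrier ?R" for x y
        using that Poly_Mapping.keys_add[of x y] by (auto simp: c a)
    qed (auto simp: c a z algebra_simps)
    show "monoid ?R"
    proof (rule monoidI)
      fix x y assume "x \<in> carrier ?R" "y \<in> carrier ?R"
      then have k: "Poly_Mapping.keys x \<subseteq> qpaths Q" "Poly_Mapping.keys y \<subseteq> qpaths Q" by (auto simp: c)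
      have "Poly_Mapping.keys (path_term Q p q d) \<subseteq> qpaths Q"
        if "p \<in> qpaths Q" "q \<in> qpaths Q" for p q and d :: 'k
        using path_algebra_path_append[OF that] wf_digraph by (auto simp: path_term_def split: if_splits)
      then have "Poly_Mapping.keys (x \<otimes>\<^bsub>?R\<^esub> y) \<subseteq> qpaths Q"
        unfolding path_algebra_mult_sup[OF finite_keys finite_keys order_refl order_refl]
        using k by (intro order_trans[OF keys_sum] UN_least) blast
      then show "x \<otimes>\<^bsub>?R\<^esub> y \<in> carrier ?R" by (simp add: c)
    next
      have "Poly_Mapping.keys (\<one>\<^bsub>?R\<^esub>) \<subseteq> qpaths Q" unfolding one_sum
        by (intro order_trans[OF keys_sum] UN_least) (auto simp: trivial_path)
      then show "\<one>\<^bsub>?R\<^esub> \<in> carrier ?R" by (simp add: c)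
    qed (simp_all add: path_algebra_assoc l1 r1)
  qed (simp_all add: a path_algebra_distl path_algebra_distr)
qed

lemma fg_modules_universal:
  fixes M :: "('a, 'm) module"
  assumes "right_module R M" "fin_gen R M"
  shows "\<exists>N\<in>fg_modules R. mod_iso R M N"
proof -
  interpret right_module R M by fact
  obtain S where S: "finite S" "S \<subseteq> carrier M" "\<And>N. submod R N M \<Longrightarrow> S \<subseteq> N \<Longrightarrow> N = carrier M"
    using assms(2) unfolding fin_gen_def by metis
  obtain ss where ss: "set ss = S" using finite_list[OF S(1)] by blast
  define ev where "ev = (\<lambda>ss rs. foldr (\<lambda>(s, r) y. (r \<odot>\<^bsub>M\<^esub> s) \<oplus>\<^bsub>M\<^esub> y) (zip ss rs) \<zero>\<^bsub>M\<^esub>)"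
  define Sp where "Sp = (\<lambda>ss. {ev ss rs | rs. length rs = length ss \<and> set rs \<subseteq> carrier R})"
  have ev_closed: "ev ss rs \<in> carrier M" if "set ss \<subseteq> carrier M" "set rs \<subseteq> carrier R" for ss rs
    using that
  proof (induction ss arbitrary: rs)
    case (Cons s ss) then show ?case by (cases rs) (auto simp: ev_def act_closed)
  qed (simp add: ev_def)
  have zero_act: "\<zero>\<^bsub>R\<^esub> \<odot>\<^bsub>M\<^esub> x = \<zero>\<^bsub>M\<^esub>" if "x \<in> carrier M" for x
    using act_add_ring[of "\<zero>\<^bsub>R\<^esub>" "\<zero>\<^bsub>R\<^esub>" x] that act_closed[of "\<zero>\<^bsub>R\<^esub>" x]
    by (metis M.add.r_cancel_one R.add.l_one R.zero_closed)
  have act_zero: "r \<odot>\<^bsub>M\<^esub> \<zero>\<^bsub>M\<^esub> = \<zero>\<^bsub>M\<^esub>" if "r \<in> carrier R" for r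
    using act_add_module[of r "\<zero>\<^bsub>M\<^esub>" "\<zero>\<^bsub>M\<^esub>"] that act_closed[of r "\<zero>\<^bsub>M\<^esub>"]
    by (metis M.add.r_cancel_one M.add.l_one M.zero_closed)
  have sp0: "\<zero>\<^bsub>M\<^esub> \<in> Sp ss" if "set ss \<subseteq> carrier M" for ss
    unfolding Sp_def using that
  proof -
    have "ev ss (map (\<lambda>_. \<zero>\<^bsub>R\<^esub>) ss) = \<zero>\<^bsub>M\<^esub>" using that
      by (induction ss) (auto simp: ev_def zero_act)
    then show "\<zero>\<^bsub>M\<^esub> \<in> {ev ss rs | rs. length rs = length ss \<and> set rs \<subseteq> carrier R}"
      by (intro CollectI exI[of _ "map (\<lambda>_. \<zero>\<^bsub>R\<^esub>) ss"]) auto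
  qed
  have sp_Cons: "Sp (s # ss) = {r \<odot>\<^bsub>M\<^esub> s \<oplus>\<^bsub>M\<^esub> y | r y. r \<in> carrier R \<and> y \<in> Sp ss}" for s ss
    apply (auto simp: Sp_def ev_def length_Suc_conv)
    subgoal by blast
    subgoal for r rs by (intro exI[of _ "r # rs"]) auto
    done
  have sub: "Sp ss \<subseteq> carrier M" if "set ss \<subseteq> carrier M" for ss
    using that ev_closed by (auto simp: Sp_def)
  have spadd: "\<forall>x\<in>Sp ss. \<forall>y\<in>Sp ss. x \<oplus>\<^bsub>M\<^esub> y \<in> Sp ss" if "set ss \<subseteq> carrier M" for ss
    using that
  proof (induction ss)
    case Nil then show ?case by (auto simp: Sp_def ev_def)
  next
    case (Cons s ss)
    show ?case
    proof (intro ballI)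
      fix x y assume "x \<in> Sp (s # ss)" "y \<in> Sp (s # ss)"
      then obtain r x' q y' where h: "x = r \<odot>\<^bsub>M\<^esub> s \<oplus>\<^bsub>M\<^esub> x'" "y = q \<odot>\<^bsub>M\<^esub> s \<oplus>\<^bsub>M\<^esub> y'" "r \<in> carrier R" "q \<in> carrier R" "x' \<in> Sp ss" "y' \<in> Sp ss"
        by (auto simp: sp_Cons)
      have cc: "x' \<in> carrier M" "y' \<in> carrier M" "s \<in> carrier M" using sub[of ss] h Cons.prems by auto
      have "x \<oplus>\<^bsub>M\<^esub> y = (r \<oplus>\<^bsub>R\<^esub> q) \<odot>\<^bsub>M\<^esub> s \<oplus>\<^bsub>M\<^esub> (x' \<oplus>\<^bsub>M\<^esub> y')"
        using h cc by (simp add: act_add_ring M.a_ac act_closed)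
      then show "x \<oplus>\<^bsub>M\<^esub> y \<in> Sp (s # ss)" using h Cons unfolding sp_Cons
        by (intro CollectI exI[of _ "r \<oplus>\<^bsub>R\<^esub> q"] exI[of _ "x' \<oplus>\<^bsub>M\<^esub> y'"]) auto
    qed
  qed
  have spact: "\<forall>x\<in>Sp ss. r \<odot>\<^bsub>M\<^esub> x \<in> Sp ss" if "set ss \<subseteq> carrier M" "r \<in> carrier R" for ss r
    using that
  proof (induction ss)
    case Nil then show ?case by (auto simp: Sp_def ev_def act_zero)
  next
    case (Cons s ss)
    show ?case
    proof
      fix x assume "x \<in> Sp (s # ss)"
      then obtain q x' where h: "x = q \<odot>\<^bsub>M\<^esub> s \<oplus>\<^bsub>M\<^esub> x'" "q \<in> carrier R" "x' \<in> Sp ss"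
        by (auto simp: sp_Cons)
      have cc: "x' \<in> carrier M" "s \<in> carrier M" using sub[of ss] h Cons.prems by auto
      have "r \<odot>\<^bsub>M\<^esub> x = (q \<otimes>\<^bsub>R\<^esub> r) \<odot>\<^bsub>M\<^esub> s \<oplus>\<^bsub>M\<^esub> r \<odot>\<^bsub>M\<^esub> x'"
        using h cc Cons.prems by (simp add: act_add_module act_mult act_closed)
      then show "r \<odot>\<^bsub>M\<^esub> x \<in> Sp (s # ss)" using h Cons unfolding sp_Cons
        by (intro CollectI exI[of _ "q \<otimes>\<^bsub>R\<^esub> r"] exI[of _ "r \<odot>\<^bsub>M\<^esub> x'"]) auto
    qed
  qed
  have gens: "set ss \<subseteq> Sp ss" if "set ss \<subseteq> carrier M" for ss
    using that
  proof (induction ss)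
    case (Cons s ss)
    have "s = \<one>\<^bsub>R\<^esub> \<odot>\<^bsub>M\<^esub> s \<oplus>\<^bsub>M\<^esub> \<zero>\<^bsub>M\<^esub>" using Cons.prems by (simp add: act_one)
    then have "s \<in> Sp (s # ss)" unfolding sp_Cons using sp0[of ss] Cons.prems
      by (intro CollectI exI[of _ "\<one>\<^bsub>R\<^esub>"] exI[of _ "\<zero>\<^bsub>M\<^esub>"]) auto
    moreover have "y \<in> Sp (s # ss)" if "y \<in> Sp ss" for y
    proof -
      have "y = \<zero>\<^bsub>R\<^esub> \<odot>\<^bsub>M\<^esub> s \<oplus>\<^bsub>M\<^esub> y" using Cons.prems that sub[of ss] by (auto simp: zero_act)
      then show ?thesis unfolding sp_Cons using that
        by (intro CollectI exI[of _ "\<zero>\<^bsub>R\<^esub>"] exI[of _ y]) auto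
    qed
    ultimately show ?case using Cons by auto
  qed simp
  have ssM: "set ss \<subseteq> carrier M" using ss S by simp
  have neg: "\<ominus>\<^bsub>M\<^esub> x = (\<ominus>\<^bsub>R\<^esub> \<one>\<^bsub>R\<^esub>) \<odot>\<^bsub>M\<^esub> x" if "x \<in> carrier M" for x
  proof -
    have "(\<ominus>\<^bsub>R\<^esub> \<one>\<^bsub>R\<^esub>) \<odot>\<^bsub>M\<^esub> x \<oplus>\<^bsub>M\<^esub> \<one>\<^bsub>R\<^esub> \<odot>\<^bsub>M\<^esub> x = \<zero>\<^bsub>M\<^esub>"
      using that by (subst act_add_ring[symmetric]) (auto simp: R.l_neg zero_act)
    then show ?thesis using that by (intro M.minus_equality) (auto simp: act_one act_closed)
  qed
  have "submod R (Sp ss) M"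
    unfolding submod_def
  proof (intro conjI ballI)
    show "additive_subgroup (Sp ss) M"
    proof (intro additive_subgroup.intro M.add.subgroupI)
      show "Sp ss \<subseteq> carrier M" using sub ssM by simp
      show "Sp ss \<noteq> {}" using sp0[OF ssM] by auto
      show "\<ominus>\<^bsub>M\<^esub> x \<in> Sp ss" if "x \<in> Sp ss" for x
        using neg[of x] that sub[OF ssM] spact[OF ssM] by auto
    qed (use spadd[OF ssM] in auto)
  qed (use spact[OF ssM] in auto)
  then have Sp: "Sp ss = carrier M" using S(3) gens[OF ssM] ss by blast
  define c where "c = (\<lambda>x. SOME rs. ev ss rs = x)"
  have ev_c: "ev ss (c x) = x" if "x \<in> carrier M" for x
  proof -
    have "x \<in> Sp ss" using that Sp by simp
    then have "\<exists>rs. ev ss rs = x" unfolding Sp_def by auto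
    then show ?thesis unfolding c_def by (rule someI_ex)
  qed
  define N :: "('a, 'a list) module" where "N = \<lparr>carrier = c ` carrier M, monoid.mult = undefined, one = undefined,
    ring.zero = c \<zero>\<^bsub>M\<^esub>, add = (\<lambda>x y. c (ev ss x \<oplus>\<^bsub>M\<^esub> ev ss y)),
    smult = (\<lambda>r x. c (r \<odot>\<^bsub>M\<^esub> ev ss x))\<rparr>"
  have N: "right_module R N"
  proof (intro right_module.intro right_module_axioms.intro R.ring_axioms abelian_groupI)
    show "\<exists>y\<in>carrier N. y \<oplus>\<^bsub>N\<^esub> x = \<zero>\<^bsub>N\<^esub>" if "x \<in> carrier N" for x
      using that by (auto simp: N_def ev_c M.l_neg intro!: bexI[of _ "\<ominus>\<^bsub>M\<^esub> _"])
  qed (auto simp: N_def ev_c act_closed act_add_ring act_add_module act_mult act_one M.a_ac)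
  have hom: "c \<in> mod_hom R M N" by (auto simp: mod_hom_def N_def ev_c)
  have iso: "mod_iso R M N" unfolding mod_iso_def
    using hom by (intro bexI[of _ c]) (auto simp: bij_betw_def N_def intro: inj_on_inverseI[of _ "ev ss"] ev_c)
  interpret N: right_module R N by fact
  have "fin_gen R N" unfolding fin_gen_def
  proof (intro exI[of _ "c ` S"] conjI allI impI)
    fix L assume L: "submod R L N \<and> c ` S \<subseteq> L"
    then have LN: "L \<subseteq> carrier N" and Ls: "additive_subgroup L N"
      by (auto simp: submod_def additive_subgroup.a_subset)
    let ?L = "ev ss ` L"
    have cL: "c (ev ss y) = y" if "y \<in> L" for y using that LN by (auto simp: N_def ev_c)
    have eM: "ev ss y \<in> carrier M" if "y \<in> L" for y using that LN by (auto simp: N_def ev_c)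
    have actL: "r \<odot>\<^bsub>M\<^esub> x \<in> ?L" if "r \<in> carrier R" "x \<in> ?L" for r x
    proof -
      obtain y where y: "y \<in> L" "x = ev ss y" using \<open>x \<in> ?L\<close> by auto
      then have "r \<odot>\<^bsub>N\<^esub> y \<in> L" using L that by (auto simp: submod_def)
      moreover have "ev ss (r \<odot>\<^bsub>N\<^esub> y) = r \<odot>\<^bsub>M\<^esub> x"
        using y eM that by (auto simp: N_def ev_c act_closed)
      ultimately show ?thesis by (metis imageI)
    qed
    have "submod R ?L M" unfolding submod_def
    proof (intro conjI ballI)
      show "additive_subgroup ?L M"
      proof (intro additive_subgroup.intro M.add.subgroupI)
        show "?L \<subseteq> carrier M" using eM by auto
        show "?L \<noteq> {}" using additive_subgroup.zero_closed[OF Ls] by auto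
        show "\<ominus>\<^bsub>M\<^esub> x \<in> ?L" if "x \<in> ?L" for x
          using neg[of x] that actL eM by auto
        fix x y assume "x \<in> ?L" "y \<in> ?L"
        then obtain x' y' where h: "x' \<in> L" "y' \<in> L" "x = ev ss x'" "y = ev ss y'" by auto
        then have "x' \<oplus>\<^bsub>N\<^esub> y' \<in> L" using additive_subgroup.a_closed[OF Ls] by blast
        moreover have "ev ss (x' \<oplus>\<^bsub>N\<^esub> y') = x \<oplus>\<^bsub>M\<^esub> y" using h eM by (auto simp: N_def ev_c)
        ultimately show "x \<oplus>\<^bsub>M\<^esub> y \<in> ?L" by (metis imageI)
      qed
    qed (use actL in auto)
    moreover have "S \<subseteq> ?L" 
    proof
      fix x assume "x \<in> S"
      then have "c x \<in> L" "x = ev ss (c x)" using L S(2) ev_c[of x] by auto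
      then show "x \<in> ?L" by (rule rev_image_eqI)
    qed
    ultimately have "?L = carrier M" using S(3) by blast
    then have "carrier N = c ` ?L" by (simp add: N_def)
    then show "L = carrier N" using cL by (auto simp: image_image)
  qed (use S in \<open>auto simp: N_def\<close>)
  then show ?thesis using N iso by (auto simp: fg_modules_def)
qed
end

theory Submission
 imports Defs
begin

text \<open>Let \<open>R\<close> be the opposite algebra of \<open>C\<close>, and let the rings \<open>S i\<close> be the opposite algebras of \<open>A\<close> and
 \<open>B\<close>. Modulo the relations a path of \<open>C\<close> lies in one of the two quivers or is a connecting arrow
 followed by a path of one of them (\<open>glued_paths\<close>). Hence \<open>R\<close> is the sum of the \<open>S i\<close> and of one copy
 of \<open>S (\<sigma> k) \<eta> k\<close> for each connecting arrow \<open>k\<close>, where \<open>\<eta> k\<close> is the idempotent of the head of \<open>k\<close>;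
 the locale \<open>glued_rings\<close> axiomatises this.

 A family of modules \<open>U i\<close> over the \<open>S i\<close> extends to the \<open>R\<close>-module \<open>glue U\<close> that adds one copy of the
 values \<open>U (\<sigma> k) \<eta> k\<close> for each connecting arrow. Gluing is left adjoint to restriction, is exact and
 preserves projective covers, and therefore commutes with syzygies (\<open>syzygy_glue\<close>). Every projective
 \<open>R\<close>-module is glued. The part of a glued module below its tops is killed by the radical of \<open>R\<close>,
 hence semisimple, and this forces every submodule of a glued module to be a glued module plus a
 semisimple one (\<open>glue_submodule\<close>). So first syzygies have this form, which is where the passage
 from \<open>n\<close> to \<open>n + 1\<close> comes from: gluing the resolutions of the \<open>n\<close>-th syzygies of the parts, and adding
 the \<open>n\<close>-th syzygies of the semisimple summands to both \<open>V\<close> and \<open>V\<^sub>0\<close>, resolves the \<open>(n + 1)\<close>-st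
 syzygy over \<open>R\<close> (\<open>syzygies_resolved_glue\<close>). The semisimple modules are add-generated by one module.

 For the Lat--Igusa--Todorov case the glued modules with components in the given subcategories form
 the new subcategory. It is closed under direct summands (\<open>glue_summand\<close>). Its \<open>\<phi>\<close>-dimension vanishes
 because the top functor recovers the components of a glued module: gluing is injective on the
 stable Grothendieck groups and commutes with the syzygy operator (\<open>K0_Top\<close>, \<open>K0_glue_cong\<close>).\<close>

text \<open>The operations of a module or ring named by one identifier are written with a plain subscript.\<close>

abbreviation (input) sub_add ("_ \<oplus>\<^sub>_ _" [65, 1000, 66] 65) where "x \<oplus>\<^sub>M y \<equiv> add M x y"
abbreviation (input) sub_minus ("_ \<ominus>\<^sub>_ _" [65, 1000, 66] 65) where "x \<ominus>\<^sub>M y \<equiv> a_minus M x y"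
abbreviation (input) sub_uminus ("\<ominus>\<^sub>_ _" [1000, 81] 80) where "\<ominus>\<^sub>M x \<equiv> a_inv M x"
abbreviation (input) sub_mult ("_ \<otimes>\<^sub>_ _" [70, 1000, 71] 70) where "x \<otimes>\<^sub>M y \<equiv> monoid.mult M x y"
abbreviation (input) sub_act ("_ \<odot>\<^sub>_ _" [70, 1000, 71] 70) where "r \<odot>\<^sub>M x \<equiv> smult M r x"
abbreviation (input) sub_set_add ("_ <+>\<^sub>_ _" [60, 1000, 61] 60) where "K <+>\<^sub>M L \<equiv> set_add M K L"
abbreviation (input) sub_zero ("\<zero>\<^sub>_" [1000] 1000) where "\<zero>\<^sub>M \<equiv> ring.zero M"
abbreviation (input) sub_one ("\<one>\<^sub>_" [1000] 1000) where "\<one>\<^sub>M \<equiv> one M"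

section \<open>Modules, homomorphisms and direct sums\<close>

context right_module
begin

lemma zero_act: "x \<in> carrier M \<Longrightarrow> \<zero>\<^sub>R \<odot>\<^sub>M x = \<zero>\<^sub>M"
 using act_add_ring[of "\<zero>\<^sub>R" "\<zero>\<^sub>R" x] act_closed[of "\<zero>\<^sub>R" x]
 by (metis M.add.r_cancel_one R.add.l_one R.zero_closed)

lemma act_zero: "r \<in> carrier R \<Longrightarrow> r \<odot>\<^sub>M \<zero>\<^sub>M = \<zero>\<^sub>M"
 using act_add_module[of r "\<zero>\<^sub>M" "\<zero>\<^sub>M"] act_closed[of r "\<zero>\<^sub>M"]
 by (metis M.add.r_cancel_one M.add.l_one M.zero_closed)

lemma uminus_act: "x \<in> carrier M \<Longrightarrow> \<ominus>\<^sub>M x = (\<ominus>\<^sub>R \<one>\<^sub>R) \<odot>\<^sub>M x"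
proof -
 assume x: "x \<in> carrier M"
 have "(\<ominus>\<^sub>R \<one>\<^sub>R) \<odot>\<^sub>M x \<oplus>\<^sub>M \<one>\<^sub>R \<odot>\<^sub>M x = \<zero>\<^sub>M"
  using x by (subst act_add_ring[symmetric]) (auto simp: R.l_neg zero_act)
 then show ?thesis using x by (intro M.minus_equality) (auto simp: act_one act_closed)
qed

lemma act_uminus: "r \<in> carrier R \<Longrightarrow> x \<in> carrier M \<Longrightarrow> r \<odot>\<^sub>M (\<ominus>\<^sub>M x) = \<ominus>\<^sub>M (r \<odot>\<^sub>M x)"
 by (rule sym, rule M.minus_equality)
   (auto simp: act_closed act_add_module[symmetric] M.l_neg act_zero)

lemma act_minus: "r \<in> carrier R \<Longrightarrow> x \<in> carrier M \<Longrightarrow> y \<in> carrier M \<Longrightarrow>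
  r \<odot>\<^sub>M (x \<ominus>\<^sub>M y) = r \<odot>\<^sub>M x \<ominus>\<^sub>M r \<odot>\<^sub>M y"
 by (simp add: a_minus_def act_add_module act_uminus)

lemma minus_eq_zeroD: "x \<ominus>\<^sub>M y = \<zero>\<^sub>M \<Longrightarrow> x \<in> carrier M \<Longrightarrow> y \<in> carrier M \<Longrightarrow> x = y"
 unfolding a_minus_def by (metis M.a_inv_closed M.minus_equality M.minus_minus)

lemma submod_iff:
 "submod R N M \<longleftrightarrow> N \<subseteq> carrier M \<and> \<zero>\<^sub>M \<in> N \<and> (\<forall>x\<in>N. \<forall>y\<in>N. x \<oplus>\<^sub>M y \<in> N)
  \<and> (\<forall>r\<in>carrier R. \<forall>x\<in>N. r \<odot>\<^sub>M x \<in> N)" (is "_ \<longleftrightarrow> ?r")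
proof
 assume "submod R N M"
 then show ?r unfolding submod_def
  by (auto dest: additive_subgroup.a_subset additive_subgroup.zero_closed
    additive_subgroup.a_closed)
next
 assume r: ?r
 have "additive_subgroup N M"
 proof (intro additive_subgroup.intro M.add.subgroupI)
  show "\<ominus>\<^sub>M x \<in> N" if "x \<in> N" for x
   using that r uminus_act[of x] by auto
 qed (use r in auto)
 then show "submod R N M" using r by (simp add: submod_def)
qed

lemma submodI:
 assumes "N \<subseteq> carrier M" "\<zero>\<^sub>M \<in> N" "\<And>x y. x \<in> N \<Longrightarrow> y \<in> N \<Longrightarrow> x \<oplus>\<^sub>M y \<in> N"
  "\<And>r x. r \<in> carrier R \<Longrightarrow> x \<in> N \<Longrightarrow> r \<odot>\<^sub>M x \<in> N"
 shows "submod R N M"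
 using assms by (auto simp: submod_iff)

lemma submod_subset: "submod R N M \<Longrightarrow> N \<subseteq> carrier M"
 and submod_zero: "submod R N M \<Longrightarrow> \<zero>\<^sub>M \<in> N"
 and submod_add: "submod R N M \<Longrightarrow> x \<in> N \<Longrightarrow> y \<in> N \<Longrightarrow> x \<oplus>\<^sub>M y \<in> N"
 and submod_act: "submod R N M \<Longrightarrow> r \<in> carrier R \<Longrightarrow> x \<in> N \<Longrightarrow> r \<odot>\<^sub>M x \<in> N"
 by (auto simp: submod_iff)

lemma submod_uminus: "submod R N M \<Longrightarrow> x \<in> N \<Longrightarrow> \<ominus>\<^sub>M x \<in> N"
 using uminus_act[of x] submod_act[of N "\<ominus>\<^sub>R \<one>\<^sub>R" x] submod_subset[of N] by auto

lemma submod_minus: "submod R N M \<Longrightarrow> x \<in> N \<Longrightarrow> y \<in> N \<Longrightarrow> x \<ominus>\<^sub>M y \<in> N"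
 by (simp add: a_minus_def submod_add submod_uminus)

lemma submod_finsum:
 assumes "submod R N M" "finite I" "\<And>i. i \<in> I \<Longrightarrow> f i \<in> N"
 shows "finsum M f I \<in> N"
 using assms(2,3)
proof (induction I rule: finite_induct)
 case (insert i I)
 then have "f \<in> I \<rightarrow> carrier M" "f i \<in> carrier M" using submod_subset[OF assms(1)] by auto
 then show ?case using insert submod_add[OF assms(1)] by (simp add: M.finsum_insert)
qed (use submod_zero[OF assms(1)] in simp)

lemma submod_module: "submod R N M \<Longrightarrow> right_module R (M\<lparr>carrier := N\<rparr>)"
proof (intro right_module.intro R.ring_axioms abelian_groupI right_module_axioms.intro)
 assume N: "submod R N M"
 note [simp] = submod_subset[OF N, THEN subsetD] submod_zero[OF N] submod_add[OF N] submod_act[OF N]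
 show "\<exists>y\<in>carrier (M\<lparr>carrier := N\<rparr>). y \<oplus>\<^bsub>M\<lparr>carrier := N\<rparr>\<^esub> x = \<zero>\<^bsub>M\<lparr>carrier := N\<rparr>\<^esub>"
  if "x \<in> carrier (M\<lparr>carrier := N\<rparr>)" for x
  using that submod_uminus[OF N, of x] by (intro bexI[of _ "\<ominus>\<^sub>M x"]) (auto simp: M.l_neg)
qed (auto simp: submod_iff subset_eq M.a_ac act_add_ring act_add_module act_mult act_one)

lemma submod_carrier: "submod R (carrier M) M"
 by (auto simp: submod_iff act_closed)

lemma submod_zero_set: "submod R {\<zero>\<^sub>M} M"
 by (auto simp: submod_iff act_zero)

lemma submod_trans:
 "submod R N M \<Longrightarrow> submod R L (M\<lparr>carrier := N\<rparr>) \<longleftrightarrow> submod R L M \<and> L \<subseteq> N"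
 using right_module.submod_iff[OF submod_module, of N L]
 by (auto simp: submod_iff)

lemma submod_add_set:
 assumes "submod R N M" "submod R L M"
 shows "submod R (N <+>\<^sub>M L) M"
proof (rule submodI)
 note s = submod_subset[OF assms(1)] submod_subset[OF assms(2)]
 show "N <+>\<^sub>M L \<subseteq> carrier M" using s by (auto simp: set_add_def')
 show "\<zero>\<^sub>M \<in> N <+>\<^sub>M L" using assms[THEN submod_zero]
  by (auto simp: set_add_def' intro!: bexI[of _ "\<zero>\<^sub>M"])
 show "x \<oplus>\<^sub>M y \<in> N <+>\<^sub>M L" if xy: "x \<in> N <+>\<^sub>M L" "y \<in> N <+>\<^sub>M L" for x y
 proof -
  obtain a b c d where h: "x = a \<oplus>\<^sub>M b" "y = c \<oplus>\<^sub>M d" "a \<in> N" "b \<in> L" "c \<in> N" "d \<in> L"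
   using xy by (auto simp: set_add_def')
  then have "x \<oplus>\<^sub>M y = (a \<oplus>\<^sub>M c) \<oplus>\<^sub>M (b \<oplus>\<^sub>M d)"
   using s by (simp add: M.a_ac subset_eq)
  moreover have "a \<oplus>\<^sub>M c \<in> N" "b \<oplus>\<^sub>M d \<in> L" using h assms submod_add by auto
  ultimately show ?thesis by (auto simp: set_add_def')
 qed
 show "r \<odot>\<^sub>M x \<in> N <+>\<^sub>M L" if rx: "r \<in> carrier R" "x \<in> N <+>\<^sub>M L" for r x
 proof -
  obtain a b where h: "x = a \<oplus>\<^sub>M b" "a \<in> N" "b \<in> L"
   using rx by (auto simp: set_add_def')
  then have "r \<odot>\<^sub>M x = r \<odot>\<^sub>M a \<oplus>\<^sub>M r \<odot>\<^sub>M b"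
   using s rx by (simp add: act_add_module subset_eq)
  moreover have "r \<odot>\<^sub>M a \<in> N" "r \<odot>\<^sub>M b \<in> L" using h rx assms submod_act by auto
  ultimately show ?thesis by (auto simp: set_add_def')
 qed
qed

end

lemma mod_homI:
 assumes "\<And>x. x \<in> carrier M \<Longrightarrow> f x \<in> carrier N"
  "\<And>x y. x \<in> carrier M \<Longrightarrow> y \<in> carrier M \<Longrightarrow> f (x \<oplus>\<^sub>M y) = f x \<oplus>\<^sub>N f y"
  "\<And>r x. r \<in> carrier R \<Longrightarrow> x \<in> carrier M \<Longrightarrow> f (r \<odot>\<^sub>M x) = r \<odot>\<^sub>N f x"
 shows "f \<in> mod_hom R M N"
 using assms by (auto simp: mod_hom_def)

lemma mh_closed: "f \<in> mod_hom R M N \<Longrightarrow> x \<in> carrier M \<Longrightarrow> f x \<in> carrier N"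
 and mh_add: "f \<in> mod_hom R M N \<Longrightarrow> x \<in> carrier M \<Longrightarrow> y \<in> carrier M \<Longrightarrow>
  f (x \<oplus>\<^sub>M y) = f x \<oplus>\<^sub>N f y"
 and mh_act: "f \<in> mod_hom R M N \<Longrightarrow> r \<in> carrier R \<Longrightarrow> x \<in> carrier M \<Longrightarrow>
  f (r \<odot>\<^sub>M x) = r \<odot>\<^sub>N f x"
 by (auto simp: mod_hom_def)

lemma mh_zero:
 assumes "right_module R M" "right_module R N" "f \<in> mod_hom R M N"
 shows "f \<zero>\<^sub>M = \<zero>\<^sub>N"
proof -
 interpret M: right_module R M by fact
 interpret N: right_module R N by fact
 show ?thesis using mh_act[OF assms(3), of "\<zero>\<^sub>R" "\<zero>\<^sub>M"] mh_closed[OF assms(3)]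
  by (simp add: M.zero_act N.zero_act)
qed

lemma mh_uminus:
 assumes "right_module R M" "right_module R N" "f \<in> mod_hom R M N" "x \<in> carrier M"
 shows "f (\<ominus>\<^sub>M x) = \<ominus>\<^sub>N f x"
proof -
 interpret M: right_module R M by fact
 interpret N: right_module R N by fact
 show ?thesis using mh_act[OF assms(3)] mh_closed[OF assms(3)] assms(4)
  by (simp add: M.uminus_act N.uminus_act)
qed

lemma mh_minus:
 assumes "right_module R M" "right_module R N" "f \<in> mod_hom R M N" "x \<in> carrier M" "y \<in> carrier M"
 shows "f (x \<ominus>\<^sub>M y) = f x \<ominus>\<^sub>N f y"
proof -
 interpret M: right_module R M by fact
 show ?thesis using assms by (simp add: a_minus_def mh_add[OF assms(3)] mh_uminus)
qed

lemma mh_finsum: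
 assumes "right_module R M" "right_module R N" "f \<in> mod_hom R M N" "finite I"
  "g \<in> I \<rightarrow> carrier M"
 shows "f (finsum M g I) = finsum N (\<lambda>i. f (g i)) I"
 using assms(4,5)
proof (induction I rule: finite_induct)
 interpret M: right_module R M by fact
 interpret N: right_module R N by fact
 {
  case empty
  show ?case using mh_zero[OF assms(1-3)] by simp
 next
  case (insert i I)
  then have "g \<in> I \<rightarrow> carrier M" "g i \<in> carrier M" by auto
  with insert show ?case using mh_closed[OF assms(3)] mh_add[OF assms(3)]
   by (simp add: M.finsum_insert N.finsum_insert Pi_iff)
 }
qed

lemma mh_comp:
 "f \<in> mod_hom R L M \<Longrightarrow> g \<in> mod_hom R M N \<Longrightarrow> (\<lambda>x. g (f x)) \<in> mod_hom R L N"
 by (rule mod_homI) (simp_all add: mh_closed mh_add mh_act)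

lemma submod_vimage:
 assumes "right_module R M" "right_module R N" "f \<in> mod_hom R M N" "submod R L N"
 shows "submod R {x \<in> carrier M. f x \<in> L} M"
proof -
 interpret M: right_module R M by fact
 interpret N: right_module R N by fact
 show ?thesis
  by (rule M.submodI)
    (use assms(4) in \<open>auto simp: mh_add[OF assms(3)] mh_act[OF assms(3)] M.act_closed
     mh_zero[OF assms(1-3)] N.submod_zero N.submod_add N.submod_act\<close>)
qed

lemma submod_image:
 assumes "right_module R M" "right_module R N" "f \<in> mod_hom R M N" "submod R L M"
 shows "submod R (f ` L) N"
proof -
 interpret M: right_module R M by fact
 interpret N: right_module R N by fact
 have L: "L \<subseteq> carrier M" using assms(4) by (rule M.submod_subset)
 show ?thesis
 proof (rule N.submodI)
  show "f ` L \<subseteq> carrier N" using L mh_closed[OF assms(3)] by auto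
  show "\<zero>\<^sub>N \<in> f ` L" using mh_zero[OF assms(1-3)] M.submod_zero[OF assms(4)] by force
  show "x \<oplus>\<^sub>N y \<in> f ` L" if xy: "x \<in> f ` L" "y \<in> f ` L" for x y
  proof -
   obtain a b where ab: "x = f a" "y = f b" "a \<in> L" "b \<in> L" using xy by auto
   then have "a \<in> carrier M" "b \<in> carrier M" using L by auto
   then have "x \<oplus>\<^sub>N y = f (a \<oplus>\<^sub>M b)" "a \<oplus>\<^sub>M b \<in> L"
    using ab mh_add[OF assms(3), of a b] M.submod_add[OF assms(4)] by auto
   then show ?thesis by auto
  qed
  show "r \<odot>\<^sub>N x \<in> f ` L" if rx: "r \<in> carrier R" "x \<in> f ` L" for r x
  proof -
   obtain a where a: "x = f a" "a \<in> L" using rx by auto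
   then have "a \<in> carrier M" using L by auto
   then have "r \<odot>\<^sub>N x = f (r \<odot>\<^sub>M a)" "r \<odot>\<^sub>M a \<in> L"
    using a rx mh_act[OF assms(3), of r a] M.submod_act[OF assms(4)] by auto
   then show ?thesis by auto
  qed
 qed
qed

lemma submod_kernel:
 assumes "right_module R M" "right_module R N" "f \<in> mod_hom R M N"
 shows "submod R (a_kernel M N f) M"
proof -
 have "a_kernel M N f = {x \<in> carrier M. f x \<in> {\<zero>\<^sub>N}}" by (auto simp: a_kernel_def')
 then show ?thesis
  using submod_vimage[OF assms right_module.submod_zero_set[OF assms(2)]] by simp
qed

lemma mh_inj_iff:
 assumes "right_module R M" "right_module R N" "f \<in> mod_hom R M N"
 shows "inj_on f (carrier M) \<longleftrightarrow> (\<forall>x\<in>carrier M. f x = \<zero>\<^sub>N \<longrightarrow> x = \<zero>\<^sub>M)"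
proof -
 interpret M: right_module R M by fact
 interpret N: right_module R N by fact
 note z = mh_zero[OF assms]
 show ?thesis
 proof
  assume "inj_on f (carrier M)"
  then show "\<forall>x\<in>carrier M. f x = \<zero>\<^sub>N \<longrightarrow> x = \<zero>\<^sub>M"
   using z by (auto simp: inj_on_def)
 next
  assume *: "\<forall>x\<in>carrier M. f x = \<zero>\<^sub>N \<longrightarrow> x = \<zero>\<^sub>M"
  show "inj_on f (carrier M)"
  proof (rule inj_onI)
   fix x y assume h: "x \<in> carrier M" "y \<in> carrier M" "f x = f y"
   then have "f (x \<ominus>\<^sub>M y) = \<zero>\<^sub>N"
    using mh_minus[OF assms, of x y] mh_closed[OF assms(3), of y]
    by (simp add: a_minus_def N.r_neg)
   then have "x \<ominus>\<^sub>M y = \<zero>\<^sub>M" using * h by simp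
   then show "x = y" using h M.minus_eq_zeroD by blast
  qed
 qed
qed

lemma mod_isoI:
 assumes "f \<in> mod_hom R M N" "inj_on f (carrier M)" "carrier N \<subseteq> f ` carrier M"
 shows "mod_iso R M N"
proof -
 have "f ` carrier M = carrier N" using assms by (auto simp: mh_closed)
 then show ?thesis using assms by (auto simp: mod_iso_def bij_betw_def)
qed

lemma mod_isoI_kernel:
 assumes "right_module R M" "right_module R N" "f \<in> mod_hom R M N"
  "\<And>x. x \<in> carrier M \<Longrightarrow> f x = \<zero>\<^sub>N \<Longrightarrow> x = \<zero>\<^sub>M" "\<And>y. y \<in> carrier N \<Longrightarrow> \<exists>x\<in>carrier M. f x = y"
 shows "mod_iso R M N"
 using assms(4,5) by (intro mod_isoI[OF assms(3)]) (auto simp: mh_inj_iff[OF assms(1-3)] image_iff)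

lemma mod_isoI_inverse:
 assumes "f \<in> mod_hom R M N" "\<And>y. y \<in> carrier N \<Longrightarrow> g y \<in> carrier M"
  "\<And>x. x \<in> carrier M \<Longrightarrow> g (f x) = x" "\<And>y. y \<in> carrier N \<Longrightarrow> f (g y) = y"
 shows "mod_iso R M N"
 by (rule mod_isoI[OF assms(1)])
   (use assms in \<open>auto intro!: inj_on_inverseI[of _ g] simp: image_iff, metis\<close>)

lemma mh_inverse:
 assumes f: "f \<in> mod_hom R M N" "bij_betw f (carrier M) (carrier N)" and "right_module R M"
 obtains g where "g \<in> mod_hom R N M"
  "\<And>x. x \<in> carrier M \<Longrightarrow> g (f x) = x" "\<And>y. y \<in> carrier N \<Longrightarrow> f (g y) = y"
proof -
 interpret right_module R M by fact
 let ?g = "inv_into (carrier M) f"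
 have gf: "\<And>x. x \<in> carrier M \<Longrightarrow> ?g (f x) = x" and fg: "\<And>y. y \<in> carrier N \<Longrightarrow> f (?g y) = y"
  and g: "\<And>y. y \<in> carrier N \<Longrightarrow> ?g y \<in> carrier M"
  using f(2) by (auto simp: bij_betw_inv_into_left bij_betw_inv_into_right bij_betw_def inv_into_into)
 have "?g \<in> mod_hom R N M"
 proof (rule mod_homI)
  show "?g (x \<oplus>\<^sub>N y) = ?g x \<oplus>\<^sub>M ?g y" if "x \<in> carrier N" "y \<in> carrier N" for x y
  proof -
   have "f (?g x \<oplus>\<^sub>M ?g y) = x \<oplus>\<^sub>N y" using that by (simp add: mh_add[OF f(1)] g fg)
   then show ?thesis using gf[of "?g x \<oplus>\<^sub>M ?g y"] g that by simp
  qed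
  show "?g (r \<odot>\<^sub>N x) = r \<odot>\<^sub>M ?g x" if "r \<in> carrier R" "x \<in> carrier N" for r x
  proof -
   have "f (r \<odot>\<^sub>M ?g x) = r \<odot>\<^sub>N x" using that by (simp add: mh_act[OF f(1)] g fg)
   then show ?thesis using gf[of "r \<odot>\<^sub>M ?g x"] g that by (simp add: act_closed)
  qed
 qed (rule g)
 then show ?thesis using that gf fg by blast
qed

lemma mod_iso_obtain:
 assumes "mod_iso R M N" "right_module R M"
 obtains f g where "f \<in> mod_hom R M N" "g \<in> mod_hom R N M"
  "\<And>x. x \<in> carrier M \<Longrightarrow> g (f x) = x" "\<And>y. y \<in> carrier N \<Longrightarrow> f (g y) = y"
 using assms(1) mh_inverse[OF _ _ assms(2)] unfolding mod_iso_def by metis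

lemma mod_iso_refl: "mod_iso R M M"
 unfolding mod_iso_def by (rule bexI[of _ id]) (auto simp: mod_hom_def)

lemma mod_iso_sym: "mod_iso R M N \<Longrightarrow> right_module R M \<Longrightarrow> mod_iso R N M"
 by (elim mod_iso_obtain, assumption) (auto intro!: mod_isoI_inverse mh_closed)

lemma mod_iso_trans:
 assumes "mod_iso R L M" "mod_iso R M N" shows "mod_iso R L N"
proof -
 obtain f g where "f \<in> mod_hom R L M" "bij_betw f (carrier L) (carrier M)"
  "g \<in> mod_hom R M N" "bij_betw g (carrier M) (carrier N)"
  using assms by (auto simp: mod_iso_def)
 then show ?thesis unfolding mod_iso_def
  by (intro bexI[of _ "g \<circ> f"] bij_betw_trans) (auto simp: comp_def intro: mh_comp)
qed

lemma mod_iso_zero: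
 assumes "mod_iso R M N" "right_module R M" "right_module R N"
 shows "carrier M = {\<zero>\<^sub>M} \<longleftrightarrow> carrier N = {\<zero>\<^sub>N}"
proof -
 interpret M: right_module R M by fact
 interpret N: right_module R N by fact
 obtain f g where h: "f \<in> mod_hom R M N" "g \<in> mod_hom R N M"
  "\<And>x. x \<in> carrier M \<Longrightarrow> g (f x) = x" "\<And>y. y \<in> carrier N \<Longrightarrow> f (g y) = y"
  using mod_iso_obtain[OF assms(1,2)] by metis
 have z: "f \<zero>\<^sub>M = \<zero>\<^sub>N" "g \<zero>\<^sub>N = \<zero>\<^sub>M"
  using mh_zero[OF assms(2,3) h(1)] mh_zero[OF assms(3,2) h(2)] .
 have "y = \<zero>\<^sub>N" if "carrier M = {\<zero>\<^sub>M}" "y \<in> carrier N" for y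
  using h(4)[of y] mh_closed[OF h(2), of y] that z by auto
 moreover have "y = \<zero>\<^sub>M" if "carrier N = {\<zero>\<^sub>N}" "y \<in> carrier M" for y
  using h(3)[of y] mh_closed[OF h(1), of y] that z by auto
 ultimately show ?thesis by auto
qed

lemma zero_modules_iso:
 assumes "right_module R M" "right_module R N" "carrier M = {\<zero>\<^sub>M}" "carrier N = {\<zero>\<^sub>N}"
 shows "mod_iso R M N"
proof -
 interpret M: right_module R M by fact
 interpret N: right_module R N by fact
 show ?thesis
  by (rule mod_isoI_inverse[of "\<lambda>_. \<zero>\<^sub>N" _ _ _ "\<lambda>_. \<zero>\<^sub>M"])
    (use assms in \<open>auto intro!: mod_homI simp: N.act_zero\<close>)
qed

lemma dsum_simps [simp]:
 "carrier (dsum M N) = carrier M \<times> carrier N"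
 "\<zero>\<^bsub>dsum M N\<^esub> = (\<zero>\<^sub>M, \<zero>\<^sub>N)"
 "(x, y) \<oplus>\<^bsub>dsum M N\<^esub> (x', y') = (x \<oplus>\<^sub>M x', y \<oplus>\<^sub>N y')"
 "r \<odot>\<^bsub>dsum M N\<^esub> (x, y) = (r \<odot>\<^sub>M x, r \<odot>\<^sub>N y)"
 by (simp_all add: dsum_def)

lemma dsum_module:
 assumes "right_module R M" "right_module R N" shows "right_module R (dsum M N)"
proof -
 interpret M: right_module R M by fact
 interpret N: right_module R N by fact
 show ?thesis
 proof (intro right_module.intro M.R.ring_axioms abelian_groupI right_module_axioms.intro)
  show "\<exists>y\<in>carrier (dsum M N). y \<oplus>\<^bsub>dsum M N\<^esub> x = \<zero>\<^bsub>dsum M N\<^esub>" if "x \<in> carrier (dsum M N)" for x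
   using that by (intro bexI[of _ "(\<ominus>\<^sub>M fst x, \<ominus>\<^sub>N snd x)"]) (auto simp: M.l_neg N.l_neg)
 qed (auto simp: M.a_ac N.a_ac M.act_closed M.act_add_ring M.act_add_module M.act_mult M.act_one
    N.act_closed N.act_add_ring N.act_add_module N.act_mult N.act_one)
qed

lemma dsum_fst_hom: "fst \<in> mod_hom R (dsum M N) M"
 and dsum_snd_hom: "snd \<in> mod_hom R (dsum M N) N"
 by (auto intro!: mod_homI)

lemma dsum_inl_hom: "right_module R N \<Longrightarrow> (\<lambda>x. (x, \<zero>\<^sub>N)) \<in> mod_hom R M (dsum M N)"
proof -
 assume "right_module R N"
 then interpret N: right_module R N .
 show ?thesis by (auto intro!: mod_homI simp: N.act_zero)
qed

lemma dsum_inr_hom: "right_module R M \<Longrightarrow> (\<lambda>x. (\<zero>\<^sub>M, x)) \<in> mod_hom R N (dsum M N)"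
proof -
 assume "right_module R M"
 then interpret N: right_module R M .
 show ?thesis by (auto intro!: mod_homI simp: N.act_zero)
qed

lemma dsum_pair_hom:
 "f \<in> mod_hom R L M \<Longrightarrow> g \<in> mod_hom R L N \<Longrightarrow> (\<lambda>x. (f x, g x)) \<in> mod_hom R L (dsum M N)"
 by (auto intro!: mod_homI simp: mh_closed mh_add mh_act)

lemma dsum_map_hom:
 "f \<in> mod_hom R M M' \<Longrightarrow> g \<in> mod_hom R N N' \<Longrightarrow> map_prod f g \<in> mod_hom R (dsum M N) (dsum M' N')"
 by (auto intro!: mod_homI simp: mh_closed mh_add mh_act)

lemma dsum_copair_hom:
 assumes "right_module R N" "f \<in> mod_hom R L N" "g \<in> mod_hom R M N"
 shows "(\<lambda>x. f (fst x) \<oplus>\<^sub>N g (snd x)) \<in> mod_hom R (dsum L M) N"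
proof -
 interpret N: right_module R N by fact
 note [simp] = mh_closed[OF assms(2)] mh_closed[OF assms(3)] mh_add[OF assms(2)]
  mh_add[OF assms(3)] mh_act[OF assms(2)] mh_act[OF assms(3)]
 show ?thesis by (rule mod_homI) (auto simp: N.act_add_module N.a_ac)
qed

lemma dsum_iso:
 assumes "mod_iso R M M'" "mod_iso R N N'" shows "mod_iso R (dsum M N) (dsum M' N')"
proof -
 obtain f g where h: "f \<in> mod_hom R M M'" "bij_betw f (carrier M) (carrier M')"
  "g \<in> mod_hom R N N'" "bij_betw g (carrier N) (carrier N')"
  using assms by (auto simp: mod_iso_def)
 show ?thesis unfolding mod_iso_def
  by (rule bexI[of _ "map_prod f g"]) (use h in \<open>auto intro: bij_betw_map_prod dsum_map_hom\<close>)
qed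

lemma dsum_comm: "mod_iso R (dsum M N) (dsum N M)"
 by (rule mod_isoI_inverse[of prod.swap _ _ _ prod.swap]) (auto intro!: mod_homI)

lemma dsum_assoc: "mod_iso R (dsum (dsum L M) N) (dsum L (dsum M N))"
 by (rule mod_isoI_inverse[of "\<lambda>((x, y), z). (x, (y, z))" _ _ _ "\<lambda>(x, (y, z)). ((x, y), z)"])
   (auto intro!: mod_homI)

lemma dsum_zero_right:
 assumes "right_module R M" "right_module R Z" "carrier Z = {\<zero>\<^sub>Z}"
 shows "mod_iso R (dsum M Z) M"
 by (rule mod_isoI_inverse[of fst _ _ _ "\<lambda>x. (x, \<zero>\<^sub>Z)"]) (use assms in \<open>auto simp: dsum_fst_hom\<close>)

lemma dsum_zero_left:
 assumes "right_module R M" "right_module R Z" "carrier Z = {\<zero>\<^sub>Z}"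
 shows "mod_iso R (dsum Z M) M"
 using mod_iso_trans[OF dsum_comm dsum_zero_right[OF assms]] .

lemma retract_dsum:
 assumes "right_module R M" "right_module R N" "i \<in> mod_hom R N M" "p \<in> mod_hom R M N"
  "\<And>x. x \<in> carrier N \<Longrightarrow> p (i x) = x"
 shows "mod_iso R M (dsum N (M\<lparr>carrier := a_kernel M N p\<rparr>))"
proof -
 interpret M: right_module R M by fact
 interpret N: right_module R N by fact
 note [simp] = mh_closed[OF assms(3)] mh_closed[OF assms(4)] mh_add[OF assms(3)]
  mh_add[OF assms(4)] mh_act[OF assms(3)] mh_act[OF assms(4)]
  mh_uminus[OF assms(1,2,4)] mh_uminus[OF assms(2,1,3)] assms(5)
 show ?thesis
 proof (rule mod_isoI_inverse[of "\<lambda>m. (p m, m \<ominus>\<^sub>M i (p m))" _ _ _ "\<lambda>(n, k). i n \<oplus>\<^sub>M k"])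
  show "(\<lambda>m. (p m, m \<ominus>\<^sub>M i (p m))) \<in> mod_hom R M (dsum N (M\<lparr>carrier := a_kernel M N p\<rparr>))"
   by (rule mod_homI)
     (auto simp: a_kernel_def' M.act_minus M.act_closed N.act_closed N.r_neg a_minus_def
      M.minus_add M.a_ac M.act_add_module M.act_uminus)
 qed (auto simp: a_kernel_def' a_minus_def M.r_neg M.r_neg1 M.r_neg2 M.a_ac)
qed

lemma dsum_family_simps [simp]:
 "carrier (dsum_family n N) = (\<Pi>\<^sub>E i\<in>{..<n}. carrier (N i))"
 "\<zero>\<^bsub>dsum_family n N\<^esub> = (\<lambda>i\<in>{..<n}. \<zero>\<^bsub>N i\<^esub>)"
 "x \<oplus>\<^bsub>dsum_family n N\<^esub> y = (\<lambda>i\<in>{..<n}. x i \<oplus>\<^bsub>N i\<^esub> y i)"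
 "r \<odot>\<^bsub>dsum_family n N\<^esub> x = (\<lambda>i\<in>{..<n}. r \<odot>\<^bsub>N i\<^esub> x i)"
 by (simp_all add: dsum_family_def)

lemma dsum_family_module:
 assumes R: "ring R" and N: "\<And>i. i < n \<Longrightarrow> right_module R (N i)" shows "right_module R (dsum_family n N)"
proof -
 have ag: "abelian_group (N i)" and am: "abelian_monoid (N i)" if "i < n" for i
  using N[OF that] by (auto simp: right_module_def abelian_group_def)
 note m = abelian_monoid.a_closed[OF am] abelian_monoid.zero_closed[OF am] abelian_monoid.a_assoc[OF am]
   abelian_monoid.a_comm[OF am] abelian_monoid.l_zero[OF am]
  and x = right_module.act_closed[OF N] right_module.act_add_ring[OF N] right_module.act_add_module[OF N]
   right_module.act_mult[OF N] right_module.act_one[OF N]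
 show ?thesis
 proof (intro right_module.intro R abelian_groupI right_module_axioms.intro)
  show "\<exists>y\<in>carrier (dsum_family n N). y \<oplus>\<^bsub>dsum_family n N\<^esub> x = \<zero>\<^bsub>dsum_family n N\<^esub>"
   if "x \<in> carrier (dsum_family n N)" for x
   using that by (intro bexI[of _ "\<lambda>i\<in>{..<n}. \<ominus>\<^bsub>N i\<^esub> x i"])
    (auto intro!: ext simp: restrict_def PiE_iff extensional_def abelian_group.l_neg[OF ag] abelian_group.a_inv_closed[OF ag])
 qed (use x m in \<open>auto intro!: restrict_PiE_iff[THEN iffD2] ext simp: PiE_iff extensional_def restrict_def\<close>)
qed

lemma dsum_family_Suc: "mod_iso R (dsum_family (Suc n) N) (dsum (dsum_family n N) (N n))"
proof (rule mod_isoI_inverse[of "\<lambda>x. (restrict x {..<n}, x n)" _ _ _ "\<lambda>(x, y). x(n := y)"])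
 show "(\<lambda>x. (restrict x {..<n}, x n)) \<in> mod_hom R (dsum_family (Suc n) N) (dsum (dsum_family n N) (N n))"
 proof (rule mod_homI)
  fix x assume "x \<in> carrier (dsum_family (Suc n) N)"
  then show "(restrict x {..<n}, x n) \<in> carrier (dsum (dsum_family n N) (N n))" by (auto simp: PiE_iff)
 next
  fix x y
  have "restrict (\<lambda>i\<in>{..<Suc n}. x i \<oplus>\<^bsub>N i\<^esub> y i) {..<n}
    = (\<lambda>i\<in>{..<n}. restrict x {..<n} i \<oplus>\<^bsub>N i\<^esub> restrict y {..<n} i)"
   by (rule restrict_ext) simp
  then show "(restrict (x \<oplus>\<^bsub>dsum_family (Suc n) N\<^esub> y) {..<n}, (x \<oplus>\<^bsub>dsum_family (Suc n) N\<^esub> y) n)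
    = (restrict x {..<n}, x n) \<oplus>\<^bsub>dsum (dsum_family n N) (N n)\<^esub> (restrict y {..<n}, y n)"
   by simp
 next
  fix r x
  have "restrict (\<lambda>i\<in>{..<Suc n}. r \<odot>\<^bsub>N i\<^esub> x i) {..<n} = (\<lambda>i\<in>{..<n}. r \<odot>\<^bsub>N i\<^esub> restrict x {..<n} i)"
   by (rule restrict_ext) simp
  then show "(restrict (r \<odot>\<^bsub>dsum_family (Suc n) N\<^esub> x) {..<n}, (r \<odot>\<^bsub>dsum_family (Suc n) N\<^esub> x) n)
    = r \<odot>\<^bsub>dsum (dsum_family n N) (N n)\<^esub> (restrict x {..<n}, x n)"
   by simp
 qed
 fix x assume x: "x \<in> carrier (dsum_family (Suc n) N)"
 show "(case (restrict x {..<n}, x n) of (x, y) \<Rightarrow> x(n := y)) = x"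
 proof
  fix i show "(case (restrict x {..<n}, x n) of (x, y) \<Rightarrow> x(n := y)) i = x i"
   using x PiE_arb[of x "{..<Suc n}" _ i] by (cases "i < n"; cases "i = n") (simp_all add: restrict_def)
 qed
next
 fix z assume z: "z \<in> carrier (dsum (dsum_family n N) (N n))"
 then show "(case z of (x, y) \<Rightarrow> x(n := y)) \<in> carrier (dsum_family (Suc n) N)"
  by (auto simp: lessThan_Suc intro!: PiE_fun_upd)
 show "(restrict (case z of (x, y) \<Rightarrow> x(n := y)) {..<n}, (case z of (x, y) \<Rightarrow> x(n := y)) n) = z"
 proof (cases z)
  case (Pair x y)
  have "restrict (x(n := y)) {..<n} i = x i" for i
   using z PiE_arb[of x "{..<n}" "\<lambda>i. carrier (N i)" i] Pair by (cases "i < n") auto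
  then show ?thesis by (auto simp: Pair)
 qed
qed

lemma dsum_family_0: "carrier (dsum_family 0 N) = {\<zero>\<^bsub>dsum_family 0 N\<^esub>}"
 by auto

section \<open>Finitely generated modules\<close>

definition fg_module :: "'a ring \<Rightarrow> ('a, 'm) module \<Rightarrow> bool" where
 "fg_module R M \<longleftrightarrow> right_module R M \<and> fin_gen R M"

lemma fg_modulesI: "fg_module R M \<Longrightarrow> M \<in> fg_modules R"
 and fg_modulesD: "M \<in> fg_modules R \<Longrightarrow> fg_module R M"
 by (auto simp: fg_module_def fg_modules_def)

lemma fg_mod_rm: "fg_module R M \<Longrightarrow> right_module R M"
 by (simp add: fg_module_def)

lemma fg_mods_rm: "M \<in> fg_modules R \<Longrightarrow> right_module R M"
 by (simp add: fg_modules_def)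

lemma fg_module_surj:
 assumes "fg_module R M" "right_module R N" "f \<in> mod_hom R M N" "f ` carrier M = carrier N"
 shows "fg_module R N"
proof -
 interpret M: right_module R M using assms by (simp add: fg_module_def)
 interpret N: right_module R N by fact
 obtain S where S: "finite S" "S \<subseteq> carrier M" "\<And>L. submod R L M \<Longrightarrow> S \<subseteq> L \<Longrightarrow> L = carrier M"
  using assms(1) by (auto simp: fg_module_def fin_gen_def)
 have "L = carrier N" if L: "submod R L N" "f ` S \<subseteq> L" for L
 proof -
  have "{x \<in> carrier M. f x \<in> L} = carrier M"
   using submod_vimage[OF M.right_module_axioms N.right_module_axioms assms(3) L(1)] L(2) S(2)
   by (intro S(3)) auto
  then have "f x \<in> L" if "x \<in> carrier M" for x using that by blast
  then have "carrier N \<subseteq> L" unfolding assms(4)[symmetric] by blast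
  then show ?thesis using N.submod_subset[OF L(1)] by blast
 qed
 then show ?thesis using S(1,2) assms(2) mh_closed[OF assms(3)]
  by (auto simp: fg_module_def fin_gen_def intro!: exI[of _ "f ` S"])
qed

lemma fg_module_iso:
 assumes "mod_iso R M N" "fg_module R M" "right_module R N"
 shows "fg_module R N"
 using assms(1) fg_module_surj[OF assms(2,3)] unfolding mod_iso_def bij_betw_def by blast

lemma fg_module_dsum:
 assumes "fg_module R M" "fg_module R N" shows "fg_module R (dsum M N)"
proof -
 interpret M: right_module R M using assms by (simp add: fg_module_def)
 interpret N: right_module R N using assms by (simp add: fg_module_def)
 note MN = dsum_module[OF M.right_module_axioms N.right_module_axioms]
 interpret MN: right_module R "dsum M N" by (rule MN)
 obtain S where S: "finite S" "S \<subseteq> carrier M" "\<And>L. submod R L M \<Longrightarrow> S \<subseteq> L \<Longrightarrow> L = carrier M"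
  using assms(1) by (auto simp: fg_module_def fin_gen_def)
 obtain T where T: "finite T" "T \<subseteq> carrier N" "\<And>L. submod R L N \<Longrightarrow> T \<subseteq> L \<Longrightarrow> L = carrier N"
  using assms(2) by (auto simp: fg_module_def fin_gen_def)
 let ?U = "(\<lambda>x. (x, \<zero>\<^sub>N)) ` S \<union> (\<lambda>x. (\<zero>\<^sub>M, x)) ` T"
 have "L = carrier (dsum M N)" if L: "submod R L (dsum M N)" "?U \<subseteq> L" for L
 proof -
  have "{x \<in> carrier M. (x, \<zero>\<^sub>N) \<in> L} = carrier M"
   using submod_vimage[OF M.right_module_axioms MN dsum_inl_hom[OF N.right_module_axioms] L(1)] L(2) S(2)
   by (intro S(3)) auto
  moreover have "{x \<in> carrier N. (\<zero>\<^sub>M, x) \<in> L} = carrier N"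
   using submod_vimage[OF N.right_module_axioms MN dsum_inr_hom[OF M.right_module_axioms] L(1)] L(2) T(2)
   by (intro T(3)) auto
  ultimately have "(x, y) \<in> L" if "x \<in> carrier M" "y \<in> carrier N" for x y
   using MN.submod_add[OF L(1), of "(x, \<zero>\<^sub>N)" "(\<zero>\<^sub>M, y)"] that by auto
  then show ?thesis using MN.submod_subset[OF L(1)] by auto
 qed
 moreover have "finite ?U" "?U \<subseteq> carrier (dsum M N)" using S T by auto
 ultimately have "fin_gen R (dsum M N)" unfolding fin_gen_def by (intro exI[of _ ?U]) blast
 then show ?thesis using MN by (simp add: fg_module_def)
qed

lemma fg_module_zero: "right_module R M \<Longrightarrow> carrier M = {\<zero>\<^sub>M} \<Longrightarrow> fg_module R M"
 unfolding fg_module_def fin_gen_def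
 by (auto intro!: exI[of _ "{}"] dest: right_module.submod_subset right_module.submod_zero)

lemma fg_module_dsum_family:
 assumes "ring R" "\<And>i. i < n \<Longrightarrow> fg_module R (N i)" shows "fg_module R (dsum_family n N)"
 using assms(2)
proof (induction n)
 case 0
 then show ?case by (intro fg_module_zero dsum_family_module assms) auto
next
 case (Suc n)
 have m: "right_module R (dsum_family (Suc n) N)"
  by (rule dsum_family_module[OF assms(1)], rule fg_mod_rm, rule Suc.prems)
 have "fg_module R (dsum (dsum_family n N) (N n))"
  using Suc by (intro fg_module_dsum) auto
 then show ?case using fg_module_iso[OF mod_iso_sym[OF dsum_family_Suc m] _ m] by blast
qed

text \<open>A finitely generated module over any type has an isomorphic copy among the objects of the
 module category; this lets constructions that leave the type of lists be brought back to it.\<close>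

definition list_copy :: "'a ring \<Rightarrow> ('a, 'm) module \<Rightarrow> ('a, 'a list) module" where
 "list_copy R M = (SOME N. N \<in> fg_modules R \<and> mod_iso R M N)"

lemma list_copy:
 assumes "fg_module R M"
 shows "list_copy R M \<in> fg_modules R" "mod_iso R M (list_copy R M)" "mod_iso R (list_copy R M) M"
proof -
 have "\<exists>N. N \<in> fg_modules R \<and> mod_iso R M N"
  using fg_modules_universal[of R M] assms by (auto simp: fg_module_def)
 then have "list_copy R M \<in> fg_modules R \<and> mod_iso R M (list_copy R M)"
  unfolding list_copy_def by (rule someI_ex)
 then show "list_copy R M \<in> fg_modules R" "mod_iso R M (list_copy R M)" "mod_iso R (list_copy R M) M"
  using mod_iso_sym[of R M] assms by (auto simp: fg_module_def)
qed

lemma zero_modules_iff: "M \<in> zero_modules R \<longleftrightarrow> right_module R M \<and> carrier M = {\<zero>\<^sub>M}"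
 using fg_module_zero by (auto simp: zero_modules_def fg_modules_def fg_module_def)

definition zero_module :: "('a, 'a list) module" where
 "zero_module = \<lparr>carrier = {[]}, monoid.mult = undefined, one = undefined, ring.zero = [],
  add = (\<lambda>_ _. []), smult = (\<lambda>_ _. [])\<rparr>"

lemma zero_module: "ring R \<Longrightarrow> zero_module \<in> zero_modules R"
 unfolding zero_modules_iff
 by (auto simp: zero_module_def intro!: right_module.intro right_module_axioms.intro abelian_groupI)

section \<open>Short exact sequences\<close>

definition ses :: "'a ring \<Rightarrow> ('a, 'l) module \<Rightarrow> ('a, 'm) module \<Rightarrow> ('a, 'n) module \<Rightarrow> bool" where
 "ses R L M N \<longleftrightarrow> (\<exists>f g. short_exact R L M N f g)"

lemma ses_iso:
 assumes "ses R L M N" "mod_iso R L L'" "mod_iso R M M'" "mod_iso R N N'"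
  "right_module R L" "right_module R M" "right_module R N" "right_module R N'"
 shows "ses R L' M' N'"
proof -
 obtain f g where "short_exact R L M N f g" using assms(1) by (auto simp: ses_def)
 then have fg: "f \<in> mod_hom R L M" "g \<in> mod_hom R M N" "inj_on f (carrier L)"
  "f ` carrier L = a_kernel M N g" "g ` carrier M = carrier N"
  by (auto simp: short_exact_def)
 obtain l l' where l: "l \<in> mod_hom R L L'" "l' \<in> mod_hom R L' L"
  "\<And>x. x \<in> carrier L \<Longrightarrow> l' (l x) = x" "\<And>y. y \<in> carrier L' \<Longrightarrow> l (l' y) = y"
  using mod_iso_obtain[OF assms(2,5)] by metis
 obtain m m' where m: "m \<in> mod_hom R M M'" "m' \<in> mod_hom R M' M"
  "\<And>x. x \<in> carrier M \<Longrightarrow> m' (m x) = x" "\<And>y. y \<in> carrier M' \<Longrightarrow> m (m' y) = y"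
  using mod_iso_obtain[OF assms(3,6)] by metis
 obtain n n' where n: "n \<in> mod_hom R N N'" "n' \<in> mod_hom R N' N"
  "\<And>x. x \<in> carrier N \<Longrightarrow> n' (n x) = x" "\<And>y. y \<in> carrier N' \<Longrightarrow> n (n' y) = y"
  using mod_iso_obtain[OF assms(4,7)] by metis
 have z: "n \<zero>\<^sub>N = \<zero>\<^sub>N'" "n' \<zero>\<^sub>N' = \<zero>\<^sub>N" using mh_zero n assms by metis+
 note c = mh_closed[OF fg(1)] mh_closed[OF fg(2)] mh_closed[OF l(1)] mh_closed[OF l(2)]
  mh_closed[OF m(1)] mh_closed[OF m(2)] mh_closed[OF n(1)] mh_closed[OF n(2)]
 show ?thesis unfolding ses_def short_exact_def
 proof (intro exI conjI)
  show "(\<lambda>x. m (f (l' x))) \<in> mod_hom R L' M'" "(\<lambda>x. n (g (m' x))) \<in> mod_hom R M' N'"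
   using mh_comp fg l m n by metis+
  show "inj_on (\<lambda>x. m (f (l' x))) (carrier L')"
   using c l m fg(3) by (intro inj_onI) (metis inj_onD)
  show "(\<lambda>x. m (f (l' x))) ` carrier L' = a_kernel M' N' (\<lambda>x. n (g (m' x)))" (is "?A = ?B")
  proof
   have "n (g (m' (m (f (l' x))))) = \<zero>\<^sub>N'" if "x \<in> carrier L'" for x
   proof -
    have "f (l' x) \<in> a_kernel M N g" using fg(4) that c by blast
    then show ?thesis using c m that z by (simp add: a_kernel_def')
   qed
   then show "?A \<subseteq> ?B" using c by (auto simp: a_kernel_def')
   show "?B \<subseteq> ?A"
   proof
    fix y assume "y \<in> ?B"
    then have y: "y \<in> carrier M'" "n (g (m' y)) = \<zero>\<^sub>N'" by (auto simp: a_kernel_def')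
    then have "g (m' y) = \<zero>\<^sub>N" using n(3) z c by metis
    then have "m' y \<in> f ` carrier L" using fg(4) y c by (auto simp: a_kernel_def')
    then obtain x where "x \<in> carrier L" "m' y = f x" by auto
    then have "y = m (f (l' (l x)))" "l x \<in> carrier L'" using l(3) m(4)[OF y(1)] c by auto
    then show "y \<in> ?A" by blast
   qed
  qed
  show "(\<lambda>x. n (g (m' x))) ` carrier M' = carrier N'"
  proof
   show "carrier N' \<subseteq> (\<lambda>x. n (g (m' x))) ` carrier M'"
   proof
    fix y assume y: "y \<in> carrier N'"
    then obtain x where "x \<in> carrier M" "n' y = g x" using fg(5) c by (metis image_iff)
    then have "y = n (g (m' (m x)))" "m x \<in> carrier M'" using n(4)[OF y] m(3) c by auto
    then show "y \<in> (\<lambda>x. n (g (m' x))) ` carrier M'" by blast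
   qed
  qed (use c in auto)
 qed
qed

lemma ses_dsum:
 assumes "ses R L M N" "ses R L' M' N'"
 shows "ses R (dsum L L') (dsum M M') (dsum N N')"
proof -
 obtain f g f' g' where "short_exact R L M N f g" "short_exact R L' M' N' f' g'"
  using assms by (auto simp: ses_def)
 then have "short_exact R (dsum L L') (dsum M M') (dsum N N') (map_prod f f') (map_prod g g')"
  unfolding short_exact_def
  by (auto intro!: dsum_map_hom map_prod_inj_on simp: a_kernel_def' set_eq_iff image_iff)
 then show ?thesis by (auto simp: ses_def)
qed

section \<open>Finite length\<close>

text \<open>Finite length is expressed by a strictly monotone measure on submodules; an upper bound of the
 measure at the whole module bounds the length.\<close>

definition length_le :: "'a ring \<Rightarrow> ('a, 'm) module \<Rightarrow> nat \<Rightarrow> bool" where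
 "length_le R M n \<longleftrightarrow> (\<exists>l :: 'm set \<Rightarrow> nat. l (carrier M) \<le> n \<and>
  (\<forall>N N'. submod R N M \<and> submod R N' M \<and> N \<subset> N' \<longrightarrow> l N < l N'))"

definition fin_length :: "'a ring \<Rightarrow> ('a, 'm) module \<Rightarrow> bool" where
 "fin_length R M \<longleftrightarrow> (\<exists>n. length_le R M n)"

lemma length_le_embed:
 assumes "right_module R N" "right_module R M" "i \<in> mod_hom R N M" "inj_on i (carrier N)" "length_le R M n"
 shows "length_le R N n" "\<not> carrier M \<subseteq> i ` carrier N \<Longrightarrow> \<exists>m<n. length_le R N m"
proof -
 interpret N: right_module R N by fact
 interpret M: right_module R M by fact
 obtain l where l: "l (carrier M) \<le> n" "\<And>L L'. submod R L M \<Longrightarrow> submod R L' M \<Longrightarrow> L \<subset> L' \<Longrightarrow> l L < l L'"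
  using assms(5) by (auto simp: length_le_def)
 have s: "l (i ` L) < l (i ` L')" if "submod R L N" "submod R L' N" "L \<subset> L'" for L L'
 proof -
  have "i ` L \<subset> i ` L'"
   using that assms(4) N.submod_subset[of L'] inj_on_image_eq_iff[of i "carrier N" L L'] by blast
  then show ?thesis using that by (intro l(2) submod_image[OF assms(1-3)])
 qed
 have i: "submod R (i ` carrier N) M" by (rule submod_image[OF assms(1-3) N.submod_carrier])
 then have iM: "i ` carrier N \<subseteq> carrier M" by (rule M.submod_subset)
 have p: "l (i ` carrier N) < n" if "\<not> carrier M \<subseteq> i ` carrier N"
 proof -
  have "i ` carrier N \<subset> carrier M" using iM that by blast
  from l(2)[OF i M.submod_carrier this] show ?thesis using l(1) by simp
 qed
 then have "l (i ` carrier N) \<le> n"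
  using l(1) iM by (metis less_imp_le_nat subset_antisym)
 then show "length_le R N n" unfolding length_le_def using s by (intro exI[of _ "\<lambda>L. l (i ` L)"]) auto
 show "\<exists>m<n. length_le R N m" if "\<not> carrier M \<subseteq> i ` carrier N"
  using s p[OF that] unfolding length_le_def by (intro exI[of _ "l (i ` carrier N)"] conjI exI[of _ "\<lambda>L. l (i ` L)"]) auto
qed

lemma submod_inclusion: "submod R L M \<Longrightarrow> right_module R M \<Longrightarrow> (\<lambda>x. x) \<in> mod_hom R (M\<lparr>carrier := L\<rparr>) M"
 using right_module.submod_subset[of R M L] by (auto intro!: mod_homI)

lemma fin_len_submod:
 assumes "fin_length R M" "right_module R M" "submod R L M"
 shows "fin_length R (M\<lparr>carrier := L\<rparr>)"
 using length_le_embed(1)[OF right_module.submod_module[OF assms(2,3)] assms(2) submod_inclusion[OF assms(3,2)]] assms(1)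
 by (auto simp: fin_length_def)

lemma fin_length_iso:
 assumes "mod_iso R N M" "fin_length R M" "right_module R N" "right_module R M"
 shows "fin_length R N"
 using assms(1,2) length_le_embed(1)[OF assms(3,4)] by (auto simp: fin_length_def mod_iso_def bij_betw_def)

lemma fin_length_fin_gen:
 assumes "right_module R M" "fin_length R M" shows "fg_module R M"
proof -
 interpret right_module R M by fact
 obtain l where l: "\<And>L L'. submod R L M \<Longrightarrow> submod R L' M \<Longrightarrow> L \<subset> L' \<Longrightarrow> l L < (l L' :: nat)"
  using assms(2) by (auto simp: fin_length_def length_le_def)
 define sp where "sp S = \<Inter>{L. submod R L M \<and> S \<subseteq> L}" for S
 have sp: "submod R (sp S) M" "S \<subseteq> sp S" if "S \<subseteq> carrier M" for S
  using that submod_carrier by (auto simp: sp_def submod_iff)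
 have min: "sp S \<subseteq> L" if "submod R L M" "S \<subseteq> L" for S L using that by (auto simp: sp_def)
 have bound: "l (sp S) \<le> l (carrier M)" if "S \<subseteq> carrier M" for S
  using l[OF sp(1)[OF that] submod_carrier] submod_subset[OF sp(1)[OF that]]
  by (cases "sp S = carrier M") (auto simp: psubset_eq)
 obtain S where S: "finite S" "S \<subseteq> carrier M"
  and max: "\<And>T. finite T \<Longrightarrow> T \<subseteq> carrier M \<Longrightarrow> l (sp T) \<le> l (sp S)"
 proof -
  have "\<exists>S. (finite S \<and> S \<subseteq> carrier M) \<and> (\<forall>T. finite T \<and> T \<subseteq> carrier M \<longrightarrow> l (sp T) \<le> l (sp S))"
   by (rule ex_has_greatest_nat[of _ "{}" _ "l (carrier M) + 1"]) (use bound in \<open>auto simp: less_Suc_eq_le\<close>)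
  then show ?thesis using that by blast
 qed
 have "carrier M \<subseteq> sp S"
 proof
  fix x assume x: "x \<in> carrier M"
  then have xS: "insert x S \<subseteq> carrier M" using S by simp
  show "x \<in> sp S"
  proof (rule ccontr)
   assume "x \<notin> sp S"
   then have "sp S \<subset> sp (insert x S)" using sp[OF xS] min[of "sp (insert x S)" S] by blast
   then show False using l[OF sp(1)[OF S(2)] sp(1)[OF xS]] max[of "insert x S"] S xS by auto
  qed
 qed
 then have "fin_gen R M" unfolding fin_gen_def
  using S min submod_subset by (intro exI[of _ S]) blast
 then show ?thesis using assms by (simp add: fg_module_def)
qed

text \<open>Iterated kernels of a surjective endomorphism that is not injective would ascend forever.\<close>

lemma fin_length_surj_inj:
 assumes "right_module R M" "fin_length R M" "h \<in> mod_hom R M M" "h ` carrier M = carrier M"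
 shows "inj_on h (carrier M)"
proof (rule ccontr)
 interpret right_module R M by fact
 obtain l where l: "\<And>L L'. submod R L M \<Longrightarrow> submod R L' M \<Longrightarrow> L \<subset> L' \<Longrightarrow> l L < (l L' :: nat)"
  using assms(2) by (auto simp: fin_length_def length_le_def)
 assume "\<not> inj_on h (carrier M)"
 then obtain x where x: "x \<in> carrier M" "h x = \<zero>\<^sub>M" "x \<noteq> \<zero>\<^sub>M"
  using mh_inj_iff[OF assms(1,1,3)] by auto
 have hn: "h ^^ n \<in> mod_hom R M M" for n
  by (induction n) (auto intro!: mod_homI simp: mh_closed[OF assms(3)] mh_add[OF assms(3)]
    mh_act[OF assms(3)] mh_closed mh_add mh_act)
 have hs: "(h ^^ n) ` carrier M = carrier M" for n
 proof (induction n)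
  case (Suc n)
  have "(h ^^ Suc n) ` carrier M = h ` (h ^^ n) ` carrier M" by (simp add: image_comp)
  then show ?case using Suc assms(4) by simp
 qed simp
 define K where "K n = a_kernel M M (h ^^ n)" for n
 have K: "submod R (K n) M" for n unfolding K_def by (rule submod_kernel[OF assms(1,1) hn])
 have "K n \<subset> K (Suc n)" for n
 proof
  show "K n \<subseteq> K (Suc n)" using mh_zero[OF assms(1,1,3)] by (auto simp: K_def a_kernel_def')
  obtain y where y: "y \<in> carrier M" "(h ^^ n) y = x" using hs[of n] x(1) by (metis imageE)
  then show "K n \<noteq> K (Suc n)" using x by (auto simp: K_def a_kernel_def' set_eq_iff intro!: exI[of _ y])
 qed
 then have "l (K n) < l (K (Suc n))" for n by (intro l K)
 then have "n \<le> l (K n)" for n by (induction n) (simp, metis Suc_leI le_less_trans)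
 moreover have "l (K n) \<le> l (carrier M)" for n
  using l[OF K[of n] submod_carrier] submod_subset[OF K[of n]] by (cases "K n = carrier M") (auto simp: psubset_eq)
 ultimately show False using Suc_n_not_le_n le_trans by blast
qed

definition fin_len_ring :: "'a ring \<Rightarrow> bool" where
 "fin_len_ring R \<longleftrightarrow> ring R \<and> (\<forall>M\<in>fg_modules R. fin_length R M)"

lemma fin_len_ring:
 assumes "fin_len_ring R" "fg_module R M" shows "fin_length R M"
 using assms list_copy[OF assms(2)] fin_length_iso[OF list_copy(2)[OF assms(2)]]
 by (auto simp: fin_len_ring_def fg_mod_rm fg_mods_rm)

lemma fl_ring_is_ring: "fin_len_ring R \<Longrightarrow> ring R"
 by (simp add: fin_len_ring_def)

lemma fg_module_submod:
 assumes "fin_len_ring R" "fg_module R M" "submod R L M"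
 shows "fg_module R (M\<lparr>carrier := L\<rparr>)"
proof (rule fin_length_fin_gen)
 note M = fg_mod_rm[OF assms(2)]
 show "right_module R (M\<lparr>carrier := L\<rparr>)" by (rule right_module.submod_module[OF M assms(3)])
 show "fin_length R (M\<lparr>carrier := L\<rparr>)"
  by (rule fin_len_submod[OF fin_len_ring[OF assms(1,2)] M assms(3)])
qed

section \<open>Projective modules\<close>

lemma (in right_module) act_finsum:
 assumes "finite I" "f \<in> I \<rightarrow> carrier M" "r \<in> carrier R"
 shows "r \<odot>\<^sub>M finsum M f I = finsum M (\<lambda>i. r \<odot>\<^sub>M f i) I"
 using assms(1,2)
proof (induction I rule: finite_induct)
 case empty
 then show ?case using assms(3) by (simp add: act_zero)
next
 case (insert i I)
 then have "f \<in> I \<rightarrow> carrier M" "f i \<in> carrier M" by auto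
 with insert assms(3) show ?case by (simp add: M.finsum_insert act_add_module act_closed Pi_iff)
qed

definition reg :: "'a ring \<Rightarrow> ('a, 'a) module" where
 "reg R = \<lparr>carrier = carrier R, monoid.mult = undefined, one = undefined, ring.zero = \<zero>\<^sub>R,
  add = add R, smult = (\<lambda>r x. x \<otimes>\<^sub>R r)\<rparr>"

lemma reg_simps [simp]: "carrier (reg R) = carrier R" "\<zero>\<^bsub>reg R\<^esub> = \<zero>\<^sub>R" "x \<oplus>\<^bsub>reg R\<^esub> y = x \<oplus>\<^sub>R y"
 "r \<odot>\<^bsub>reg R\<^esub> x = x \<otimes>\<^sub>R r"
 by (simp_all add: reg_def)

lemma reg_module: "ring R \<Longrightarrow> right_module R (reg R)"
proof -
 assume "ring R"
 then interpret ring R .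
 show ?thesis
  by (intro right_module.intro ring_axioms abelian_groupI right_module_axioms.intro)
    (auto simp: a_ac m_assoc l_distr r_distr intro!: exI[of _ "\<ominus>\<^sub>R _"] simp: Bex_def l_neg r_neg)
qed

lemma fg_module_reg: "ring R \<Longrightarrow> fg_module R (reg R)"
proof -
 assume R: "ring R"
 then interpret ring R .
 interpret right_module R "reg R" by (rule reg_module) fact
 have "L = carrier R" if L: "submod R L (reg R)" "\<one>\<^sub>R \<in> L" for L
  using submod_subset[OF L(1)] submod_act[OF L(1) _ L(2)] by auto
 then show ?thesis unfolding fg_module_def fin_gen_def
  by (auto intro!: exI[of _ "{\<one>\<^sub>R}"] reg_module R)
qed

definition free_mod :: "'a ring \<Rightarrow> nat \<Rightarrow> ('a, nat \<Rightarrow> 'a) module" where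
 "free_mod R m = dsum_family m (\<lambda>_. reg R)"

lemma fg_module_free: "ring R \<Longrightarrow> fg_module R (free_mod R m)"
 unfolding free_mod_def by (intro fg_module_dsum_family fg_module_reg)

definition dual_basis :: "'a ring \<Rightarrow> ('a, 'm) module \<Rightarrow> nat \<Rightarrow> (nat \<Rightarrow> 'm) \<Rightarrow> (nat \<Rightarrow> 'm \<Rightarrow> 'a) \<Rightarrow> bool" where
 "dual_basis R P m x \<phi> \<longleftrightarrow> (\<forall>i<m. x i \<in> carrier P \<and> \<phi> i \<in> mod_hom R P (reg R)) \<and>
  (\<forall>p\<in>carrier P. finsum P (\<lambda>i. \<phi> i p \<odot>\<^sub>P x i) {..<m} = p)"

text \<open>The existence of a finite dual basis does not refer to the type of the elements of other modules.
 It therefore transfers projectivity between types, which the lifting property alone cannot do.\<close>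

definition fg_projective :: "'a ring \<Rightarrow> ('a, 'm) module \<Rightarrow> bool" where
 "fg_projective R P \<longleftrightarrow> right_module R P \<and> (\<exists>m x \<phi>. dual_basis R P m x \<phi>)"

lemma dual_basisD:
 assumes "dual_basis R P m x \<phi>"
 shows "\<And>i. i < m \<Longrightarrow> x i \<in> carrier P" "\<And>i. i < m \<Longrightarrow> \<phi> i \<in> mod_hom R P (reg R)"
  "\<And>p. p \<in> carrier P \<Longrightarrow> finsum P (\<lambda>i. \<phi> i p \<odot>\<^sub>P x i) {..<m} = p"
 using assms by (simp_all add: dual_basis_def)

lemma linear_combination_hom:
 fixes m :: nat
 assumes "right_module R P" "right_module R M" "\<And>i. i < m \<Longrightarrow> \<phi> i \<in> mod_hom R P (reg R)"
  "\<And>i. i < m \<Longrightarrow> y i \<in> carrier M"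
 shows "(\<lambda>p. finsum M (\<lambda>i. \<phi> i p \<odot>\<^sub>M y i) {..<m}) \<in> mod_hom R P M"
proof -
 interpret P: right_module R P by fact
 interpret M: right_module R M by fact
 have c: "\<phi> i p \<in> carrier R" if "i < m" "p \<in> carrier P" for i p
  using mh_closed[OF assms(3)] that by force
 show ?thesis
 proof (rule mod_homI)
  fix p q assume pq: "p \<in> carrier P" "q \<in> carrier P"
  have "finsum M (\<lambda>i. \<phi> i (p \<oplus>\<^sub>P q) \<odot>\<^sub>M y i) {..<m}
    = finsum M (\<lambda>i. \<phi> i p \<odot>\<^sub>M y i \<oplus>\<^sub>M \<phi> i q \<odot>\<^sub>M y i) {..<m}"
   using pq c assms(4) mh_add[OF assms(3)]
   by (intro M.finsum_cong') (auto simp: M.act_add_ring M.act_closed)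
  also have "\<dots> = finsum M (\<lambda>i. \<phi> i p \<odot>\<^sub>M y i) {..<m} \<oplus>\<^sub>M finsum M (\<lambda>i. \<phi> i q \<odot>\<^sub>M y i) {..<m}"
   using pq c assms(4) by (intro M.finsum_addf) (auto simp: M.act_closed)
  finally show "finsum M (\<lambda>i. \<phi> i (p \<oplus>\<^sub>P q) \<odot>\<^sub>M y i) {..<m}
    = finsum M (\<lambda>i. \<phi> i p \<odot>\<^sub>M y i) {..<m} \<oplus>\<^sub>M finsum M (\<lambda>i. \<phi> i q \<odot>\<^sub>M y i) {..<m}" .
 next
  fix r p assume rp: "r \<in> carrier R" "p \<in> carrier P"
  have "finsum M (\<lambda>i. \<phi> i (r \<odot>\<^sub>P p) \<odot>\<^sub>M y i) {..<m} = finsum M (\<lambda>i. r \<odot>\<^sub>M (\<phi> i p \<odot>\<^sub>M y i)) {..<m}"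
   using rp c assms(4) mh_act[OF assms(3)]
   by (intro M.finsum_cong') (auto simp: M.act_mult M.act_closed)
  then show "finsum M (\<lambda>i. \<phi> i (r \<odot>\<^sub>P p) \<odot>\<^sub>M y i) {..<m} = r \<odot>\<^sub>M finsum M (\<lambda>i. \<phi> i p \<odot>\<^sub>M y i) {..<m}"
   using rp c assms(4) by (subst M.act_finsum) (auto simp: M.act_closed)
 qed (use c assms(4) in \<open>auto intro!: M.finsum_closed simp: M.act_closed\<close>)
qed

lemma fg_projective_lift:
 assumes "fg_projective R P" "right_module R M" "right_module R N"
  "g \<in> mod_hom R M N" "g ` carrier M = carrier N" "h \<in> mod_hom R P N"
 obtains k where "k \<in> mod_hom R P M" "\<And>x. x \<in> carrier P \<Longrightarrow> g (k x) = h x"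
proof -
 interpret P: right_module R P using assms(1) by (simp add: fg_projective_def)
 interpret M: right_module R M by fact
 interpret N: right_module R N by fact
 obtain m x \<phi> where db: "dual_basis R P m x \<phi>" using assms(1) by (auto simp: fg_projective_def)
 note b = dual_basisD[OF db]
 have "\<exists>y. \<forall>i<m. y i \<in> carrier M \<and> g (y i) = h (x i)"
 proof (rule exI[of _ "\<lambda>i. inv_into (carrier M) g (h (x i))"], intro allI impI)
  fix i assume "i < m"
  then have "h (x i) \<in> g ` carrier M" using b(1) mh_closed[OF assms(6)] assms(5) by simp
  then show "inv_into (carrier M) g (h (x i)) \<in> carrier M \<and> g (inv_into (carrier M) g (h (x i))) = h (x i)"
   by (simp add: inv_into_into f_inv_into_f)
 qed
 then obtain y where y: "\<And>i. i < m \<Longrightarrow> y i \<in> carrier M" "\<And>i. i < m \<Longrightarrow> g (y i) = h (x i)" by auto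
 have c: "\<phi> i p \<in> carrier R" if "i < m" "p \<in> carrier P" for i p
  using mh_closed[OF b(2)] that by force
 let ?k = "\<lambda>p. finsum M (\<lambda>i. \<phi> i p \<odot>\<^sub>M y i) {..<m}"
 have "g (?k p) = h p" if p: "p \<in> carrier P" for p
 proof -
  have "g (?k p) = finsum N (\<lambda>i. g (\<phi> i p \<odot>\<^sub>M y i)) {..<m}"
   using p c y by (intro mh_finsum[OF assms(2-4)]) (auto simp: M.act_closed)
  also have "\<dots> = finsum N (\<lambda>i. h (\<phi> i p \<odot>\<^sub>P x i)) {..<m}"
   using p c y b(1) mh_closed[OF assms(6)] mh_act[OF assms(4)] mh_act[OF assms(6)]
   by (intro N.finsum_cong') (auto simp: N.act_closed)
  also have "\<dots> = h (finsum P (\<lambda>i. \<phi> i p \<odot>\<^sub>P x i) {..<m})"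
   using p c b(1) by (intro mh_finsum[OF P.right_module_axioms assms(3,6), symmetric]) (auto simp: P.act_closed)
  finally show ?thesis using b(3)[OF p] by simp
 qed
 moreover have "?k \<in> mod_hom R P M"
  using linear_combination_hom[OF P.right_module_axioms assms(2)] b y by blast
 ultimately show thesis using that by blast
qed

lemma dsum_family_proj_hom: "j < n \<Longrightarrow> (\<lambda>x. x j) \<in> mod_hom R (dsum_family n N) (N j)"
 by (rule mod_homI) auto

lemma free_fg_projective:
 assumes "ring R" shows "fg_projective R (free_mod R m)"
proof -
 have F: "right_module R (free_mod R m)" using fg_module_free[OF assms] by (simp add: fg_module_def)
 interpret F: right_module R "free_mod R m" by (rule F)
 interpret Rg: right_module R "reg R" by (rule reg_module) fact
 define x where "x i = (\<lambda>j\<in>{..<m}. if i = j then \<one>\<^sub>R else \<zero>\<^sub>R)" for i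
 have x: "x i \<in> carrier (free_mod R m)" for i by (auto simp: x_def free_mod_def)
 have "finsum (free_mod R m) (\<lambda>i. p i \<odot>\<^bsub>free_mod R m\<^esub> x i) {..<m} = p" if p: "p \<in> carrier (free_mod R m)" for p
 proof -
  have p': "p i \<in> carrier R" if "i < m" for i using p that by (auto simp: free_mod_def)
  have "finsum (free_mod R m) (\<lambda>i. p i \<odot>\<^bsub>free_mod R m\<^esub> x i) {..<m} j = p j" if j: "j < m" for j
  proof -
   have "finsum (free_mod R m) (\<lambda>i. p i \<odot>\<^bsub>free_mod R m\<^esub> x i) {..<m} j
     = finsum (reg R) (\<lambda>i. (p i \<odot>\<^bsub>free_mod R m\<^esub> x i) j) {..<m}"
    using dsum_family_proj_hom[OF j, of R "\<lambda>_. reg R"] p' x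
    by (intro mh_finsum[OF F Rg.right_module_axioms]) (auto simp: free_mod_def[symmetric] F.act_closed)
   also have "\<dots> = finsum (reg R) (\<lambda>i. if j = i then p i else \<zero>\<^bsub>reg R\<^esub>) {..<m}"
    using p' j by (intro Rg.M.finsum_cong') (auto simp: free_mod_def x_def)
   also have "\<dots> = p j" using p' j by (subst Rg.M.finsum_singleton) auto
   finally show ?thesis .
  qed
  moreover have "finsum (free_mod R m) (\<lambda>i. p i \<odot>\<^bsub>free_mod R m\<^esub> x i) {..<m} \<in> carrier (free_mod R m)"
   using p' x by (intro F.finsum_closed) (auto simp: F.act_closed)
  ultimately show ?thesis using p unfolding free_mod_def by (auto intro: PiE_ext)
 qed
 then have "dual_basis R (free_mod R m) m x (\<lambda>i p. p i)"
  using x dsum_family_proj_hom[of _ m R "\<lambda>_. reg R"] by (auto simp: dual_basis_def free_mod_def)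
 then show ?thesis using F by (auto simp: fg_projective_def)
qed

lemma fg_projective_retract:
 assumes "fg_projective R F" "right_module R P" "i \<in> mod_hom R P F" "p \<in> mod_hom R F P"
  "\<And>x. x \<in> carrier P \<Longrightarrow> p (i x) = x"
 shows "fg_projective R P"
proof -
 interpret F: right_module R F using assms(1) by (simp add: fg_projective_def)
 interpret P: right_module R P by fact
 obtain m x \<phi> where db: "dual_basis R F m x \<phi>" using assms(1) by (auto simp: fg_projective_def)
 note b = dual_basisD[OF db]
 have c: "\<phi> i p \<in> carrier R" if "i < m" "p \<in> carrier F" for i p
  using mh_closed[OF b(2)] that by force
 have "finsum P (\<lambda>j. \<phi> j (i q) \<odot>\<^sub>P p (x j)) {..<m} = q" if q: "q \<in> carrier P" for q
 proof -
  have iq: "i q \<in> carrier F" using mh_closed[OF assms(3)] q .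
  have "q = p (finsum F (\<lambda>j. \<phi> j (i q) \<odot>\<^sub>F x j) {..<m})" using b(3)[OF iq] assms(5) q by simp
  also have "\<dots> = finsum P (\<lambda>j. p (\<phi> j (i q) \<odot>\<^sub>F x j)) {..<m}"
   using iq c b(1) by (intro mh_finsum[OF F.right_module_axioms assms(2,4)]) (auto simp: F.act_closed)
  also have "\<dots> = finsum P (\<lambda>j. \<phi> j (i q) \<odot>\<^sub>P p (x j)) {..<m}"
   using iq c b(1) mh_act[OF assms(4)] mh_closed[OF assms(4)]
   by (intro P.finsum_cong') (auto simp: P.act_closed)
  finally show ?thesis by simp
 qed
 then have "dual_basis R P m (\<lambda>j. p (x j)) (\<lambda>j q. \<phi> j (i q))"
  using b(1) mh_closed[OF assms(4)] mh_comp[OF assms(3) b(2)] by (simp add: dual_basis_def)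
 then show ?thesis using assms by (auto simp: fg_projective_def)
qed

lemma fg_projective_iso:
 assumes "mod_iso R P P'" "fg_projective R P" "right_module R P'" shows "fg_projective R P'"
proof -
 have "right_module R P" using assms by (simp add: fg_projective_def)
 then obtain f g where "f \<in> mod_hom R P P'" "g \<in> mod_hom R P' P" "\<And>y. y \<in> carrier P' \<Longrightarrow> f (g y) = y"
  using mod_iso_obtain[OF assms(1)] by metis
 then show ?thesis using fg_projective_retract[OF assms(2,3)] by blast
qed

lemma fg_projective_zero:
 assumes "right_module R M" "carrier M = {\<zero>\<^sub>M}" shows "fg_projective R M"
proof -
 interpret right_module R M by fact
 have "dual_basis R M 0 undefined undefined" using assms by (auto simp: dual_basis_def)
 then show ?thesis using assms by (auto simp: fg_projective_def)
qed

lemma fg_projective_fg: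
 assumes "fg_projective R P" shows "fg_module R P"
proof -
 interpret P: right_module R P using assms by (simp add: fg_projective_def)
 obtain m x \<phi> where db: "dual_basis R P m x \<phi>" using assms(1) by (auto simp: fg_projective_def)
 note b = dual_basisD[OF db]
 have c: "\<phi> i p \<in> carrier R" if "i < m" "p \<in> carrier P" for i p
  using mh_closed[OF b(2)] that by force
 have "L = carrier P" if L: "submod R L P" "x ` {..<m} \<subseteq> L" for L
 proof
  show "L \<subseteq> carrier P" by (rule P.submod_subset[OF L(1)])
  show "carrier P \<subseteq> L"
  proof
   fix p assume p: "p \<in> carrier P"
   have "finsum P (\<lambda>i. \<phi> i p \<odot>\<^sub>P x i) {..<m} \<in> L"
    using L c p by (intro P.submod_finsum[OF L(1)] P.submod_act[OF L(1)]) auto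
   then show "p \<in> L" using b(3)[OF p] by simp
  qed
 qed
 then have "fin_gen R P" unfolding fin_gen_def using b(1) by (intro exI[of _ "x ` {..<m}"]) auto
 then show ?thesis using P.right_module_axioms by (simp add: fg_module_def)
qed

lemma free_surjection:
 assumes "fg_module R M"
 obtains m g where "g \<in> mod_hom R (free_mod R m) M" "g ` carrier (free_mod R m) = carrier M"
proof -
 interpret M: right_module R M using assms by (simp add: fg_module_def)
 obtain S where S: "finite S" "S \<subseteq> carrier M" "\<And>N. submod R N M \<Longrightarrow> S \<subseteq> N \<Longrightarrow> N = carrier M"
  using assms by (auto simp: fg_module_def fin_gen_def)
 obtain y where y: "bij_betw y {0..<card S} S" using ex_bij_betw_nat_finite[OF S(1)] by auto
 define m where "m = card S"
 have yS: "y ` {..<m} = S" using y by (simp add: bij_betw_def m_def atLeast0LessThan)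
 then have yM: "y i \<in> carrier M" if "i < m" for i using S(2) that by blast
 let ?F = "free_mod R m"
 have F: "right_module R ?F" using fg_module_free[OF M.R.ring_axioms] by (simp add: fg_module_def)
 let ?g = "\<lambda>p. finsum M (\<lambda>i. p i \<odot>\<^sub>M y i) {..<m}"
 have g: "?g \<in> mod_hom R ?F M"
  using yM dsum_family_proj_hom[of _ m R "\<lambda>_. reg R"]
  by (intro linear_combination_hom F M.right_module_axioms) (auto simp: free_mod_def)
 have "?g ` carrier ?F = carrier M"
 proof (rule S(3))
  show "submod R (?g ` carrier ?F) M"
   by (rule submod_image[OF F M.right_module_axioms g right_module.submod_carrier[OF F]])
  show "S \<subseteq> ?g ` carrier ?F"
  proof
   fix s assume "s \<in> S"
   then obtain j where j: "j < m" "s = y j" using yS by auto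
   let ?u = "\<lambda>i\<in>{..<m}. if j = i then \<one>\<^sub>R else \<zero>\<^sub>R"
   have "?g ?u = finsum M (\<lambda>i. if j = i then y i else \<zero>\<^sub>M) {..<m}"
    using yM by (intro M.finsum_cong') (auto simp: M.act_one M.zero_act)
   also have "\<dots> = s" using j yM by (subst M.finsum_singleton) auto
   finally have "s = ?g ?u" by simp
   moreover have "?u \<in> carrier ?F" by (auto simp: free_mod_def)
   ultimately show "s \<in> ?g ` carrier ?F" by (rule image_eqI)
  qed
 qed
 then show thesis using that g by blast
qed

lemma fg_projective_free_retract:
 assumes "fg_projective R P"
 obtains m i p where "i \<in> mod_hom R P (free_mod R m)" "p \<in> mod_hom R (free_mod R m) P"
  "\<And>x. x \<in> carrier P \<Longrightarrow> p (i x) = x"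
proof -
 have P: "right_module R P" using assms by (simp add: fg_projective_def)
 then have R: "ring R" by (simp add: right_module_def)
 obtain m p where p: "p \<in> mod_hom R (free_mod R m) P" "p ` carrier (free_mod R m) = carrier P"
  using free_surjection[OF fg_projective_fg[OF assms]] by metis
 have "(\<lambda>x. x) \<in> mod_hom R P P" by (auto intro: mod_homI)
 then show thesis
  using fg_projective_lift[OF assms fg_mod_rm[OF fg_module_free[OF R]] P p] that p(1) by metis
qed

text \<open>Lifting the identity along a surjection from a free module makes the module a retract of it; the
 free module is first replaced by a copy among the objects that the definition ranges over.\<close>

lemma projective_iff: "projective R P \<longleftrightarrow> P \<in> fg_modules R \<and> fg_projective R P"
proof safe
 assume P: "projective R P"
 then show Pf: "P \<in> fg_modules R" by (simp add: projective_def)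
 have Pr: "right_module R P" and R: "ring R" using fg_mods_rm[OF Pf] by (simp_all add: right_module_def)
 obtain m p where p: "p \<in> mod_hom R (free_mod R m) P" "p ` carrier (free_mod R m) = carrier P"
  using free_surjection[OF fg_modulesD[OF Pf]] by metis
 let ?F = "list_copy R (free_mod R m)"
 note F = list_copy[OF fg_module_free[OF R, of m]]
 obtain f g where fg: "f \<in> mod_hom R (free_mod R m) ?F" "g \<in> mod_hom R ?F (free_mod R m)"
  "\<And>x. x \<in> carrier (free_mod R m) \<Longrightarrow> g (f x) = x"
  using mod_iso_obtain[OF F(2) fg_mod_rm[OF fg_module_free[OF R]]] by metis
 have pg: "(\<lambda>x. p (g x)) \<in> mod_hom R ?F P" by (rule mh_comp[OF fg(2) p(1)])
 have "carrier P \<subseteq> (\<lambda>x. p (g x)) ` carrier ?F"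
 proof
  fix y assume "y \<in> carrier P"
  then obtain x where "x \<in> carrier (free_mod R m)" "y = p x" using p(2) by auto
  then have "y = p (g (f x))" "f x \<in> carrier ?F" using fg mh_closed[OF fg(1)] by auto
  then show "y \<in> (\<lambda>x. p (g x)) ` carrier ?F" by blast
 qed
 then have s: "(\<lambda>x. p (g x)) ` carrier ?F = carrier P" using mh_closed[OF pg] by auto
 have idh: "(\<lambda>x. x) \<in> mod_hom R P P" by (auto intro: mod_homI)
 have "\<exists>k\<in>mod_hom R P ?F. \<forall>x\<in>carrier P. p (g (k x)) = x"
  using P[unfolded projective_def, THEN conjunct2, rule_format, OF F(1) Pf pg idh s] .
 then obtain k where "k \<in> mod_hom R P ?F" "\<And>x. x \<in> carrier P \<Longrightarrow> p (g (k x)) = x" by blast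
 then show "fg_projective R P"
  using fg_projective_retract[OF fg_projective_iso[OF F(2) free_fg_projective[OF R] fg_mods_rm[OF F(1)]] Pr _ pg]
  by simp
next
 assume P: "P \<in> fg_modules R" "fg_projective R P"
 show "projective R P" unfolding projective_def
 proof (intro conjI ballI impI P(1))
  fix M N g h
  assume "M \<in> fg_modules R" "N \<in> fg_modules R" "g \<in> mod_hom R M N" "h \<in> mod_hom R P N"
   "g ` carrier M = carrier N"
  then obtain k where "k \<in> mod_hom R P M" "\<And>x. x \<in> carrier P \<Longrightarrow> g (k x) = h x"
   using fg_projective_lift[OF P(2), of M N g h] fg_mods_rm by blast
  then show "\<exists>k\<in>mod_hom R P M. \<forall>x\<in>carrier P. g (k x) = h x" by blast
 qed
qed

lemma fg_projective_dsum:
 assumes "fg_projective R P" "fg_projective R P'" shows "fg_projective R (dsum P P')"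
proof -
 have P: "right_module R P" "right_module R P'" using assms by (simp_all add: fg_projective_def)
 let ?D = "dsum P P'"
 have D: "fg_module R ?D" by (intro fg_module_dsum fg_projective_fg assms)
 note Dr = fg_mod_rm[OF D]
 let ?L = "list_copy R ?D"
 note L = list_copy[OF D]
 obtain a b where ab: "a \<in> mod_hom R ?D ?L" "b \<in> mod_hom R ?L ?D" "\<And>x. x \<in> carrier ?L \<Longrightarrow> a (b x) = x"
  using mod_iso_obtain[OF L(2) Dr] by metis
 have "projective R ?L" unfolding projective_def
 proof (intro conjI ballI impI L(1))
  fix M N g h
  assume h: "M \<in> fg_modules R" "N \<in> fg_modules R" "g \<in> mod_hom R M N" "h \<in> mod_hom R ?L N"
   "g ` carrier M = carrier N"
  note MN = h(1,2)[THEN fg_mods_rm]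
  note ha = mh_comp[OF ab(1) h(4)]
  obtain k where k: "k \<in> mod_hom R P M" "\<And>x. x \<in> carrier P \<Longrightarrow> g (k x) = h (a (x, \<zero>\<^sub>P'))"
   using fg_projective_lift[OF assms(1) MN h(3,5) mh_comp[OF dsum_inl_hom[OF P(2)] ha]] by metis
  obtain k' where k': "k' \<in> mod_hom R P' M" "\<And>x. x \<in> carrier P' \<Longrightarrow> g (k' x) = h (a (\<zero>\<^sub>P, x))"
   using fg_projective_lift[OF assms(2) MN h(3,5) mh_comp[OF dsum_inr_hom[OF P(1)] ha]] by metis
  let ?k = "\<lambda>x. k (fst (b x)) \<oplus>\<^sub>M k' (snd (b x))"
  have "?k \<in> mod_hom R ?L M"
   using mh_comp[OF ab(2) dsum_copair_hom[OF MN(1) k(1) k'(1)]] .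
  moreover have "g (?k x) = h x" if x: "x \<in> carrier ?L" for x
  proof -
   interpret P: right_module R P by (rule P)
   interpret P': right_module R P' by (rule P)
   obtain y z where yz: "b x = (y, z)" "y \<in> carrier P" "z \<in> carrier P'"
    using mh_closed[OF ab(2) x] by auto
   have "g (?k x) = g (k y) \<oplus>\<^sub>N g (k' z)"
    using mh_add[OF h(3) mh_closed[OF k(1) yz(2)] mh_closed[OF k'(1) yz(3)]] yz(1) by simp
   also have "\<dots> = h (a (y, \<zero>\<^sub>P')) \<oplus>\<^sub>N h (a (\<zero>\<^sub>P, z))"
    using k(2)[OF yz(2)] k'(2)[OF yz(3)] by simp
   also have "\<dots> = h (a ((y, \<zero>\<^sub>P') \<oplus>\<^sub>?D (\<zero>\<^sub>P, z)))"
    using yz by (intro mh_add[OF ha, symmetric]) auto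
   also have "\<dots> = h (a (b x))" using yz by simp
   also have "\<dots> = h x" using ab(3)[OF x] by simp
   finally show ?thesis .
  qed
  ultimately show "\<exists>k\<in>mod_hom R ?L M. \<forall>x\<in>carrier ?L. g (k x) = h x"
   by (intro bexI[of _ ?k] ballI)
 qed
 then have "fg_projective R ?L" using projective_iff by blast
 then show ?thesis by (rule fg_projective_iso[OF L(3) _ Dr])
qed

section \<open>Projective covers and syzygies\<close>

definition pcover :: "'a ring \<Rightarrow> ('a, 'm) module \<Rightarrow> ('a, 'p) module \<Rightarrow> ('p \<Rightarrow> 'm) \<Rightarrow> bool" where
 "pcover R M P f \<longleftrightarrow> right_module R M \<and> fg_projective R P \<and> f \<in> mod_hom R P M \<and> f ` carrier P = carrier M \<and>
  (\<forall>L. submod R L P \<and> f ` L = carrier M \<longrightarrow> L = carrier P)"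

abbreviation ker_mod where
 "ker_mod P M f \<equiv> P\<lparr>carrier := a_kernel P M f\<rparr>"

lemma kernel_superfluous_iff:
 assumes "right_module R M" "right_module R P" "f \<in> mod_hom R P M" "f ` carrier P = carrier M"
 shows "superfluous R (a_kernel P M f) P \<longleftrightarrow> (\<forall>L. submod R L P \<and> f ` L = carrier M \<longrightarrow> L = carrier P)"
proof -
 interpret M: right_module R M by fact
 interpret P: right_module R P by fact
 have K: "submod R (a_kernel P M f) P" by (rule submod_kernel[OF assms(2,1,3)])
 have "a_kernel P M f <+>\<^sub>P L = carrier P \<longleftrightarrow> f ` L = carrier M" if L: "submod R L P" for L
 proof
  assume s: "a_kernel P M f <+>\<^sub>P L = carrier P"
  have "f p \<in> f ` L" if p: "p \<in> carrier P" for p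
  proof -
   obtain k l where kl: "p = k \<oplus>\<^sub>P l" "k \<in> a_kernel P M f" "l \<in> L"
   proof -
    have "p \<in> a_kernel P M f <+>\<^sub>P L" using p s by simp
    then show ?thesis using that by (auto simp: set_add_def')
   qed
   then have "f p = f l" using P.submod_subset[OF L] mh_closed[OF assms(3)]
    by (auto simp: a_kernel_def' mh_add[OF assms(3)] subset_eq)
   then show ?thesis using kl by blast
  qed
  then show "f ` L = carrier M" using P.submod_subset[OF L] unfolding assms(4)[symmetric] by blast
 next
  assume s: "f ` L = carrier M"
  have "p \<in> a_kernel P M f <+>\<^sub>P L" if p: "p \<in> carrier P" for p
  proof -
   have "f p \<in> f ` L" using s p mh_closed[OF assms(3)] by simp
   then obtain l where l: "l \<in> L" "f p = f l" by auto
   then have lP: "l \<in> carrier P" using P.submod_subset[OF L] by auto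
   then have "p \<ominus>\<^sub>P l \<in> a_kernel P M f" "p = (p \<ominus>\<^sub>P l) \<oplus>\<^sub>P l"
    using p l mh_closed[OF assms(3), of l]
    by (auto simp: a_kernel_def' mh_add[OF assms(3)] mh_uminus[OF assms(2,1,3)] a_minus_def M.r_neg P.a_assoc P.l_neg)
   then show ?thesis using l by (auto simp: set_add_def')
  qed
  then show "a_kernel P M f <+>\<^sub>P L = carrier P"
   using P.submod_subset[OF P.submod_add_set[OF K L]] by blast
 qed
 then show ?thesis using K unfolding superfluous_def by blast
qed

lemma projective_cover_iff:
 assumes "right_module R M"
 shows "projective_cover R M P f \<longleftrightarrow> P \<in> fg_modules R \<and> pcover R M P f"
proof -
 have "superfluous R (a_kernel P M f) P \<longleftrightarrow> (\<forall>L. submod R L P \<and> f ` L = carrier M \<longrightarrow> L = carrier P)"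
  if "fg_projective R P" "f \<in> mod_hom R P M" "f ` carrier P = carrier M"
  using kernel_superfluous_iff[OF assms _ that(2,3)] that(1) by (simp add: fg_projective_def)
 then show ?thesis using assms unfolding projective_cover_def projective_iff pcover_def by metis
qed

text \<open>A lift of one cover through the other is surjective by minimality, hence has a section; the section
 is surjective by minimality too, so that the lift is an isomorphism and matches the kernels.\<close>

lemma pcover_unique:
 assumes "pcover R M P f" "pcover R M' P' f'" "mod_iso R M M'"
 shows "mod_iso R (ker_mod P M f) (ker_mod P' M' f')"
proof -
 have c: "right_module R M" "fg_projective R P" "f \<in> mod_hom R P M" "f ` carrier P = carrier M"
   "\<And>L. submod R L P \<Longrightarrow> f ` L = carrier M \<Longrightarrow> L = carrier P"
  and c': "right_module R M'" "fg_projective R P'" "f' \<in> mod_hom R P' M'" "f' ` carrier P' = carrier M'"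
   "\<And>L. submod R L P' \<Longrightarrow> f' ` L = carrier M' \<Longrightarrow> L = carrier P'"
  using assms(1,2) by (auto simp: pcover_def)
 have P: "right_module R P" "right_module R P'" using c(2) c'(2) by (simp_all add: fg_projective_def)
 obtain a b where ab: "a \<in> mod_hom R M M'" "b \<in> mod_hom R M' M"
  "\<And>x. x \<in> carrier M \<Longrightarrow> b (a x) = x" "\<And>x. x \<in> carrier M' \<Longrightarrow> a (b x) = x"
  using mod_iso_obtain[OF assms(3) c(1)] by metis
 note cl = mh_closed[OF ab(1)] mh_closed[OF ab(2)] mh_closed[OF c(3)] mh_closed[OF c'(3)]
 obtain h where h: "h \<in> mod_hom R P P'" "\<And>x. x \<in> carrier P \<Longrightarrow> f' (h x) = a (f x)"
  using fg_projective_lift[OF c(2) P(2) c'(1,3,4) mh_comp[OF c(3) ab(1)]] by metis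
 have "f' ` h ` carrier P = a ` f ` carrier P" using h(2) by (auto simp: image_image)
 also have "\<dots> = carrier M'" using ab(4) cl unfolding c(4) by (auto simp: image_iff) metis
 finally have hs: "h ` carrier P = carrier P'"
  by (intro c'(5) submod_image[OF P h(1) right_module.submod_carrier[OF P(1)]])
 have "(\<lambda>x. x) \<in> mod_hom R P' P'" by (auto intro: mod_homI)
 then obtain s where s: "s \<in> mod_hom R P' P" "\<And>x. x \<in> carrier P' \<Longrightarrow> h (s x) = x"
  using fg_projective_lift[OF c'(2) P h(1) hs] by metis
 have fs: "f (s x) = b (f' x)" if "x \<in> carrier P'" for x
  using h(2)[of "s x"] s that mh_closed[OF s(1)] ab(3) cl by metis
 then have "f ` s ` carrier P' = b ` f' ` carrier P'" by (auto simp: image_image)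
 also have "\<dots> = carrier M" using ab(3) cl unfolding c'(4) by (auto simp: image_iff) metis
 finally have ss: "s ` carrier P' = carrier P"
  by (intro c(5) submod_image[OF P(2,1) s(1) right_module.submod_carrier[OF P(2)]])
 have sh: "s (h x) = x" if "x \<in> carrier P" for x
  using ss s(2) that by (metis imageE)
 note cl' = mh_closed[OF h(1)] mh_closed[OF s(1)]
 have z: "a \<zero>\<^sub>M = \<zero>\<^sub>M'" "b \<zero>\<^sub>M' = \<zero>\<^sub>M"
  using mh_zero[OF c(1) c'(1) ab(1)] mh_zero[OF c'(1) c(1) ab(2)] .
 show ?thesis
 proof (rule mod_isoI_inverse[of h _ _ _ s])
  show "h \<in> mod_hom R (ker_mod P M f) (ker_mod P' M' f')"
   using h z cl' by (auto intro!: mod_homI simp: a_kernel_def' mh_add[OF h(1)] mh_act[OF h(1)])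
 qed (use fs z cl' s sh in \<open>auto simp: a_kernel_def'\<close>)
qed

text \<open>A minimal submodule of a free module among those that still cover \<open>M\<close> is a direct summand, because
 lifting the covering map through it gives an endomorphism that is surjective by minimality and hence
 bijective.\<close>

lemma pcover_exists:
 assumes "fin_len_ring R" "fg_module R M"
 obtains P :: "('a, 'a list) module" and f where "P \<in> fg_modules R" "pcover R M P f"
proof -
 have M: "right_module R M" and R: "ring R"
  using assms by (simp_all add: fg_module_def fin_len_ring_def)
 obtain m g0 where g0: "g0 \<in> mod_hom R (free_mod R m) M" "g0 ` carrier (free_mod R m) = carrier M"
  using free_surjection[OF assms(2)] by metis
 define F where "F = list_copy R (free_mod R m)"
 note F0 = list_copy[OF fg_module_free[OF R, of m], folded F_def]
 have F: "right_module R F" using F0(1) by (rule fg_mods_rm)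
 obtain a b where ab: "a \<in> mod_hom R F (free_mod R m)" "b \<in> mod_hom R (free_mod R m) F"
  "\<And>x. x \<in> carrier (free_mod R m) \<Longrightarrow> a (b x) = x"
  using mod_iso_obtain[OF F0(3) F] by metis
 define g where "g = (\<lambda>x. g0 (a x))"
 have g: "g \<in> mod_hom R F M" unfolding g_def by (rule mh_comp[OF ab(1) g0(1)])
 have "carrier M \<subseteq> g ` carrier F"
 proof
  fix y assume "y \<in> carrier M"
  then obtain x where "x \<in> carrier (free_mod R m)" "y = g0 x" using g0(2) by auto
  then have "y = g (b x)" "b x \<in> carrier F" using ab mh_closed[OF ab(2)] by (auto simp: g_def)
  then show "y \<in> g ` carrier F" by blast
 qed
 then have gs: "g ` carrier F = carrier M" using mh_closed[OF g] by auto
 have Fp: "fg_projective R F" by (rule fg_projective_iso[OF F0(2) free_fg_projective[OF R] F])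
 interpret F: right_module R F by (rule F)
 have Fl: "fin_length R F" by (rule fin_len_ring[OF assms(1) fg_modulesD[OF F0(1)]])
 then obtain l where l: "\<And>L L'. submod R L F \<Longrightarrow> submod R L' F \<Longrightarrow> L \<subset> L' \<Longrightarrow> l L < (l L' :: nat)"
  by (auto simp: fin_length_def length_le_def)
 obtain L where L: "submod R L F" "g ` L = carrier M"
  and min: "\<And>L'. submod R L' F \<Longrightarrow> g ` L' = carrier M \<Longrightarrow> l L \<le> l L'"
  using ex_has_least_nat[of "\<lambda>L. submod R L F \<and> g ` L = carrier M" "carrier F" l] gs F.submod_carrier by auto
 have Lmin: "L' = L" if "submod R L' F" "g ` L' = carrier M" "L' \<subseteq> L" for L'
  using min[OF that(1,2)] l[OF that(1) L(1)] that(3) by (auto simp: psubset_eq)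
 let ?P = "F\<lparr>carrier := L\<rparr>"
 have P: "right_module R ?P" by (rule F.submod_module[OF L(1)])
 have LF: "L \<subseteq> carrier F" by (rule F.submod_subset[OF L(1)])
 have gP: "g \<in> mod_hom R ?P M" using mh_comp[OF submod_inclusion[OF L(1) F] g] .
 obtain h where h: "h \<in> mod_hom R F ?P" "\<And>x. x \<in> carrier F \<Longrightarrow> g (h x) = g x"
  using fg_projective_lift[OF Fp P M gP _ g] L(2) by auto
 have hP: "h \<in> mod_hom R ?P ?P" using mh_comp[OF submod_inclusion[OF L(1) F] h(1)] .
 have hL: "submod R (h ` L) ?P"
  using submod_image[OF P P hP] right_module.submod_carrier[OF P] by simp
 have "h ` L = L"
 proof (rule Lmin)
  show "submod R (h ` L) F" "h ` L \<subseteq> L" using hL F.submod_trans[OF L(1)] by auto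
  show "g ` h ` L = carrier M" using h(2) LF L(2) by (auto simp: image_image subset_eq)
 qed
 then have "bij_betw h (carrier ?P) (carrier ?P)"
  using fin_length_surj_inj[OF P fin_len_submod[OF Fl F L(1)] hP] by (simp add: bij_betw_def)
 then obtain k where k: "k \<in> mod_hom R ?P ?P" "\<And>x. x \<in> carrier ?P \<Longrightarrow> k (h x) = x"
  using mh_inverse[OF hP _ P] by metis
 have Pp: "fg_projective R ?P"
  by (rule fg_projective_retract[OF Fp P submod_inclusion[OF L(1) F] mh_comp[OF h(1) k(1)]]) (use k(2) in simp)
 have "pcover R M ?P g" unfolding pcover_def
  using M Pp gP L(2) Lmin F.submod_trans[OF L(1)] by simp
 moreover have "?P \<in> fg_modules R" using fg_projective_fg[OF Pp] by (rule fg_modulesI)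
 ultimately show thesis using that by blast
qed

lemma syzygy_cover:
 assumes "fin_len_ring R" "M \<in> fg_modules R"
 obtains P f where "P \<in> fg_modules R" "pcover R M P f" "syzygy R M = ker_mod P M f"
proof -
 note M = fg_mods_rm[OF assms(2)]
 obtain P f where "P \<in> fg_modules R" "pcover R M P f"
  using pcover_exists[OF assms(1) fg_modulesD[OF assms(2)]] by metis
 then have "\<exists>K P f. projective_cover R M P f \<and> K = ker_mod P M f"
  using projective_cover_iff[OF M] by auto
 then have "\<exists>P f. projective_cover R M P f \<and> syzygy R M = ker_mod P M f"
  unfolding syzygy_def by (rule someI_ex)
 then show thesis using that projective_cover_iff[OF M] by auto
qed

lemma syzygy_fg:
 assumes "fin_len_ring R" "M \<in> fg_modules R"
 shows "syzygy R M \<in> fg_modules R"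
proof -
 obtain P f where *: "P \<in> fg_modules R" "pcover R M P f" "syzygy R M = ker_mod P M f"
  using syzygy_cover[OF assms] by metis
 then have "submod R (a_kernel P M f) P"
  by (intro submod_kernel) (auto simp: pcover_def fg_projective_def)
 then show ?thesis using fg_module_submod[OF assms(1) fg_modulesD[OF *(1)]] * fg_modulesI by auto
qed

lemma syzygy_pcover:
 assumes "fin_len_ring R" "M \<in> fg_modules R" "pcover R M' P f" "mod_iso R M M'"
 shows "mod_iso R (syzygy R M) (ker_mod P M' f)"
 using syzygy_cover[OF assms(1,2)] pcover_unique[OF _ assms(3,4)] by metis

lemma pcover_dsum:
 assumes "pcover R M P f" "pcover R M' P' f'"
 shows "pcover R (dsum M M') (dsum P P') (map_prod f f')"
proof -
 have c: "right_module R M" "fg_projective R P" "f \<in> mod_hom R P M" "f ` carrier P = carrier M"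
   "\<And>L. submod R L P \<Longrightarrow> f ` L = carrier M \<Longrightarrow> L = carrier P"
  and c': "right_module R M'" "fg_projective R P'" "f' \<in> mod_hom R P' M'" "f' ` carrier P' = carrier M'"
   "\<And>L. submod R L P' \<Longrightarrow> f' ` L = carrier M' \<Longrightarrow> L = carrier P'"
  using assms(1,2) by (auto simp: pcover_def)
 have Pr: "right_module R P" "right_module R P'" using c(2) c'(2) by (simp_all add: fg_projective_def)
 interpret M: right_module R M by (rule c)
 interpret M': right_module R M' by (rule c')
 interpret P: right_module R P by (rule Pr)
 interpret P': right_module R P' by (rule Pr)
 interpret D: right_module R "dsum P P'" by (rule dsum_module[OF Pr])
 have L: "L = carrier (dsum P P')" if L: "submod R L (dsum P P')" "map_prod f f' ` L = carrier (dsum M M')" for L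
 proof -
  note LD = D.submod_subset[OF L(1)]
  have surj: "\<exists>x y. (x, y) \<in> L \<and> f x = m \<and> f' y = m'" if "m \<in> carrier M" "m' \<in> carrier M'" for m m'
  proof -
   have "(m, m') \<in> map_prod f f' ` L" using L(2) that by simp
   then show ?thesis by auto
  qed
  \<comment> \<open>the first components of those elements of \<open>L\<close> whose second component is in the kernel\<close>
  define A where "A = {x \<in> carrier P. \<exists>y. (x, y) \<in> L \<and> f' y = \<zero>\<^sub>M'}"
  have z: "f \<zero>\<^sub>P = \<zero>\<^sub>M" "f' \<zero>\<^sub>P' = \<zero>\<^sub>M'"
   using mh_zero[OF Pr(1) c(1,3)] mh_zero[OF Pr(2) c'(1,3)] .
  have "submod R A P"
  proof (rule P.submodI)
   show "\<zero>\<^sub>P \<in> A" using D.submod_zero[OF L(1)] z by (auto simp: A_def)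
   show "x \<oplus>\<^sub>P y \<in> A" if xy: "x \<in> A" "y \<in> A" for x y
   proof -
    obtain u v where uv: "(x, u) \<in> L" "(y, v) \<in> L" "f' u = \<zero>\<^sub>M'" "f' v = \<zero>\<^sub>M'" "x \<in> carrier P" "y \<in> carrier P"
     using xy by (auto simp: A_def)
    then have "u \<in> carrier P'" "v \<in> carrier P'" using LD by auto
    then have "(x \<oplus>\<^sub>P y, u \<oplus>\<^sub>P' v) \<in> L" "f' (u \<oplus>\<^sub>P' v) = \<zero>\<^sub>M'"
     using D.submod_add[OF L(1) uv(1,2)] uv by (auto simp: mh_add[OF c'(3)])
    then show ?thesis using uv by (auto simp: A_def)
   qed
   show "r \<odot>\<^sub>P x \<in> A" if rx: "r \<in> carrier R" "x \<in> A" for r x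
   proof -
    obtain u where u: "(x, u) \<in> L" "f' u = \<zero>\<^sub>M'" "x \<in> carrier P" using rx by (auto simp: A_def)
    then have "u \<in> carrier P'" using LD by auto
    then have "(r \<odot>\<^sub>P x, r \<odot>\<^sub>P' u) \<in> L" "f' (r \<odot>\<^sub>P' u) = \<zero>\<^sub>M'"
     using D.submod_act[OF L(1) rx(1) u(1)] u rx by (auto simp: mh_act[OF c'(3)] M'.act_zero)
    then show ?thesis using u rx by (auto simp: A_def P.act_closed)
   qed
  qed (auto simp: A_def)
  moreover have "f ` A = carrier M"
  proof
   show "f ` A \<subseteq> carrier M" using mh_closed[OF c(3)] by (auto simp: A_def)
   show "carrier M \<subseteq> f ` A"
   proof
    fix m assume "m \<in> carrier M"
    then obtain x y where xy: "(x, y) \<in> L" "f x = m" "f' y = \<zero>\<^sub>M'" using surj by blast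
    then have "x \<in> A" using LD by (auto simp: A_def)
    then show "m \<in> f ` A" using xy by blast
   qed
  qed
  ultimately have A: "A = carrier P" by (rule c(5))
  let ?B = "{y \<in> carrier P'. (\<zero>\<^sub>P, y) \<in> L}"
  have "?B = carrier P'"
  proof (rule c'(5))
   show "submod R ?B P'" by (rule submod_vimage[OF Pr(2) D.right_module_axioms dsum_inr_hom[OF Pr(1)] L(1)])
   show "f' ` ?B = carrier M'"
   proof
    show "f' ` ?B \<subseteq> carrier M'" using mh_closed[OF c'(3)] by auto
    show "carrier M' \<subseteq> f' ` ?B"
    proof
     fix m assume m: "m \<in> carrier M'"
     then obtain x y where xy: "(x, y) \<in> L" "f' y = m" using surj[of "\<zero>\<^sub>M" m] by blast
     then have xyP: "x \<in> carrier P" "y \<in> carrier P'" using LD by auto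
     then obtain u where u: "(x, u) \<in> L" "f' u = \<zero>\<^sub>M'" using A by (auto simp: A_def)
     have uP: "u \<in> carrier P'" using u LD by auto
     have "(x, y) \<oplus>\<^bsub>dsum P P'\<^esub> (\<ominus>\<^sub>R \<one>\<^sub>R) \<odot>\<^bsub>dsum P P'\<^esub> (x, u) \<in> L"
      using xy u by (intro D.submod_add[OF L(1)] D.submod_act[OF L(1)]) auto
     then have "(\<zero>\<^sub>P, y \<oplus>\<^sub>P' \<ominus>\<^sub>P' u) \<in> L"
      using xyP uP by (simp add: P.uminus_act[symmetric] P'.uminus_act[symmetric] P.r_neg)
     moreover have "f' (y \<oplus>\<^sub>P' \<ominus>\<^sub>P' u) = m"
      using xy u xyP uP m by (simp add: mh_add[OF c'(3)] mh_uminus[OF Pr(2) c'(1,3)])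
     ultimately show "m \<in> f' ` ?B" using xyP uP by force
    qed
   qed
  qed
  then have B: "(\<zero>\<^sub>P, y) \<in> L" if "y \<in> carrier P'" for y using that by blast
  have "(x, y) \<in> L" if xy: "x \<in> carrier P" "y \<in> carrier P'" for x y
  proof -
   obtain u where u: "(x, u) \<in> L" using A xy by (auto simp: A_def)
   then have uP: "u \<in> carrier P'" using LD by auto
   then have "u \<oplus>\<^sub>P' (y \<ominus>\<^sub>P' u) = y" using xy P'.a_lcomm[of u y "\<ominus>\<^sub>P' u"] by (simp add: a_minus_def P'.r_neg)
   then show ?thesis
    using D.submod_add[OF L(1) u B[of "y \<ominus>\<^sub>P' u"]] xy uP by simp
  qed
  then show ?thesis using LD by auto
 qed
 have "map_prod f f' ` carrier (dsum P P') = carrier (dsum M M')"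
  using map_prod_surj_on[OF c(4) c'(4)] by simp
 then show ?thesis unfolding pcover_def
  using L c c' by (auto simp: dsum_module fg_projective_dsum dsum_map_hom)
qed

lemma syzygy_dsum:
 assumes R: "fin_len_ring R" and fg: "M \<in> fg_modules R" "N \<in> fg_modules R" "N' \<in> fg_modules R"
  and iso: "mod_iso R M (dsum N N')"
 shows "mod_iso R (syzygy R M) (dsum (syzygy R N) (syzygy R N'))"
proof -
 obtain P f where P: "P \<in> fg_modules R" "pcover R N P f" "syzygy R N = ker_mod P N f"
  using syzygy_cover[OF R fg(2)] by metis
 obtain P' f' where P': "P' \<in> fg_modules R" "pcover R N' P' f'" "syzygy R N' = ker_mod P' N' f'"
  using syzygy_cover[OF R fg(3)] by metis
 have "mod_iso R (ker_mod (dsum P P') (dsum N N') (map_prod f f')) (dsum (ker_mod P N f) (ker_mod P' N' f'))"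
  by (rule mod_isoI_inverse[of "\<lambda>x. x" _ _ _ "\<lambda>x. x"]) (auto intro!: mod_homI simp: a_kernel_def')
 then show ?thesis
  using syzygy_pcover[OF R fg(1) pcover_dsum[OF P(2) P'(2)] iso] P P' mod_iso_trans by metis
qed

lemma syzygy_projective:
 assumes "fin_len_ring R" "projective R P" shows "syzygy R P \<in> zero_modules R"
proof -
 have P: "P \<in> fg_modules R" "fg_projective R P" "right_module R P"
  using assms(2) by (auto simp: projective_iff fg_mods_rm)
 interpret right_module R P by (rule P)
 have "pcover R P P (\<lambda>x. x)" using P by (auto simp: pcover_def intro: mod_homI)
 then have "mod_iso R (syzygy R P) (ker_mod P P (\<lambda>x. x))"
  using syzygy_pcover[OF assms(1) P(1) _ mod_iso_refl] by metis
 moreover have "a_kernel P P (\<lambda>x. x) = {\<zero>\<^sub>P}" by (auto simp: a_kernel_def')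
 moreover have "right_module R (P\<lparr>carrier := {\<zero>\<^sub>P}\<rparr>)" by (rule submod_module[OF submod_zero_set])
 moreover note s = syzygy_fg[OF assms(1) P(1)]
 ultimately have "carrier (syzygy R P) = {\<zero>\<^bsub>syzygy R P\<^esub>}"
  using mod_iso_zero[of R "syzygy R P" "P\<lparr>carrier := {\<zero>\<^sub>P}\<rparr>"] by (simp add: fg_mods_rm)
 then show ?thesis using s by (simp add: zero_modules_def)
qed

lemma syzygy_pow_fg:
 "fin_len_ring R \<Longrightarrow> M \<in> fg_modules R \<Longrightarrow> (syzygy R ^^ n) M \<in> fg_modules R"
 by (induction n) (auto simp: syzygy_fg)

lemma syzygy_pow_dsum:
 assumes "fin_len_ring R" "M \<in> fg_modules R" "N \<in> fg_modules R" "N' \<in> fg_modules R"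
  "mod_iso R M (dsum N N')"
 shows "mod_iso R ((syzygy R ^^ n) M) (dsum ((syzygy R ^^ n) N) ((syzygy R ^^ n) N'))"
 using assms by (induction n) (auto intro: syzygy_dsum syzygy_pow_fg)

section \<open>Direct summands and additive closures\<close>

declare mod_iso_trans [trans]

lemma dir_summandI:
 assumes "N \<in> fg_modules R" "fg_module R Y" "mod_iso R M (dsum N Y)"
 shows "dir_summand R N M"
 using assms list_copy[OF assms(2)] mod_iso_trans[OF assms(3) dsum_iso[OF mod_iso_refl list_copy(2)[OF assms(2)]]]
 by (auto simp: dir_summand_def)

lemma dir_summand_fg: "dir_summand R N M \<Longrightarrow> N \<in> fg_modules R"
 by (simp add: dir_summand_def)

lemma dir_summand_iso:
 assumes "ring R" "N \<in> fg_modules R" "mod_iso R M N" "M \<in> fg_modules R" shows "dir_summand R N M"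
proof (rule dir_summandI[OF assms(2)])
 note z = zero_module[OF assms(1), unfolded zero_modules_iff]
 show "fg_module R zero_module" using z by (intro fg_module_zero) auto
 have N: "right_module R N" by (rule fg_mods_rm[OF assms(2)])
 have "mod_iso R N (dsum N zero_module)"
  using z N by (intro mod_iso_sym[OF dsum_zero_right] dsum_module) auto
 then show "mod_iso R M (dsum N zero_module)" by (rule mod_iso_trans[OF assms(3)])
qed

lemma dir_summand_refl: "ring R \<Longrightarrow> M \<in> fg_modules R \<Longrightarrow> dir_summand R M M"
 by (rule dir_summand_iso[OF _ _ mod_iso_refl])

lemma dir_summand_trans:
 assumes "dir_summand R N M" "dir_summand R M L"
 shows "dir_summand R N L"
proof -
 obtain N' where N': "N \<in> fg_modules R" "N' \<in> fg_modules R" "mod_iso R M (dsum N N')"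
  using assms(1) by (auto simp: dir_summand_def)
 obtain M' where M': "M' \<in> fg_modules R" "mod_iso R L (dsum M M')"
  using assms(2) by (auto simp: dir_summand_def)
 have "mod_iso R L (dsum (dsum N N') M')"
  by (rule mod_iso_trans[OF M'(2) dsum_iso[OF N'(3) mod_iso_refl]])
 then have "mod_iso R L (dsum N (dsum N' M'))" by (rule mod_iso_trans[OF _ dsum_assoc])
 then show ?thesis
  using N' M' by (intro dir_summandI[OF N'(1) fg_module_dsum]) (auto dest: fg_modulesD)
qed

lemma dir_summand_retract:
 assumes "fin_len_ring R" "N \<in> fg_modules R" "M \<in> fg_modules R"
  "i \<in> mod_hom R N M" "p \<in> mod_hom R M N" "\<And>x. x \<in> carrier N \<Longrightarrow> p (i x) = x"
 shows "dir_summand R N M"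
proof (rule dir_summandI[OF assms(2)])
 note r = fg_mods_rm[OF assms(3)] fg_mods_rm[OF assms(2)]
 show "mod_iso R M (dsum N (ker_mod M N p))" by (rule retract_dsum[OF r assms(4-6)])
 show "fg_module R (ker_mod M N p)"
  by (rule fg_module_submod[OF assms(1) fg_modulesD[OF assms(3)] submod_kernel[OF r assms(5)]])
qed

lemma dir_summand_obtain:
 assumes "dir_summand R N M" "right_module R M"
 obtains i p where "i \<in> mod_hom R N M" "p \<in> mod_hom R M N" "\<And>x. x \<in> carrier N \<Longrightarrow> p (i x) = x"
proof -
 obtain N' where N': "N \<in> fg_modules R" "N' \<in> fg_modules R" "mod_iso R M (dsum N N')"
  using assms(1) by (auto simp: dir_summand_def)
 obtain f g where fg: "f \<in> mod_hom R M (dsum N N')" "g \<in> mod_hom R (dsum N N') M"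
  "\<And>y. y \<in> carrier (dsum N N') \<Longrightarrow> f (g y) = y"
  using mod_iso_obtain[OF N'(3) assms(2)] by metis
 have N'r: "right_module R N'" by (rule fg_mods_rm[OF N'(2)])
 interpret N': right_module R N' by (rule N'r)
 show thesis
 proof (rule that[of "\<lambda>x. g (x, \<zero>\<^sub>N')" "\<lambda>m. fst (f m)"])
  show "(\<lambda>x. g (x, \<zero>\<^sub>N')) \<in> mod_hom R N M" by (rule mh_comp[OF dsum_inl_hom[OF N'r] fg(2)])
  show "(\<lambda>m. fst (f m)) \<in> mod_hom R M N" by (rule mh_comp[OF fg(1) dsum_fst_hom])
 qed (use fg(3) in auto)
qed

lemma add_closure_fg: "M \<in> add_closure R C \<Longrightarrow> M \<in> fg_modules R"
 by (simp add: add_closure_def)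

lemma add_closure_iso:
 "M \<in> add_closure R C \<Longrightarrow> N \<in> fg_modules R \<Longrightarrow> mod_iso R N M \<Longrightarrow> N \<in> add_closure R C"
 using mod_iso_trans unfolding add_closure_def by blast

lemma add_closure_zero:
 assumes "Z \<in> zero_modules R" shows "Z \<in> add_closure R C"
proof -
 have Z: "right_module R Z" "carrier Z = {\<zero>\<^sub>Z}" using assms by (auto simp: zero_modules_iff)
 then have "mod_iso R Z (dsum_family 0 (\<lambda>_. Z))"
  by (intro zero_modules_iso dsum_family_module) (auto simp: right_module_def)
 then show ?thesis using assms unfolding add_closure_def
  by (auto simp: zero_modules_def intro!: exI[of _ "0::nat"])
qed

lemma dsum_family_cong: "(\<And>i. i < n \<Longrightarrow> F i = G i) \<Longrightarrow> dsum_family n F = dsum_family n G"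
 unfolding dsum_family_def by (auto intro!: PiE_cong ext restrict_ext)

lemma add_closure_summand_dsum:
 assumes "M \<in> fg_modules R" "N \<in> add_closure R C" "dir_summand R N' Y" "Y \<in> C" "mod_iso R M (dsum N N')"
 shows "M \<in> add_closure R C"
proof -
 obtain n F where F: "\<forall>i<n. \<exists>Y\<in>C. dir_summand R (F i) Y" "mod_iso R N (dsum_family n F)"
  using assms(2) by (auto simp: add_closure_def)
 let ?G = "F(n := N')"
 have G: "\<forall>i<Suc n. \<exists>Y\<in>C. dir_summand R (?G i) Y" using F(1) assms(3,4) by (auto simp: less_Suc_eq)
 have R: "ring R" using fg_mods_rm[OF assms(1)] by (simp add: right_module_def)
 have Gm: "right_module R (?G i)" if "i < Suc n" for i
  using G that dir_summand_fg fg_mods_rm by blast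
 have "mod_iso R M (dsum (dsum_family n F) N')"
  by (rule mod_iso_trans[OF assms(5) dsum_iso[OF F(2) mod_iso_refl]])
 also have "dsum_family n F = dsum_family n ?G" by (rule dsum_family_cong) simp
 finally have "mod_iso R M (dsum (dsum_family n ?G) (?G n))" by simp
 moreover have "mod_iso R (dsum (dsum_family n ?G) (?G n)) (dsum_family (Suc n) ?G)"
  by (rule mod_iso_sym[OF dsum_family_Suc dsum_family_module[OF R]]) (rule Gm)
 ultimately have "mod_iso R M (dsum_family (Suc n) ?G)" by (rule mod_iso_trans)
 then show ?thesis using assms(1) G unfolding add_closure_def by blast
qed

lemma add_closure_summand:
 assumes "dir_summand R N Y" "Y \<in> C" shows "N \<in> add_closure R C"
proof -
 note N = dir_summand_fg[OF assms(1)]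
 note Nr = fg_mods_rm[OF N]
 then have z: "zero_module \<in> zero_modules R" by (intro zero_module) (simp add: right_module_def)
 then have "mod_iso R N (dsum zero_module N)"
  using Nr by (intro mod_iso_sym[OF dsum_zero_left] dsum_module) (auto simp: zero_modules_iff)
 then show ?thesis using add_closure_summand_dsum[OF N add_closure_zero[OF z] assms] by blast
qed

lemma add_closure_induct [consumes 1, case_names zero summand dsum]:
 assumes "M \<in> add_closure R C"
  and zero: "\<And>Z. Z \<in> zero_modules R \<Longrightarrow> P Z"
  and summand: "\<And>N Y. dir_summand R N Y \<Longrightarrow> Y \<in> C \<Longrightarrow> P N"
  and dsum: "\<And>M N N'. M \<in> fg_modules R \<Longrightarrow> N \<in> fg_modules R \<Longrightarrow> N' \<in> fg_modules R \<Longrightarrow>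
   mod_iso R M (dsum N N') \<Longrightarrow> P N \<Longrightarrow> P N' \<Longrightarrow> P M"
 shows "P M"
proof -
 have R: "ring R" using fg_mods_rm[OF add_closure_fg[OF assms(1)]] by (simp add: right_module_def)
 have "P M" if "M \<in> fg_modules R" "\<forall>i<n. \<exists>Y\<in>C. dir_summand R (F i) Y" "mod_iso R M (dsum_family n F)" for M n F
  using that
 proof (induction n arbitrary: M)
  case 0
  have "right_module R (dsum_family 0 F)" by (rule dsum_family_module[OF R]) simp
  then show ?case
   using 0 mod_iso_zero[OF 0(3) fg_mods_rm[OF 0(1)]] by (intro zero) (auto simp: zero_modules_def)
 next
  case (Suc n)
  have Ffg: "fg_module R (F i)" if "i < Suc n" for i
   using Suc.prems(2) that by (auto dest: dir_summand_fg fg_modulesD)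
  note D = fg_module_dsum_family[OF R, of n F]
  let ?L = "list_copy R (dsum_family n F)"
  have D: "fg_module R (dsum_family n F)" using Ffg by (intro fg_module_dsum_family R) simp
  note L = list_copy[OF D]
  have "mod_iso R M (dsum (dsum_family n F) (F n))" by (rule mod_iso_trans[OF Suc.prems(3) dsum_family_Suc])
  then have "mod_iso R M (dsum ?L (F n))" by (rule mod_iso_trans[OF _ dsum_iso[OF L(2) mod_iso_refl]])
  moreover have "P ?L" using Suc.prems(2) L by (intro Suc.IH) auto
  moreover have "P (F n)" using Suc.prems(2) summand by blast
  ultimately show ?case using dsum Suc.prems(1) L(1) Ffg fg_modulesI by blast
 qed
 then show ?thesis using assms(1) unfolding add_closure_def by blast
qed

lemma add_closure_dsum:
 assumes "M \<in> fg_modules R" "N \<in> add_closure R C" "N' \<in> add_closure R C" "mod_iso R M (dsum N N')"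
 shows "M \<in> add_closure R C"
 using assms(3,1,2,4)
proof (induction arbitrary: M N rule: add_closure_induct)
 case (zero Z)
 then have "mod_iso R M N"
  using mod_iso_trans[OF zero(4) dsum_zero_right] by (auto simp: zero_modules_iff fg_mods_rm add_closure_fg)
 then show ?case using add_closure_iso zero by blast
next
 case (summand N' Y)
 then show ?case using add_closure_summand_dsum by blast
next
 case (dsum K N1 N2)
 note r = fg_mods_rm[OF dsum(1)] fg_mods_rm[OF dsum(2)] fg_mods_rm[OF dsum(3)]
  fg_mods_rm[OF add_closure_fg[OF dsum.prems(2)]]
 have D: "fg_module R (dsum N N1)"
  by (rule fg_module_dsum[OF fg_modulesD[OF add_closure_fg[OF dsum.prems(2)]] fg_modulesD[OF dsum(2)]])
 note L = list_copy[OF D]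
 have "mod_iso R M (dsum N (dsum N1 N2))"
  by (rule mod_iso_trans[OF dsum.prems(3) dsum_iso[OF mod_iso_refl dsum(4)]])
 also have "mod_iso R \<dots> (dsum (dsum N N1) N2)" by (rule mod_iso_sym[OF dsum_assoc]) (intro dsum_module r)
 also have "mod_iso R \<dots> (dsum (list_copy R (dsum N N1)) N2)" by (rule dsum_iso[OF L(2) mod_iso_refl])
 finally have "mod_iso R M (dsum (list_copy R (dsum N N1)) N2)" .
 moreover have "list_copy R (dsum N N1) \<in> add_closure R C"
  by (rule dsum.IH(1)[OF L(1) dsum.prems(2) L(3)])
 ultimately show ?case using dsum.IH(2) dsum.prems(1) by blast
qed

definition add_closed :: "'a ring \<Rightarrow> ('a, 'a list) module set \<Rightarrow> bool" where
 "add_closed R D \<longleftrightarrow> D \<subseteq> fg_modules R \<and> zero_modules R \<subseteq> D \<and>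
  (\<forall>M\<in>fg_modules R. \<forall>N\<in>D. \<forall>N'\<in>D. mod_iso R M (dsum N N') \<longrightarrow> M \<in> D) \<and>
  (\<forall>M\<in>D. \<forall>N. dir_summand R N M \<longrightarrow> N \<in> D)"

lemma add_closed_iff:
 assumes "ring R" shows "add_closed R D \<longleftrightarrow> D \<subseteq> fg_modules R \<and> D = add_closure R D"
proof
 assume D: "D \<subseteq> fg_modules R \<and> D = add_closure R D"
 show "add_closed R D" unfolding add_closed_def
 proof (intro conjI ballI allI impI)
  show "zero_modules R \<subseteq> D" using D add_closure_zero by blast
  show "M \<in> D" if "M \<in> fg_modules R" "N \<in> D" "N' \<in> D" "mod_iso R M (dsum N N')" for M N N'
   using add_closure_dsum[of M R N D N'] that D by simp
  show "N \<in> D" if "M \<in> D" "dir_summand R N M" for M N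
   using add_closure_summand[OF that(2,1)] D by simp
 qed (use D in simp)
next
 assume D: "add_closed R D"
 have "N \<in> D" if "N \<in> add_closure R D" for N
  using that by (induction rule: add_closure_induct) (use D in \<open>unfold add_closed_def, blast+\<close>)
 moreover have "N \<in> add_closure R D" if "N \<in> D" for N
  using that D dir_summand_refl[OF assms] by (intro add_closure_summand[of R N N]) (auto simp: add_closed_def)
 ultimately show "D \<subseteq> fg_modules R \<and> D = add_closure R D" using D by (auto simp: add_closed_def)
qed

text \<open>Every module of finite length is a finite direct sum of indecomposable ones; as no uniqueness is
 needed, this is stated as an induction principle.\<close>

lemma indecomposable_induct [consumes 2, case_names zero indecomposable dsum]:
 assumes R: "fin_len_ring R" and "M \<in> fg_modules R"
  and zero: "\<And>Z. Z \<in> zero_modules R \<Longrightarrow> P Z"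
  and indec: "\<And>N. indecomposable R N \<Longrightarrow> P N"
  and dsum: "\<And>M N N'. M \<in> fg_modules R \<Longrightarrow> N \<in> fg_modules R \<Longrightarrow> N' \<in> fg_modules R \<Longrightarrow>
   mod_iso R M (dsum N N') \<Longrightarrow> P N \<Longrightarrow> P N' \<Longrightarrow> P M"
 shows "P M"
proof -
 have "P M" if "M \<in> fg_modules R" "length_le R M n" for M n
  using that
 proof (induction n arbitrary: M rule: less_induct)
  case (less n)
  show ?case
  proof (cases "M \<in> zero_modules R \<or> indecomposable R M")
   case True
   then show ?thesis using zero indec by blast
  next
   case False
   then obtain N N' where N: "N \<in> fg_modules R" "N' \<in> fg_modules R" "mod_iso R M (dsum N N')"
    "N \<notin> zero_modules R" "N' \<notin> zero_modules R"
    using less.prems(1) unfolding indecomposable_def by blast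
   note r = fg_mods_rm[OF less.prems(1)] fg_mods_rm[OF N(1)] fg_mods_rm[OF N(2)]
   interpret N: right_module R N by (rule r)
   interpret N': right_module R N' by (rule r)
   obtain f g where fg: "f \<in> mod_hom R M (dsum N N')" "g \<in> mod_hom R (dsum N N') M"
    "\<And>y. y \<in> carrier (dsum N N') \<Longrightarrow> f (g y) = y"
    using mod_iso_obtain[OF N(3) r(1)] by metis
   have g_inj: "y = z" if "g y = g z" "y \<in> carrier (dsum N N')" "z \<in> carrier (dsum N N')" for y z
    using that fg(3) by metis
   obtain y y' where y: "y \<in> carrier N" "y \<noteq> \<zero>\<^sub>N" and y': "y' \<in> carrier N'" "y' \<noteq> \<zero>\<^sub>N'"
    using N(1,2,4,5) N.zero_closed N'.zero_closed unfolding zero_modules_def by blast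
   have "\<exists>m<n. length_le R N m"
   proof (rule length_le_embed(2)[OF r(2,1) mh_comp[OF dsum_inl_hom[OF r(3)] fg(2)] _ less.prems(2)])
    show "inj_on (\<lambda>x. g (x, \<zero>\<^sub>N')) (carrier N)" by (rule inj_onI) (auto dest: g_inj)
    have "g (\<zero>\<^sub>N, y') \<notin> (\<lambda>x. g (x, \<zero>\<^sub>N')) ` carrier N" using y' by (auto dest: g_inj)
    moreover have "g (\<zero>\<^sub>N, y') \<in> carrier M" using y' by (intro mh_closed[OF fg(2)]) auto
    ultimately show "\<not> carrier M \<subseteq> (\<lambda>x. g (x, \<zero>\<^sub>N')) ` carrier N" by blast
   qed
   moreover have "\<exists>m<n. length_le R N' m"
   proof (rule length_le_embed(2)[OF r(3,1) mh_comp[OF dsum_inr_hom[OF r(2)] fg(2)] _ less.prems(2)])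
    show "inj_on (\<lambda>x. g (\<zero>\<^sub>N, x)) (carrier N')" by (rule inj_onI) (auto dest: g_inj)
    have "g (y, \<zero>\<^sub>N') \<notin> (\<lambda>x. g (\<zero>\<^sub>N, x)) ` carrier N'" using y by (auto dest: g_inj)
    moreover have "g (y, \<zero>\<^sub>N') \<in> carrier M" using y by (intro mh_closed[OF fg(2)]) auto
    ultimately show "\<not> carrier M \<subseteq> (\<lambda>x. g (\<zero>\<^sub>N, x)) ` carrier N'" by blast
   qed
   ultimately have "P N" "P N'" using less.IH N(1,2) by blast+
   then show ?thesis using dsum less.prems(1) N by blast
  qed
 qed
 moreover obtain n where "length_le R M n"
  using fin_len_ring[OF R fg_modulesD[OF assms(2)]] by (auto simp: fin_length_def)
 ultimately show ?thesis using assms(2) by blast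
qed

section \<open>The stable Grothendieck group\<close>

lemma K0_relations_subset: "K0_relations R \<subseteq> carrier (free_Abelian_group (fg_modules R))"
proof -
 have "Poly_Mapping.keys (frag_of M - (frag_of M' + frag_of M'')) \<subseteq> fg_modules R"
  if "M \<in> fg_modules R" "M' \<in> fg_modules R" "M'' \<in> fg_modules R" for M M' M''
  using that keys_diff[of "frag_of M" "frag_of M' + frag_of M''"] Poly_Mapping.keys_add[of "frag_of M'" "frag_of M''"]
  by fastforce
 then show ?thesis by (auto simp: K0_relations_def projective_def)
qed

lemma K0_relations_normal:
 "generate (free_Abelian_group (fg_modules R)) (K0_relations R) \<lhd> free_Abelian_group (fg_modules R)"
 using comm_group.normal_iff_subgroup[OF abelian_free_Abelian_group]
  group.generate_is_subgroup[OF group_free_Abelian_group K0_relations_subset] by blast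

lemma K0_comm_group: "comm_group (K0 R)"
 unfolding K0_def
 by (intro comm_group.abelian_FactGroup abelian_free_Abelian_group
   group.generate_is_subgroup group_free_Abelian_group K0_relations_subset)

lemma K0_class_closed: "M \<in> fg_modules R \<Longrightarrow> K0_class R M \<in> carrier (K0 R)"
 by (auto simp: K0_def K0_class_def carrier_FactGroup)

lemma K0_coset_eq:
 fixes R :: "'a ring"
 defines "F \<equiv> free_Abelian_group (fg_modules R)"
 assumes "x \<in> carrier F" "y \<in> carrier F" "y - x \<in> K0_relations R"
 shows "generate F (K0_relations R) #>\<^bsub>F\<^esub> x = generate F (K0_relations R) #>\<^bsub>F\<^esub> y"
proof (rule group.repr_independence)
 show "y \<in> generate F (K0_relations R) #>\<^bsub>F\<^esub> x"
  using generate.incl[OF assms(4), of F] unfolding r_coset_def F_def by force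
 show "subgroup (generate F (K0_relations R)) F"
  unfolding F_def by (intro group.generate_is_subgroup group_free_Abelian_group K0_relations_subset)
qed (use assms in \<open>auto simp: F_def\<close>)

lemma K0_class_dsum:
 assumes fg: "M \<in> fg_modules R" "N \<in> fg_modules R" "N' \<in> fg_modules R" and iso: "mod_iso R M (dsum N N')"
 shows "K0_class R M = K0_class R N \<otimes>\<^bsub>K0 R\<^esub> K0_class R N'"
proof -
 let ?F = "free_Abelian_group (fg_modules R)"
 let ?H = "generate ?F (K0_relations R)"
 have "frag_of M - (frag_of N + frag_of N') \<in> K0_relations R"
  using assms unfolding K0_relations_def by blast
 then have "?H #>\<^bsub>?F\<^esub> (frag_of N + frag_of N') = ?H #>\<^bsub>?F\<^esub> frag_of M"
  using fg Poly_Mapping.keys_add[of "frag_of N" "frag_of N'"]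
  by (intro K0_coset_eq) auto
 moreover have "?H #>\<^bsub>?F\<^esub> (frag_of N \<otimes>\<^sub>?F frag_of N') = (?H #>\<^bsub>?F\<^esub> frag_of N) <#>\<^bsub>?F\<^esub> (?H #>\<^bsub>?F\<^esub> frag_of N')"
  using fg by (intro normal.rcos_sum[OF K0_relations_normal, symmetric]) auto
 ultimately show ?thesis by (simp add: K0_class_def K0_def FactGroup_def)
qed

lemma K0_class_projective:
 assumes "projective R P" shows "K0_class R P = \<one>\<^bsub>K0 R\<^esub>"
proof -
 let ?F = "free_Abelian_group (fg_modules R)"
 let ?H = "generate ?F (K0_relations R)"
 have "frag_of P \<in> K0_relations R" using assms by (auto simp: K0_relations_def)
 then have "?H #>\<^bsub>?F\<^esub> 0 = ?H #>\<^bsub>?F\<^esub> frag_of P"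
  using assms by (intro K0_coset_eq) (auto simp: projective_def)
 moreover have "?H #>\<^bsub>?F\<^esub> \<one>\<^sub>?F = ?H"
  by (intro group.coset_join2 group_free_Abelian_group group.generate_is_subgroup K0_relations_subset
    generate.one monoid.one_closed group.is_monoid)
 ultimately show ?thesis by (simp add: K0_class_def K0_def FactGroup_def)
qed

lemma zero_projective: "Z \<in> zero_modules R \<Longrightarrow> projective R Z"
 by (auto simp: projective_iff zero_modules_iff fg_projective_zero intro!: fg_modulesI fg_module_zero)

lemma K0_class_iso:
 assumes "M \<in> fg_modules R" "N \<in> fg_modules R" "mod_iso R M N"
 shows "K0_class R M = K0_class R N"
proof -
 interpret K: comm_group "K0 R" by (rule K0_comm_group)
 note r = fg_mods_rm[OF assms(1)] fg_mods_rm[OF assms(2)]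
 then have z: "zero_module \<in> zero_modules R" by (intro zero_module) (simp add: right_module_def)
 then have "zero_module \<in> fg_modules R" by (simp add: zero_modules_def)
 note zm = z[unfolded zero_modules_iff, THEN conjunct1] z[unfolded zero_modules_iff, THEN conjunct2] this
 have "mod_iso R M (dsum N zero_module)"
  by (rule mod_iso_trans[OF assms(3) mod_iso_sym[OF dsum_zero_right[OF r(2) zm(1,2)] dsum_module[OF r(2) zm(1)]]])
 then show ?thesis
  using K0_class_dsum[OF assms(1,2) zm(3)] K0_class_projective[OF zero_projective[OF z]]
   K0_class_closed[OF assms(2)] by simp
qed

text \<open>Additive invariants of modules that vanish on projective modules factor through \<open>K\<^sub>0\<close>; the syzygy and
 the gluing and top functors all act on \<open>K\<^sub>0\<close> for this reason.\<close>

lemma K0_universal: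
 assumes "comm_group H" "\<And>M. M \<in> fg_modules R \<Longrightarrow> t M \<in> carrier H"
  and add: "\<And>M N N'. M \<in> fg_modules R \<Longrightarrow> N \<in> fg_modules R \<Longrightarrow> N' \<in> fg_modules R \<Longrightarrow>
   mod_iso R M (dsum N N') \<Longrightarrow> t M = t N \<otimes>\<^sub>H t N'"
  and proj: "\<And>P. projective R P \<Longrightarrow> t P = \<one>\<^sub>H"
 obtains h where "h \<in> hom (K0 R) H" "\<And>M. M \<in> fg_modules R \<Longrightarrow> h (K0_class R M) = t M"
proof -
 let ?F = "free_Abelian_group (fg_modules R)"
 interpret H: comm_group H by fact
 obtain h where h: "h \<in> hom ?F H" "\<And>M. M \<in> fg_modules R \<Longrightarrow> h (frag_of M) = t M"
  using H.free_Abelian_group_universal[of t "fg_modules R"] assms(2) by (metis image_subsetI)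
 interpret h: group_hom ?F H h by (intro group_hom.intro group_hom_axioms.intro h H.is_group) simp
 have "K0_relations R \<subseteq> kernel ?F H h"
 proof
  fix x assume x: "x \<in> K0_relations R"
  then have xF: "x \<in> carrier ?F" using K0_relations_subset by blast
  from x have "h x = \<one>\<^sub>H" unfolding K0_relations_def
  proof (elim UnE CollectE exE conjE)
   fix M N N' assume m: "x = frag_of M - (frag_of N + frag_of N')"
    "M \<in> fg_modules R" "N \<in> fg_modules R" "N' \<in> fg_modules R" "mod_iso R M (dsum N N')"
   then have c: "frag_of M \<in> carrier ?F" "frag_of N \<in> carrier ?F" "frag_of N' \<in> carrier ?F" by auto
   have "h (x \<otimes>\<^sub>?F (frag_of N \<otimes>\<^sub>?F frag_of N')) = h x \<otimes>\<^sub>H (t N \<otimes>\<^sub>H t N')"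
    using xF c h(2) m(3,4) h.hom_mult[OF xF h.G.m_closed[OF c(2,3)]] h.hom_mult[OF c(2,3)]
    by simp
   moreover have "x \<otimes>\<^sub>?F (frag_of N \<otimes>\<^sub>?F frag_of N') = frag_of M" using m(1) by simp
   ultimately have "t M = h x \<otimes>\<^sub>H (t N \<otimes>\<^sub>H t N')" using h(2) m(2) by simp
   then show "h x = \<one>\<^sub>H" using add[OF m(2-5)] assms(2) m(3,4) h.hom_closed[OF xF]
    by (metis H.r_cancel_one' H.m_closed)
  qed (use h(2) proj in \<open>auto simp: projective_def\<close>)
  then show "x \<in> kernel ?F H h" using xF by (simp add: kernel_def)
 qed
 then have "generate ?F (K0_relations R) \<subseteq> kernel ?F H h"
  by (rule group.generate_subgroup_incl[OF group_free_Abelian_group _ h.subgroup_kernel])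
 from h.FactGroup_universal_kernel[OF K0_relations_normal this]
 obtain g where "g \<in> hom (K0 R) H" "\<And>x. x \<in> carrier ?F \<Longrightarrow> g (generate ?F (K0_relations R) #>\<^bsub>?F\<^esub> x) = h x"
  unfolding K0_def by blast
 then show thesis using h(2) by (intro that[of g]) (auto simp: K0_class_def)
qed

lemma K0_map:
 assumes "\<And>M. M \<in> fg_modules R \<Longrightarrow> T M \<in> fg_modules R'"
  and add: "\<And>M N N'. M \<in> fg_modules R \<Longrightarrow> N \<in> fg_modules R \<Longrightarrow> N' \<in> fg_modules R \<Longrightarrow>
   mod_iso R M (dsum N N') \<Longrightarrow> mod_iso R' (T M) (dsum (T N) (T N'))"
  and proj: "\<And>P. projective R P \<Longrightarrow> projective R' (T P)"
 obtains h where "h \<in> hom (K0 R) (K0 R')" "\<And>M. M \<in> fg_modules R \<Longrightarrow> h (K0_class R M) = K0_class R' (T M)"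
proof (rule K0_universal[of "K0 R'" R "\<lambda>M. K0_class R' (T M)"])
 show "comm_group (K0 R')" by (rule K0_comm_group)
 show "K0_class R' (T M) = K0_class R' (T N) \<otimes>\<^bsub>K0 R'\<^esub> K0_class R' (T N')"
  if "M \<in> fg_modules R" "N \<in> fg_modules R" "N' \<in> fg_modules R" "mod_iso R M (dsum N N')" for M N N'
  by (rule K0_class_dsum[OF assms(1)[OF that(1)] assms(1)[OF that(2)] assms(1)[OF that(3)] add[OF that]])
qed (use assms(1) proj that in \<open>simp_all add: K0_class_closed K0_class_projective\<close>)

lemma Omega_bar:
 assumes R: "fin_len_ring R"
 shows "Omega_bar R \<in> hom (K0 R) (K0 R)"
  "M \<in> fg_modules R \<Longrightarrow> Omega_bar R (K0_class R M) = K0_class R (syzygy R M)"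
proof -
 obtain h where "h \<in> hom (K0 R) (K0 R)" "\<And>M. M \<in> fg_modules R \<Longrightarrow> h (K0_class R M) = K0_class R (syzygy R M)"
  by (rule K0_map[of R "syzygy R" R])
    (use R in \<open>auto intro: syzygy_fg syzygy_dsum zero_projective syzygy_projective\<close>)
 then have "\<exists>h. h \<in> hom (K0 R) (K0 R) \<and> (\<forall>M\<in>fg_modules R. h (K0_class R M) = K0_class R (syzygy R M))"
  by blast
 then have "Omega_bar R \<in> hom (K0 R) (K0 R) \<and> (\<forall>M\<in>fg_modules R. Omega_bar R (K0_class R M) = K0_class R (syzygy R M))"
  unfolding Omega_bar_def by (rule someI_ex)
 then show "Omega_bar R \<in> hom (K0 R) (K0 R)"
  "M \<in> fg_modules R \<Longrightarrow> Omega_bar R (K0_class R M) = K0_class R (syzygy R M)" by auto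
qed

lemma K0_class_in_add_subgroup:
 assumes R: "fin_len_ring R" and "N \<in> fg_modules R" "M \<in> fg_modules R" "dir_summand R N M"
 shows "K0_class R N \<in> add_subgroup R M"
 using assms(1,2,4)
proof (induction rule: indecomposable_induct)
 case (zero Z)
 then show ?case using K0_class_projective[OF zero_projective[of Z R]] generate.one[of "K0 R"]
  by (auto simp: add_subgroup_def)
next
 case (indecomposable N)
 then show ?case unfolding add_subgroup_def by (intro generate.incl) blast
next
 case (dsum N N1 N2)
 have "dir_summand R N1 N" "dir_summand R N2 N"
  using dsum(1-4) mod_iso_trans[OF dsum(4) dsum_comm] by (auto simp: dir_summand_def)
 then have "K0_class R N1 \<in> add_subgroup R M" "K0_class R N2 \<in> add_subgroup R M"
  using dsum.IH dsum.prems dir_summand_trans by blast+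
 then show ?case unfolding K0_class_dsum[OF dsum(1-4)] add_subgroup_def by (rule generate.eng)
qed

text \<open>On a subcategory closed under direct sums, every element of the subgroup of \<open>K\<^sub>0\<close> generated by
 its classes is a difference of two classes. The vanishing of all \<open>\<phi>\<close>-values therefore reduces to
 a statement on pairs of modules.\<close>

lemma IT_phi_dim_zero_iff:
 assumes R: "fin_len_ring R" and D: "add_closed R D" and Om: "syzygy R ` D \<subseteq> D"
 shows "IT_phi_dim R D = 0 \<longleftrightarrow>
  (\<forall>N\<in>D. \<forall>N'\<in>D. K0_class R (syzygy R N) = K0_class R (syzygy R N') \<longrightarrow> K0_class R N = K0_class R N')"
  (is "_ \<longleftrightarrow> ?inj")
proof -
 interpret K: comm_group "K0 R" by (rule K0_comm_group)
 interpret O: group_hom "K0 R" "K0 R" "Omega_bar R"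
  by (intro group_hom.intro group_hom_axioms.intro K.is_group Omega_bar R)
 have Rr: "ring R" by (rule fl_ring_is_ring[OF R])
 have Dfg: "M \<in> fg_modules R" if "M \<in> D" for M using D that by (auto simp: add_closed_def)
 have Dc: "K0_class R M \<in> carrier (K0 R)" if "M \<in> D" for M using Dfg[OF that] by (rule K0_class_closed)
 have Oc: "Omega_bar R (K0_class R M) = K0_class R (syzygy R M)" if "M \<in> D" for M
  by (rule Omega_bar(2)[OF R Dfg[OF that]])
 have Dsum: "\<exists>M\<in>D. mod_iso R M (dsum N N') \<and> K0_class R M = K0_class R N \<otimes>\<^bsub>K0 R\<^esub> K0_class R N'"
  if "N \<in> D" "N' \<in> D" for N N'
 proof -
  have "fg_module R (dsum N N')" using that Dfg by (intro fg_module_dsum fg_modulesD)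
  note L = list_copy[OF this]
  have "list_copy R (dsum N N') \<in> D" using D that L unfolding add_closed_def by blast
  moreover have "K0_class R (list_copy R (dsum N N')) = K0_class R N \<otimes>\<^bsub>K0 R\<^esub> K0_class R N'"
   by (rule K0_class_dsum[OF L(1) Dfg[OF that(1)] Dfg[OF that(2)] L(3)])
  ultimately show ?thesis using L(3) by blast
 qed
 have phi0: "IT_phi R M = 0 \<longleftrightarrow> (\<forall>m. inj_on (Omega_bar R) ((Omega_bar R ^^ m) ` add_subgroup R M))" (is "_ \<longleftrightarrow> ?z") for M
 proof
  assume ?z
  then have "enat 0 \<in> {enat k | k. \<forall>m\<ge>k. inj_on (Omega_bar R) ((Omega_bar R ^^ m) ` add_subgroup R M)}" by blast
  then have "IT_phi R M \<le> enat 0" unfolding IT_phi_def by (rule Inf_lower)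
  then show "IT_phi R M = 0" by (simp flip: zero_enat_def)
 next
  assume z: "IT_phi R M = 0"
  show ?z
  proof (rule ccontr)
   assume nz: "\<not> ?z"
   have "1 \<le> k" if k: "k \<in> {enat k | k. \<forall>m\<ge>k. inj_on (Omega_bar R) ((Omega_bar R ^^ m) ` add_subgroup R M)}" for k
   proof -
    obtain j where j: "k = enat j" "\<forall>m\<ge>j. inj_on (Omega_bar R) ((Omega_bar R ^^ m) ` add_subgroup R M)"
     using k by blast
    then have "j \<noteq> 0" using nz by (metis le0)
    then show ?thesis using j(1) by (simp add: one_enat_def)
   qed
   then have "1 \<le> IT_phi R M" unfolding IT_phi_def by (rule Inf_greatest)
   then show False using z by simp
  qed
 qed
 have "IT_phi_dim R D = 0 \<longleftrightarrow> (\<forall>M\<in>D. IT_phi R M = 0)"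
  unfolding IT_phi_dim_def by (auto simp: SUP_eq_iff bot_enat_def[symmetric] simp del: bot_enat_def)
 also have "\<dots> \<longleftrightarrow> ?inj"
 proof
  assume z: "\<forall>M\<in>D. IT_phi R M = 0"
  show ?inj
  proof (intro ballI impI)
   fix N N' assume N: "N \<in> D" "N' \<in> D" "K0_class R (syzygy R N) = K0_class R (syzygy R N')"
   obtain M where M: "M \<in> D" "mod_iso R M (dsum N N')" using Dsum[OF N(1,2)] by blast
   have "dir_summand R N M" "dir_summand R N' M"
    using M N Dfg mod_iso_trans[OF M(2) dsum_comm] by (auto simp: dir_summand_def)
   then have mem: "K0_class R N \<in> add_subgroup R M" "K0_class R N' \<in> add_subgroup R M"
    using K0_class_in_add_subgroup[OF R] Dfg N M by blast+
   have "inj_on (Omega_bar R) ((Omega_bar R ^^ 0) ` add_subgroup R M)" using z M phi0 by blast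
   then show "K0_class R N = K0_class R N'"
    using mem N Oc by (auto dest: inj_onD)
  qed
 next
  assume inj: ?inj
  define G where "G = {K0_class R N \<otimes>\<^bsub>K0 R\<^esub> inv\<^bsub>K0 R\<^esub> K0_class R N' | N N'. N \<in> D \<and> N' \<in> D}"
  have Ginj: "inj_on (Omega_bar R) G"
  proof (rule inj_onI)
   fix x y assume xy: "x \<in> G" "y \<in> G" "Omega_bar R x = Omega_bar R y"
   obtain N N' L L' where h: "x = K0_class R N \<otimes>\<^bsub>K0 R\<^esub> inv\<^bsub>K0 R\<^esub> K0_class R N'"
    "y = K0_class R L \<otimes>\<^bsub>K0 R\<^esub> inv\<^bsub>K0 R\<^esub> K0_class R L'" "N \<in> D" "N' \<in> D" "L \<in> D" "L' \<in> D"
    using xy by (auto simp: G_def)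
   have cross: "a \<otimes>\<^bsub>K0 R\<^esub> inv\<^bsub>K0 R\<^esub> b = c \<otimes>\<^bsub>K0 R\<^esub> inv\<^bsub>K0 R\<^esub> d \<longleftrightarrow> a \<otimes>\<^bsub>K0 R\<^esub> d = c \<otimes>\<^bsub>K0 R\<^esub> b"
    if c: "a \<in> carrier (K0 R)" "b \<in> carrier (K0 R)" "c \<in> carrier (K0 R)" "d \<in> carrier (K0 R)" for a b c d
   proof -
    have "a \<otimes>\<^bsub>K0 R\<^esub> inv\<^bsub>K0 R\<^esub> b = c \<otimes>\<^bsub>K0 R\<^esub> inv\<^bsub>K0 R\<^esub> d \<longleftrightarrow> a = (c \<otimes>\<^bsub>K0 R\<^esub> inv\<^bsub>K0 R\<^esub> d) \<otimes>\<^bsub>K0 R\<^esub> b"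
     using c K.inv_solve_right[of "c \<otimes>\<^bsub>K0 R\<^esub> inv\<^bsub>K0 R\<^esub> d" a b] by auto
    also have "\<dots> \<longleftrightarrow> a = (c \<otimes>\<^bsub>K0 R\<^esub> b) \<otimes>\<^bsub>K0 R\<^esub> inv\<^bsub>K0 R\<^esub> d" using c by (simp add: K.m_ac)
    also have "\<dots> \<longleftrightarrow> a \<otimes>\<^bsub>K0 R\<^esub> d = c \<otimes>\<^bsub>K0 R\<^esub> b" using c K.inv_solve_right[of a "c \<otimes>\<^bsub>K0 R\<^esub> b" d] by auto
    finally show ?thesis .
   qed
   obtain M where M: "M \<in> D" "K0_class R M = K0_class R N \<otimes>\<^bsub>K0 R\<^esub> K0_class R L'" using Dsum[OF h(3,6)] by blast
   obtain M' where M': "M' \<in> D" "K0_class R M' = K0_class R L \<otimes>\<^bsub>K0 R\<^esub> K0_class R N'" using Dsum[OF h(5,4)] by blast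
   note c = Dc[OF h(3)] Dc[OF h(4)] Dc[OF h(5)] Dc[OF h(6)]
   have "Omega_bar R (K0_class R N) \<otimes>\<^bsub>K0 R\<^esub> Omega_bar R (K0_class R L')
     = Omega_bar R (K0_class R L) \<otimes>\<^bsub>K0 R\<^esub> Omega_bar R (K0_class R N')"
    using xy(3) c unfolding h(1,2) by (simp add: cross)
   then have "Omega_bar R (K0_class R M) = Omega_bar R (K0_class R M')"
    unfolding M(2) M'(2) O.hom_mult[OF c(1,4)] O.hom_mult[OF c(3,2)] .
   then have "K0_class R M = K0_class R M'"
    unfolding Oc[OF M(1)] Oc[OF M'(1)] by (rule inj[rule_format, OF M(1) M'(1)])
   then show "x = y" unfolding h(1,2) M(2) M'(2) cross[OF c] .
  qed
  have zD: "zero_module \<in> D" "K0_class R zero_module = \<one>\<^bsub>K0 R\<^esub>"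
   using D zero_module[OF Rr] zero_projective[THEN K0_class_projective] by (auto simp: add_closed_def)
  have GG: "x \<otimes>\<^bsub>K0 R\<^esub> y \<in> G" if xy: "x \<in> G" "y \<in> G" for x y
  proof -
   obtain N N' L L' where h: "x = K0_class R N \<otimes>\<^bsub>K0 R\<^esub> inv\<^bsub>K0 R\<^esub> K0_class R N'"
    "y = K0_class R L \<otimes>\<^bsub>K0 R\<^esub> inv\<^bsub>K0 R\<^esub> K0_class R L'" "N \<in> D" "N' \<in> D" "L \<in> D" "L' \<in> D"
    using xy by (auto simp: G_def)
   obtain M where M: "M \<in> D" "K0_class R M = K0_class R N \<otimes>\<^bsub>K0 R\<^esub> K0_class R L" using Dsum[OF h(3,5)] by blast
   obtain M' where M': "M' \<in> D" "K0_class R M' = K0_class R N' \<otimes>\<^bsub>K0 R\<^esub> K0_class R L'" using Dsum[OF h(4,6)] by blast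
   have "x \<otimes>\<^bsub>K0 R\<^esub> y = K0_class R M \<otimes>\<^bsub>K0 R\<^esub> inv\<^bsub>K0 R\<^esub> K0_class R M'"
    unfolding M M' h(1,2) using Dc[OF h(3)] Dc[OF h(4)] Dc[OF h(5)] Dc[OF h(6)]
    by (simp add: K.inv_mult K.m_ac)
   then show ?thesis using M(1) M'(1) unfolding G_def by blast
  qed
  have GI: "K0_class R N \<otimes>\<^bsub>K0 R\<^esub> inv\<^bsub>K0 R\<^esub> K0_class R N' \<in> G" if "N \<in> D" "N' \<in> D" for N N'
   unfolding G_def using that by blast
  have G1: "\<one>\<^bsub>K0 R\<^esub> \<in> G" using GI[OF zD(1,1)] by (simp add: zD(2))
  have Gcl: "K0_class R N \<in> G" "inv\<^bsub>K0 R\<^esub> K0_class R N \<in> G" if "N \<in> D" for N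
   using GI[OF that zD(1)] GI[OF zD(1) that] Dc[OF that] by (simp_all add: zD(2))
  have add_sub: "add_subgroup R M \<subseteq> G" if M: "M \<in> D" for M
  proof
   fix x assume "x \<in> add_subgroup R M"
   then show "x \<in> G" unfolding add_subgroup_def
   proof (induction rule: generate.induct)
    case (incl x)
    then obtain N where N: "x = K0_class R N" "dir_summand R N M" by blast
    then have "N \<in> D" using D M by (auto simp: add_closed_def)
    then show ?case using Gcl N by simp
   next
    case (inv x)
    then obtain N where N: "x = K0_class R N" "dir_summand R N M" by blast
    then have "N \<in> D" using D M by (auto simp: add_closed_def)
    then show ?case using Gcl N by simp
   qed (auto simp: G1 GG)
  qed
  have OG: "Omega_bar R ` G \<subseteq> G"
  proof clarify
   fix x assume "x \<in> G"
   then obtain N N' where h: "x = K0_class R N \<otimes>\<^bsub>K0 R\<^esub> inv\<^bsub>K0 R\<^esub> K0_class R N'" "N \<in> D" "N' \<in> D"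
    by (auto simp: G_def)
   then have "Omega_bar R x = K0_class R (syzygy R N) \<otimes>\<^bsub>K0 R\<^esub> inv\<^bsub>K0 R\<^esub> K0_class R (syzygy R N')"
    using Dc by (simp add: Oc)
   then show "Omega_bar R x \<in> G" using h Om unfolding G_def by blast
  qed
  show "\<forall>M\<in>D. IT_phi R M = 0"
  proof
   fix M assume M: "M \<in> D"
   have "(Omega_bar R ^^ m) ` add_subgroup R M \<subseteq> G" for m
    by (induction m) (use add_sub[OF M] OG in \<open>auto simp: image_subset_iff\<close>)
   then show "IT_phi R M = 0" unfolding phi0 using Ginj inj_on_subset by blast
  qed
 qed
 finally show ?thesis .
qed

lemma zero_IT_subcategory_iff:
 assumes R: "fin_len_ring R"
 shows "zero_IT_subcategory R D \<longleftrightarrow> add_closed R D \<and> syzygy R ` D \<subseteq> D \<and>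
  (\<forall>N\<in>D. \<forall>N'\<in>D. K0_class R (syzygy R N) = K0_class R (syzygy R N') \<longrightarrow> K0_class R N = K0_class R N')"
 using IT_phi_dim_zero_iff[OF R, of D] add_closed_iff[OF fl_ring_is_ring[OF R], of D]
 unfolding zero_IT_subcategory_def by blast

section \<open>Gluing modules along square-zero arrows\<close>

lemmas (in right_module) act_rules = act_closed act_add_ring act_add_module act_mult act_one zero_act act_zero act_uminus
lemmas (in right_module) add_rules = M.a_closed M.zero_closed M.a_assoc M.a_comm M.a_lcomm M.l_zero M.r_zero
 M.a_inv_closed M.l_neg M.r_neg

lemma additive_finsum:
 assumes "abelian_monoid M" "abelian_monoid N" "\<And>x. x \<in> carrier M \<Longrightarrow> f x \<in> carrier N"
  "\<And>x y. x \<in> carrier M \<Longrightarrow> y \<in> carrier M \<Longrightarrow> f (x \<oplus>\<^sub>M y) = f x \<oplus>\<^sub>N f y" "f \<zero>\<^sub>M = \<zero>\<^sub>N"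
  "finite I" "g \<in> I \<rightarrow> carrier M"
 shows "f (finsum M g I) = finsum N (\<lambda>i. f (g i)) I"
 using assms(6,7)
proof (induction I rule: finite_induct)
 interpret M: abelian_monoid M by fact
 interpret N: abelian_monoid N by fact
 {
  case empty
  show ?case using assms(5) by simp
 next
  case (insert i I)
  then have g: "g \<in> I \<rightarrow> carrier M" "g i \<in> carrier M" by auto
  then have "finsum M g I \<in> carrier M" by (intro M.finsum_closed)
  with insert g show ?case using assms(3,4)
   by (simp add: M.finsum_insert N.finsum_insert Pi_iff)
 }
qed

lemma (in right_module) finsum_act:
 assumes "finite I" "f \<in> I \<rightarrow> carrier R" "x \<in> carrier M"
 shows "finsum R f I \<odot>\<^sub>M x = finsum M (\<lambda>i. f i \<odot>\<^sub>M x) I"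
 using assms by (intro additive_finsum[where f = "\<lambda>r. r \<odot>\<^sub>M x"])
  (auto simp: act_rules intro: R.abelian_monoid_axioms M.abelian_monoid_axioms)

lemma mh_fixed:
 "f \<in> mod_hom R M N \<Longrightarrow> r \<odot>\<^sub>M x = x \<Longrightarrow> r \<in> carrier R \<Longrightarrow> x \<in> carrier M \<Longrightarrow> r \<odot>\<^sub>N f x = f x"
 using mh_act[of f R M N r x] by simp

text \<open>The ring \<open>R\<close> contains the pairwise annihilating rings \<open>S i\<close> as corners via \<open>\<iota>\<close>, with projections \<open>\<pi>\<close>.
 Every element is a sum of corner elements \<open>\<pi> i r\<close> and of \<open>\<gamma> k r\<close> times the connecting element
 \<open>\<beta> k\<close>. Multiplying \<open>\<beta> k\<close> by \<open>r\<close> from the right only sees a scalar, which is embedded as \<open>\<epsilon> k r\<close> into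
 \<open>S (\<sigma> k)\<close>, so that \<open>\<gamma> k\<close> is a twisted derivation. Indices \<open>k\<close> outside \<open>\<Gamma>\<close> carry zero data.
 \<open>rad\<close> stands for the radical: modules killed by it are semisimple and lie in the additive closure of \<open>T\<close>.\<close>

locale glued_rings =
 fixes R :: "'c ring" and S :: "'i::finite \<Rightarrow> 'd ring"
  and \<pi> :: "'i \<Rightarrow> 'c \<Rightarrow> 'd" and \<iota> :: "'i \<Rightarrow> 'd \<Rightarrow> 'c"
  and \<Gamma> :: "'g set" and \<sigma> :: "'g \<Rightarrow> 'i" and \<beta> :: "'g \<Rightarrow> 'c" and \<eta> :: "'g \<Rightarrow> 'd"
  and \<epsilon> :: "'g \<Rightarrow> 'c \<Rightarrow> 'd" and \<gamma> :: "'g \<Rightarrow> 'c \<Rightarrow> 'd"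
  and rad :: "'c set" and T :: "('c, 'c list) module"
 assumes R_fl: "fin_len_ring R" and S_fl: "fin_len_ring (S i)"
  and pi_hom: "\<pi> i \<in> ring_hom R (S i)"
  and iota_closed: "a \<in> carrier (S i) \<Longrightarrow> \<iota> i a \<in> carrier R"
  and iota_add: "a \<in> carrier (S i) \<Longrightarrow> b \<in> carrier (S i) \<Longrightarrow> \<iota> i (a \<oplus>\<^bsub>S i\<^esub> b) = \<iota> i a \<oplus>\<^sub>R \<iota> i b"
  and iota_mult: "a \<in> carrier (S i) \<Longrightarrow> b \<in> carrier (S i) \<Longrightarrow> \<iota> i (a \<otimes>\<^bsub>S i\<^esub> b) = \<iota> i a \<otimes>\<^sub>R \<iota> i b"
  and iota_orth: "i \<noteq> j \<Longrightarrow> a \<in> carrier (S i) \<Longrightarrow> b \<in> carrier (S j) \<Longrightarrow> \<iota> i a \<otimes>\<^sub>R \<iota> j b = \<zero>\<^sub>R"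
  and iota_one: "finsum R (\<lambda>i. \<iota> i \<one>\<^bsub>S i\<^esub>) UNIV = \<one>\<^sub>R"
  and pi_iota: "a \<in> carrier (S j) \<Longrightarrow> \<pi> i (\<iota> j a) = (if i = j then a else \<zero>\<^bsub>S i\<^esub>)"
  and fin_\<Gamma>: "finite \<Gamma>" and eta_off: "k \<notin> \<Gamma> \<Longrightarrow> \<eta> k = \<zero>\<^bsub>S (\<sigma> k)\<^esub>"
  and beta_closed: "\<beta> k \<in> carrier R" and eta_closed: "\<eta> k \<in> carrier (S (\<sigma> k))"
  and eta_idem: "\<eta> k \<otimes>\<^bsub>S (\<sigma> k)\<^esub> \<eta> k = \<eta> k" and iota_eta_beta: "\<iota> (\<sigma> k) (\<eta> k) \<otimes>\<^sub>R \<beta> k = \<beta> k"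
  and eps_closed: "r \<in> carrier R \<Longrightarrow> \<epsilon> k r \<in> carrier (S (\<sigma> k))"
  and eps_add: "r \<in> carrier R \<Longrightarrow> s \<in> carrier R \<Longrightarrow> \<epsilon> k (r \<oplus>\<^sub>R s) = \<epsilon> k r \<oplus>\<^bsub>S (\<sigma> k)\<^esub> \<epsilon> k s"
  and eps_mult: "r \<in> carrier R \<Longrightarrow> s \<in> carrier R \<Longrightarrow> \<epsilon> k (r \<otimes>\<^sub>R s) = \<epsilon> k r \<otimes>\<^bsub>S (\<sigma> k)\<^esub> \<epsilon> k s"
  and eps_eta: "r \<in> carrier R \<Longrightarrow> \<epsilon> k r \<otimes>\<^bsub>S (\<sigma> k)\<^esub> \<eta> k = \<eta> k \<otimes>\<^bsub>S (\<sigma> k)\<^esub> \<epsilon> k r"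
  and eps_one: "\<eta> k \<otimes>\<^bsub>S (\<sigma> k)\<^esub> \<epsilon> k \<one>\<^sub>R = \<eta> k"
  and gam_closed: "r \<in> carrier R \<Longrightarrow> \<gamma> k r \<in> carrier (S (\<sigma> k))"
  and gam_add: "r \<in> carrier R \<Longrightarrow> s \<in> carrier R \<Longrightarrow> \<gamma> k (r \<oplus>\<^sub>R s) = \<gamma> k r \<oplus>\<^bsub>S (\<sigma> k)\<^esub> \<gamma> k s"
  and gam_mult: "r \<in> carrier R \<Longrightarrow> s \<in> carrier R \<Longrightarrow>
   \<gamma> k (r \<otimes>\<^sub>R s) = \<gamma> k r \<otimes>\<^bsub>S (\<sigma> k)\<^esub> \<epsilon> k s \<oplus>\<^bsub>S (\<sigma> k)\<^esub> \<pi> (\<sigma> k) r \<otimes>\<^bsub>S (\<sigma> k)\<^esub> \<gamma> k s"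
  and gam_eta: "r \<in> carrier R \<Longrightarrow> \<gamma> k r \<otimes>\<^bsub>S (\<sigma> k)\<^esub> \<eta> k = \<gamma> k r"
  and gam_one: "\<gamma> k \<one>\<^sub>R = \<zero>\<^bsub>S (\<sigma> k)\<^esub>"
  and gam_iota: "a \<in> carrier (S i) \<Longrightarrow> \<gamma> k (\<iota> i a) = \<zero>\<^bsub>S (\<sigma> k)\<^esub>"
  and pi_beta: "\<pi> i (\<beta> k) = \<zero>\<^bsub>S i\<^esub>" and eps_beta: "\<epsilon> l (\<beta> k) = \<zero>\<^bsub>S (\<sigma> l)\<^esub>"
  and gam_beta: "\<gamma> l (\<beta> k) = (if l = k then \<eta> k else \<zero>\<^bsub>S (\<sigma> l)\<^esub>)"
  and beta_mult: "r \<in> carrier R \<Longrightarrow> \<beta> k \<otimes>\<^sub>R r = \<iota> (\<sigma> k) (\<epsilon> k r) \<otimes>\<^sub>R \<beta> k"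
  and decomposition: "r \<in> carrier R \<Longrightarrow>
   r = finsum R (\<lambda>i. \<iota> i (\<pi> i r)) UNIV \<oplus>\<^sub>R finsum R (\<lambda>k. \<iota> (\<sigma> k) (\<gamma> k r) \<otimes>\<^sub>R \<beta> k) \<Gamma>"
  and rad_subset: "rad \<subseteq> carrier R" and beta_rad: "r \<in> rad \<Longrightarrow> \<beta> k \<otimes>\<^sub>R r = \<zero>\<^sub>R"
  and complement: "M \<in> fg_modules R \<Longrightarrow> (\<And>r x. r \<in> rad \<Longrightarrow> x \<in> carrier M \<Longrightarrow> r \<odot>\<^sub>M x = \<zero>\<^sub>M) \<Longrightarrow>
   submod R K M \<Longrightarrow> \<exists>K'. submod R K' M \<and> K \<inter> K' = {\<zero>\<^sub>M} \<and> K <+>\<^sub>M K' = carrier M"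
  and T_fg: "T \<in> fg_modules R"
  and add_T: "M \<in> fg_modules R \<Longrightarrow> (\<And>r x. r \<in> rad \<Longrightarrow> x \<in> carrier M \<Longrightarrow> r \<odot>\<^sub>M x = \<zero>\<^sub>M) \<Longrightarrow>
   M \<in> add_closure R {T}"
begin

lemma R_ring: "ring R" and S_ring: "ring (S i)"
 using R_fl S_fl by (simp_all add: fin_len_ring_def)

sublocale R: ring R by (rule R_ring)
sublocale S: ring "S i" for i by (rule S_ring)

lemma pi_closed: "r \<in> carrier R \<Longrightarrow> \<pi> i r \<in> carrier (S i)"
 and pi_add: "r \<in> carrier R \<Longrightarrow> s \<in> carrier R \<Longrightarrow> \<pi> i (r \<oplus>\<^sub>R s) = \<pi> i r \<oplus>\<^bsub>S i\<^esub> \<pi> i s"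
 and pi_mult: "r \<in> carrier R \<Longrightarrow> s \<in> carrier R \<Longrightarrow> \<pi> i (r \<otimes>\<^sub>R s) = \<pi> i r \<otimes>\<^bsub>S i\<^esub> \<pi> i s"
 and pi_one: "\<pi> i \<one>\<^sub>R = \<one>\<^bsub>S i\<^esub>"
 using pi_hom[of i] by (auto simp: ring_hom_closed ring_hom_add ring_hom_mult ring_hom_one)

lemma pi_zero: "\<pi> i \<zero>\<^sub>R = \<zero>\<^bsub>S i\<^esub>"
 using pi_add[of "\<zero>\<^sub>R" "\<zero>\<^sub>R" i] pi_closed[of "\<zero>\<^sub>R" i]
 by (metis R.add.l_one R.zero_closed S.add.r_cancel_one)

lemma iota_zero: "\<iota> i \<zero>\<^bsub>S i\<^esub> = \<zero>\<^sub>R"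
 using iota_add[of "\<zero>\<^bsub>S i\<^esub>" i "\<zero>\<^bsub>S i\<^esub>"] iota_closed[of "\<zero>\<^bsub>S i\<^esub>" i]
 by (metis R.add.r_cancel_one S.add.l_one S.zero_closed)

lemmas closed = pi_closed iota_closed beta_closed eta_closed eps_closed gam_closed

subsection \<open>Restriction along the corner embeddings\<close>

definition res :: "'i \<Rightarrow> ('c, 'm) module \<Rightarrow> ('d, 'm) module" where
 "res i N = \<lparr>carrier = {n \<in> carrier N. \<iota> i \<one>\<^bsub>S i\<^esub> \<odot>\<^sub>N n = n}, monoid.mult = undefined, one = undefined,
  ring.zero = \<zero>\<^sub>N, add = add N, smult = (\<lambda>a n. \<iota> i a \<odot>\<^sub>N n)\<rparr>"

lemma res_simps [simp]:
 "n \<in> carrier (res i N) \<longleftrightarrow> n \<in> carrier N \<and> \<iota> i \<one>\<^bsub>S i\<^esub> \<odot>\<^sub>N n = n"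
 "\<zero>\<^bsub>res i N\<^esub> = \<zero>\<^sub>N" "x \<oplus>\<^bsub>res i N\<^esub> y = x \<oplus>\<^sub>N y" "a \<odot>\<^bsub>res i N\<^esub> n = \<iota> i a \<odot>\<^sub>N n"
 by (simp_all add: res_def)

lemma iota_act:
 assumes "right_module R N" "n \<in> carrier N" "a \<in> carrier (S i)" "b \<in> carrier (S i)"
 shows "\<iota> i b \<odot>\<^sub>N (\<iota> i a \<odot>\<^sub>N n) = \<iota> i (a \<otimes>\<^bsub>S i\<^esub> b) \<odot>\<^sub>N n"
 using assms by (simp add: right_module.act_mult[symmetric] iota_closed iota_mult)

lemma iota_act_res: "right_module R N \<Longrightarrow> n \<in> carrier N \<Longrightarrow> a \<in> carrier (S i) \<Longrightarrow> \<iota> i a \<odot>\<^sub>N n \<in> carrier (res i N)"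
 by (simp add: iota_act right_module.act_closed iota_closed)

lemma iota_act_orth:
 assumes "right_module R N" "n \<in> carrier (res i N)" "i \<noteq> j" "a \<in> carrier (S j)"
 shows "\<iota> j a \<odot>\<^sub>N n = \<zero>\<^sub>N"
proof -
 interpret N: right_module R N by fact
 have n: "n \<in> carrier N" "\<iota> i \<one>\<^bsub>S i\<^esub> \<odot>\<^sub>N n = n" using assms(2) by auto
 have "\<iota> j a \<odot>\<^sub>N (\<iota> i \<one>\<^bsub>S i\<^esub> \<odot>\<^sub>N n) = (\<iota> i \<one>\<^bsub>S i\<^esub> \<otimes>\<^sub>R \<iota> j a) \<odot>\<^sub>N n"
  using n(1) assms(4) by (intro N.act_mult[symmetric]) (auto simp: iota_closed)
 then show ?thesis using n assms iota_orth[of i j] by (simp add: N.zero_act)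
qed

lemma res_module: "right_module R N \<Longrightarrow> right_module (S i) (res i N)"
proof -
 assume N: "right_module R N"
 then interpret N: right_module R N .
 note [simp] = iota_closed iota_add iota_act[OF N] N.act_rules
 show ?thesis
 proof (intro right_module.intro S_ring abelian_groupI right_module_axioms.intro)
  show "\<exists>y\<in>carrier (res i N). y \<oplus>\<^bsub>res i N\<^esub> x = \<zero>\<^bsub>res i N\<^esub>" if "x \<in> carrier (res i N)" for x
   using that by (intro bexI[of _ "\<ominus>\<^sub>N x"]) (auto simp: N.l_neg)
 qed (auto simp: N.a_ac)
qed

lemma res_hom: "f \<in> mod_hom R M N \<Longrightarrow> f \<in> mod_hom (S i) (res i M) (res i N)"
 by (rule mod_homI) (auto simp: mh_closed mh_add mh_act iota_closed mh_fixed)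

lemma res_submod:
 assumes "right_module R N" "submod R L N" shows "submod (S i) (L \<inter> carrier (res i N)) (res i N)"
proof -
 interpret N: right_module R N by fact
 interpret rN: right_module "S i" "res i N" by (rule res_module) fact
 have z: "x \<oplus>\<^sub>N y \<in> carrier (res i N)" if "x \<in> carrier (res i N)" "y \<in> carrier (res i N)" for x y
  using rN.a_closed[OF that] by simp
 show ?thesis
  using N.submod_subset[OF assms(2)] rN.zero_closed z iota_act_res[OF assms(1), of _ _ i]
  by (intro rN.submodI) (auto simp: N.submod_zero[OF assms(2)] N.submod_add[OF assms(2)] N.submod_act[OF assms(2)] iota_closed)
qed

lemma act_decomposition:
 assumes "right_module R N" "n \<in> carrier N" "r \<in> carrier R"
 shows "r \<odot>\<^sub>N n = finsum N (\<lambda>i. \<iota> i (\<pi> i r) \<odot>\<^sub>N n) UNIV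
  \<oplus>\<^sub>N finsum N (\<lambda>k. \<beta> k \<odot>\<^sub>N (\<iota> (\<sigma> k) (\<gamma> k r) \<odot>\<^sub>N n)) \<Gamma>"
proof -
 interpret N: right_module R N by fact
 let ?a = "finsum R (\<lambda>i. \<iota> i (\<pi> i r)) UNIV" and ?b = "finsum R (\<lambda>k. \<iota> (\<sigma> k) (\<gamma> k r) \<otimes>\<^sub>R \<beta> k) \<Gamma>"
 have ab: "?a \<in> carrier R" "?b \<in> carrier R" using assms(3) by (auto intro!: R.finsum_closed simp: closed)
 have "r \<odot>\<^sub>N n = ?a \<odot>\<^sub>N n \<oplus>\<^sub>N ?b \<odot>\<^sub>N n"
  using decomposition[OF assms(3)] N.act_add_ring[OF ab assms(2)] by simp
 moreover have "?a \<odot>\<^sub>N n = finsum N (\<lambda>i. \<iota> i (\<pi> i r) \<odot>\<^sub>N n) UNIV"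
  using assms by (intro N.finsum_act) (auto simp: closed)
 moreover have "?b \<odot>\<^sub>N n = finsum N (\<lambda>k. (\<iota> (\<sigma> k) (\<gamma> k r) \<otimes>\<^sub>R \<beta> k) \<odot>\<^sub>N n) \<Gamma>"
  using assms by (intro N.finsum_act fin_\<Gamma>) (auto simp: closed)
 moreover have "\<dots> = finsum N (\<lambda>k. \<beta> k \<odot>\<^sub>N (\<iota> (\<sigma> k) (\<gamma> k r) \<odot>\<^sub>N n)) \<Gamma>"
  using assms by (intro N.finsum_cong') (auto simp: closed N.act_mult N.act_closed)
 ultimately show ?thesis by simp
qed

subsection \<open>The gluing functor\<close>

text \<open>The induced module along the corner embeddings in coordinates: a family \<open>x\<close> of tops and, for each
 connecting element, a value \<open>y k\<close> that stands for \<open>\<beta> k\<close> applied to an element of \<open>U (\<sigma> k)\<close>.\<close>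

definition glue :: "('i \<Rightarrow> ('d, 'm) module) \<Rightarrow> ('c, ('i \<Rightarrow> 'm) \<times> ('g \<Rightarrow> 'm)) module" where
 "glue U = \<lparr>carrier = {(x, y). (\<forall>i. x i \<in> carrier (U i)) \<and>
   (\<forall>k. y k \<in> carrier (U (\<sigma> k)) \<and> \<eta> k \<odot>\<^bsub>U (\<sigma> k)\<^esub> y k = y k)},
  monoid.mult = undefined, one = undefined,
  ring.zero = (\<lambda>i. \<zero>\<^bsub>U i\<^esub>, \<lambda>k. \<zero>\<^bsub>U (\<sigma> k)\<^esub>),
  add = (\<lambda>(x, y) (x', y'). (\<lambda>i. x i \<oplus>\<^bsub>U i\<^esub> x' i, \<lambda>k. y k \<oplus>\<^bsub>U (\<sigma> k)\<^esub> y' k)),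
  smult = (\<lambda>r (x, y). (\<lambda>i. \<pi> i r \<odot>\<^bsub>U i\<^esub> x i,
   \<lambda>k. \<epsilon> k r \<odot>\<^bsub>U (\<sigma> k)\<^esub> y k \<oplus>\<^bsub>U (\<sigma> k)\<^esub> \<gamma> k r \<odot>\<^bsub>U (\<sigma> k)\<^esub> x (\<sigma> k)))\<rparr>"

lemma glue_simps [simp]:
 "(x, y) \<in> carrier (glue U) \<longleftrightarrow> (\<forall>i. x i \<in> carrier (U i)) \<and>
   (\<forall>k. y k \<in> carrier (U (\<sigma> k)) \<and> \<eta> k \<odot>\<^bsub>U (\<sigma> k)\<^esub> y k = y k)"
 "\<zero>\<^bsub>glue U\<^esub> = (\<lambda>i. \<zero>\<^bsub>U i\<^esub>, \<lambda>k. \<zero>\<^bsub>U (\<sigma> k)\<^esub>)"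
 "(x, y) \<oplus>\<^bsub>glue U\<^esub> (x', y') = (\<lambda>i. x i \<oplus>\<^bsub>U i\<^esub> x' i, \<lambda>k. y k \<oplus>\<^bsub>U (\<sigma> k)\<^esub> y' k)"
 "r \<odot>\<^bsub>glue U\<^esub> (x, y) = (\<lambda>i. \<pi> i r \<odot>\<^bsub>U i\<^esub> x i,
   \<lambda>k. \<epsilon> k r \<odot>\<^bsub>U (\<sigma> k)\<^esub> y k \<oplus>\<^bsub>U (\<sigma> k)\<^esub> \<gamma> k r \<odot>\<^bsub>U (\<sigma> k)\<^esub> x (\<sigma> k))"
 by (simp_all add: glue_def)

lemma glue_cases:
 assumes "z \<in> carrier (glue U)"
 obtains x y where "z = (x, y)" "\<And>i. x i \<in> carrier (U i)" "\<And>k. y k \<in> carrier (U (\<sigma> k))"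
  "\<And>k. \<eta> k \<odot>\<^bsub>U (\<sigma> k)\<^esub> y k = y k"
 using assms by (cases z) auto

lemma glue_module:
 assumes U: "\<And>i. right_module (S i) (U i)" shows "right_module R (glue U)"
proof -
 let ?G = "glue U"
 note [simp] = right_module.act_rules[OF U] right_module.add_rules[OF U] closed
 have eta_eps: "\<eta> k \<odot>\<^bsub>U (\<sigma> k)\<^esub> (\<epsilon> k r \<odot>\<^bsub>U (\<sigma> k)\<^esub> v) = \<epsilon> k r \<odot>\<^bsub>U (\<sigma> k)\<^esub> (\<eta> k \<odot>\<^bsub>U (\<sigma> k)\<^esub> v)"
  if "r \<in> carrier R" "v \<in> carrier (U (\<sigma> k))" for k r v
  using that right_module.act_mult[OF U, of "\<epsilon> k r" "\<sigma> k" "\<eta> k" v] right_module.act_mult[OF U, of "\<eta> k" "\<sigma> k" "\<epsilon> k r" v]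
  by (simp add: eps_eta)
 have eta_gam: "\<eta> k \<odot>\<^bsub>U (\<sigma> k)\<^esub> (\<gamma> k r \<odot>\<^bsub>U (\<sigma> k)\<^esub> v) = \<gamma> k r \<odot>\<^bsub>U (\<sigma> k)\<^esub> v"
  if "r \<in> carrier R" "v \<in> carrier (U (\<sigma> k))" for k r v
  using that right_module.act_mult[OF U, of "\<gamma> k r" "\<sigma> k" "\<eta> k" v] by (simp add: gam_eta)
 have eps1: "\<epsilon> k \<one>\<^sub>R \<odot>\<^bsub>U (\<sigma> k)\<^esub> v = v" if "\<eta> k \<odot>\<^bsub>U (\<sigma> k)\<^esub> v = v" "v \<in> carrier (U (\<sigma> k))" for k v
  using that right_module.act_mult[OF U, of "\<eta> k" "\<sigma> k" "\<epsilon> k \<one>\<^sub>R" v] by (simp add: eps_one)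
 show ?thesis
 proof (intro right_module.intro R_ring abelian_groupI right_module_axioms.intro)
  show "\<exists>y\<in>carrier ?G. y \<oplus>\<^sub>?G x = \<zero>\<^sub>?G" if x: "x \<in> carrier ?G" for x
  proof -
   obtain u v where h: "x = (u, v)" "\<And>i. u i \<in> carrier (U i)" "\<And>k. v k \<in> carrier (U (\<sigma> k))"
    "\<And>k. \<eta> k \<odot>\<^bsub>U (\<sigma> k)\<^esub> v k = v k" using x by (elim glue_cases) blast
   show ?thesis using h
    by (intro bexI[of _ "(\<lambda>i. \<ominus>\<^bsub>U i\<^esub> u i, \<lambda>k. \<ominus>\<^bsub>U (\<sigma> k)\<^esub> v k)"]) simp_all
  qed
 next
  fix r s z assume "r \<in> carrier R" "s \<in> carrier R" "z \<in> carrier ?G"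
  then show "(r \<oplus>\<^sub>R s) \<odot>\<^sub>?G z = r \<odot>\<^sub>?G z \<oplus>\<^sub>?G s \<odot>\<^sub>?G z"
   by (elim glue_cases) (simp add: pi_add eps_add gam_add)
 next
  fix r s z assume "r \<in> carrier R" "s \<in> carrier R" "z \<in> carrier ?G"
  then show "(r \<otimes>\<^sub>R s) \<odot>\<^sub>?G z = s \<odot>\<^sub>?G (r \<odot>\<^sub>?G z)"
   by (elim glue_cases) (simp add: pi_mult eps_mult gam_mult)
 next
  fix r y z assume "r \<in> carrier R" "y \<in> carrier ?G" "z \<in> carrier ?G"
  then show "r \<odot>\<^sub>?G (y \<oplus>\<^sub>?G z) = r \<odot>\<^sub>?G y \<oplus>\<^sub>?G r \<odot>\<^sub>?G z"
   by (elim glue_cases) simp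
 next
  fix r z assume "r \<in> carrier R" "z \<in> carrier ?G"
  then show "r \<odot>\<^sub>?G z \<in> carrier ?G"
   by (elim glue_cases) (simp add: eta_eps eta_gam)
 next
  fix z assume "z \<in> carrier ?G"
  then show "\<one>\<^sub>R \<odot>\<^sub>?G z = z"
   by (elim glue_cases) (simp add: pi_one gam_one eps1)
 qed ((elim glue_cases)?, simp)+
qed

definition emb :: "('i \<Rightarrow> ('d, 'm) module) \<Rightarrow> 'i \<Rightarrow> 'm \<Rightarrow> ('i \<Rightarrow> 'm) \<times> ('g \<Rightarrow> 'm)" where
 "emb U i x = (\<lambda>j. if j = i then x else \<zero>\<^bsub>U j\<^esub>, \<lambda>k. \<zero>\<^bsub>U (\<sigma> k)\<^esub>)"

lemma fst_emb [simp]: "fst (emb U i x) j = (if j = i then x else \<zero>\<^bsub>U j\<^esub>)"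
 by (simp add: emb_def)

lemma emb_hom:
 assumes U: "\<And>i. right_module (S i) (U i)"
 shows "emb U i \<in> mod_hom (S i) (U i) (res i (glue U))"
proof -
 note [simp] = right_module.act_rules[OF U] right_module.add_rules[OF U] closed pi_iota gam_iota
 have act: "\<iota> i a \<odot>\<^bsub>glue U\<^esub> emb U i x = emb U i (a \<odot>\<^bsub>U i\<^esub> x)" if "a \<in> carrier (S i)" "x \<in> carrier (U i)" for a x
  using that by (auto simp: emb_def fun_eq_iff)
 have c: "emb U i x \<in> carrier (glue U)" if "x \<in> carrier (U i)" for x using that by (simp add: emb_def)
 show ?thesis
 proof (rule mod_homI)
  show "emb U i (x \<oplus>\<^bsub>U i\<^esub> y) = emb U i x \<oplus>\<^bsub>res i (glue U)\<^esub> emb U i y" if "x \<in> carrier (U i)" "y \<in> carrier (U i)" for x y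
   using that by (auto simp: emb_def fun_eq_iff)
 qed (simp_all add: act c)
qed

lemma emb_closed:
 assumes "\<And>i. right_module (S i) (U i)" "x \<in> carrier (U i)"
 shows "emb U i x \<in> carrier (glue U)" "emb U i x \<in> carrier (res i (glue U))"
 using mh_closed[OF emb_hom[of U i, OF assms(1)] assms(2)] by auto

text \<open>A connecting element sees only the component at its source.\<close>

lemma beta_act_glue:
 assumes U: "\<And>i. right_module (S i) (U i)" and "z \<in> carrier (glue U)"
 shows "\<beta> k \<odot>\<^bsub>glue U\<^esub> z = (\<lambda>i. \<zero>\<^bsub>U i\<^esub>, \<lambda>l. if l = k then \<eta> k \<odot>\<^bsub>U (\<sigma> k)\<^esub> fst z (\<sigma> k) else \<zero>\<^bsub>U (\<sigma> l)\<^esub>)"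
proof -
 note [simp] = right_module.act_rules[OF U] right_module.add_rules[OF U] closed
 show ?thesis using assms(2) by (elim glue_cases) (auto simp: pi_beta eps_beta gam_beta fun_eq_iff)
qed

lemma y_off:
 assumes "\<And>i. right_module (S i) (U i)" "(x, y) \<in> carrier (glue U)" "k \<notin> \<Gamma>"
 shows "y k = \<zero>\<^bsub>U (\<sigma> k)\<^esub>"
proof -
 have "y k = \<eta> k \<odot>\<^bsub>U (\<sigma> k)\<^esub> y k" "y k \<in> carrier (U (\<sigma> k))" using assms(2) by auto
 then show ?thesis using eta_off[OF assms(3)] right_module.zero_act[OF assms(1)] by metis
qed

definition extend :: "('c, 'n) module \<Rightarrow> ('i \<Rightarrow> 'm \<Rightarrow> 'n) \<Rightarrow> ('i \<Rightarrow> 'm) \<times> ('g \<Rightarrow> 'm) \<Rightarrow> 'n" where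
 "extend N h z = finsum N (\<lambda>i. h i (fst z i)) UNIV \<oplus>\<^sub>N finsum N (\<lambda>k. \<beta> k \<odot>\<^sub>N h (\<sigma> k) (snd z k)) \<Gamma>"

lemma iota_act_sum:
 assumes N: "right_module R N" and n: "\<And>i. n i \<in> carrier (res i N)" and "a \<in> carrier (S j)"
 shows "\<iota> j a \<odot>\<^sub>N finsum N n UNIV = \<iota> j a \<odot>\<^sub>N n j"
proof -
 interpret N: right_module R N by fact
 have "\<iota> j a \<odot>\<^sub>N finsum N n UNIV = finsum N (\<lambda>i. \<iota> j a \<odot>\<^sub>N n i) UNIV"
  using n assms(3) by (intro N.act_finsum) (auto simp: closed)
 also have "\<dots> = finsum N (\<lambda>i. if j = i then \<iota> j a \<odot>\<^sub>N n i else \<zero>\<^sub>N) UNIV"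
 proof (intro N.finsum_cong')
  show "\<iota> j a \<odot>\<^sub>N n i = (if j = i then \<iota> j a \<odot>\<^sub>N n i else \<zero>\<^sub>N)" for i
   using iota_act_orth[OF N n[of i] _ assms(3)] by auto
 qed (use n assms(3) in \<open>auto simp: closed N.act_closed\<close>)
 also have "\<dots> = \<iota> j a \<odot>\<^sub>N n j"
  using n assms(3) by (intro N.finsum_singleton) (auto simp: closed N.act_closed)
 finally show ?thesis .
qed

text \<open>Gluing is left adjoint to restriction to the corners: a family of homomorphisms from the components
 extends, with the values below the tops dictated by the action of the \<open>\<beta> k\<close>.\<close>

lemma extend_hom:
 assumes N: "right_module R N" and U: "\<And>i. right_module (S i) (U i)"
  and h: "\<And>i. h i \<in> mod_hom (S i) (U i) (res i N)"
 shows "extend N h \<in> mod_hom R (glue U) N"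
proof -
 let ?G = "glue U"
 interpret N: right_module R N by fact
 have hc: "h i x \<in> carrier N" "h i x \<in> carrier (res i N)" if "x \<in> carrier (U i)" for i x
  using mh_closed[OF h that] by auto
 have ha: "h i (a \<odot>\<^bsub>U i\<^esub> x) = \<iota> i a \<odot>\<^sub>N h i x" if "a \<in> carrier (S i)" "x \<in> carrier (U i)" for i a x
  using mh_act[OF h that] by simp
 have hp: "h i (x \<oplus>\<^bsub>U i\<^esub> y) = h i x \<oplus>\<^sub>N h i y" if "x \<in> carrier (U i)" "y \<in> carrier (U i)" for i x y
  using mh_add[OF h that] by simp
 note Ucl = right_module.act_closed[OF U]
 have sc: "finsum N (\<lambda>i. h i (x i)) UNIV \<in> carrier N" if "\<And>i. x i \<in> carrier (U i)" for x
  using that hc by (intro N.finsum_closed) auto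
 have bc: "finsum N (\<lambda>k. \<beta> k \<odot>\<^sub>N h (\<sigma> k) (y k)) \<Gamma> \<in> carrier N" if "\<And>k. y k \<in> carrier (U (\<sigma> k))" for y
  using that hc by (intro N.finsum_closed) (auto simp: N.act_closed closed)
 show ?thesis
 proof (rule mod_homI)
  fix z assume "z \<in> carrier ?G"
  then show "extend N h z \<in> carrier N" by (elim glue_cases) (simp add: extend_def sc bc)
 next
  fix z z' assume "z \<in> carrier ?G" "z' \<in> carrier ?G"
  then obtain x y x' y' where z: "z = (x, y)" "z' = (x', y')" "\<And>i. x i \<in> carrier (U i)" "\<And>k. y k \<in> carrier (U (\<sigma> k))"
   "\<And>i. x' i \<in> carrier (U i)" "\<And>k. y' k \<in> carrier (U (\<sigma> k))" by (elim glue_cases) blast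
  have "finsum N (\<lambda>i. h i (x i \<oplus>\<^bsub>U i\<^esub> x' i)) UNIV = finsum N (\<lambda>i. h i (x i)) UNIV \<oplus>\<^sub>N finsum N (\<lambda>i. h i (x' i)) UNIV"
   using z hc by (subst N.finsum_addf[symmetric]) (auto simp: hp intro!: N.finsum_cong')
  moreover have "finsum N (\<lambda>k. \<beta> k \<odot>\<^sub>N h (\<sigma> k) (y k \<oplus>\<^bsub>U (\<sigma> k)\<^esub> y' k)) \<Gamma>
    = finsum N (\<lambda>k. \<beta> k \<odot>\<^sub>N h (\<sigma> k) (y k)) \<Gamma> \<oplus>\<^sub>N finsum N (\<lambda>k. \<beta> k \<odot>\<^sub>N h (\<sigma> k) (y' k)) \<Gamma>"
   using z hc by (subst N.finsum_addf[symmetric])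
    (auto simp: hp closed N.act_closed N.act_add_module intro!: N.finsum_cong')
  ultimately show "extend N h (z \<oplus>\<^sub>?G z') = extend N h z \<oplus>\<^sub>N extend N h z'"
   using z sc[of x] sc[of x'] bc[of y] bc[of y'] by (simp add: extend_def N.a_ac)
 next
  fix r z assume r: "r \<in> carrier R" and "z \<in> carrier ?G"
  then obtain x y where z: "z = (x, y)" "\<And>i. x i \<in> carrier (U i)" "\<And>k. y k \<in> carrier (U (\<sigma> k))"
   by (elim glue_cases) blast
  let ?n = "finsum N (\<lambda>i. h i (x i)) UNIV"
  have i1: "\<iota> j a \<odot>\<^sub>N ?n = h j (a \<odot>\<^bsub>U j\<^esub> x j)" if "a \<in> carrier (S j)" for j a
   using iota_act_sum[OF N, of "\<lambda>i. h i (x i)" a j] hc(2) z that ha by simp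
  have "r \<odot>\<^sub>N ?n = finsum N (\<lambda>i. h i (\<pi> i r \<odot>\<^bsub>U i\<^esub> x i)) UNIV
    \<oplus>\<^sub>N finsum N (\<lambda>k. \<beta> k \<odot>\<^sub>N h (\<sigma> k) (\<gamma> k r \<odot>\<^bsub>U (\<sigma> k)\<^esub> x (\<sigma> k))) \<Gamma>"
   using act_decomposition[OF N sc[OF z(2)] r] by (simp add: i1 closed r)
  moreover have "r \<odot>\<^sub>N finsum N (\<lambda>k. \<beta> k \<odot>\<^sub>N h (\<sigma> k) (y k)) \<Gamma>
    = finsum N (\<lambda>k. \<beta> k \<odot>\<^sub>N h (\<sigma> k) (\<epsilon> k r \<odot>\<^bsub>U (\<sigma> k)\<^esub> y k)) \<Gamma>"
  proof -
   have "r \<odot>\<^sub>N (\<beta> k \<odot>\<^sub>N h (\<sigma> k) (y k)) = \<beta> k \<odot>\<^sub>N h (\<sigma> k) (\<epsilon> k r \<odot>\<^bsub>U (\<sigma> k)\<^esub> y k)" for k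
    using r z hc(1)[OF z(3)] by (simp add: N.act_mult[symmetric] closed beta_mult ha)
   then show ?thesis using r z hc
    by (subst N.act_finsum[OF fin_\<Gamma>]) (auto simp: closed N.act_closed)
  qed
  moreover have "finsum N (\<lambda>k. \<beta> k \<odot>\<^sub>N h (\<sigma> k) (\<epsilon> k r \<odot>\<^bsub>U (\<sigma> k)\<^esub> y k \<oplus>\<^bsub>U (\<sigma> k)\<^esub> \<gamma> k r \<odot>\<^bsub>U (\<sigma> k)\<^esub> x (\<sigma> k))) \<Gamma>
    = finsum N (\<lambda>k. \<beta> k \<odot>\<^sub>N h (\<sigma> k) (\<epsilon> k r \<odot>\<^bsub>U (\<sigma> k)\<^esub> y k)) \<Gamma>
    \<oplus>\<^sub>N finsum N (\<lambda>k. \<beta> k \<odot>\<^sub>N h (\<sigma> k) (\<gamma> k r \<odot>\<^bsub>U (\<sigma> k)\<^esub> x (\<sigma> k))) \<Gamma>"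
   using z hc r by (subst N.finsum_addf[symmetric])
    (auto simp: hp closed N.act_closed N.act_add_module Ucl intro!: N.finsum_cong')
  moreover have "r \<odot>\<^sub>N extend N h z = r \<odot>\<^sub>N ?n \<oplus>\<^sub>N r \<odot>\<^sub>N finsum N (\<lambda>k. \<beta> k \<odot>\<^sub>N h (\<sigma> k) (y k)) \<Gamma>"
   using r sc[of x] bc[of y] z by (simp add: extend_def N.act_add_module)
  ultimately show "extend N h (r \<odot>\<^sub>?G z) = r \<odot>\<^sub>N extend N h z"
   using z r sc[of "\<lambda>i. \<pi> i r \<odot>\<^bsub>U i\<^esub> x i"] bc[of "\<lambda>k. \<epsilon> k r \<odot>\<^bsub>U (\<sigma> k)\<^esub> y k"] bc[of "\<lambda>k. \<gamma> k r \<odot>\<^bsub>U (\<sigma> k)\<^esub> x (\<sigma> k)"]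
   by (simp add: extend_def N.a_ac Ucl closed)
 qed
qed

lemma extend_natural:
 assumes N: "right_module R N" "right_module R N'" and g: "g \<in> mod_hom R N N'"
  and h: "\<And>i x. x \<in> carrier (U i) \<Longrightarrow> h i x \<in> carrier N" and z: "z \<in> carrier (glue U)"
 shows "g (extend N h z) = extend N' (\<lambda>i x. g (h i x)) z"
proof -
 interpret N: right_module R N by fact
 interpret N': right_module R N' by fact
 obtain x y where xy: "z = (x, y)" "\<And>i. x i \<in> carrier (U i)" "\<And>k. y k \<in> carrier (U (\<sigma> k))"
  using z by (elim glue_cases) blast
 have "g (finsum N (\<lambda>i. h i (x i)) UNIV) = finsum N' (\<lambda>i. g (h i (x i))) UNIV"
  using xy h by (intro mh_finsum[OF N g]) auto
 moreover have "g (finsum N (\<lambda>k. \<beta> k \<odot>\<^sub>N h (\<sigma> k) (y k)) \<Gamma>) = finsum N' (\<lambda>k. g (\<beta> k \<odot>\<^sub>N h (\<sigma> k) (y k))) \<Gamma>"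
  using xy h by (intro mh_finsum[OF N g fin_\<Gamma>]) (auto simp: closed N.act_closed)
 moreover have "finsum N (\<lambda>i. h i (x i)) UNIV \<in> carrier N" "finsum N (\<lambda>k. \<beta> k \<odot>\<^sub>N h (\<sigma> k) (y k)) \<Gamma> \<in> carrier N"
  using xy h by (auto intro!: N.finsum_closed simp: closed N.act_closed)
 ultimately show ?thesis
  using xy h by (simp add: extend_def mh_add[OF g] mh_act[OF g] closed)
qed

lemma glue_fst_finsum:
 assumes U: "\<And>i. right_module (S i) (U i)" and "finite I" "f \<in> I \<rightarrow> carrier (glue U)"
 shows "fst (finsum (glue U) f I) i = finsum (U i) (\<lambda>j. fst (f j) i) I"
  "snd (finsum (glue U) f I) k = finsum (U (\<sigma> k)) (\<lambda>j. snd (f j) k) I"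
proof -
 interpret G: right_module R "glue U" by (rule glue_module[OF U])
 have m: "abelian_monoid (U i)" for i using U[of i] by (simp add: right_module_def abelian_group_def)
 show "fst (finsum (glue U) f I) i = finsum (U i) (\<lambda>j. fst (f j) i) I"
  by (rule additive_finsum[OF G.M.abelian_monoid_axioms m _ _ _ assms(2,3), where f = "\<lambda>z. fst z i"])
    (auto elim!: glue_cases)
 show "snd (finsum (glue U) f I) k = finsum (U (\<sigma> k)) (\<lambda>j. snd (f j) k) I"
  by (rule additive_finsum[OF G.M.abelian_monoid_axioms m _ _ _ assms(2,3), where f = "\<lambda>z. snd z k"])
    (auto elim!: glue_cases)
qed

lemma glue_extend_emb:
 assumes U: "\<And>i. right_module (S i) (U i)" and z: "z \<in> carrier (glue U)"
 shows "extend (glue U) (emb U) z = z"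
proof -
 interpret G: right_module R "glue U" by (rule glue_module[OF U])
 obtain x y where xy: "z = (x, y)" "\<And>i. x i \<in> carrier (U i)" "\<And>k. y k \<in> carrier (U (\<sigma> k))"
  "\<And>k. \<eta> k \<odot>\<^bsub>U (\<sigma> k)\<^esub> y k = y k"
  using z by (elim glue_cases) blast
 note emb_c = emb_closed(1)[OF U]
 note [simp] = right_module.act_rules[OF U] right_module.add_rules[OF U] closed
 have m: "abelian_monoid (U i)" for i using U[of i] by (simp add: right_module_def abelian_group_def)
 note fs = abelian_monoid.finsum_singleton[OF m] and fz = abelian_monoid.finsum_zero[OF m]
 let ?a = "finsum (glue U) (\<lambda>i. emb U i (x i)) UNIV"
 let ?b = "finsum (glue U) (\<lambda>k. \<beta> k \<odot>\<^bsub>glue U\<^esub> emb U (\<sigma> k) (y k)) \<Gamma>"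
 have bi: "\<beta> k \<odot>\<^bsub>glue U\<^esub> emb U (\<sigma> k) (y k) = (\<lambda>i. \<zero>\<^bsub>U i\<^esub>, \<lambda>l. if l = k then y k else \<zero>\<^bsub>U (\<sigma> l)\<^esub>)" for k
  using beta_act_glue[OF U emb_c, of "y k" "\<sigma> k" k] xy by (auto simp: fun_eq_iff)
 have a: "?a = (x, \<lambda>k. \<zero>\<^bsub>U (\<sigma> k)\<^esub>)"
 proof (intro prod_eqI ext)
  show "fst ?a i = fst (x, \<lambda>k. \<zero>\<^bsub>U (\<sigma> k)\<^esub>) i" for i
  proof -
   have "fst ?a i = finsum (U i) (\<lambda>j. if i = j then x j else \<zero>\<^bsub>U i\<^esub>) UNIV"
    using xy emb_c by (subst glue_fst_finsum[OF U]) auto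
   also have "\<dots> = x i" using xy
    by (subst abelian_monoid.finsum_cong'[OF m refl, where g = "\<lambda>j. if i = j then x i else \<zero>\<^bsub>U i\<^esub>"])
      (auto simp: fs)
   finally show ?thesis by simp
  qed
  show "snd ?a k = snd (x, \<lambda>k. \<zero>\<^bsub>U (\<sigma> k)\<^esub>) k" for k
   using xy emb_c by (subst glue_fst_finsum[OF U]) (auto simp: emb_def fz)
 qed
 have c: "\<beta> k \<odot>\<^bsub>glue U\<^esub> emb U (\<sigma> k) (y k) \<in> carrier (glue U)" for k
  using xy emb_c by (intro G.act_closed) auto
 have b: "?b = (\<lambda>i. \<zero>\<^bsub>U i\<^esub>, y)"
 proof (intro prod_eqI ext)
  show "fst ?b i = fst (\<lambda>i. \<zero>\<^bsub>U i\<^esub>, y) i" for i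
   using c by (subst glue_fst_finsum[OF U fin_\<Gamma>]) (auto simp: bi fz)
  show "snd ?b k = snd (\<lambda>i. \<zero>\<^bsub>U i\<^esub>, y) k" for k
  proof (cases "k \<in> \<Gamma>")
   case True
   have "snd ?b k = finsum (U (\<sigma> k)) (\<lambda>l. if k = l then y l else \<zero>\<^bsub>U (\<sigma> k)\<^esub>) \<Gamma>"
    using c xy by (subst glue_fst_finsum[OF U fin_\<Gamma>]) (auto simp: bi intro!: abelian_monoid.finsum_cong'[OF m])
   also have "\<dots> = y k" using True xy fin_\<Gamma>
    by (subst abelian_monoid.finsum_cong'[OF m refl, where g = "\<lambda>l. if k = l then y k else \<zero>\<^bsub>U (\<sigma> k)\<^esub>"])
      (auto simp: fs)
   finally show ?thesis by simp
  next
   case False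
   have "snd ?b k = finsum (U (\<sigma> k)) (\<lambda>l. \<zero>\<^bsub>U (\<sigma> k)\<^esub>) \<Gamma>"
    using c xy False by (subst glue_fst_finsum[OF U fin_\<Gamma>]) (auto simp: bi intro!: abelian_monoid.finsum_cong'[OF m])
   then show ?thesis using y_off[OF U, of x y k] z False xy(1) by (simp add: fz)
  qed
 qed
 show ?thesis using xy by (simp add: extend_def a b)
qed

lemma glue_generated:
 assumes U: "\<And>i. right_module (S i) (U i)" and L: "submod R L (glue U)"
  and emb: "\<And>i x. x \<in> carrier (U i) \<Longrightarrow> emb U i x \<in> L"
 shows "L = carrier (glue U)"
proof
 interpret G: right_module R "glue U" by (rule glue_module[OF U])
 show "L \<subseteq> carrier (glue U)" by (rule G.submod_subset[OF L])
 show "carrier (glue U) \<subseteq> L"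
 proof
  fix z assume z: "z \<in> carrier (glue U)"
  then obtain x y where xy: "z = (x, y)" "\<And>i. x i \<in> carrier (U i)" "\<And>k. y k \<in> carrier (U (\<sigma> k))"
   by (elim glue_cases) blast
  have "extend (glue U) (emb U) z \<in> L" unfolding extend_def using xy emb
   by (intro G.submod_add[OF L] G.submod_finsum[OF L] G.submod_act[OF L] fin_\<Gamma>) (auto simp: closed)
  then show "z \<in> L" using glue_extend_emb[OF U z] by simp
 qed
qed

lemma hom_eq_extend:
 assumes U: "\<And>i. right_module (S i) (U i)" and N: "right_module R N" and F: "F \<in> mod_hom R (glue U) N"
  and z: "z \<in> carrier (glue U)"
 shows "F z = extend N (\<lambda>i x. F (emb U i x)) z"
 using extend_natural[of "glue U" N F U "emb U" z, OF glue_module[OF U] N F emb_closed(1)[OF U] z]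
  glue_extend_emb[OF U z] by simp

lemma glue_fg:
 assumes U: "\<And>i. fg_module (S i) (U i)" shows "fg_module R (glue U)"
proof -
 note Um = fg_mod_rm[OF U]
 note G = glue_module[OF Um]
 interpret G: right_module R "glue U" by (rule G)
 have "\<exists>A. finite A \<and> A \<subseteq> carrier (U i) \<and> (\<forall>N. submod (S i) N (U i) \<and> A \<subseteq> N \<longrightarrow> N = carrier (U i))" for i
  using U[of i] by (simp add: fg_module_def fin_gen_def)
 then obtain A where A: "\<And>i. finite (A i)" "\<And>i. A i \<subseteq> carrier (U i)"
  "\<And>i N. submod (S i) N (U i) \<Longrightarrow> A i \<subseteq> N \<Longrightarrow> N = carrier (U i)" by metis
 let ?A = "\<Union>i. emb U i ` A i"
 have "L = carrier (glue U)" if L: "submod R L (glue U)" "?A \<subseteq> L" for L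
 proof (rule glue_generated[OF Um L(1)])
  fix i x assume x: "x \<in> carrier (U i)"
  have "{x \<in> carrier (U i). emb U i x \<in> L \<inter> carrier (res i (glue U))} = carrier (U i)"
   using L(2) A(2) emb_closed(2)[OF Um]
   by (intro A(3) submod_vimage[OF Um res_module[OF G] emb_hom[OF Um] res_submod[OF G L(1)]]) blast
  then show "emb U i x \<in> L" using x by blast
 qed
 moreover have "finite ?A" using A(1) by simp
 moreover have "?A \<subseteq> carrier (glue U)" using A(2) emb_closed(1)[OF Um] by blast
 ultimately have "fin_gen R (glue U)" unfolding fin_gen_def by (intro exI[of _ ?A]) blast
 then show ?thesis using G by (simp add: fg_module_def)
qed

definition glue_map :: "('i \<Rightarrow> 'm \<Rightarrow> 'n) \<Rightarrow> ('i \<Rightarrow> 'm) \<times> ('g \<Rightarrow> 'm) \<Rightarrow> ('i \<Rightarrow> 'n) \<times> ('g \<Rightarrow> 'n)" where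
 "glue_map f = (\<lambda>(x, y). (\<lambda>i. f i (x i), \<lambda>k. f (\<sigma> k) (y k)))"

lemma glue_map_hom:
 assumes f: "\<And>i. f i \<in> mod_hom (S i) (U i) (V i)" and U: "\<And>i. right_module (S i) (U i)"
 shows "glue_map f \<in> mod_hom R (glue U) (glue V)"
 by (rule mod_homI)
   (auto elim!: glue_cases simp: glue_map_def mh_closed[OF f] mh_add[OF f]
    mh_act[OF f] mh_fixed[OF f] closed right_module.act_closed[OF U])

lemma glue_cong:
 assumes "\<And>i. mod_iso (S i) (U i) (V i)" "\<And>i. right_module (S i) (U i)"
 shows "mod_iso R (glue U) (glue V)"
proof -
 have "\<exists>f g. f \<in> mod_hom (S i) (U i) (V i) \<and> g \<in> mod_hom (S i) (V i) (U i) \<and>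
  (\<forall>x\<in>carrier (U i). g (f x) = x) \<and> (\<forall>y\<in>carrier (V i). f (g y) = y)" for i
  using mod_iso_obtain[OF assms] by metis
 then obtain f g where f: "\<And>i. f i \<in> mod_hom (S i) (U i) (V i)" and g: "\<And>i. g i \<in> mod_hom (S i) (V i) (U i)"
  and gf: "\<And>i x. x \<in> carrier (U i) \<Longrightarrow> g i (f i x) = x" and fg: "\<And>i y. y \<in> carrier (V i) \<Longrightarrow> f i (g i y) = y"
  by metis
 show ?thesis
 proof (rule mod_isoI_inverse[of "glue_map f" _ _ _ "glue_map g"])
  show "glue_map f \<in> mod_hom R (glue U) (glue V)" by (rule glue_map_hom[OF f assms(2)])
 qed (auto elim!: glue_cases simp: glue_map_def gf fg mh_closed[OF g] mh_fixed[OF g] closed)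
qed

lemma glue_dsum: "mod_iso R (glue (\<lambda>i. dsum (U i) (V i))) (dsum (glue U) (glue V))"
proof (rule mod_isoI_inverse[of "\<lambda>(x, y). ((\<lambda>i. fst (x i), \<lambda>k. fst (y k)), (\<lambda>i. snd (x i), \<lambda>k. snd (y k)))" _ _ _
   "\<lambda>((x, y), (x', y')). (\<lambda>i. (x i, x' i), \<lambda>k. (y k, y' k))"])
 have s: "a \<oplus>\<^bsub>dsum M N\<^esub> b = (fst a \<oplus>\<^sub>M fst b, snd a \<oplus>\<^sub>N snd b)" "r \<odot>\<^bsub>dsum M N\<^esub> a = (r \<odot>\<^sub>M fst a, r \<odot>\<^sub>N snd a)"
  for a b r and M :: "('d, 'x) module" and N :: "('d, 'y) module" by (cases a; cases b; simp)+
 show "(\<lambda>(x, y). ((\<lambda>i. fst (x i), \<lambda>k. fst (y k)), (\<lambda>i. snd (x i), \<lambda>k. snd (y k))))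
   \<in> mod_hom R (glue (\<lambda>i. dsum (U i) (V i))) (dsum (glue U) (glue V))"
  by (rule mod_homI) (auto elim!: glue_cases simp: s mem_Times_iff prod_eq_iff)
qed (auto elim!: glue_cases simp: mem_Times_iff)

lemma glue_zero:
 assumes "\<And>i. carrier (U i) = {\<zero>\<^bsub>U i\<^esub>}" "\<And>i. right_module (S i) (U i)"
 shows "carrier (glue U) = {\<zero>\<^bsub>glue U\<^esub>}"
proof -
 interpret G: right_module R "glue U" by (rule glue_module[OF assms(2)])
 have "z = \<zero>\<^bsub>glue U\<^esub>" if "z \<in> carrier (glue U)" for z
  using that assms(1) by (elim glue_cases) (auto simp: fun_eq_iff)
 then show ?thesis using G.zero_closed by blast
qed

text \<open>Exactness is checked componentwise; at a connecting element one takes the images under the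
 idempotent \<open>\<eta> k\<close>, which is exact.\<close>

lemma glue_ses:
 assumes "\<And>i. ses (S i) (L i) (M i) (N i)" and m: "\<And>i. right_module (S i) (L i)" "\<And>i. right_module (S i) (M i)"
  "\<And>i. right_module (S i) (N i)"
 shows "ses R (glue L) (glue M) (glue N)"
proof -
 have "\<exists>f g. short_exact (S i) (L i) (M i) (N i) f g" for i using assms(1) by (simp add: ses_def)
 then obtain f g where s: "\<And>i. short_exact (S i) (L i) (M i) (N i) (f i) (g i)" by metis
 then have f: "\<And>i. f i \<in> mod_hom (S i) (L i) (M i)" and g: "\<And>i. g i \<in> mod_hom (S i) (M i) (N i)"
  and emb: "\<And>i. inj_on (f i) (carrier (L i))" and ex: "\<And>i. f i ` carrier (L i) = a_kernel (M i) (N i) (g i)"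
  and surj: "\<And>i. g i ` carrier (M i) = carrier (N i)"
  by (auto simp: short_exact_def)
 have gf: "g i (f i x) = \<zero>\<^bsub>N i\<^esub>" if "x \<in> carrier (L i)" for i x
  using ex[of i] that by (auto simp: a_kernel_def')
 have exE: "\<exists>x\<in>carrier (L i). f i x = y" if "y \<in> carrier (M i)" "g i y = \<zero>\<^bsub>N i\<^esub>" for i y
  using ex[of i] that by (auto simp: a_kernel_def' set_eq_iff image_iff) metis
 have suE: "\<exists>x\<in>carrier (M i). g i x = y" if "y \<in> carrier (N i)" for i y
  using surj[of i] that by (metis imageE)
 note cl = mh_closed[OF f] mh_closed[OF g]
 note ac = mh_fixed[OF f] mh_fixed[OF g] eta_closed
 show ?thesis unfolding ses_def short_exact_def
 proof (intro exI conjI)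
  show "glue_map f \<in> mod_hom R (glue L) (glue M)" by (rule glue_map_hom[OF f m(1)])
  show "glue_map g \<in> mod_hom R (glue M) (glue N)" by (rule glue_map_hom[OF g m(2)])
  show "inj_on (glue_map f) (carrier (glue L))"
  proof (rule inj_onI)
   fix z z' assume "z \<in> carrier (glue L)" "z' \<in> carrier (glue L)" "glue_map f z = glue_map f z'"
   then show "z = z'"
    by (elim glue_cases) (auto simp: glue_map_def fun_eq_iff inj_on_eq_iff[OF emb])
  qed
  show "glue_map f ` carrier (glue L) = a_kernel (glue M) (glue N) (glue_map g)" (is "?A = ?B")
  proof
   show "?A \<subseteq> ?B"
    by (auto elim!: glue_cases simp: glue_map_def a_kernel_def' gf cl ac)
   show "?B \<subseteq> ?A"
   proof
    fix z assume "z \<in> ?B"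
    then obtain x y where z: "z = (x, y)" "\<And>i. x i \<in> carrier (M i)" "\<And>k. y k \<in> carrier (M (\<sigma> k))"
     "\<And>k. \<eta> k \<odot>\<^bsub>M (\<sigma> k)\<^esub> y k = y k" "\<And>i. g i (x i) = \<zero>\<^bsub>N i\<^esub>" "\<And>k. g (\<sigma> k) (y k) = \<zero>\<^bsub>N (\<sigma> k)\<^esub>"
    proof (cases z)
     case (Pair x y)
     then show ?thesis using \<open>z \<in> ?B\<close>
      by (intro that[of x y]) (auto simp: a_kernel_def' glue_map_def fun_eq_iff)
    qed
    have "\<exists>u. \<forall>i. u i \<in> carrier (L i) \<and> f i (u i) = x i"
     by (rule choice) (use exE[OF z(2,5)] in blast)
    moreover have "\<exists>v. \<forall>k. v k \<in> carrier (L (\<sigma> k)) \<and> f (\<sigma> k) (v k) = y k"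
     by (rule choice) (use exE[OF z(3,6)] in blast)
    ultimately obtain u v where uv: "\<And>i. u i \<in> carrier (L i)" "\<And>i. f i (u i) = x i"
     "\<And>k. v k \<in> carrier (L (\<sigma> k))" "\<And>k. f (\<sigma> k) (v k) = y k" by blast
    have "\<eta> k \<odot>\<^bsub>L (\<sigma> k)\<^esub> v k = v k" for k
    proof (rule inj_onD[OF emb])
     show "f (\<sigma> k) (\<eta> k \<odot>\<^bsub>L (\<sigma> k)\<^esub> v k) = f (\<sigma> k) (v k)"
      using uv z by (simp add: mh_act[OF f] eta_closed)
    qed (use uv right_module.act_closed[OF m(1)] eta_closed in auto)
    then have "(u, v) \<in> carrier (glue L)" "z = glue_map f (u, v)" using uv z by (auto simp: glue_map_def)
    then show "z \<in> ?A" by blast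
   qed
  qed
  show "glue_map g ` carrier (glue M) = carrier (glue N)" (is "?A = ?B")
  proof
   show "?A \<subseteq> ?B" by (auto elim!: glue_cases simp: glue_map_def cl ac)
   show "?B \<subseteq> ?A"
   proof
    fix z assume "z \<in> ?B"
    then obtain x y where z: "z = (x, y)" "\<And>i. x i \<in> carrier (N i)" "\<And>k. y k \<in> carrier (N (\<sigma> k))"
     "\<And>k. \<eta> k \<odot>\<^bsub>N (\<sigma> k)\<^esub> y k = y k" by (elim glue_cases) blast
    have "\<exists>u. \<forall>i. u i \<in> carrier (M i) \<and> g i (u i) = x i"
     by (rule choice) (use suE[OF z(2)] in blast)
    moreover have "\<exists>v. \<forall>k. v k \<in> carrier (M (\<sigma> k)) \<and> g (\<sigma> k) (v k) = y k"
     by (rule choice) (use suE[OF z(3)] in blast)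
    ultimately obtain u v where uv: "\<And>i. u i \<in> carrier (M i)" "\<And>i. g i (u i) = x i"
     "\<And>k. v k \<in> carrier (M (\<sigma> k))" "\<And>k. g (\<sigma> k) (v k) = y k" by blast
    \<comment> \<open>a preimage need not be fixed by the idempotent, but its image under the idempotent is one that is\<close>
    let ?v = "\<lambda>k. \<eta> k \<odot>\<^bsub>M (\<sigma> k)\<^esub> v k"
    have "\<eta> k \<odot>\<^bsub>M (\<sigma> k)\<^esub> ?v k = ?v k" for k
     using right_module.act_mult[OF m(2), of "\<eta> k" "\<sigma> k" "\<eta> k" "v k"] uv eta_closed eta_idem by simp
    then have "(u, ?v) \<in> carrier (glue M)" "z = glue_map g (u, ?v)"
     using uv z right_module.act_closed[OF m(2)] eta_closed by (auto simp: glue_map_def mh_act[OF g])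
    then show "z \<in> ?A" by blast
   qed
  qed
 qed
qed

end

section \<open>Quotient modules\<close>

lemma image_module:
 assumes "right_module R N" and p: "p \<in> mod_hom R N Q" "p ` carrier N = carrier Q" "p \<zero>\<^sub>N = \<zero>\<^sub>Q"
 shows "right_module R Q"
proof -
 interpret N: right_module R N by fact
 note h = mh_add[OF p(1), symmetric] mh_act[OF p(1), symmetric] p(3)[symmetric]
 have E: "\<exists>x\<in>carrier N. y = p x" if "y \<in> carrier Q" for y using that p(2) by blast
 have I: "p x \<in> carrier Q" if "x \<in> carrier N" for x using that p(2) by blast
 note r = N.act_rules N.add_rules
 show ?thesis
 proof (intro right_module.intro N.R.ring_axioms abelian_groupI right_module_axioms.intro)
  show "\<exists>y\<in>carrier Q. y \<oplus>\<^sub>Q x = \<zero>\<^sub>Q" if x: "x \<in> carrier Q" for x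
  proof -
   obtain u where u: "u \<in> carrier N" "x = p u" using E[OF x] by blast
   then have "p (\<ominus>\<^sub>N u) \<oplus>\<^sub>Q x = \<zero>\<^sub>Q" by (simp add: h r)
   then show ?thesis using I[of "\<ominus>\<^sub>N u"] u by blast
  qed
  show "\<zero>\<^sub>Q \<in> carrier Q" using I[OF N.zero_closed] p(3) by simp
  show "x \<oplus>\<^sub>Q y \<in> carrier Q" if "x \<in> carrier Q" "y \<in> carrier Q" for x y
   using E[OF that(1)] E[OF that(2)] by (auto simp: h intro!: I)
  show "x \<oplus>\<^sub>Q y \<oplus>\<^sub>Q z = x \<oplus>\<^sub>Q (y \<oplus>\<^sub>Q z)" if "x \<in> carrier Q" "y \<in> carrier Q" "z \<in> carrier Q" for x y z
   using E[OF that(1)] E[OF that(2)] E[OF that(3)] by (auto simp: h r)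
  show "x \<oplus>\<^sub>Q y = y \<oplus>\<^sub>Q x" if "x \<in> carrier Q" "y \<in> carrier Q" for x y
   using E[OF that(1)] E[OF that(2)] by (auto simp: h r)
  show "\<zero>\<^sub>Q \<oplus>\<^sub>Q x = x" if "x \<in> carrier Q" for x using E[OF that] by (auto simp: h r)
  show "\<one>\<^sub>R \<odot>\<^sub>Q x = x" if "x \<in> carrier Q" for x using E[OF that] by (auto simp: h r)
  fix q assume q: "q \<in> carrier R"
  show "q \<odot>\<^sub>Q x \<in> carrier Q" if "x \<in> carrier Q" for x
   using E[OF that] q by (auto simp: h r intro!: I)
  show "q \<odot>\<^sub>Q (x \<oplus>\<^sub>Q y) = q \<odot>\<^sub>Q x \<oplus>\<^sub>Q q \<odot>\<^sub>Q y" if "x \<in> carrier Q" "y \<in> carrier Q" for x y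
   using E[OF that(1)] E[OF that(2)] q by (auto simp: h r)
  fix s assume s: "s \<in> carrier R"
  show "(q \<oplus>\<^sub>R s) \<odot>\<^sub>Q x = q \<odot>\<^sub>Q x \<oplus>\<^sub>Q s \<odot>\<^sub>Q x" if "x \<in> carrier Q" for x
   using E[OF that] q s by (auto simp: h r)
  show "(q \<otimes>\<^sub>R s) \<odot>\<^sub>Q x = s \<odot>\<^sub>Q (q \<odot>\<^sub>Q x)" if "x \<in> carrier Q" for x
   using E[OF that] q s by (auto simp: h r)
 qed
qed

text \<open>A quotient is carried by chosen representatives of the cosets, which keeps the type of the
 elements.\<close>

definition quot_rep :: "('a, 'm) module \<Rightarrow> 'm set \<Rightarrow> 'm \<Rightarrow> 'm" where
 "quot_rep N L n = (SOME m. m \<in> carrier N \<and> m \<ominus>\<^sub>N n \<in> L)"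

definition quot_mod :: "('a, 'm) module \<Rightarrow> 'm set \<Rightarrow> ('a, 'm) module" where
 "quot_mod N L = \<lparr>carrier = quot_rep N L ` carrier N, monoid.mult = undefined, one = undefined,
  ring.zero = quot_rep N L \<zero>\<^sub>N, add = (\<lambda>x y. quot_rep N L (x \<oplus>\<^sub>N y)),
  smult = (\<lambda>r x. quot_rep N L (r \<odot>\<^sub>N x))\<rparr>"

context right_module
begin

lemma quot_rep:
 assumes L: "submod R L M" and n: "n \<in> carrier M"
 shows "quot_rep M L n \<in> carrier M" "quot_rep M L n \<ominus>\<^sub>M n \<in> L"
proof -
 have "n \<in> carrier M \<and> n \<ominus>\<^sub>M n \<in> L" using n submod_zero[OF L] by (simp add: a_minus_def M.r_neg)
 then have "quot_rep M L n \<in> carrier M \<and> quot_rep M L n \<ominus>\<^sub>M n \<in> L" unfolding quot_rep_def by (rule someI)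
 then show "quot_rep M L n \<in> carrier M" "quot_rep M L n \<ominus>\<^sub>M n \<in> L" by auto
qed

lemma quot_rep_eq_iff:
 assumes L: "submod R L M" and nm: "n \<in> carrier M" "m \<in> carrier M"
 shows "quot_rep M L n = quot_rep M L m \<longleftrightarrow> n \<ominus>\<^sub>M m \<in> L"
proof -
 have t: "x \<ominus>\<^sub>M z \<in> L" if "x \<ominus>\<^sub>M y \<in> L" "y \<ominus>\<^sub>M z \<in> L" "x \<in> carrier M" "y \<in> carrier M" "z \<in> carrier M" for x y z
 proof -
  have "x \<ominus>\<^sub>M z = (x \<ominus>\<^sub>M y) \<oplus>\<^sub>M (y \<ominus>\<^sub>M z)"
   using that(3-5) by (simp add: a_minus_def M.a_assoc M.r_neg1)
  then show ?thesis using submod_add[OF L that(1,2)] by simp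
 qed
 have s: "y \<ominus>\<^sub>M x \<in> L" if "x \<ominus>\<^sub>M y \<in> L" "x \<in> carrier M" "y \<in> carrier M" for x y
 proof -
  have "y \<ominus>\<^sub>M x = \<ominus>\<^sub>M (x \<ominus>\<^sub>M y)" using that(2,3) by (simp add: a_minus_def M.minus_add M.a_comm)
  then show ?thesis using submod_uminus[OF L that(1)] by simp
 qed
 note q = quot_rep[OF L]
 show ?thesis
 proof
  assume e: "quot_rep M L n = quot_rep M L m"
  show "n \<ominus>\<^sub>M m \<in> L"
   by (rule t[OF s[OF q(2)[OF nm(1)] q(1)[OF nm(1)] nm(1)]]) (use e q[OF nm(1)] q[OF nm(2)] nm in auto)
 next
  assume e: "n \<ominus>\<^sub>M m \<in> L"
  have "x \<ominus>\<^sub>M n \<in> L \<longleftrightarrow> x \<ominus>\<^sub>M m \<in> L" if "x \<in> carrier M" for x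
   using t[of x n m] t[of x m n] s[OF e nm] e that nm by blast
  then have "(\<lambda>x. x \<in> carrier M \<and> x \<ominus>\<^sub>M n \<in> L) = (\<lambda>x. x \<in> carrier M \<and> x \<ominus>\<^sub>M m \<in> L)" by auto
  then show "quot_rep M L n = quot_rep M L m" by (simp add: quot_rep_def)
 qed
qed

lemma quot_rep_hom: "submod R L M \<Longrightarrow> quot_rep M L \<in> mod_hom R M (quot_mod M L)"
proof -
 assume L: "submod R L M"
 note q = quot_rep[OF L]
 show ?thesis
 proof (rule mod_homI)
  show "quot_rep M L (x \<oplus>\<^sub>M y) = quot_rep M L x \<oplus>\<^bsub>quot_mod M L\<^esub> quot_rep M L y"
   if xy: "x \<in> carrier M" "y \<in> carrier M" for x y
  proof -
   note c = q(1)[OF xy(1)] q(1)[OF xy(2)] xy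
   have "(quot_rep M L x \<oplus>\<^sub>M quot_rep M L y) \<ominus>\<^sub>M (x \<oplus>\<^sub>M y)
     = (quot_rep M L x \<ominus>\<^sub>M x) \<oplus>\<^sub>M (quot_rep M L y \<ominus>\<^sub>M y)"
    using c by (simp add: a_minus_def M.minus_add M.a_ac)
   then have "(quot_rep M L x \<oplus>\<^sub>M quot_rep M L y) \<ominus>\<^sub>M (x \<oplus>\<^sub>M y) \<in> L"
    using submod_add[OF L q(2)[OF xy(1)] q(2)[OF xy(2)]] by simp
   then have "quot_rep M L (quot_rep M L x \<oplus>\<^sub>M quot_rep M L y) = quot_rep M L (x \<oplus>\<^sub>M y)"
    using quot_rep_eq_iff[OF L] c by simp
   then show ?thesis by (simp add: quot_mod_def)
  qed
  show "quot_rep M L (r \<odot>\<^sub>M x) = r \<odot>\<^bsub>quot_mod M L\<^esub> quot_rep M L x"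
   if rx: "r \<in> carrier R" "x \<in> carrier M" for r x
  proof -
   have "r \<odot>\<^sub>M quot_rep M L x \<ominus>\<^sub>M r \<odot>\<^sub>M x \<in> L"
    using submod_act[OF L rx(1) q(2)[OF rx(2)]] act_minus[OF rx(1) q(1)[OF rx(2)] rx(2)] by simp
   then have "quot_rep M L (r \<odot>\<^sub>M quot_rep M L x) = quot_rep M L (r \<odot>\<^sub>M x)"
    using quot_rep_eq_iff[OF L] rx q by (simp add: act_closed)
   then show ?thesis by (simp add: quot_mod_def)
  qed
 qed (simp add: quot_mod_def)
qed

lemma quot_module: "submod R L M \<Longrightarrow> right_module R (quot_mod M L)"
 by (rule image_module[OF right_module_axioms quot_rep_hom]) (simp_all add: quot_mod_def)

end

context glued_rings
begin

section \<open>Projective covers of glued modules\<close>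

lemma res_surj:
 assumes "right_module R M" "right_module R N" "g \<in> mod_hom R M N" "g ` carrier M = carrier N"
 shows "g ` carrier (res i M) = carrier (res i N)"
proof
 interpret M: right_module R M by fact
 show "g ` carrier (res i M) \<subseteq> carrier (res i N)" using mh_closed[OF res_hom[OF assms(3)]] by blast
 show "carrier (res i N) \<subseteq> g ` carrier (res i M)"
 proof
  fix n assume n: "n \<in> carrier (res i N)"
  then obtain m where m: "m \<in> carrier M" "n = g m" using assms(4) by auto
  then have "n = g (\<iota> i \<one>\<^bsub>S i\<^esub> \<odot>\<^sub>M m)" using n mh_act[OF assms(3), of "\<iota> i \<one>\<^bsub>S i\<^esub>" m] iota_closed by auto
  then show "n \<in> g ` carrier (res i M)"
   using iota_act_res[OF assms(1) m(1) S.one_closed, of i] by blast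
 qed
qed

lemma extend_cong:
 assumes "right_module R N" "\<And>i x. x \<in> carrier (U i) \<Longrightarrow> h i x = h' i x \<and> h' i x \<in> carrier N" "z \<in> carrier (glue U)"
 shows "extend N h z = extend N h' z"
proof -
 interpret N: right_module R N by fact
 obtain x y where z: "z = (x, y)" "\<And>i. x i \<in> carrier (U i)" "\<And>k. y k \<in> carrier (U (\<sigma> k))"
  using assms(3) by (elim glue_cases) blast
 have "h i (x i) = h' i (x i)" "h (\<sigma> k) (y k) = h' (\<sigma> k) (y k)" for i k using assms(2) z by auto
 then show ?thesis by (simp add: extend_def z)
qed

lemma extend_emb:
 assumes N: "right_module R N" and U: "\<And>i. right_module (S i) (U i)"
  and h: "\<And>i. h i \<in> mod_hom (S i) (U i) (res i N)" and x: "x \<in> carrier (U i)"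
 shows "extend N h (emb U i x) = h i x"
proof -
 interpret N: right_module R N by fact
 have h0: "h i \<zero>\<^bsub>U i\<^esub> = \<zero>\<^sub>N" for i using mh_zero[OF U res_module[OF N] h] by simp
 have hc: "h i x \<in> carrier N" using mh_closed[OF h x] by simp
 have "finsum N (\<lambda>j. h j (if j = i then x else \<zero>\<^bsub>U j\<^esub>)) UNIV = finsum N (\<lambda>j. if i = j then h i x else \<zero>\<^sub>N) UNIV"
  using hc by (intro N.finsum_cong') (auto simp: h0)
 also have "\<dots> = h i x" using hc by (subst N.finsum_singleton) auto
 finally have "finsum N (\<lambda>j. h j (fst (emb U i x) j)) UNIV = h i x" by simp
 moreover have "finsum N (\<lambda>k. \<beta> k \<odot>\<^sub>N h (\<sigma> k) (snd (emb U i x) k)) \<Gamma> = \<zero>\<^sub>N"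
  by (simp add: emb_def h0 N.act_zero closed N.finsum_zero)
 ultimately show ?thesis using hc by (simp add: extend_def)
qed

lemma glue_fg_projective:
 assumes P: "\<And>i. fg_projective (S i) (P i)" shows "fg_projective R (glue P)"
proof -
 have Pm: "right_module (S i) (P i)" for i using P by (simp add: fg_projective_def)
 have G: "fg_module R (glue P)" by (rule glue_fg[OF fg_projective_fg[OF P]])
 note Gm = fg_mod_rm[OF G]
 let ?L = "list_copy R (glue P)"
 note L = list_copy[OF G]
 obtain a b where ab: "a \<in> mod_hom R (glue P) ?L" "b \<in> mod_hom R ?L (glue P)" "\<And>x. x \<in> carrier ?L \<Longrightarrow> a (b x) = x"
  using mod_iso_obtain[OF L(2) Gm] by metis
 have "projective R ?L" unfolding projective_def
 proof (intro conjI ballI impI L(1))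
  fix M N g h
  assume h: "M \<in> fg_modules R" "N \<in> fg_modules R" "g \<in> mod_hom R M N" "h \<in> mod_hom R ?L N"
   "g ` carrier M = carrier N"
  note MN = h(1,2)[THEN fg_mods_rm]
  note F = mh_comp[OF ab(1) h(4)]
  have "\<exists>k. \<forall>i. k i \<in> mod_hom (S i) (P i) (res i M) \<and> (\<forall>x\<in>carrier (P i). g (k i x) = h (a (emb P i x)))"
  proof (rule choice, rule allI)
   fix i
   show "\<exists>k. k \<in> mod_hom (S i) (P i) (res i M) \<and> (\<forall>x\<in>carrier (P i). g (k x) = h (a (emb P i x)))"
    by (rule fg_projective_lift[OF P res_module[OF MN(1)] res_module[OF MN(2)] res_hom[OF h(3)]
       res_surj[OF MN h(3,5)] mh_comp[OF emb_hom[OF Pm] res_hom[OF F]]]) blast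
  qed
  then obtain k where k: "\<And>i. k i \<in> mod_hom (S i) (P i) (res i M)"
   "\<And>i x. x \<in> carrier (P i) \<Longrightarrow> g (k i x) = h (a (emb P i x))" by blast
  have kc: "k i x \<in> carrier M" if "x \<in> carrier (P i)" for i x using mh_closed[OF k(1) that] by simp
  have "g (extend M k (b x)) = h x" if x: "x \<in> carrier ?L" for x
  proof -
   have bx: "b x \<in> carrier (glue P)" by (rule mh_closed[OF ab(2) x])
   have "g (extend M k (b x)) = extend N (\<lambda>i x. g (k i x)) (b x)" by (rule extend_natural[OF MN h(3) kc bx])
   also have "\<dots> = extend N (\<lambda>i x. h (a (emb P i x))) (b x)"
    using k(2) mh_closed[OF F emb_closed(1)[OF Pm]] by (intro extend_cong[OF MN(2) _ bx]) simp
   also have "\<dots> = h (a (b x))" by (rule hom_eq_extend[OF Pm MN(2) F bx, symmetric])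
   finally show ?thesis using ab(3)[OF x] by simp
  qed
  moreover have "(\<lambda>x. extend M k (b x)) \<in> mod_hom R ?L M"
   by (rule mh_comp[OF ab(2) extend_hom[OF MN(1) Pm k(1)]])
  ultimately show "\<exists>k\<in>mod_hom R ?L M. \<forall>x\<in>carrier ?L. g (k x) = h x"
   by (intro bexI[of _ "\<lambda>x. extend M k (b x)"] ballI)
 qed
 then have "fg_projective R ?L" using projective_iff by blast
 then show ?thesis by (rule fg_projective_iso[OF L(3) _ Gm])
qed

text \<open>The action of \<open>\<beta> k\<close> is determined by the top component at \<open>\<sigma> k\<close>.\<close>

lemma beta_act_top:
 assumes U: "\<And>i. right_module (S i) (U i)" and "z \<in> carrier (glue U)" "w \<in> carrier (glue U)" "fst z (\<sigma> k) = fst w (\<sigma> k)"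
 shows "\<beta> k \<odot>\<^bsub>glue U\<^esub> z = \<beta> k \<odot>\<^bsub>glue U\<^esub> w"
 using assms(2-4) by (auto simp: beta_act_glue[OF U] fun_eq_iff)

definition bottom :: "('i \<Rightarrow> ('d, 'm) module) \<Rightarrow> (('i \<Rightarrow> 'm) \<times> ('g \<Rightarrow> 'm)) set" where
 "bottom U = {z \<in> carrier (glue U). \<forall>i. fst z i = \<zero>\<^bsub>U i\<^esub>}"

lemma bottom_eq_sum:
 assumes U: "\<And>i. right_module (S i) (U i)" and z: "z \<in> bottom U"
  and w: "\<And>k. w k \<in> carrier (glue U)" "\<And>k. fst (w k) (\<sigma> k) = snd z k"
 shows "z = finsum (glue U) (\<lambda>k. \<beta> k \<odot>\<^bsub>glue U\<^esub> w k) \<Gamma>"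
proof -
 let ?G = "glue U"
 interpret G: right_module R "glue U" by (rule glue_module[OF U])
 have zG: "z \<in> carrier ?G" and z0: "\<And>i. fst z i = \<zero>\<^bsub>U i\<^esub>" using z by (auto simp: bottom_def)
 then have zk: "snd z k \<in> carrier (U (\<sigma> k))" for k by (elim glue_cases) auto
 have e: "emb U i \<zero>\<^bsub>U i\<^esub> = \<zero>\<^sub>?G" for i by (auto simp: emb_def)
 have "\<beta> k \<odot>\<^sub>?G emb U (\<sigma> k) (snd z k) = \<beta> k \<odot>\<^sub>?G w k" for k
  using w zk by (intro beta_act_top[OF U emb_closed(1)[OF U]]) auto
 moreover have "finsum ?G (\<lambda>k. \<beta> k \<odot>\<^sub>?G w k) \<Gamma> \<in> carrier ?G"
  using w(1) by (intro G.finsum_closed) (auto simp: G.act_closed closed)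
 ultimately have "extend ?G (emb U) z = finsum ?G (\<lambda>k. \<beta> k \<odot>\<^sub>?G w k) \<Gamma>"
  by (simp add: extend_def z0 e G.finsum_zero del: glue_simps(2))
 then show ?thesis using glue_extend_emb[OF U zG] by simp
qed

definition infl :: "'i \<Rightarrow> ('d, 'm) module \<Rightarrow> ('c, 'm) module" where
 "infl i V = \<lparr>carrier = carrier V, monoid.mult = undefined, one = undefined,
  ring.zero = \<zero>\<^sub>V, add = add V, smult = (\<lambda>r v. \<pi> i r \<odot>\<^sub>V v)\<rparr>"

lemma infl_simps [simp]: "carrier (infl i V) = carrier V" "\<zero>\<^bsub>infl i V\<^esub> = \<zero>\<^sub>V"
 "x \<oplus>\<^bsub>infl i V\<^esub> y = x \<oplus>\<^sub>V y" "r \<odot>\<^bsub>infl i V\<^esub> v = \<pi> i r \<odot>\<^sub>V v"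
 by (simp_all add: infl_def)

lemma infl_module: "right_module (S i) V \<Longrightarrow> right_module R (infl i V)"
proof -
 assume "right_module (S i) V"
 then interpret V: right_module "S i" V .
 show ?thesis
 proof (intro right_module.intro R_ring abelian_groupI right_module_axioms.intro)
  show "\<exists>y\<in>carrier (infl i V). y \<oplus>\<^bsub>infl i V\<^esub> x = \<zero>\<^bsub>infl i V\<^esub>" if "x \<in> carrier (infl i V)" for x
   using that by (intro bexI[of _ "\<ominus>\<^sub>V x"]) (auto simp: V.l_neg)
 qed (auto simp: V.act_rules V.a_ac pi_closed pi_add pi_mult pi_one)
qed

lemma infl_submod: "right_module (S i) V \<Longrightarrow> submod R L (infl i V) \<longleftrightarrow> submod (S i) L V"
proof -
 assume V: "right_module (S i) V"
 have "(\<forall>r\<in>carrier R. \<forall>x\<in>L. \<pi> i r \<odot>\<^sub>V x \<in> L) \<longleftrightarrow> (\<forall>a\<in>carrier (S i). \<forall>x\<in>L. a \<odot>\<^sub>V x \<in> L)"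
  using pi_closed iota_closed pi_iota[of _ i i] by metis
 then show ?thesis
  by (simp add: right_module.submod_iff[OF V] right_module.submod_iff[OF infl_module[OF V]])
qed

lemma top_hom: "(\<lambda>z. fst z i) \<in> mod_hom R (glue U) (infl i (U i))"
 by (rule mod_homI) (auto elim!: glue_cases)

lemma hom_infl_top:
 assumes U: "\<And>i. right_module (S i) (U i)" and V: "right_module (S i) V"
  and F: "F \<in> mod_hom R (glue U) (infl i V)" and z: "z \<in> carrier (glue U)"
 shows "F z = F (emb U i (fst z i))"
proof -
 interpret I: right_module R "infl i V" by (rule infl_module[OF V])
 interpret V: right_module "S i" V by (rule V)
 obtain x y where xy: "z = (x, y)" "\<And>i. x i \<in> carrier (U i)" "\<And>k. y k \<in> carrier (U (\<sigma> k))"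
  using z by (elim glue_cases) blast
 have c: "F (emb U j u) \<in> carrier V" if "u \<in> carrier (U j)" for j u
  using mh_closed[OF F emb_closed(1)[OF U that]] by simp
 have off: "F (emb U j u) = \<zero>\<^sub>V" if "j \<noteq> i" "u \<in> carrier (U j)" for j u
 proof -
  have "F (\<iota> j \<one>\<^bsub>S j\<^esub> \<odot>\<^bsub>glue U\<^esub> emb U j u) = \<pi> i (\<iota> j \<one>\<^bsub>S j\<^esub>) \<odot>\<^sub>V F (emb U j u)"
   using mh_act[OF F _ emb_closed(1)[OF U that(2)], of "\<iota> j \<one>\<^bsub>S j\<^esub>"] by (simp add: iota_closed)
  moreover have "\<iota> j \<one>\<^bsub>S j\<^esub> \<odot>\<^bsub>glue U\<^esub> emb U j u = emb U j u" using emb_closed(2)[OF U that(2)] by simp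
  ultimately show ?thesis using that c by (simp add: pi_iota V.zero_act)
 qed
 have "finsum (infl i V) (\<lambda>j. F (emb U j (x j))) UNIV
   = finsum (infl i V) (\<lambda>j. if i = j then F (emb U i (x i)) else \<zero>\<^bsub>infl i V\<^esub>) UNIV"
  using off xy c by (intro I.finsum_cong') auto
 also have "\<dots> = F (emb U i (x i))" using c xy by (subst I.finsum_singleton) auto
 finally have "finsum (infl i V) (\<lambda>j. F (emb U j (x j))) UNIV = F (emb U i (x i))" .
 moreover have "finsum (infl i V) (\<lambda>k. \<beta> k \<odot>\<^bsub>infl i V\<^esub> F (emb U (\<sigma> k) (y k))) \<Gamma> = \<zero>\<^sub>V"
  using I.finsum_zero c xy by (simp add: pi_beta V.zero_act)
 ultimately show ?thesis
  using hom_eq_extend[OF U infl_module[OF V] F z] c xy by (simp add: extend_def)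
qed

lemma bottom_submod: "(\<And>i. right_module (S i) (U i)) \<Longrightarrow> submod R (bottom U) (glue U)"
proof -
 assume U: "\<And>i. right_module (S i) (U i)"
 interpret G: right_module R "glue U" by (rule glue_module[OF U])
 note top = mh_add[OF top_hom[of _ U]] mh_act[OF top_hom[of _ U]]
 show ?thesis
 proof (rule G.submodI)
  show "\<zero>\<^bsub>glue U\<^esub> \<in> bottom U" using G.zero_closed by (simp add: bottom_def)
 qed (auto simp: bottom_def top G.act_closed right_module.act_rules[OF U] right_module.add_rules[OF U] pi_closed)
qed

text \<open>A submodule of \<open>glue P\<close> covering \<open>glue M\<close> has full tops, because the covers of the components are
 minimal; the tops generate everything below them through the \<open>\<beta> k\<close>.\<close>

lemma glue_pcover:
 assumes c: "\<And>i. pcover (S i) (M i) (P i) (f i)"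
 shows "pcover R (glue M) (glue P) (glue_map f)"
proof -
 have Mm: "\<And>i. right_module (S i) (M i)" and P: "\<And>i. fg_projective (S i) (P i)"
  and f: "\<And>i. f i \<in> mod_hom (S i) (P i) (M i)" and fs: "\<And>i. f i ` carrier (P i) = carrier (M i)"
  and min: "\<And>i L. submod (S i) L (P i) \<Longrightarrow> f i ` L = carrier (M i) \<Longrightarrow> L = carrier (P i)"
  using c unfolding pcover_def by blast+
 have Pm: "right_module (S i) (P i)" for i using P by (simp add: fg_projective_def)
 interpret G: right_module R "glue P" by (rule glue_module[OF Pm])
 have fh: "glue_map f \<in> mod_hom R (glue P) (glue M)" by (rule glue_map_hom[OF f Pm])
 have f0: "f i \<zero>\<^bsub>P i\<^esub> = \<zero>\<^bsub>M i\<^esub>" for i by (rule mh_zero[OF Pm Mm f])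
 have femb: "glue_map f (emb P i x) = emb M i (f i x)" for i x by (auto simp: glue_map_def emb_def f0)
 have surj: "glue_map f ` carrier (glue P) = carrier (glue M)"
 proof (rule glue_generated[OF Mm])
  show "submod R (glue_map f ` carrier (glue P)) (glue M)"
   by (rule submod_image[OF G.right_module_axioms glue_module[OF Mm] fh G.submod_carrier])
  fix i m assume "m \<in> carrier (M i)"
  then obtain x where "x \<in> carrier (P i)" "m = f i x" using fs by blast
  then show "emb M i m \<in> glue_map f ` carrier (glue P)"
   using femb[of i x] emb_closed(1)[OF Pm, of x i] by force
 qed
 have "L = carrier (glue P)" if L: "submod R L (glue P)" "glue_map f ` L = carrier (glue M)" for L
 proof -
  note LG = G.submod_subset[OF L(1)]
  \<comment> \<open>the tops of \<open>L\<close> are everything, by minimality of the given covers\<close>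
  have tops: "\<exists>z\<in>L. fst z i = x" if x: "x \<in> carrier (P i)" for i x
  proof -
   let ?A = "(\<lambda>z. fst z i) ` L"
   have "submod R ?A (infl i (P i))"
    by (rule submod_image[OF G.right_module_axioms infl_module[OF Pm] top_hom L(1)])
   then have sub: "submod (S i) ?A (P i)" using infl_submod[OF Pm] by blast
   have "f i ` ?A = carrier (M i)"
   proof
    show "f i ` ?A \<subseteq> carrier (M i)"
     using right_module.submod_subset[OF Pm sub] mh_closed[OF f] by blast
    show "carrier (M i) \<subseteq> f i ` ?A"
    proof
     fix m assume m: "m \<in> carrier (M i)"
     then have "emb M i m \<in> glue_map f ` L" using L(2) emb_closed(1)[OF Mm] by simp
     then obtain z where "z \<in> L" "emb M i m = glue_map f z" by blast
     then have "m = f i (fst z i)" using fst_emb[of M i m i] by (simp add: glue_map_def split: prod.splits)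
     then show "m \<in> f i ` ?A" using \<open>z \<in> L\<close> by blast
    qed
   qed
   from min[OF sub this] have "x \<in> ?A" using x by simp
   then show ?thesis by auto
  qed
  have bot: "z \<in> L" if z: "z \<in> bottom P" for z
  proof -
   have zk: "snd z k \<in> carrier (P (\<sigma> k))" for k using z by (auto simp: bottom_def elim!: glue_cases)
   have "\<exists>w. \<forall>k. w k \<in> L \<and> fst (w k) (\<sigma> k) = snd z k" by (rule choice) (use tops[OF zk] in blast)
   then obtain w where w: "\<And>k. w k \<in> L" "\<And>k. fst (w k) (\<sigma> k) = snd z k" by blast
   have "z = finsum (glue P) (\<lambda>k. \<beta> k \<odot>\<^bsub>glue P\<^esub> w k) \<Gamma>"
    using w LG by (intro bottom_eq_sum[OF Pm z]) auto
   also have "\<dots> \<in> L" using w by (intro G.submod_finsum[OF L(1) fin_\<Gamma>] G.submod_act[OF L(1)] closed)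
   finally show ?thesis .
  qed
  show ?thesis
  proof (rule glue_generated[OF Pm L(1)])
   fix i x assume x: "x \<in> carrier (P i)"
   obtain z where z: "z \<in> L" "fst z i = x" using tops[OF x] by blast
   let ?u = "\<iota> i \<one>\<^bsub>S i\<^esub> \<odot>\<^bsub>glue P\<^esub> z"
   have u: "?u \<in> L" by (intro G.submod_act[OF L(1)] closed z S.one_closed)
   have zG: "z \<in> carrier (glue P)" and uG: "?u \<in> carrier (glue P)" and eG: "emb P i x \<in> carrier (glue P)"
    using z u LG emb_closed(1)[OF Pm x] by auto
   have "fst ?u j = fst (emb P i x) j" for j
    using zG z(2) by (elim glue_cases) (auto simp: pi_iota right_module.act_rules[OF Pm])
   then have "emb P i x \<ominus>\<^bsub>glue P\<^esub> ?u \<in> bottom P"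
    using mh_minus[OF G.right_module_axioms infl_module[OF Pm] top_hom eG uG] uG eG G.minus_closed[OF eG uG]
     mh_closed[OF top_hom eG] right_module.add_rules(10)[OF infl_module[OF Pm]]
    by (auto simp: bottom_def a_minus_def simp del: fst_emb)
   then have "emb P i x \<ominus>\<^bsub>glue P\<^esub> ?u \<in> L" by (rule bot)
   then have "(emb P i x \<ominus>\<^bsub>glue P\<^esub> ?u) \<oplus>\<^bsub>glue P\<^esub> ?u \<in> L" using u by (rule G.submod_add[OF L(1)])
   then show "emb P i x \<in> L" using eG uG by (simp add: a_minus_def G.a_assoc G.l_neg del: glue_simps(2))
  qed
 qed
 then show ?thesis unfolding pcover_def
  using glue_module[OF Mm] glue_fg_projective[OF P] fh surj by blast
qed

lemma syzygy_glue:
 assumes M: "\<And>i. M i \<in> fg_modules (S i)" and N: "N \<in> fg_modules R" "mod_iso R N (glue M)"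
 shows "mod_iso R (syzygy R N) (glue (\<lambda>i. syzygy (S i) (M i)))"
proof -
 have "\<exists>P f. pcover (S i) (M i) P f \<and> syzygy (S i) (M i) = ker_mod P (M i) f" for i
  using syzygy_cover[OF S_fl M] by metis
 then obtain P f where c: "\<And>i. pcover (S i) (M i) (P i) (f i)"
  and s: "\<And>i. syzygy (S i) (M i) = ker_mod (P i) (M i) (f i)" by metis
 have "mod_iso R (syzygy R N) (ker_mod (glue P) (glue M) (glue_map f))"
  by (rule syzygy_pcover[OF R_fl N(1) glue_pcover[OF c] N(2)])
 also have "mod_iso R \<dots> (glue (\<lambda>i. syzygy (S i) (M i)))"
  unfolding s
  by (rule mod_isoI_inverse[of "\<lambda>x. x" _ _ _ "\<lambda>x. x"])
    (auto intro!: mod_homI simp: a_kernel_def' glue_map_def fun_eq_iff)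
 finally show ?thesis .
qed

lemma syzygy_pow_glue:
 assumes M: "\<And>i. M i \<in> fg_modules (S i)" and N: "N \<in> fg_modules R" "mod_iso R N (glue M)"
 shows "mod_iso R ((syzygy R ^^ n) N) (glue (\<lambda>i. (syzygy (S i) ^^ n) (M i)))"
proof (induction n)
 case (Suc n)
 show ?case using syzygy_glue[OF syzygy_pow_fg[OF S_fl M] syzygy_pow_fg[OF R_fl N(1)] Suc] by simp
qed (use N in simp)

end

context glued_rings
begin

section \<open>The top functor\<close>

text \<open>The smallest submodule whose quotient is inflated from \<open>S i\<close>.\<close>

definition radical_part :: "'i \<Rightarrow> ('c, 'm) module \<Rightarrow> 'm set" where
 "radical_part i N = carrier N \<inter> \<Inter>{L. submod R L N \<and> (\<forall>r\<in>carrier R. \<forall>n\<in>carrier N. \<pi> i r = \<zero>\<^bsub>S i\<^esub> \<longrightarrow> r \<odot>\<^sub>N n \<in> L)}"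

definition Top :: "'i \<Rightarrow> ('c, 'm) module \<Rightarrow> ('d, 'm) module" where
 "Top i N = res i (quot_mod N (radical_part i N))"

lemma radical_part_submod: "right_module R N \<Longrightarrow> submod R (radical_part i N) N"
proof -
 assume "right_module R N"
 then interpret N: right_module R N .
 show ?thesis by (rule N.submodI)
   (auto simp: radical_part_def N.submod_zero N.submod_add N.submod_act N.act_closed)
qed

lemma radical_part_least:
 "submod R L N \<Longrightarrow> (\<And>r n. r \<in> carrier R \<Longrightarrow> n \<in> carrier N \<Longrightarrow> \<pi> i r = \<zero>\<^bsub>S i\<^esub> \<Longrightarrow> r \<odot>\<^sub>N n \<in> L) \<Longrightarrow>
  radical_part i N \<subseteq> L"
 by (auto simp: radical_part_def)

lemma radical_partI:
 "right_module R N \<Longrightarrow> r \<in> carrier R \<Longrightarrow> n \<in> carrier N \<Longrightarrow> \<pi> i r = \<zero>\<^bsub>S i\<^esub> \<Longrightarrow> r \<odot>\<^sub>N n \<in> radical_part i N"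
 by (auto simp: radical_part_def right_module.act_closed)

lemma radical_part_map:
 assumes N: "right_module R N" "right_module R N'" and f: "f \<in> mod_hom R N N'" and n: "n \<in> radical_part i N"
 shows "f n \<in> radical_part i N'"
proof -
 have "radical_part i N \<subseteq> {n \<in> carrier N. f n \<in> radical_part i N'}"
  by (rule radical_part_least[OF submod_vimage[OF N f radical_part_submod[OF N(2)]]])
    (use radical_partI[OF N(2)] mh_closed[OF f] mh_act[OF f] N in \<open>auto simp: right_module.act_closed\<close>)
 then show ?thesis using n by auto
qed

definition top_proj :: "'i \<Rightarrow> ('c, 'm) module \<Rightarrow> 'm \<Rightarrow> 'm" where
 "top_proj i N = quot_rep N (radical_part i N)"

lemma top_proj_eq_iff:
 "right_module R N \<Longrightarrow> n \<in> carrier N \<Longrightarrow> m \<in> carrier N \<Longrightarrow>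
  top_proj i N n = top_proj i N m \<longleftrightarrow> n \<ominus>\<^sub>N m \<in> radical_part i N"
 unfolding top_proj_def by (rule right_module.quot_rep_eq_iff[OF _ radical_part_submod])

lemma Top:
 assumes N: "right_module R N"
 shows "right_module (S i) (Top i N)" "top_proj i N \<in> mod_hom R N (infl i (Top i N))"
  "top_proj i N ` carrier N = carrier (Top i N)"
proof -
 interpret N: right_module R N by (rule N)
 let ?D = "radical_part i N"
 note D = radical_part_submod[OF N, of i]
 let ?Q = "quot_mod N ?D"
 interpret Q: right_module R ?Q by (rule N.quot_module[OF D])
 show "right_module (S i) (Top i N)" unfolding Top_def by (rule res_module[OF Q.right_module_axioms])
 have p: "top_proj i N \<in> mod_hom R N ?Q" unfolding top_proj_def by (rule N.quot_rep_hom[OF D])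
 have key: "\<iota> i (\<pi> i r) \<odot>\<^sub>?Q top_proj i N n = r \<odot>\<^sub>?Q top_proj i N n" if rn: "r \<in> carrier R" "n \<in> carrier N" for r n
 proof -
  have c: "\<iota> i (\<pi> i r) \<in> carrier R" using rn by (simp add: closed)
  have "\<iota> i (\<pi> i r) \<odot>\<^sub>N n \<ominus>\<^sub>N r \<odot>\<^sub>N n = (\<iota> i (\<pi> i r) \<ominus>\<^sub>R r) \<odot>\<^sub>N n"
  proof -
   have "(\<ominus>\<^sub>R r) \<odot>\<^sub>N n = \<ominus>\<^sub>N (r \<odot>\<^sub>N n)"
    by (rule sym, rule N.M.minus_equality) (use rn in \<open>auto simp: N.act_closed N.act_add_ring[symmetric] R.l_neg N.zero_act\<close>)
   then show ?thesis using rn c by (simp add: a_minus_def N.act_add_ring)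
  qed
  moreover have "\<pi> i (\<iota> i (\<pi> i r) \<ominus>\<^sub>R r) = \<zero>\<^bsub>S i\<^esub>"
  proof -
   have "\<pi> i (\<iota> i (\<pi> i r) \<ominus>\<^sub>R r) \<oplus>\<^bsub>S i\<^esub> \<pi> i r = \<pi> i r"
    using rn c pi_add[of "\<iota> i (\<pi> i r) \<ominus>\<^sub>R r" r i] by (simp add: pi_iota closed a_minus_def R.a_assoc R.l_neg)
   then show ?thesis using rn c by (metis S.add.r_cancel_one' R.minus_closed pi_closed)
  qed
  ultimately have "\<iota> i (\<pi> i r) \<odot>\<^sub>N n \<ominus>\<^sub>N r \<odot>\<^sub>N n \<in> ?D"
   using radical_partI[OF N _ rn(2)] rn c by simp
  then have "top_proj i N (\<iota> i (\<pi> i r) \<odot>\<^sub>N n) = top_proj i N (r \<odot>\<^sub>N n)"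
   using top_proj_eq_iff[OF N] rn c by (simp add: N.act_closed)
  then show ?thesis using rn c by (simp add: mh_act[OF p])
 qed
 have one: "\<iota> i \<one>\<^bsub>S i\<^esub> \<odot>\<^sub>?Q top_proj i N n = top_proj i N n" if "n \<in> carrier N" for n
  using key[OF R.one_closed that] mh_closed[OF p that] by (simp add: pi_one Q.act_one)
 have pc: "top_proj i N n \<in> carrier (Top i N)" if "n \<in> carrier N" for n
  using one[OF that] mh_closed[OF p that] by (simp add: Top_def)
 show "top_proj i N \<in> mod_hom R N (infl i (Top i N))"
  by (rule mod_homI) (use pc in \<open>auto simp: Top_def key mh_add[OF p] mh_act[OF p]\<close>)
 show "top_proj i N ` carrier N = carrier (Top i N)"
  using pc by (auto simp: Top_def quot_mod_def top_proj_def)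
qed

lemma top_proj_zero_iff:
 assumes N: "right_module R N" and n: "n \<in> carrier N"
 shows "top_proj i N n = \<zero>\<^bsub>Top i N\<^esub> \<longleftrightarrow> n \<in> radical_part i N"
proof -
 interpret N: right_module R N by (rule N)
 have "top_proj i N n = top_proj i N \<zero>\<^sub>N \<longleftrightarrow> n \<ominus>\<^sub>N \<zero>\<^sub>N \<in> radical_part i N"
  by (rule top_proj_eq_iff[OF N n N.zero_closed])
 moreover have "n \<ominus>\<^sub>N \<zero>\<^sub>N = n"
  using n N.minus_equality[of "\<zero>\<^sub>N" "\<zero>\<^sub>N"] by (simp add: a_minus_def)
 moreover have "top_proj i N \<zero>\<^sub>N = \<zero>\<^bsub>Top i N\<^esub>"
  using mh_zero[OF N infl_module[OF Top(1)[OF N]] Top(2)[OF N]] by simp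
 ultimately show ?thesis by simp
qed

text \<open>The top is characterised by its universal property: a homomorphism to an inflated module
 factors through it, and is an isomorphism on the top once it is surjective with the smallest
 possible kernel.\<close>

lemma Top_factor:
 assumes N: "right_module R N" and V: "right_module (S i) V" and h: "h \<in> mod_hom R N (infl i V)"
 obtains f where "f \<in> mod_hom (S i) (Top i N) V" "\<And>n. n \<in> carrier N \<Longrightarrow> f (top_proj i N n) = h n"
proof -
 interpret N: right_module R N by (rule N)
 note I = infl_module[OF V]
 interpret I: right_module R "infl i V" by (rule I)
 interpret V: right_module "S i" V by (rule V)
 have ker: "radical_part i N \<subseteq> a_kernel N (infl i V) h"
  by (rule radical_part_least[OF submod_kernel[OF N I h]])
    (use mh_closed[OF h] in \<open>auto simp: a_kernel_def' mh_act[OF h] N.act_closed V.zero_act\<close>)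
 have hp: "h (top_proj i N n) = h n" if n: "n \<in> carrier N" for n
 proof -
  note q = N.quot_rep[OF radical_part_submod[OF N, of i] n, folded top_proj_def]
  have "h (top_proj i N n \<ominus>\<^sub>N n) = \<zero>\<^bsub>infl i V\<^esub>" using ker q(2) by (auto simp: a_kernel_def')
  then have "h (top_proj i N n) \<ominus>\<^bsub>infl i V\<^esub> h n = \<zero>\<^bsub>infl i V\<^esub>"
   using mh_minus[OF N I h q(1) n] by simp
  then show ?thesis using I.minus_eq_zeroD mh_closed[OF h] q(1) n by blast
 qed
 note T = Top[OF N, of i]
 have "h \<in> mod_hom (S i) (Top i N) V"
 proof (rule mod_homI)
  fix x assume x: "x \<in> carrier (Top i N)"
  then obtain n where n: "n \<in> carrier N" "x = top_proj i N n" using T(3) by blast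
  then show "h x \<in> carrier V" using hp mh_closed[OF h] by simp
  fix y assume "y \<in> carrier (Top i N)"
  then obtain m where m: "m \<in> carrier N" "y = top_proj i N m" using T(3) by blast
  have "h (x \<oplus>\<^bsub>Top i N\<^esub> y) = h (top_proj i N (n \<oplus>\<^sub>N m))" using mh_add[OF T(2) n(1) m(1)] n m by simp
  then show "h (x \<oplus>\<^bsub>Top i N\<^esub> y) = h x \<oplus>\<^sub>V h y"
   using n m hp mh_add[OF h n(1) m(1)] by simp
 next
  fix a x assume a: "a \<in> carrier (S i)" and x: "x \<in> carrier (Top i N)"
  then obtain n where n: "n \<in> carrier N" "x = top_proj i N n" using T(3) by blast
  have "a \<odot>\<^bsub>Top i N\<^esub> x = top_proj i N (\<iota> i a \<odot>\<^sub>N n)"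
   using mh_act[OF T(2) iota_closed[OF a] n(1)] n a by (simp add: pi_iota)
  then show "h (a \<odot>\<^bsub>Top i N\<^esub> x) = a \<odot>\<^sub>V h x"
   using hp n a mh_act[OF h iota_closed[OF a] n(1)] by (simp add: pi_iota N.act_closed iota_closed)
 qed
 then show thesis using that hp by blast
qed

lemma Top_iso:
 assumes N: "right_module R N" and V: "right_module (S i) V" and h: "h \<in> mod_hom R N (infl i V)"
  and surj: "\<And>v. v \<in> carrier V \<Longrightarrow> \<exists>n\<in>carrier N. h n = v"
  and ker: "\<And>n. n \<in> carrier N \<Longrightarrow> h n = \<zero>\<^sub>V \<Longrightarrow> n \<in> radical_part i N"
 shows "mod_iso (S i) (Top i N) V"
proof -
 interpret N: right_module R N by (rule N)
 obtain f where f: "f \<in> mod_hom (S i) (Top i N) V" "\<And>n. n \<in> carrier N \<Longrightarrow> f (top_proj i N n) = h n"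
  using Top_factor[OF N V h] by blast
 note T = Top[OF N, of i]
 show ?thesis
 proof (rule mod_isoI_kernel[OF T(1) V f(1)])
  fix x assume x: "x \<in> carrier (Top i N)" "f x = \<zero>\<^sub>V"
  then obtain n where n: "n \<in> carrier N" "x = top_proj i N n" using T(3) by blast
  then have "n \<in> radical_part i N" using f(2) x ker by simp
  then show "x = \<zero>\<^bsub>Top i N\<^esub>" using n top_proj_zero_iff[OF N n(1), of i] by simp
 next
  fix v assume "v \<in> carrier V"
  then obtain n where "n \<in> carrier N" "h n = v" using surj by blast
  then show "\<exists>x\<in>carrier (Top i N). f x = v" using f(2) T(3) by (metis imageI)
 qed
qed

lemma Top_dsum:
 assumes m: "right_module R N" "right_module R N1" "right_module R N2" and iso: "mod_iso R N (dsum N1 N2)"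
 shows "mod_iso (S i) (Top i N) (dsum (Top i N1) (Top i N2))"
proof -
 interpret N: right_module R N by (rule m)
 note D = dsum_module[OF m(2,3)]
 note T1 = Top[OF m(2), of i] and T2 = Top[OF m(3), of i]
 note z = mh_zero[OF m(2) infl_module[OF T1(1)] T1(2)] mh_zero[OF m(3) infl_module[OF T2(1)] T2(2)]
 obtain a b where ab: "a \<in> mod_hom R N (dsum N1 N2)" "b \<in> mod_hom R (dsum N1 N2) N"
  "\<And>x. x \<in> carrier N \<Longrightarrow> b (a x) = x" "\<And>y. y \<in> carrier (dsum N1 N2) \<Longrightarrow> a (b y) = y"
  using mod_iso_obtain[OF iso m(1)] by metis
 let ?h = "\<lambda>n. (top_proj i N1 (fst (a n)), top_proj i N2 (snd (a n)))"
 have ac: "fst (a n) \<in> carrier N1" "snd (a n) \<in> carrier N2" if "n \<in> carrier N" for n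
  using mh_closed[OF ab(1) that] by auto
 show ?thesis
 proof (rule Top_iso[OF m(1) dsum_module[OF T1(1) T2(1)]])
  have "?h \<in> mod_hom R N (dsum (infl i (Top i N1)) (infl i (Top i N2)))"
   by (intro dsum_pair_hom mh_comp[OF mh_comp[OF ab(1) dsum_fst_hom] T1(2)]
     mh_comp[OF mh_comp[OF ab(1) dsum_snd_hom] T2(2)])
  then show "?h \<in> mod_hom R N (infl i (dsum (Top i N1) (Top i N2)))" by (simp add: mod_hom_def)
 next
  fix v assume "v \<in> carrier (dsum (Top i N1) (Top i N2))"
  then obtain n1 n2 where n: "n1 \<in> carrier N1" "n2 \<in> carrier N2" "v = (top_proj i N1 n1, top_proj i N2 n2)"
   unfolding dsum_simps T1(3)[symmetric] T2(3)[symmetric] by blast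
  then show "\<exists>n\<in>carrier N. ?h n = v" using ab(4)[of "(n1, n2)"] mh_closed[OF ab(2), of "(n1, n2)"]
   by (intro bexI[of _ "b (n1, n2)"]) auto
 next
  fix n assume n: "n \<in> carrier N" "?h n = \<zero>\<^bsub>dsum (Top i N1) (Top i N2)\<^esub>"
  interpret N1: right_module R N1 by (rule m)
  interpret N2: right_module R N2 by (rule m)
  have r: "fst (a n) \<in> radical_part i N1" "snd (a n) \<in> radical_part i N2"
   using n(2) top_proj_zero_iff[OF m(2) ac(1)[OF n(1)]] top_proj_zero_iff[OF m(3) ac(2)[OF n(1)]] by simp_all
  have "b (fst (a n), \<zero>\<^sub>N2) \<oplus>\<^sub>N b (\<zero>\<^sub>N1, snd (a n)) = b (a n)"
   using mh_add[OF ab(2), of "(fst (a n), \<zero>\<^sub>N2)" "(\<zero>\<^sub>N1, snd (a n))"] ac[OF n(1)] by simp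
  moreover have "b (fst (a n), \<zero>\<^sub>N2) \<in> radical_part i N" "b (\<zero>\<^sub>N1, snd (a n)) \<in> radical_part i N"
   using radical_part_map[OF m(2) m(1) mh_comp[OF dsum_inl_hom[OF m(3)] ab(2)] r(1)]
    radical_part_map[OF m(3) m(1) mh_comp[OF dsum_inr_hom[OF m(2)] ab(2)] r(2)] .
  ultimately show "n \<in> radical_part i N"
   using N.submod_add[OF radical_part_submod[OF m(1)]] ab(3)[OF n(1)] by metis
 qed
qed

lemma Top_cong:
 assumes m: "right_module R N" "right_module R N'" and iso: "mod_iso R N N'"
 shows "mod_iso (S i) (Top i N) (Top i N')"
proof -
 obtain a b where ab: "a \<in> mod_hom R N N'" "b \<in> mod_hom R N' N"
  "\<And>x. x \<in> carrier N \<Longrightarrow> b (a x) = x" "\<And>y. y \<in> carrier N' \<Longrightarrow> a (b y) = y"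
  using mod_iso_obtain[OF iso m(1)] by metis
 note T = Top[OF m(2), of i]
 interpret N': right_module R N' by (rule m)
 show ?thesis
 proof (rule Top_iso[OF m(1) T(1) mh_comp[OF ab(1) T(2)]])
  show "\<exists>n\<in>carrier N. top_proj i N' (a n) = v" if v: "v \<in> carrier (Top i N')" for v
  proof -
   obtain m where "m \<in> carrier N'" "v = top_proj i N' m" using v T(3) by blast
   then show ?thesis using ab(4) mh_closed[OF ab(2)] by (intro bexI[of _ "b m"]) simp_all
  qed
  fix n assume n: "n \<in> carrier N" "top_proj i N' (a n) = \<zero>\<^bsub>Top i N'\<^esub>"
  then have "a n \<in> radical_part i N'" using top_proj_zero_iff[OF m(2) mh_closed[OF ab(1) n(1)]] by simp
  from radical_part_map[OF m(2,1) ab(2) this] show "n \<in> radical_part i N" using ab(3)[OF n(1)] by simp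
 qed
qed

lemma Top_glue:
 assumes U: "\<And>i. right_module (S i) (U i)" shows "mod_iso (S i) (Top i (glue U)) (U i)"
proof (rule Top_iso[OF glue_module[OF U] U top_hom])
 show "\<exists>n\<in>carrier (glue U). fst n i = v" if "v \<in> carrier (U i)" for v
  using emb_closed(1)[OF U that] by (intro bexI[of _ "emb U i v"]) simp_all
 fix z assume z: "z \<in> carrier (glue U)" "fst z i = \<zero>\<^bsub>U i\<^esub>"
 note G = glue_module[OF U]
 interpret G: right_module R "glue U" by (rule G)
 note D = radical_part_submod[OF G, of i]
 obtain x y where xy: "z = (x, y)" "\<And>i. x i \<in> carrier (U i)" "\<And>k. y k \<in> carrier (U (\<sigma> k))"
  using z(1) by (elim glue_cases) blast
 have "emb U j (x j) \<in> radical_part i (glue U)" for j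
 proof (cases "j = i")
  case True
  then have "emb U j (x j) = \<zero>\<^bsub>glue U\<^esub>" using z(2) xy by (auto simp: emb_def)
  then show ?thesis using G.submod_zero[OF D] by simp
 next
  case False
  have "\<iota> j \<one>\<^bsub>S j\<^esub> \<odot>\<^bsub>glue U\<^esub> emb U j (x j) \<in> radical_part i (glue U)"
   using False by (intro radical_partI[OF G] emb_closed(1)[OF U] xy) (auto simp: closed pi_iota)
  then show ?thesis using emb_closed(2)[OF U xy(2)] by simp
 qed
 moreover have "\<beta> k \<odot>\<^bsub>glue U\<^esub> emb U (\<sigma> k) (y k) \<in> radical_part i (glue U)" for k
  by (intro radical_partI[OF G] emb_closed(1)[OF U] xy closed pi_beta)
 ultimately have "extend (glue U) (emb U) z \<in> radical_part i (glue U)"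
  unfolding extend_def xy(1) fst_conv snd_conv
  by (intro G.submod_add[OF D] G.submod_finsum[OF D] fin_\<Gamma>) auto
 then show "z \<in> radical_part i (glue U)" using glue_extend_emb[OF U z(1)] by simp
qed

lemma Top_fg:
 assumes "fg_module R N" shows "fg_module (S i) (Top i N)"
proof -
 note N = fg_mod_rm[OF assms]
 interpret N: right_module R N by (rule N)
 note T = Top[OF N, of i]
 interpret T: right_module "S i" "Top i N" by (rule T)
 obtain A where A: "finite A" "A \<subseteq> carrier N" "\<And>L. submod R L N \<Longrightarrow> A \<subseteq> L \<Longrightarrow> L = carrier N"
  using assms by (auto simp: fg_module_def fin_gen_def)
 have "L = carrier (Top i N)" if L: "submod (S i) L (Top i N)" "top_proj i N ` A \<subseteq> L" for L
 proof -
  have "{n \<in> carrier N. top_proj i N n \<in> L} = carrier N"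
   using L(2) A(2) infl_submod[OF T(1), of L] L(1)
   by (intro A(3) submod_vimage[OF N infl_module[OF T(1)] T(2)]) auto
  then have "carrier (Top i N) \<subseteq> L" unfolding T(3)[symmetric] by blast
  then show ?thesis using T.submod_subset[OF L(1)] by blast
 qed
 moreover have "top_proj i N ` A \<subseteq> carrier (Top i N)" using T(3) A(2) by blast
 ultimately have "fin_gen (S i) (Top i N)" unfolding fin_gen_def using A(1) by (intro exI[of _ "top_proj i N ` A"]) simp
 then show ?thesis using T(1) by (simp add: fg_module_def)
qed

text \<open>The forms of a dual basis, followed by \<open>\<pi> i\<close>, factor through the top.\<close>

lemma Top_fg_projective:
 assumes "fg_projective R P" shows "fg_projective (S i) (Top i P)"
proof -
 have P: "right_module R P" using assms by (simp add: fg_projective_def)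
 interpret P: right_module R P by (rule P)
 note T = Top[OF P, of i]
 note I = infl_module[OF T(1)]
 interpret T: right_module "S i" "Top i P" by (rule T)
 obtain m x \<phi> where db: "dual_basis R P m x \<phi>" using assms(1) by (auto simp: fg_projective_def)
 note b = dual_basisD[OF db]
 have c: "\<phi> j p \<in> carrier R" if "j < m" "p \<in> carrier P" for j p
  using mh_closed[OF b(2)] that by force
 have "\<exists>\<psi>. \<forall>j. j < m \<longrightarrow> \<psi> j \<in> mod_hom (S i) (Top i P) (reg (S i)) \<and>
  (\<forall>p\<in>carrier P. \<psi> j (top_proj i P p) = \<pi> i (\<phi> j p))"
 proof (rule choice, rule allI)
  fix j
  show "\<exists>\<psi>. j < m \<longrightarrow> \<psi> \<in> mod_hom (S i) (Top i P) (reg (S i)) \<and> (\<forall>p\<in>carrier P. \<psi> (top_proj i P p) = \<pi> i (\<phi> j p))"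
  proof (cases "j < m")
   case True
   have hom: "(\<lambda>p. \<pi> i (\<phi> j p)) \<in> mod_hom R P (infl i (reg (S i)))"
    using c[OF True] mh_add[OF b(2)[OF True]] mh_act[OF b(2)[OF True]]
    by (intro mod_homI) (auto simp: pi_closed pi_add pi_mult)
   show ?thesis by (rule Top_factor[OF P reg_module[OF S_ring] hom]) blast
  qed simp
 qed
 then obtain \<psi> where \<psi>: "\<And>j. j < m \<Longrightarrow> \<psi> j \<in> mod_hom (S i) (Top i P) (reg (S i))"
  "\<And>j p. j < m \<Longrightarrow> p \<in> carrier P \<Longrightarrow> \<psi> j (top_proj i P p) = \<pi> i (\<phi> j p)" by blast
 have tc: "top_proj i P p \<in> carrier (Top i P)" if "p \<in> carrier P" for p using T(3) that by blast
 have "finsum (Top i P) (\<lambda>j. \<psi> j q \<odot>\<^bsub>Top i P\<^esub> top_proj i P (x j)) {..<m} = q" if q: "q \<in> carrier (Top i P)" for q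
 proof -
  obtain p where p: "p \<in> carrier P" "q = top_proj i P p" using q T(3) by blast
  have am: "abelian_monoid P" "abelian_monoid (Top i P)"
   by (rule P.M.abelian_monoid_axioms, rule T.M.abelian_monoid_axioms)
  have "top_proj i P (finsum P (\<lambda>j. \<phi> j p \<odot>\<^sub>P x j) {..<m})
    = finsum (Top i P) (\<lambda>j. top_proj i P (\<phi> j p \<odot>\<^sub>P x j)) {..<m}"
   using tc mh_add[OF T(2)] mh_zero[OF P I T(2)] c p b(1)
   by (intro additive_finsum[OF am]) (auto simp: P.act_closed)
  also have "\<dots> = finsum (Top i P) (\<lambda>j. \<psi> j q \<odot>\<^bsub>Top i P\<^esub> top_proj i P (x j)) {..<m}"
   using p \<psi>(2) c b(1) mh_act[OF T(2)] tc
   by (intro T.M.finsum_cong') (auto simp: pi_closed intro!: T.act_closed)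
  finally show ?thesis using b(3)[OF p(1)] p(2) by simp
 qed
 then have "dual_basis (S i) (Top i P) m (\<lambda>j. top_proj i P (x j)) \<psi>"
  using \<psi>(1) tc b(1) by (simp add: dual_basis_def)
 then show ?thesis using T(1) by (auto simp: fg_projective_def)
qed

section \<open>The gluing functor on stable Grothendieck groups\<close>

abbreviation gluel :: "('i \<Rightarrow> ('d, 'd list) module) \<Rightarrow> ('c, 'c list) module" where
 "gluel U \<equiv> list_copy R (glue U)"

lemma gluel:
 assumes "\<And>i. U i \<in> fg_modules (S i)"
 shows "gluel U \<in> fg_modules R" "mod_iso R (glue U) (gluel U)" "mod_iso R (gluel U) (glue U)"
 using list_copy[OF glue_fg[OF fg_modulesD[OF assms]]] .

lemma K0_Top:
 obtains h where "h \<in> hom (K0 R) (K0 (S i))"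
  "\<And>M U. M \<in> fg_modules R \<Longrightarrow> (\<And>i. U i \<in> fg_modules (S i)) \<Longrightarrow> mod_iso R M (glue U) \<Longrightarrow>
   h (K0_class R M) = K0_class (S i) (U i)"
proof -
 let ?T = "\<lambda>M. list_copy (S i) (Top i M)"
 have T: "?T M \<in> fg_modules (S i)" "mod_iso (S i) (Top i M) (?T M)" "mod_iso (S i) (?T M) (Top i M)"
  if "M \<in> fg_modules R" for M
  using list_copy[OF Top_fg[OF fg_modulesD[OF that]]] .
 obtain h where h: "h \<in> hom (K0 R) (K0 (S i))" "\<And>M. M \<in> fg_modules R \<Longrightarrow> h (K0_class R M) = K0_class (S i) (?T M)"
 proof (rule K0_map[of R ?T "S i"])
  fix M N N' assume m: "M \<in> fg_modules R" "N \<in> fg_modules R" "N' \<in> fg_modules R" "mod_iso R M (dsum N N')"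
  have "mod_iso (S i) (?T M) (Top i M)" by (rule T(3)[OF m(1)])
  also have "mod_iso (S i) \<dots> (dsum (Top i N) (Top i N'))"
   using m by (intro Top_dsum fg_mods_rm)
  also have "mod_iso (S i) \<dots> (dsum (?T N) (?T N'))" using m by (intro dsum_iso T)
  finally show "mod_iso (S i) (?T M) (dsum (?T N) (?T N'))" .
 next
  fix P assume "projective R P"
  then have P: "P \<in> fg_modules R" "fg_projective R P" by (simp_all add: projective_iff)
  show "projective (S i) (?T P)"
   using T[OF P(1)] fg_projective_iso[OF T(2)[OF P(1)] Top_fg_projective[OF P(2)]]
   by (simp add: projective_iff fg_mods_rm)
 qed (use T that in auto)
 show thesis
 proof (rule that[OF h(1)])
  fix M U assume m: "M \<in> fg_modules R" "\<And>i. U i \<in> fg_modules (S i)" "mod_iso R M (glue U)"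
  note Um = fg_mods_rm[OF m(2)]
  have "mod_iso (S i) (?T M) (Top i M)" by (rule T(3)[OF m(1)])
  also have "mod_iso (S i) \<dots> (Top i (glue U))"
   by (rule Top_cong[OF fg_mods_rm[OF m(1)] glue_module[OF Um] m(3)])
  also have "mod_iso (S i) \<dots> (U i)" by (rule Top_glue[OF Um])
  finally show "h (K0_class R M) = K0_class (S i) (U i)"
   using h(2)[OF m(1)] K0_class_iso[OF T(1)[OF m(1)] m(2)] by simp
 qed
qed

abbreviation only :: "'i \<Rightarrow> ('d, 'd list) module \<Rightarrow> 'i \<Rightarrow> ('d, 'd list) module" where
 "only i M \<equiv> (\<lambda>_. zero_module)(i := M)"

lemma zero_module_S: "zero_module \<in> fg_modules (S i)" "right_module (S i) zero_module"
 "carrier zero_module = {\<zero>\<^bsub>zero_module :: ('d, 'd list) module\<^esub>}"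
proof -
 note z = zero_module[OF S_ring, of i, unfolded zero_modules_iff]
 show "zero_module \<in> fg_modules (S i)" by (rule fg_modulesI[OF fg_module_zero[OF conjunct1[OF z] conjunct2[OF z]]])
 show "right_module (S i) zero_module" by (rule conjunct1[OF z])
 show "carrier zero_module = {\<zero>\<^bsub>zero_module :: ('d, 'd list) module\<^esub>}" by (rule conjunct2[OF z])
qed

lemma only_fg: "M \<in> fg_modules (S i) \<Longrightarrow> only i M j \<in> fg_modules (S j)"
 by (simp add: zero_module_S)

lemma glue_dsum_family:
 assumes U: "\<And>i. U i \<in> fg_modules (S i)" "\<And>i. V i \<in> fg_modules (S i)" "\<And>i. W i \<in> fg_modules (S i)"
  and iso: "\<And>i. mod_iso (S i) (U i) (dsum (V i) (W i))"
 shows "mod_iso R (gluel U) (dsum (gluel V) (gluel W))"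
proof -
 have "mod_iso R (gluel U) (glue U)" by (rule gluel(3)[OF U(1)])
 also have "mod_iso R \<dots> (glue (\<lambda>i. dsum (V i) (W i)))"
  by (rule glue_cong[OF iso fg_mods_rm[OF U(1)]])
 also have "mod_iso R \<dots> (dsum (glue V) (glue W))" by (rule glue_dsum)
 also have "mod_iso R \<dots> (dsum (gluel V) (gluel W))" by (rule dsum_iso[OF gluel(2)[OF U(2)] gluel(2)[OF U(3)]])
 finally show ?thesis .
qed

lemma glue_split:
 assumes U: "\<And>i. U i \<in> fg_modules (S i)"
 shows "mod_iso R (gluel U) (dsum (gluel (only i (U i))) (gluel (U(i := zero_module))))"
proof (rule glue_dsum_family[OF U])
 note m = fg_mods_rm[OF U]
 show "mod_iso (S j) (U j) (dsum (only i (U i) j) ((U(i := zero_module)) j))" for j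
 proof (cases "j = i")
  case True
  then show ?thesis using mod_iso_sym[OF dsum_zero_right[OF m zero_module_S(2,3)] dsum_module[OF m zero_module_S(2)]] by simp
 next
  case False
  then show ?thesis using mod_iso_sym[OF dsum_zero_left[OF m zero_module_S(2,3)] dsum_module[OF zero_module_S(2) m]] by simp
 qed
qed (use U zero_module_S in auto)

lemma K0_glue_only:
 obtains h where "h \<in> hom (K0 (S i)) (K0 R)" "\<And>M. M \<in> fg_modules (S i) \<Longrightarrow> h (K0_class (S i) M) = K0_class R (gluel (only i M))"
proof (rule K0_map[of "S i" "\<lambda>M. gluel (only i M)" R])
 show "gluel (only i M) \<in> fg_modules R" if "M \<in> fg_modules (S i)" for M by (rule gluel(1)[OF only_fg[OF that]])
 fix M N N' assume m: "M \<in> fg_modules (S i)" "N \<in> fg_modules (S i)" "N' \<in> fg_modules (S i)" "mod_iso (S i) M (dsum N N')"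
 have z: "mod_iso (S j) zero_module (dsum zero_module zero_module)" for j
  by (rule zero_modules_iso) (auto simp: zero_module_S dsum_module)
 show "mod_iso R (gluel (only i M)) (dsum (gluel (only i N)) (gluel (only i N')))"
  using m z by (intro glue_dsum_family only_fg) auto
next
 fix P assume "projective (S i) P"
 then have P: "P \<in> fg_modules (S i)" "fg_projective (S i) P" by (simp_all add: projective_iff)
 have "fg_projective (S j) (only i P j)" for j
  using P fg_projective_zero[OF zero_module_S(2,3)] by simp
 then have "fg_projective R (glue (only i P))" by (rule glue_fg_projective)
 then show "projective R (gluel (only i P))"
  using gluel[of "only i P", OF only_fg[OF P(1)]] fg_projective_iso fg_mods_rm
  unfolding projective_iff by blast
qed (use that in blast)

text \<open>Gluing is not defined on products of Grothendieck groups, but it is on each factor; a glued family is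
 the sum of its components glued separately.\<close>

lemma K0_glue_cong:
 assumes U: "\<And>i. U i \<in> fg_modules (S i)" and V: "\<And>i. V i \<in> fg_modules (S i)"
  and eq: "\<And>i. K0_class (S i) (U i) = K0_class (S i) (V i)"
 shows "K0_class R (gluel U) = K0_class R (gluel V)"
proof -
 have step: "K0_class R (gluel W) = K0_class R (gluel (W(i := V i)))"
  if W: "\<And>i. W i \<in> fg_modules (S i)" "K0_class (S i) (W i) = K0_class (S i) (V i)" for W i
 proof -
  obtain h where h: "h \<in> hom (K0 (S i)) (K0 R)" "\<And>M. M \<in> fg_modules (S i) \<Longrightarrow> h (K0_class (S i) M) = K0_class R (gluel (only i M))"
   using K0_glue_only by blast
  have s: "K0_class R (gluel W') = h (K0_class (S i) (W' i)) \<otimes>\<^bsub>K0 R\<^esub> K0_class R (gluel (W'(i := zero_module)))"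
   if W': "\<And>i. W' i \<in> fg_modules (S i)" for W'
  proof -
   have z: "(W'(i := zero_module)) j \<in> fg_modules (S j)" for j using W' zero_module_S by simp
   show ?thesis
    using K0_class_dsum[OF gluel(1)[OF W'] gluel(1)[OF only_fg[OF W']] gluel(1)[OF z] glue_split[OF W']] h(2)[OF W'] by simp
  qed
  have "(W(i := V i)) j \<in> fg_modules (S j)" for j using W V by simp
  from s[of "W(i := V i)", OF this] s[OF W(1)] show ?thesis using W(2) by simp
 qed
 have "K0_class R (gluel U) = K0_class R (gluel (\<lambda>j. if j \<in> A then V j else U j))" if "finite A" for A
  using that
 proof (induction A rule: finite_induct)
  case (insert i A)
  let ?W = "\<lambda>j. if j \<in> A then V j else U j"
  have "K0_class R (gluel ?W) = K0_class R (gluel (?W(i := V i)))"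
   using insert.hyps U V eq by (intro step) auto
  moreover have "?W(i := V i) = (\<lambda>j. if j \<in> insert i A then V j else U j)" by (auto simp: fun_eq_iff)
  ultimately show ?case using insert.IH by simp
 qed simp
 from this[of UNIV] show ?thesis by simp
qed

section \<open>Direct summands of glued modules are glued\<close>

text \<open>A retract \<open>N\<close> of \<open>glue U\<close> induces idempotents on the tops \<open>U i\<close>; their images \<open>V i\<close> glue to a module
 that maps to \<open>N\<close> isomorphically, by comparing tops and the parts below them.\<close>

lemma glue_summand:
 assumes U: "\<And>i. U i \<in> fg_modules (S i)" and N: "right_module R N"
  and j: "j \<in> mod_hom R N (glue U)" and p: "p \<in> mod_hom R (glue U) N" and pj: "\<And>n. n \<in> carrier N \<Longrightarrow> p (j n) = n"
 obtains V where "\<And>i. dir_summand (S i) (V i) (U i)" "mod_iso R N (glue V)"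
proof -
 let ?G = "glue U"
 note Um = fg_mods_rm[OF U]
 note G = glue_module[OF Um]
 interpret G: right_module R "glue U" by (rule G)
 interpret N: right_module R N by (rule N)
 note jc = mh_closed[OF j] and pc = mh_closed[OF p]
 note emc = emb_closed(1)[OF Um]
 \<comment> \<open>the idempotent endomorphism with image \<open>N\<close>, and the idempotents it induces on the tops\<close>
 define q where "q z = j (p z)" for z
 define e where "e i x = fst (q (emb U i x)) i" for i x
 have q: "q \<in> mod_hom R ?G ?G" unfolding q_def by (rule mh_comp[OF p j])
 note qc = mh_closed[OF q]
 have qtop: "(\<lambda>z. fst (q z) i) \<in> mod_hom R ?G (infl i (U i))" for i by (rule mh_comp[OF q top_hom])
 have fst_q: "fst (q z) i = e i (fst z i)" if "z \<in> carrier ?G" for z i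
  unfolding e_def by (rule hom_infl_top[OF Um Um qtop that])
 have e: "e i \<in> mod_hom (S i) (U i) (U i)" for i
 proof (rule mod_homI)
  note qe = mh_comp[OF emb_hom[OF Um] res_hom[OF qtop], of i]
  show "e i x \<in> carrier (U i)" if "x \<in> carrier (U i)" for x
   using mh_closed[OF qe that] by (simp add: e_def)
  show "e i (x \<oplus>\<^bsub>U i\<^esub> y) = e i x \<oplus>\<^bsub>U i\<^esub> e i y" if "x \<in> carrier (U i)" "y \<in> carrier (U i)" for x y
   using mh_add[OF qe that] by (simp add: e_def)
  show "e i (a \<odot>\<^bsub>U i\<^esub> x) = a \<odot>\<^bsub>U i\<^esub> e i x" if "a \<in> carrier (S i)" "x \<in> carrier (U i)" for a x
   using mh_act[OF qe that] that by (simp add: e_def pi_iota)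
 qed
 note ec = mh_closed[OF e]
 have qq: "q (q z) = q z" if "z \<in> carrier ?G" for z using pj[OF pc[OF that]] by (simp add: q_def)
 have ee: "e i (e i x) = e i x" if "x \<in> carrier (U i)" for i x
 proof -
  have "fst (q (q (emb U i x))) i = e i (fst (q (emb U i x)) i)" by (rule fst_q[OF qc[OF emc[OF that]]])
  then show ?thesis unfolding qq[OF emc[OF that]] e_def[of i x, symmetric] by (rule sym)
 qed
 define W where "W i = (U i)\<lparr>carrier := e i ` carrier (U i)\<rparr>" for i
 have Wsub: "submod (S i) (e i ` carrier (U i)) (U i)" for i
  by (rule submod_image[OF Um Um e right_module.submod_carrier[OF Um]])
 have Wfg: "fg_module (S i) (W i)" for i
  unfolding W_def by (rule fg_module_submod[OF S_fl fg_modulesD[OF U] Wsub])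
 note Wm = fg_mod_rm[OF Wfg]
 have WU: "x \<in> carrier (W i) \<Longrightarrow> x \<in> carrier (U i)" for x i using ec by (auto simp: W_def)
 have eW: "x \<in> carrier (W i) \<Longrightarrow> e i x = x" for x i using ee by (auto simp: W_def)
 have eW': "x \<in> carrier (U i) \<Longrightarrow> e i x \<in> carrier (W i)" for x i by (auto simp: W_def)
 have W_simps [simp]: "\<zero>\<^bsub>W i\<^esub> = \<zero>\<^bsub>U i\<^esub>" "add (W i) = add (U i)" "smult (W i) = smult (U i)" for i
  by (simp_all add: W_def)
 have glue_WU: "z \<in> carrier (glue W) \<Longrightarrow> z \<in> carrier ?G" for z
  using WU by (cases z) auto
 have emb_W: "emb W i x = emb U i x" for i x by (simp add: emb_def fun_eq_iff)
 let ?h = "\<lambda>i x. p (emb U i x)"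
 have h: "?h i \<in> mod_hom (S i) (W i) (res i N)" for i
  using mh_comp[OF mh_comp[OF submod_inclusion[OF Wsub Um] emb_hom[OF Um]] res_hom[OF p], of i] by (simp add: W_def)
 let ?\<Psi> = "extend N ?h"
 have \<Psi>: "?\<Psi> \<in> mod_hom R (glue W) N" by (rule extend_hom[OF N Wm h])
 have \<Psi>_emb: "?\<Psi> (emb U i x) = p (emb U i x)" if "x \<in> carrier (W i)" for i x
  using extend_emb[OF N Wm h that] by (simp add: emb_W)
 have top_\<Psi>: "fst (j (?\<Psi> z)) i = fst z i" if z: "z \<in> carrier (glue W)" for z i
 proof -
  have F: "(\<lambda>z. fst (j (?\<Psi> z)) i) \<in> mod_hom R (glue W) (infl i (U i))"
   by (rule mh_comp[OF mh_comp[OF \<Psi> j] top_hom])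
  have zi: "fst z i \<in> carrier (W i)" using z by (elim glue_cases) auto
  have "fst (j (?\<Psi> z)) i = fst (j (?\<Psi> (emb W i (fst z i)))) i" by (rule hom_infl_top[OF Wm Um F z])
  also have "\<dots> = e i (fst z i)" using \<Psi>_emb[OF zi] by (simp add: emb_W e_def q_def)
  finally show ?thesis using eW[OF zi] by simp
 qed
 have bot_\<Psi>: "j (?\<Psi> z) = z" if z: "z \<in> bottom W" for z
 proof -
  have zW: "z \<in> carrier (glue W)" and zU: "z \<in> bottom U" using z glue_WU by (auto simp: bottom_def)
  have zk: "snd z k \<in> carrier (W (\<sigma> k))" for k using zW by (elim glue_cases) auto
  have "j (?\<Psi> z) = extend ?G (\<lambda>i x. q (emb U i x)) z"
   unfolding q_def by (rule extend_natural[OF N G j _ zW]) (use pc emc WU in blast)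
  also have "\<dots> = finsum ?G (\<lambda>k. \<beta> k \<odot>\<^sub>?G q (emb U (\<sigma> k) (snd z k))) \<Gamma>"
  proof -
   have "emb U i \<zero>\<^bsub>U i\<^esub> = \<zero>\<^sub>?G" for i by (auto simp: emb_def)
   then have "q (emb U i (fst z i)) = \<zero>\<^sub>?G" for i
    using z mh_zero[OF G G q] by (simp add: bottom_def)
   moreover have "finsum ?G (\<lambda>k. \<beta> k \<odot>\<^sub>?G q (emb U (\<sigma> k) (snd z k))) \<Gamma> \<in> carrier ?G"
    using zk WU by (intro G.finsum_closed) (auto intro!: G.act_closed closed qc emc)
   ultimately show ?thesis by (simp add: extend_def G.finsum_zero del: glue_simps(2))
  qed
  also have "\<dots> = z"
   using zk WU fst_q[OF emc] eW by (intro bottom_eq_sum[OF Um zU, symmetric] qc emc) auto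
  finally show ?thesis .
 qed
 have "mod_iso R (glue W) N"
 proof (rule mod_isoI_kernel[OF glue_module[OF Wm] N \<Psi>])
  fix z assume z: "z \<in> carrier (glue W)" "?\<Psi> z = \<zero>\<^sub>N"
  have j0: "j \<zero>\<^sub>N = \<zero>\<^sub>?G" by (rule mh_zero[OF N G j])
  have "fst z i = \<zero>\<^bsub>W i\<^esub>" for i using top_\<Psi>[OF z(1), of i] z(2) j0 by simp
  then have "z \<in> bottom W" using z(1) by (simp add: bottom_def)
  then have "z = j (?\<Psi> z)" using bot_\<Psi> by simp
  then show "z = \<zero>\<^bsub>glue W\<^esub>" using z(2) j0 by simp
 next
  fix n assume n: "n \<in> carrier N"
  let ?I = "?\<Psi> ` carrier (glue W)"
  have I: "submod R ?I N" by (rule submod_image[OF glue_module[OF Wm] N \<Psi> right_module.submod_carrier[OF glue_module[OF Wm]]])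
  have pI: "p (emb U i x) \<in> ?I" if "x \<in> carrier (W i)" for i x
   using \<Psi>_emb[OF that] emb_closed(1)[OF Wm that] by (metis emb_W imageI)
  \<comment> \<open>\<open>p\<close> applied to an element with tops and bottoms in \<open>W\<close> lies in the image; for \<open>u = j n\<close> the
   bottoms enter only through \<open>\<beta>\<close>, where they may be replaced by their images under \<open>e\<close>\<close>
  let ?u = "j n"
  have u: "?u \<in> carrier ?G" "q ?u = ?u" "p ?u = n" using jc n pj by (auto simp: q_def)
  have uk: "snd ?u k \<in> carrier (U (\<sigma> k))" for k using u(1) by (elim glue_cases) auto
  have ui: "fst ?u i \<in> carrier (U i)" for i using u(1) by (elim glue_cases) auto
  have top: "p (emb U i (fst ?u i)) \<in> ?I" for i
   using fst_q[OF u(1), of i] u(2) eW'[OF ui] by (intro pI) metis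
  have bot: "\<beta> k \<odot>\<^sub>N p (emb U (\<sigma> k) (snd ?u k)) \<in> ?I" for k
  proof -
   let ?x = "snd ?u k"
   have "\<beta> k \<odot>\<^sub>N p (emb U (\<sigma> k) ?x) = p (q (\<beta> k \<odot>\<^sub>?G emb U (\<sigma> k) ?x))"
    using mh_act[OF p beta_closed emc[OF uk]] pj[OF pc[OF G.act_closed[OF beta_closed emc[OF uk]]]]
    by (simp add: q_def)
   also have "\<dots> = p (\<beta> k \<odot>\<^sub>?G q (emb U (\<sigma> k) ?x))"
    using mh_act[OF q beta_closed emc[OF uk]] by simp
   also have "\<dots> = p (\<beta> k \<odot>\<^sub>?G emb U (\<sigma> k) (e (\<sigma> k) ?x))"
    using fst_q[OF emc[OF uk]] by (subst beta_act_top[OF Um qc[OF emc[OF uk]] emc[OF ec[OF uk]]]) auto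
   also have "\<dots> = \<beta> k \<odot>\<^sub>N p (emb U (\<sigma> k) (e (\<sigma> k) ?x))"
    using mh_act[OF p beta_closed emc[OF ec[OF uk]]] .
   also have "\<dots> \<in> ?I" by (intro N.submod_act[OF I] beta_closed pI eW' uk)
   finally show ?thesis .
  qed
  have "extend N ?h ?u \<in> ?I"
   by (subst extend_def) (intro N.submod_add[OF I] N.submod_finsum[OF I] fin_\<Gamma> top bot finite)
  then have "n \<in> ?I" using hom_eq_extend[OF Um N p u(1)] u(3) by simp
  then show "\<exists>z\<in>carrier (glue W). ?\<Psi> z = n" by blast
 qed
 note NW = mod_iso_sym[OF this glue_module[OF Wm]]
 define V where "V i = list_copy (S i) (W i)" for i
 note V = list_copy[OF Wfg, folded V_def]
 have "dir_summand (S i) (V i) (U i)" for i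
 proof -
  obtain a b where ab: "a \<in> mod_hom (S i) (W i) (V i)" "b \<in> mod_hom (S i) (V i) (W i)"
   "\<And>y. y \<in> carrier (V i) \<Longrightarrow> a (b y) = y"
   using mod_iso_obtain[OF V(2) Wm] by metis
  have eWh: "e i \<in> mod_hom (S i) (U i) (W i)"
   using mh_add[OF e] mh_act[OF e] eW' by (auto intro!: mod_homI)
  have bU: "b \<in> mod_hom (S i) (V i) (U i)"
   using mh_comp[OF ab(2) submod_inclusion[OF Wsub Um, of i, folded W_def]] .
  show ?thesis
   by (rule dir_summand_retract[OF S_fl V(1) U bU mh_comp[OF eWh ab(1)]])
     (use eW mh_closed[OF ab(2)] ab(3) in simp)
 qed
 moreover have "mod_iso R N (glue V)" by (rule mod_iso_trans[OF NW glue_cong[OF V(2) Wm]])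
 ultimately show thesis using that by blast
qed

lemma reg_glue: "mod_iso R (reg R) (glue (\<lambda>i. reg (S i)))"
proof (rule mod_isoI_kernel[OF reg_module[OF R_ring] glue_module[OF reg_module[OF S_ring]], of "\<lambda>r. (\<lambda>i. \<pi> i r, \<lambda>k. \<gamma> k r)"])
 show "(\<lambda>r. (\<lambda>i. \<pi> i r, \<lambda>k. \<gamma> k r)) \<in> mod_hom R (reg R) (glue (\<lambda>i. reg (S i)))"
  by (rule mod_homI) (auto simp: closed gam_eta pi_add gam_add pi_mult gam_mult)
next
 fix r assume r: "r \<in> carrier (reg R)" "(\<lambda>i. \<pi> i r, \<lambda>k. \<gamma> k r) = \<zero>\<^bsub>glue (\<lambda>i. reg (S i))\<^esub>"
 then have "\<pi> i r = \<zero>\<^bsub>S i\<^esub>" "\<gamma> k r = \<zero>\<^bsub>S (\<sigma> k)\<^esub>" for i k by (auto simp: fun_eq_iff)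
 then show "r = \<zero>\<^bsub>reg R\<^esub>"
  using decomposition[of r] r(1) by (simp add: iota_zero closed R.finsum_zero)
next
 fix z assume "z \<in> carrier (glue (\<lambda>i. reg (S i)))"
 then obtain x y where z: "z = (x, y)" "\<And>i. x i \<in> carrier (S i)" "\<And>k. y k \<in> carrier (S (\<sigma> k))"
  "\<And>k. y k \<otimes>\<^bsub>S (\<sigma> k)\<^esub> \<eta> k = y k" by (elim glue_cases) auto
 let ?a = "finsum R (\<lambda>i. \<iota> i (x i)) UNIV" and ?b = "finsum R (\<lambda>k. \<iota> (\<sigma> k) (y k) \<otimes>\<^sub>R \<beta> k) \<Gamma>"
 have f: "(\<lambda>i. \<iota> i (x i)) \<in> UNIV \<rightarrow> carrier R" "(\<lambda>k. \<iota> (\<sigma> k) (y k) \<otimes>\<^sub>R \<beta> k) \<in> \<Gamma> \<rightarrow> carrier R"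
  using z by (auto simp: closed)
 then have ab: "?a \<in> carrier R" "?b \<in> carrier R" by (auto intro!: R.finsum_closed)
 have gz: "\<gamma> k \<zero>\<^sub>R = \<zero>\<^bsub>S (\<sigma> k)\<^esub>" for k using gam_iota[OF S.zero_closed, of k undefined] by (simp add: iota_zero)
 note am = R.abelian_monoid_axioms
 have pa: "\<pi> i ?a = x i" for i
 proof -
  have "\<pi> i ?a = finsum (S i) (\<lambda>j. \<pi> i (\<iota> j (x j))) UNIV"
   by (rule additive_finsum[OF am S.abelian_monoid_axioms _ _ _ _ f(1)]) (auto simp: pi_closed pi_add pi_zero)
  also have "\<dots> = finsum (S i) (\<lambda>j. if i = j then x i else \<zero>\<^bsub>S i\<^esub>) UNIV"
   using z by (intro S.finsum_cong') (auto simp: pi_iota)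
  also have "\<dots> = x i" using z by (subst S.finsum_singleton) auto
  finally show ?thesis .
 qed
 have pb: "\<pi> i ?b = \<zero>\<^bsub>S i\<^esub>" for i
 proof -
  have "\<pi> i ?b = finsum (S i) (\<lambda>k. \<pi> i (\<iota> (\<sigma> k) (y k) \<otimes>\<^sub>R \<beta> k)) \<Gamma>"
   by (rule additive_finsum[OF am S.abelian_monoid_axioms _ _ _ fin_\<Gamma> f(2)]) (auto simp: pi_closed pi_add pi_zero)
  also have "\<dots> = \<zero>\<^bsub>S i\<^esub>" using z by (simp add: pi_mult closed pi_beta S.finsum_zero)
  finally show ?thesis .
 qed
 have ga: "\<gamma> k ?a = \<zero>\<^bsub>S (\<sigma> k)\<^esub>" for k
 proof -
  have "\<gamma> k ?a = finsum (S (\<sigma> k)) (\<lambda>j. \<gamma> k (\<iota> j (x j))) UNIV"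
   by (rule additive_finsum[OF am S.abelian_monoid_axioms _ _ _ _ f(1)]) (auto simp: gam_closed gam_add gz)
  also have "\<dots> = \<zero>\<^bsub>S (\<sigma> k)\<^esub>" using z by (simp add: gam_iota S.finsum_zero)
  finally show ?thesis .
 qed
 have gb: "\<gamma> l ?b = y l" for l
 proof -
  have "\<gamma> l ?b = finsum (S (\<sigma> l)) (\<lambda>k. \<gamma> l (\<iota> (\<sigma> k) (y k) \<otimes>\<^sub>R \<beta> k)) \<Gamma>"
   by (rule additive_finsum[OF am S.abelian_monoid_axioms _ _ _ fin_\<Gamma> f(2)]) (auto simp: gam_closed gam_add gz)
  also have "\<dots> = finsum (S (\<sigma> l)) (\<lambda>k. if l = k then y l else \<zero>\<^bsub>S (\<sigma> l)\<^esub>) \<Gamma>"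
   using z by (intro S.finsum_cong') (auto simp: gam_mult closed gam_iota eps_beta gam_beta pi_iota)
  also have "\<dots> = y l"
  proof (cases "l \<in> \<Gamma>")
   case True
   then show ?thesis using z fin_\<Gamma> by (subst S.finsum_singleton) auto
  next
   case False
   then have "y l = \<zero>\<^bsub>S (\<sigma> l)\<^esub>" using z(4)[of l] z(3)[of l] eta_off by simp
   then have "(\<lambda>k. if l = k then y l else \<zero>\<^bsub>S (\<sigma> l)\<^esub>) = (\<lambda>_. \<zero>\<^bsub>S (\<sigma> l)\<^esub>)" by auto
   then show ?thesis using \<open>y l = \<zero>\<^bsub>S (\<sigma> l)\<^esub>\<close> by (simp add: S.finsum_zero)
  qed
  finally show ?thesis .
 qed
 have "\<pi> i (?a \<oplus>\<^sub>R ?b) = x i" "\<gamma> k (?a \<oplus>\<^sub>R ?b) = y k" for i k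
  using ab z pa pb ga gb by (simp_all add: pi_add gam_add)
 then show "\<exists>r\<in>carrier (reg R). (\<lambda>i. \<pi> i r, \<lambda>k. \<gamma> k r) = z"
  using ab z(1) by (intro bexI[of _ "?a \<oplus>\<^sub>R ?b"]) auto
qed

lemma free_glue: "\<exists>U. (\<forall>i. U i \<in> fg_modules (S i)) \<and> mod_iso R (free_mod R m) (glue U)"
proof (induction m)
 case 0
 have "mod_iso R (free_mod R 0) (glue (\<lambda>_. zero_module :: ('d, 'd list) module))"
 proof (rule zero_modules_iso)
  show "right_module R (free_mod R 0)" by (rule fg_mod_rm[OF fg_module_free[OF R_ring]])
  show "carrier (free_mod R 0) = {\<zero>\<^bsub>free_mod R 0\<^esub>}" unfolding free_mod_def by (rule dsum_family_0)
 qed (intro glue_module glue_zero zero_module_S)+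
 then show ?case using zero_module_S(1) by (intro exI[of _ "\<lambda>_. zero_module"]) simp
next
 case (Suc m)
 then obtain U where U: "\<And>i. U i \<in> fg_modules (S i)" "mod_iso R (free_mod R m) (glue U)" by blast
 have D: "fg_module (S i) (dsum (U i) (reg (S i)))" for i
  by (rule fg_module_dsum[OF fg_modulesD[OF U(1)] fg_module_reg[OF S_ring]])
 have Dm: "right_module (S i) (dsum (U i) (reg (S i)))" for i by (rule fg_mod_rm[OF D])
 let ?V = "\<lambda>i. list_copy (S i) (dsum (U i) (reg (S i)))"
 have "mod_iso R (free_mod R (Suc m)) (dsum (free_mod R m) (reg R))"
  unfolding free_mod_def by (rule dsum_family_Suc)
 also have "mod_iso R \<dots> (dsum (glue U) (glue (\<lambda>i. reg (S i))))" by (rule dsum_iso[OF U(2) reg_glue])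
 also have "mod_iso R \<dots> (glue (\<lambda>i. dsum (U i) (reg (S i))))"
  by (rule mod_iso_sym[OF glue_dsum glue_module[OF Dm]])
 also have "mod_iso R \<dots> (glue ?V)" by (rule glue_cong[OF list_copy(2)[OF D] Dm])
 finally show ?case using list_copy(1)[OF D] by (intro exI[of _ ?V]) simp
qed

lemma projective_glue:
 assumes "fg_projective R P"
 obtains U where "\<And>i. U i \<in> fg_modules (S i)" "mod_iso R P (glue U)"
proof -
 have P: "right_module R P" using assms by (simp add: fg_projective_def)
 obtain m a b where ab: "a \<in> mod_hom R P (free_mod R m)" "b \<in> mod_hom R (free_mod R m) P"
  "\<And>x. x \<in> carrier P \<Longrightarrow> b (a x) = x"
  using fg_projective_free_retract[OF assms] by metis
 obtain U where U: "\<And>i. U i \<in> fg_modules (S i)" "mod_iso R (free_mod R m) (glue U)" using free_glue by blast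
 obtain c d where cd: "c \<in> mod_hom R (free_mod R m) (glue U)" "d \<in> mod_hom R (glue U) (free_mod R m)"
  "\<And>x. x \<in> carrier (free_mod R m) \<Longrightarrow> d (c x) = x"
  using mod_iso_obtain[OF U(2) fg_mod_rm[OF fg_module_free[OF R_ring]]] by metis
 obtain V where V: "\<And>i. dir_summand (S i) (V i) (U i)" "mod_iso R P (glue V)"
 proof (rule glue_summand[OF U(1) P mh_comp[OF ab(1) cd(1)] mh_comp[OF cd(2) ab(2)]])
  show "b (d (c (a n))) = n" if "n \<in> carrier P" for n
   using ab(3)[OF that] cd(3)[OF mh_closed[OF ab(1) that]] by simp
 qed blast
 then show thesis using that dir_summand_fg by blast
qed

end

lemma complement_retraction:
 assumes M: "right_module R M" and K: "submod R K M" and L: "submod R L M"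
  and KL: "K \<inter> L = {\<zero>\<^sub>M}" "K <+>\<^sub>M L = carrier M"
 obtains \<rho> where "\<rho> \<in> mod_hom R M (M\<lparr>carrier := K\<rparr>)" "\<And>x. x \<in> K \<Longrightarrow> \<rho> x = x" "\<And>x. x \<in> L \<Longrightarrow> \<rho> x = \<zero>\<^sub>M"
proof -
 interpret M: right_module R M by (rule M)
 note c = subsetD[OF M.submod_subset[OF K]] subsetD[OF M.submod_subset[OF L]]
 let ?D = "dsum (M\<lparr>carrier := K\<rparr>) (M\<lparr>carrier := L\<rparr>)" and ?s = "\<lambda>z. fst z \<oplus>\<^sub>M snd z"
 have D: "right_module R ?D" by (rule dsum_module[OF M.submod_module[OF K] M.submod_module[OF L]])
 have s: "?s \<in> mod_hom R ?D M" by (rule dsum_copair_hom[OF M submod_inclusion[OF K M] submod_inclusion[OF L M]])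
 have "inj_on ?s (carrier ?D)" unfolding mh_inj_iff[OF D M s]
 proof (intro ballI impI)
  fix z assume z: "z \<in> carrier ?D" "fst z \<oplus>\<^sub>M snd z = \<zero>\<^sub>M"
  then have "\<ominus>\<^sub>M snd z = fst z" using c by (intro M.minus_equality) auto
  then have "fst z \<in> K \<inter> L" using z M.submod_uminus[OF L, of "snd z"] by auto
  then show "z = \<zero>\<^sub>?D" using KL z c by (auto simp: prod_eq_iff)
 qed
 moreover have "?s ` carrier ?D = carrier M" unfolding KL(2)[symmetric] set_add_def' by force
 ultimately have b: "bij_betw ?s (carrier ?D) (carrier M)" by (simp only: bij_betw_def simp_thms)
 obtain t where t: "t \<in> mod_hom R M ?D" "\<And>z. z \<in> carrier ?D \<Longrightarrow> t (?s z) = z"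
  by (rule mh_inverse[OF s b D]) blast
 show thesis
 proof (rule that[OF mh_comp[OF t(1) dsum_fst_hom]])
  show "fst (t x) = x" if "x \<in> K" for x using t(2)[of "(x, \<zero>\<^sub>M)"] that M.submod_zero[OF L] c by simp
  show "fst (t x) = \<zero>\<^sub>M" if "x \<in> L" for x using t(2)[of "(\<zero>\<^sub>M, x)"] that M.submod_zero[OF K] c by simp
 qed
qed

context glued_rings
begin

section \<open>Submodules of glued modules\<close>

definition killed :: "('c, 'm) module \<Rightarrow> bool" where
 "killed M \<longleftrightarrow> (\<forall>r\<in>rad. \<forall>x\<in>carrier M. r \<odot>\<^sub>M x = \<zero>\<^sub>M)"

lemma killed_retraction:
 assumes M: "fg_module R M" "killed M" and K: "submod R K M"
 obtains \<rho> where "\<rho> \<in> mod_hom R M (M\<lparr>carrier := K\<rparr>)" "\<And>x. x \<in> K \<Longrightarrow> \<rho> x = x"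
proof -
 note Mm = fg_mod_rm[OF M(1)]
 interpret M: right_module R M by (rule Mm)
 let ?L = "list_copy R M"
 note L = list_copy[OF M(1)]
 interpret L: right_module R ?L by (rule fg_mods_rm[OF L(1)])
 obtain a b where ab: "a \<in> mod_hom R M ?L" "b \<in> mod_hom R ?L M"
  "\<And>x. x \<in> carrier M \<Longrightarrow> b (a x) = x" "\<And>y. y \<in> carrier ?L \<Longrightarrow> a (b y) = y"
  using mod_iso_obtain[OF L(2) Mm] by metis
 note ac = mh_closed[OF ab(1)] and bc = mh_closed[OF ab(2)]
 have kill: "r \<odot>\<^sub>?L x = \<zero>\<^sub>?L" if rx: "r \<in> rad" "x \<in> carrier ?L" for r x
 proof -
  have r: "r \<in> carrier R" using rx rad_subset by blast
  have "r \<odot>\<^sub>?L x = a (r \<odot>\<^sub>M b x)" using mh_act[OF ab(1) r bc[OF rx(2)]] ab(4)[OF rx(2)] by simp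
  also have "\<dots> = a \<zero>\<^sub>M" using M(2) rx bc by (simp add: killed_def)
  also have "\<dots> = \<zero>\<^sub>?L" by (rule mh_zero[OF Mm L.right_module_axioms ab(1)])
  finally show ?thesis .
 qed
 have aK: "submod R (a ` K) ?L" by (rule submod_image[OF Mm L.right_module_axioms ab(1) K])
 from complement[OF L(1) kill this]
 obtain K' where K': "submod R K' ?L" "a ` K \<inter> K' = {\<zero>\<^sub>?L}" "a ` K <+>\<^sub>?L K' = carrier ?L"
  by blast
 obtain \<rho> where \<rho>: "\<rho> \<in> mod_hom R ?L (?L\<lparr>carrier := a ` K\<rparr>)" "\<And>y. y \<in> a ` K \<Longrightarrow> \<rho> y = y"
  using complement_retraction[OF L.right_module_axioms aK K'] by metis
 note KM = subsetD[OF M.submod_subset[OF K]]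
 have c: "\<rho> (a x) \<in> a ` K" "\<rho> (a x) \<in> carrier ?L" if "x \<in> carrier M" for x
  using mh_closed[OF \<rho>(1) ac[OF that]] L.submod_subset[OF aK] by auto
 show thesis
 proof (rule that[of "\<lambda>x. b (\<rho> (a x))"])
  show "(\<lambda>x. b (\<rho> (a x))) \<in> mod_hom R M (M\<lparr>carrier := K\<rparr>)"
  proof (rule mod_homI)
   show "b (\<rho> (a x)) \<in> carrier (M\<lparr>carrier := K\<rparr>)" if "x \<in> carrier M" for x
    using c(1)[OF that] ab(3) KM by auto
  qed (use c ac mh_add[OF ab(1)] mh_add[OF ab(2)] mh_add[OF \<rho>(1)] mh_act[OF ab(1)]
    mh_act[OF ab(2)] mh_act[OF \<rho>(1)] in simp_all)
  show "b (\<rho> (a x)) = x" if "x \<in> K" for x using \<rho>(2) ab(3) KM that by simp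
 qed
qed

lemma killed_submod: "killed M \<Longrightarrow> L \<subseteq> carrier M \<Longrightarrow> killed (M\<lparr>carrier := L\<rparr>)"
 by (auto simp: killed_def)

lemma killed_iso:
 assumes "mod_iso R M N" "right_module R M" "right_module R N" "killed M" shows "killed N"
proof -
 obtain f g where f: "f \<in> mod_hom R M N" "g \<in> mod_hom R N M" "\<And>y. y \<in> carrier N \<Longrightarrow> f (g y) = y"
  using mod_iso_obtain[OF assms(1,2)] by metis
 have "r \<odot>\<^sub>N y = \<zero>\<^sub>N" if "r \<in> rad" "y \<in> carrier N" for r y
 proof -
  have r: "r \<in> carrier R" using that rad_subset by blast
  have "r \<odot>\<^sub>N y = f (r \<odot>\<^sub>M g y)" using mh_act[OF f(1) r mh_closed[OF f(2) that(2)]] f(3)[OF that(2)] by simp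
  also have "\<dots> = f \<zero>\<^sub>M" using assms(4) that mh_closed[OF f(2)] by (simp add: killed_def)
  finally show ?thesis using mh_zero[OF assms(2,3) f(1)] by simp
 qed
 then show ?thesis by (simp add: killed_def)
qed

lemma bottom_killed:
 assumes U: "\<And>i. right_module (S i) (U i)"
 shows "killed ((glue U)\<lparr>carrier := bottom U\<rparr>)"
proof -
 let ?G = "glue U"
 interpret G: right_module R "glue U" by (rule glue_module[OF U])
 have "r \<odot>\<^sub>?G z = \<zero>\<^sub>?G" if r: "r \<in> rad" and z: "z \<in> bottom U" for r z
 proof -
  have rR: "r \<in> carrier R" using r rad_subset by blast
  have zk: "snd z k \<in> carrier (U (\<sigma> k))" for k using z by (auto simp: bottom_def elim!: glue_cases)
  note e = emb_closed(1)[OF U zk]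
  have "z = finsum ?G (\<lambda>k. \<beta> k \<odot>\<^sub>?G emb U (\<sigma> k) (snd z k)) \<Gamma>"
   by (rule bottom_eq_sum[OF U z e]) simp
  then have "r \<odot>\<^sub>?G z = finsum ?G (\<lambda>k. r \<odot>\<^sub>?G (\<beta> k \<odot>\<^sub>?G emb U (\<sigma> k) (snd z k))) \<Gamma>"
   using G.act_finsum[OF fin_\<Gamma> _ rR, of "\<lambda>k. \<beta> k \<odot>\<^sub>?G emb U (\<sigma> k) (snd z k)"] e by (simp add: G.act_closed closed)
  also have "\<dots> = finsum ?G (\<lambda>k. \<zero>\<^sub>?G) \<Gamma>"
  proof (rule G.finsum_cong')
   show "r \<odot>\<^sub>?G (\<beta> k \<odot>\<^sub>?G emb U (\<sigma> k) (snd z k)) = \<zero>\<^sub>?G" for k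
    using G.act_mult[OF beta_closed rR e, of k k] beta_rad[OF r] G.zero_act[OF e] by metis
  qed (simp_all del: glue_simps)
  also have "\<dots> = \<zero>\<^sub>?G" by (rule G.finsum_zero)
  finally show ?thesis .
 qed
 then show ?thesis by (simp add: killed_def)
qed

text \<open>Submodules of a glued module are glued up to a killed direct summand. The retraction of the
 bottom onto its intersection with the submodule \<open>N\<close> removes the bottom part from \<open>N\<close>: what is left
 of \<open>N\<close> is carried by its tops \<open>W\<close>.\<close>

lemma glue_submodule:
 assumes U: "\<And>i. U i \<in> fg_modules (S i)" and N: "submod R N (glue U)"
 obtains V Q where "\<And>i. V i \<in> fg_modules (S i)" "Q \<in> fg_modules R" "killed Q"
  "mod_iso R ((glue U)\<lparr>carrier := N\<rparr>) (dsum (glue V) Q)"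
proof -
 let ?G = "glue U"
 note Um = fg_mods_rm[OF U]
 note G = glue_module[OF Um]
 have Gfg: "fg_module R ?G" by (rule glue_fg[OF fg_modulesD[OF U]])
 interpret G: right_module R "glue U" by (rule G)
 let ?N = "?G\<lparr>carrier := N\<rparr>"
 have Nm: "right_module R ?N" by (rule G.submod_module[OF N])
 interpret N: right_module R ?N by (rule Nm)
 have NG: "N \<subseteq> carrier ?G" by (rule G.submod_subset[OF N])
 note incl = submod_inclusion[OF N G]
 let ?Z = "bottom U"
 have Z: "submod R ?Z ?G" by (rule bottom_submod[OF Um])
 have ZG: "?Z \<subseteq> carrier ?G" by (auto simp: bottom_def)
 let ?ZM = "?G\<lparr>carrier := ?Z\<rparr>"
 have ZM: "fg_module R ?ZM" "killed ?ZM"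
  by (rule fg_module_submod[OF R_fl Gfg Z]) (rule bottom_killed[OF Um])
 let ?K = "N \<inter> ?Z"
 have K: "submod R ?K ?G"
  by (rule G.submodI) (use NG G.submod_zero[OF N] G.submod_zero[OF Z] G.submod_add[OF N] G.submod_add[OF Z]
   G.submod_act[OF N] G.submod_act[OF Z] in auto)
 have KZ: "submod R ?K ?ZM" using G.submod_trans[OF Z, of ?K] K by simp
 obtain \<rho> where \<rho>: "\<rho> \<in> mod_hom R ?ZM ((?ZM)\<lparr>carrier := ?K\<rparr>)" "\<And>x. x \<in> ?K \<Longrightarrow> \<rho> x = x"
  using killed_retraction[OF ZM KZ] by metis
 have \<rho>c: "\<rho> z \<in> ?K" if "z \<in> ?Z" for z using mh_closed[OF \<rho>(1)] that by simp
 have \<rho>a: "\<rho> (z \<oplus>\<^sub>?G w) = \<rho> z \<oplus>\<^sub>?G \<rho> w" if "z \<in> ?Z" "w \<in> ?Z" for z w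
  using mh_add[OF \<rho>(1)] that by simp
 have \<rho>r: "\<rho> (r \<odot>\<^sub>?G z) = r \<odot>\<^sub>?G \<rho> z" if "z \<in> ?Z" "r \<in> carrier R" for z r
  using mh_act[OF \<rho>(1)] that by simp
 define zp where "zp z = (\<lambda>i. \<zero>\<^bsub>U i\<^esub>, snd z)" for z :: "('i \<Rightarrow> 'd list) \<times> ('g \<Rightarrow> 'd list)"
 note rules = right_module.act_rules[OF Um] right_module.add_rules[OF Um] closed
 have zpc: "zp z \<in> ?Z" if "z \<in> carrier ?G" for z
  using that by (elim glue_cases) (simp add: zp_def bottom_def rules)
 have zpa: "zp (z \<oplus>\<^sub>?G w) = zp z \<oplus>\<^sub>?G zp w" if "z \<in> carrier ?G" "w \<in> carrier ?G" for z w
  using that by (elim glue_cases) (simp add: zp_def rules)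
 have zpi: "zp (\<iota> i a \<odot>\<^sub>?G z) = \<iota> i a \<odot>\<^sub>?G zp z" if "z \<in> carrier ?G" "a \<in> carrier (S i)" for i a z
  using that by (elim glue_cases) (simp add: zp_def rules gam_iota)
 have zp_id: "zp z = z" if "z \<in> ?Z" for z using that by (auto simp: zp_def bottom_def prod_eq_iff fun_eq_iff)
 define t where "t n = n \<ominus>\<^sub>?G \<rho> (zp n)" for n
 have \<rho>z: "\<rho> (zp n) \<in> ?K" "\<rho> (zp n) \<in> carrier ?G" if "n \<in> N" for n
  using \<rho>c[OF zpc, of n] that NG by blast+
 have tN: "t n \<in> N" if "n \<in> N" for n
  unfolding t_def using that \<rho>z by (intro G.submod_minus[OF N]) auto
 have ta: "t (n \<oplus>\<^sub>?G m) = t n \<oplus>\<^sub>?G t m" if nm: "n \<in> N" "m \<in> N" for n m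
 proof -
  have c: "n \<in> carrier ?G" "m \<in> carrier ?G" using nm NG by auto
  have "\<rho> (zp (n \<oplus>\<^sub>?G m)) = \<rho> (zp n) \<oplus>\<^sub>?G \<rho> (zp m)" using c by (simp add: zpa \<rho>a zpc)
  then show ?thesis unfolding t_def using c \<rho>z nm by (simp add: a_minus_def G.minus_add G.a_ac)
 qed
 have ti: "t (\<iota> i a \<odot>\<^sub>?G n) = \<iota> i a \<odot>\<^sub>?G t n" if na: "n \<in> N" "a \<in> carrier (S i)" for n i a
 proof -
  have c: "n \<in> carrier ?G" using na NG by auto
  have "\<rho> (zp (\<iota> i a \<odot>\<^sub>?G n)) = \<iota> i a \<odot>\<^sub>?G \<rho> (zp n)" using c na by (simp add: zpi \<rho>r zpc closed)
  then show ?thesis unfolding t_def using c \<rho>z na by (simp add: G.act_minus closed)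
 qed
 have tK: "t n = \<zero>\<^sub>?G" if n: "n \<in> ?K" for n
 proof -
  have "t n = n \<ominus>\<^sub>?G n" unfolding t_def using zp_id[of n] \<rho>(2)[OF n] n by simp
  then show ?thesis using subsetD[OF NG, of n] n by (simp add: a_minus_def G.r_neg del: glue_simps)
 qed
 have topa: "fst (z \<oplus>\<^sub>?G w) i = fst z i \<oplus>\<^bsub>U i\<^esub> fst w i" for z w i by (cases z; cases w) simp
 have topi: "fst (\<iota> j a \<odot>\<^sub>?G z) i = (if i = j then a \<odot>\<^bsub>U i\<^esub> fst z i else \<zero>\<^bsub>U i\<^esub>)"
  if "a \<in> carrier (S j)" "z \<in> carrier ?G" for a z i j
  using that by (elim glue_cases) (simp add: pi_iota rules)
 have topc: "fst z i \<in> carrier (U i)" if "z \<in> carrier ?G" for z i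
  using that by (elim glue_cases) simp
 have topt: "fst (t n) i = fst n i" if "n \<in> N" for n i
 proof -
  have c: "n \<in> carrier ?G" using that NG by auto
  have m: "\<ominus>\<^sub>?G \<rho> (zp n) \<in> ?Z" using \<rho>z[OF that] G.submod_uminus[OF Z] by blast
  then show ?thesis unfolding t_def a_minus_def using topc[OF c] by (simp add: topa bottom_def rules)
 qed
 \<comment> \<open>the tops of \<open>N\<close>, and the element of \<open>N\<close> over a given top\<close>
 define W where "W i = (U i)\<lparr>carrier := (\<lambda>z. fst z i) ` N\<rparr>" for i
 have Wsub: "submod (S i) ((\<lambda>z. fst z i) ` N) (U i)" for i
  using submod_image[OF G infl_module[OF Um] top_hom N] infl_submod[OF Um] by blast
 have Wfg: "fg_module (S i) (W i)" for i
  unfolding W_def by (rule fg_module_submod[OF S_fl fg_modulesD[OF U] Wsub])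
 note Wm = fg_mod_rm[OF Wfg]
 have W_simps [simp]: "\<zero>\<^bsub>W i\<^esub> = \<zero>\<^bsub>U i\<^esub>" "add (W i) = add (U i)" "smult (W i) = smult (U i)" for i
  by (simp_all add: W_def)
 have WU: "x \<in> carrier (W i) \<Longrightarrow> x \<in> carrier (U i)" for x i using topc NG by (auto simp: W_def)
 have glue_WU: "z \<in> carrier (glue W) \<Longrightarrow> z \<in> carrier ?G" for z using WU by (cases z) auto
 define h where "h i x = t (\<iota> i \<one>\<^bsub>S i\<^esub> \<odot>\<^sub>?G (SOME n. n \<in> N \<and> fst n i = x))" for i x
 have i1N: "\<iota> i a \<odot>\<^sub>?G n \<in> N" if "n \<in> N" "a \<in> carrier (S i)" for i n a
  using that by (intro G.submod_act[OF N] closed)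
 have h_eq: "h i (fst n i) = t (\<iota> i \<one>\<^bsub>S i\<^esub> \<odot>\<^sub>?G n)" if n: "n \<in> N" for i n
 proof -
  define m where "m = (SOME m. m \<in> N \<and> fst m i = fst n i)"
  have "m \<in> N \<and> fst m i = fst n i" unfolding m_def by (rule someI[of _ n]) (use n in simp)
  then have m: "m \<in> N" "fst m i = fst n i" by auto
  have c: "n \<in> carrier ?G" "m \<in> carrier ?G" using n m NG by auto
  let ?i = "\<iota> i \<one>\<^bsub>S i\<^esub>"
  let ?d = "?i \<odot>\<^sub>?G m \<ominus>\<^sub>?G ?i \<odot>\<^sub>?G n"
  have ic: "?i \<odot>\<^sub>?G m \<in> carrier ?G" "?i \<odot>\<^sub>?G n \<in> carrier ?G"
   using c by (auto intro!: G.act_closed closed)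
  have dN: "?d \<in> N" using m n by (intro G.submod_minus[OF N] i1N) auto
  have "fst ?d j = fst (?i \<odot>\<^sub>?G m) j \<ominus>\<^bsub>infl j (U j)\<^esub> fst (?i \<odot>\<^sub>?G n) j" for j
   by (rule mh_minus[OF G infl_module[OF Um] top_hom ic])
  moreover have "fst (?i \<odot>\<^sub>?G m) j = fst (?i \<odot>\<^sub>?G n) j" for j
   using c m(2) by (simp add: topi)
  ultimately have "fst ?d j = \<zero>\<^bsub>U j\<^esub>" for j
   using right_module.add_rules(10)[OF infl_module[OF Um], of "fst (?i \<odot>\<^sub>?G n) j" j] topc[OF ic(2), of j]
   by (simp add: a_minus_def)
  then have dK: "?d \<in> ?K" using dN NG by (auto simp: bottom_def)
  have "t (?i \<odot>\<^sub>?G m) = t (?d \<oplus>\<^sub>?G ?i \<odot>\<^sub>?G n)"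
   using ic by (simp add: a_minus_def G.a_assoc G.l_neg del: glue_simps)
  also have "\<dots> = t (?i \<odot>\<^sub>?G n)"
   using ta[OF dN i1N[OF n S.one_closed]] tK[OF dK] tN[OF i1N[OF n S.one_closed, of i]] NG
   by (simp add: subset_eq del: glue_simps)
  finally show ?thesis by (simp add: h_def m_def)
 qed
 have WE: "\<exists>n\<in>N. x = fst n i" if "x \<in> carrier (W i)" for x i using that by (auto simp: W_def)
 have h: "h i \<in> mod_hom (S i) (W i) (res i ?N)" for i
 proof (rule mod_homI)
  fix x assume "x \<in> carrier (W i)"
  then obtain n where n: "n \<in> N" "x = fst n i" using WE by blast
  have c: "n \<in> carrier ?G" using n NG by auto
  have "\<iota> i \<one>\<^bsub>S i\<^esub> \<odot>\<^sub>?G t (\<iota> i \<one>\<^bsub>S i\<^esub> \<odot>\<^sub>?G n) = t (\<iota> i \<one>\<^bsub>S i\<^esub> \<odot>\<^sub>?G n)"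
   using ti[OF i1N[OF n(1) S.one_closed] S.one_closed, of i i] iota_act[OF G c S.one_closed S.one_closed, of i] by simp
  then show "h i x \<in> carrier (res i ?N)" using n tN[OF i1N[OF n(1) S.one_closed]] by (simp add: h_eq)
  fix y assume "y \<in> carrier (W i)"
  then obtain m where m: "m \<in> N" "y = fst m i" using WE by blast
  have d: "m \<in> carrier ?G" using m NG by auto
  have "h i (x \<oplus>\<^bsub>U i\<^esub> y) = h i (fst (n \<oplus>\<^sub>?G m) i)" using n m by (simp add: topa)
  also have "\<dots> = t (\<iota> i \<one>\<^bsub>S i\<^esub> \<odot>\<^sub>?G (n \<oplus>\<^sub>?G m))" by (rule h_eq[OF G.submod_add[OF N n(1) m(1)]])
  also have "\<dots> = t (\<iota> i \<one>\<^bsub>S i\<^esub> \<odot>\<^sub>?G n) \<oplus>\<^sub>?G t (\<iota> i \<one>\<^bsub>S i\<^esub> \<odot>\<^sub>?G m)"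
   using ta[OF i1N[OF n(1) S.one_closed] i1N[OF m(1) S.one_closed]] G.act_add_module[OF iota_closed[OF S.one_closed] c d] by simp
  finally show "h i (x \<oplus>\<^bsub>W i\<^esub> y) = h i x \<oplus>\<^bsub>res i ?N\<^esub> h i y" using n m by (simp add: h_eq)
 next
  fix a x assume a: "a \<in> carrier (S i)" and "x \<in> carrier (W i)"
  then obtain n where n: "n \<in> N" "x = fst n i" using WE by blast
  have c: "n \<in> carrier ?G" using n NG by auto
  have "h i (a \<odot>\<^bsub>U i\<^esub> x) = h i (fst (\<iota> i a \<odot>\<^sub>?G n) i)" using n a c by (simp add: topi)
  also have "\<dots> = t (\<iota> i \<one>\<^bsub>S i\<^esub> \<odot>\<^sub>?G (\<iota> i a \<odot>\<^sub>?G n))" by (rule h_eq[OF i1N[OF n(1) a]])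
  also have "\<dots> = t (\<iota> i a \<odot>\<^sub>?G (\<iota> i \<one>\<^bsub>S i\<^esub> \<odot>\<^sub>?G n))" using iota_act[OF G c] a by simp
  also have "\<dots> = \<iota> i a \<odot>\<^sub>?G h i x" using ti[OF i1N[OF n(1) S.one_closed] a] n by (simp add: h_eq)
  finally show "h i (a \<odot>\<^bsub>W i\<^esub> x) = a \<odot>\<^bsub>res i ?N\<^esub> h i x" by simp
 qed
 let ?\<Psi> = "extend ?N h"
 note GW = glue_module[OF Wm]
 have \<Psi>: "?\<Psi> \<in> mod_hom R (glue W) ?N" by (rule extend_hom[OF Nm Wm h])
 have \<Psi>N: "?\<Psi> z \<in> N" if "z \<in> carrier (glue W)" for z using mh_closed[OF \<Psi> that] by simp
 have top_h: "fst (h i x) i = x" if xW: "x \<in> carrier (W i)" for i x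
 proof -
  obtain n where n: "n \<in> N" "x = fst n i" using WE[OF xW] by auto
  have c: "n \<in> carrier ?G" using n NG by auto
  show ?thesis using n c topt[OF i1N[OF n(1) S.one_closed]] topi[OF S.one_closed c] topc[OF c] by (simp add: h_eq rules)
 qed
 have hN: "h i x \<in> N" if "x \<in> carrier (W i)" for i x using mh_closed[OF h that] by simp
 have top_\<Psi>: "fst (?\<Psi> z) i = fst z i" if z: "z \<in> carrier (glue W)" for z i
 proof -
  have F: "(\<lambda>z. fst (?\<Psi> z) i) \<in> mod_hom R (glue W) (infl i (U i))"
   by (rule mh_comp[OF mh_comp[OF \<Psi> incl] top_hom])
  have zi: "fst z i \<in> carrier (W i)" using z by (elim glue_cases) auto
  have "fst (?\<Psi> z) i = fst (?\<Psi> (emb W i (fst z i))) i" by (rule hom_infl_top[OF Wm Um F z])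
  also have "\<dots> = fst z i" using extend_emb[OF Nm Wm h zi] top_h[OF zi] by simp
  finally show ?thesis .
 qed
 have bot_\<Psi>: "?\<Psi> z = z" if z: "z \<in> bottom W" for z
 proof -
  have zW: "z \<in> carrier (glue W)" and zU: "z \<in> bottom U" using z glue_WU by (auto simp: bottom_def)
  have zk: "snd z k \<in> carrier (W (\<sigma> k))" for k using zW by (elim glue_cases) auto
  have hk: "h (\<sigma> k) (snd z k) \<in> carrier ?G" for k using hN[OF zk] NG by blast
  have h0: "h i \<zero>\<^bsub>U i\<^esub> = \<zero>\<^sub>?G" for i using mh_zero[OF Wm res_module[OF Nm] h, of i] by simp
  have "?\<Psi> z = extend ?G h z"
   using extend_natural[OF Nm G incl _ zW, of h] hN by simp
  also have "\<dots> = finsum ?G (\<lambda>k. \<beta> k \<odot>\<^sub>?G h (\<sigma> k) (snd z k)) \<Gamma>"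
  proof -
   have "finsum ?G (\<lambda>k. \<beta> k \<odot>\<^sub>?G h (\<sigma> k) (snd z k)) \<Gamma> \<in> carrier ?G"
    using hk by (intro G.finsum_closed) (auto intro!: G.act_closed closed)
   then show ?thesis using z by (simp add: extend_def bottom_def h0 G.finsum_zero del: glue_simps(2))
  qed
  also have "\<dots> = z" using top_h[OF zk] by (intro bottom_eq_sum[OF Um zU hk, symmetric])
  finally show ?thesis .
 qed
 \<comment> \<open>the bottom of \<open>glue W\<close> is split off from the bottom of \<open>N\<close>\<close>
 have bWK: "bottom W \<subseteq> ?K"
  using bot_\<Psi> \<Psi>N glue_WU by (auto simp: bottom_def) metis+
 have bW: "submod R (bottom W) ?G"
 proof -
  interpret GW: right_module R "glue W" by (rule GW)
  have eqs: "\<zero>\<^bsub>glue W\<^esub> = \<zero>\<^sub>?G" "add (glue W) = add ?G" "smult (glue W) = smult ?G"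
   by (simp_all add: glue_def)
  have b: "submod R (bottom W) (glue W)" by (rule bottom_submod[OF Wm])
  show ?thesis
  proof (rule G.submodI)
   show "bottom W \<subseteq> carrier ?G" using G.submod_subset[OF K] bWK by (rule subset_trans[rotated])
   show "\<zero>\<^sub>?G \<in> bottom W" using GW.submod_zero[OF b] unfolding eqs .
  qed (use GW.submod_add[OF b] GW.submod_act[OF b] in \<open>unfold eqs\<close>)
 qed
 let ?KM = "?G\<lparr>carrier := ?K\<rparr>"
 have KM: "fg_module R ?KM" "killed ?KM"
  using fg_module_submod[OF R_fl Gfg K] killed_submod[OF ZM(2), of ?K] by auto
 note KMm = fg_mod_rm[OF KM(1)]
 have bWKM: "submod R (bottom W) ?KM" using G.submod_trans[OF K] bW bWK by simp
 obtain \<tau> where \<tau>: "\<tau> \<in> mod_hom R ?KM (?KM\<lparr>carrier := bottom W\<rparr>)" "\<And>x. x \<in> bottom W \<Longrightarrow> \<tau> x = x"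
  using killed_retraction[OF KM bWKM] by metis
 note bWm = right_module.submod_module[OF KMm bWKM]
 have ker: "submod R (a_kernel ?KM (?KM\<lparr>carrier := bottom W\<rparr>) \<tau>) ?KM"
  by (rule submod_kernel[OF KMm bWm \<tau>(1)])
 define Q where "Q = ?KM\<lparr>carrier := a_kernel ?KM (?KM\<lparr>carrier := bottom W\<rparr>) \<tau>\<rparr>"
 have Q_simps: "carrier Q = {x \<in> ?K. \<tau> x = \<zero>\<^sub>?G}" "\<zero>\<^sub>Q = \<zero>\<^sub>?G" "add Q = add ?G" "smult Q = smult ?G"
  by (auto simp: Q_def a_kernel_def')
 have Qfg: "fg_module R Q" unfolding Q_def by (rule fg_module_submod[OF R_fl KM(1) ker])
 have Qk: "killed Q" using KM(2) by (auto simp: killed_def Q_simps)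
 note Qm = fg_mod_rm[OF Qfg]
 have Qincl: "(\<lambda>x. x) \<in> mod_hom R Q ?N" by (rule mod_homI) (auto simp: Q_simps)
 have \<tau>m: "\<tau> (\<ominus>\<^sub>?KM x) = \<ominus>\<^bsub>?KM\<lparr>carrier := bottom W\<rparr>\<^esub> \<tau> x" if "x \<in> ?K" for x
  by (rule mh_uminus[OF KMm bWm \<tau>(1)]) (use that in simp)
 let ?f = "\<lambda>z. ?\<Psi> (fst z) \<oplus>\<^sub>?N snd z"
 have f: "?f \<in> mod_hom R (dsum (glue W) Q) ?N" by (rule dsum_copair_hom[OF Nm \<Psi> Qincl])
 have "mod_iso R (dsum (glue W) Q) ?N"
 proof (rule mod_isoI_kernel[OF dsum_module[OF GW Qm] Nm f])
  fix w assume w: "w \<in> carrier (dsum (glue W) Q)" "?f w = \<zero>\<^sub>?N"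
  obtain z s where zs: "w = (z, s)" "z \<in> carrier (glue W)" "s \<in> ?K" "\<tau> s = \<zero>\<^sub>?G"
   using w(1) by (auto simp: Q_simps)
  have e: "?\<Psi> z \<oplus>\<^sub>?G s = \<zero>\<^sub>?G" using w(2) zs(1) by simp
  have sG: "s \<in> carrier ?G" using zs(3) NG by auto
  have "fst z i = \<zero>\<^bsub>U i\<^esub>" for i
  proof -
   have "fst (?\<Psi> z \<oplus>\<^sub>?G s) i = fst z i" using zs topc[OF glue_WU[OF zs(2)], of i]
    by (simp add: topa top_\<Psi> bottom_def rules)
   then show ?thesis using e by simp
  qed
  then have zb: "z \<in> bottom W" using zs(2) by (simp add: bottom_def)
  then have zK: "z \<in> ?K" using bWK by blast
  have zG: "z \<in> carrier ?G" by (rule glue_WU[OF zs(2)])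
  have zs0: "z \<oplus>\<^sub>?G s = \<zero>\<^sub>?G" using e bot_\<Psi>[OF zb] by simp
  have "\<tau> (z \<oplus>\<^sub>?G s) = \<tau> z \<oplus>\<^sub>?G \<tau> s" using mh_add[OF \<tau>(1), of z s] zK zs(3) by simp
  moreover have "\<tau> \<zero>\<^sub>?G = \<zero>\<^sub>?G" using mh_zero[OF KMm bWm \<tau>(1)] by simp
  ultimately have "z = \<zero>\<^sub>?G" using zs0 zs(4) \<tau>(2)[OF zb] zG by (simp del: glue_simps)
  then have "w = (\<zero>\<^sub>?G, \<zero>\<^sub>?G)" using zs0 sG zs(1) by (simp del: glue_simps)
  then show "w = \<zero>\<^bsub>dsum (glue W) Q\<^esub>" by (simp add: Q_simps)
 next
  fix n assume "n \<in> carrier ?N"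
  then have n: "n \<in> N" by simp
  have nG: "n \<in> carrier ?G" using n NG by blast
  define w where "w = (\<lambda>i. fst n i, \<lambda>k. \<zero>\<^bsub>U (\<sigma> k)\<^esub>)"
  have w: "w \<in> carrier (glue W)"
   using n right_module.submod_zero[OF Um Wsub] by (auto simp: w_def W_def rules)
  let ?d = "n \<ominus>\<^sub>?G ?\<Psi> w"
  have \<Psi>wN: "?\<Psi> w \<in> N" by (rule \<Psi>N[OF w])
  have \<Psi>wG: "?\<Psi> w \<in> carrier ?G" using \<Psi>wN NG by blast
  have dN: "?d \<in> N" by (rule G.submod_minus[OF N n \<Psi>wN])
  have "fst ?d i = fst n i \<ominus>\<^bsub>infl i (U i)\<^esub> fst (?\<Psi> w) i" for i
   by (rule mh_minus[OF G infl_module[OF Um] top_hom nG \<Psi>wG])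
  then have "fst ?d i = \<zero>\<^bsub>U i\<^esub>" for i
   using right_module.add_rules(10)[OF infl_module[OF Um], of "fst n i" i] topc[OF nG, of i] top_\<Psi>[OF w, of i]
   by (simp add: a_minus_def w_def)
  then have dK: "?d \<in> ?K" using dN NG by (auto simp: bottom_def)
  have \<tau>d: "\<tau> ?d \<in> bottom W" using mh_closed[OF \<tau>(1), of ?d] dK by simp
  then have \<tau>dW: "\<tau> ?d \<in> carrier (glue W)" and \<tau>dK: "\<tau> ?d \<in> ?K" using bWK by (auto simp: bottom_def)
  have \<tau>dG: "\<tau> ?d \<in> carrier ?G" by (rule glue_WU[OF \<tau>dW])
  let ?s = "?d \<ominus>\<^sub>?G \<tau> ?d"
  have sK: "?s \<in> ?K" by (rule G.submod_minus[OF K dK \<tau>dK])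
  have dG: "?d \<in> carrier ?G" using dN NG by blast
  have "?s \<oplus>\<^sub>?G \<tau> ?d = ?d" using dG \<tau>dG by (simp add: a_minus_def[of _ ?d] G.a_assoc G.l_neg del: glue_simps)
  then have "\<tau> ?s \<oplus>\<^sub>?G \<tau> (\<tau> ?d) = \<tau> ?d"
   using mh_add[OF \<tau>(1), of ?s "\<tau> ?d"] sK \<tau>dK by simp
  moreover have "\<tau> ?s \<in> carrier ?G"
   using mh_closed[OF \<tau>(1), of ?s] sK glue_WU by (auto simp: bottom_def)
  ultimately have \<tau>s: "\<tau> ?s = \<zero>\<^sub>?G" using \<tau>(2)[OF \<tau>d] \<tau>dG by (metis G.add.r_cancel_one')
  let ?w = "(w \<oplus>\<^bsub>glue W\<^esub> \<tau> ?d, ?s)"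
  have wD: "?w \<in> carrier (dsum (glue W) Q)"
   using w \<tau>dW sK \<tau>s abelian_group.axioms(1)[of "glue W"] GW right_module.add_rules(1)[OF GW] by (simp add: Q_simps)
  have "?\<Psi> (w \<oplus>\<^bsub>glue W\<^esub> \<tau> ?d) = ?\<Psi> w \<oplus>\<^sub>?G \<tau> ?d"
   using mh_add[OF \<Psi> w \<tau>dW] bot_\<Psi>[OF \<tau>d] by simp
  then have "?f ?w = (?\<Psi> w \<oplus>\<^sub>?G \<tau> ?d) \<oplus>\<^sub>?G ?s" by simp
  also have "\<dots> = ?\<Psi> w \<oplus>\<^sub>?G (?s \<oplus>\<^sub>?G \<tau> ?d)"
   using \<Psi>wG \<tau>dG dG by (simp add: G.a_ac G.minus_closed del: glue_simps)
  also have "\<dots> = ?\<Psi> w \<oplus>\<^sub>?G ?d" using \<open>?s \<oplus>\<^sub>?G \<tau> ?d = ?d\<close> by simp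
  also have "\<dots> = n" using nG \<Psi>wG by (simp add: a_minus_def G.a_lcomm[of _ n] G.r_neg del: glue_simps)
  finally show "\<exists>w\<in>carrier (dsum (glue W) Q). ?f w = n" using wD by (rule bexI)
 qed
 then have "mod_iso R ?N (dsum (glue W) Q)" by (rule mod_iso_sym[OF _ dsum_module[OF GW Qm]])
 also have "mod_iso R \<dots> (dsum (glue (\<lambda>i. list_copy (S i) (W i))) (list_copy R Q))"
  by (rule dsum_iso[OF glue_cong[OF list_copy(2)[OF Wfg] Wm] list_copy(2)[OF Qfg]])
 finally show thesis
  using list_copy(1)[OF Wfg] list_copy(1)[OF Qfg]
   killed_iso[OF list_copy(2)[OF Qfg] Qm fg_mods_rm[OF list_copy(1)[OF Qfg]] Qk]
  by (intro that[of "\<lambda>i. list_copy (S i) (W i)" "list_copy R Q"]) auto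
qed

section \<open>Transfer of the Igusa--Todorov conditions\<close>

text \<open>Projective covers over \<open>R\<close> are glued modules, so that a syzygy is a submodule of a glued module.\<close>

lemma syzygy_decomposition:
 assumes M: "M \<in> fg_modules R"
 obtains V Q where "\<And>i. V i \<in> fg_modules (S i)" "Q \<in> fg_modules R" "killed Q"
  "mod_iso R (syzygy R M) (dsum (gluel V) Q)"
proof -
 obtain P f where P: "P \<in> fg_modules R" "pcover R M P f" "syzygy R M = ker_mod P M f"
  using syzygy_cover[OF R_fl M] by metis
 have c: "right_module R M" "fg_projective R P" "f \<in> mod_hom R P M" using P(2) by (auto simp: pcover_def)
 have Pm: "right_module R P" by (rule fg_mods_rm[OF P(1)])
 interpret P: right_module R P by (rule Pm)
 obtain U where U: "\<And>i. U i \<in> fg_modules (S i)" "mod_iso R P (glue U)"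
  using projective_glue[OF c(2)] by metis
 note G = glue_module[OF fg_mods_rm[OF U(1)]]
 obtain a b where ab: "a \<in> mod_hom R P (glue U)" "b \<in> mod_hom R (glue U) P" "\<And>x. x \<in> carrier P \<Longrightarrow> b (a x) = x"
  using mod_iso_obtain[OF U(2) Pm] by metis
 let ?K = "a_kernel P M f"
 have K: "submod R ?K P" by (rule submod_kernel[OF Pm c(1,3)])
 have aK: "submod R (a ` ?K) (glue U)" by (rule submod_image[OF Pm G ab(1) K])
 have KP: "?K \<subseteq> carrier P" by (rule P.submod_subset[OF K])
 have iso: "mod_iso R (ker_mod P M f) ((glue U)\<lparr>carrier := a ` ?K\<rparr>)"
 proof (rule mod_isoI)
  show "a \<in> mod_hom R (ker_mod P M f) ((glue U)\<lparr>carrier := a ` ?K\<rparr>)"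
   by (rule mod_homI) (simp_all add: subsetD[OF KP] mh_add[OF ab(1)] mh_act[OF ab(1)])
  show "inj_on a (carrier (ker_mod P M f))" using KP ab(3) by (auto intro!: inj_on_inverseI[of _ b])
 qed simp
 obtain V Q where VQ: "\<And>i. V i \<in> fg_modules (S i)" "Q \<in> fg_modules R" "killed Q"
  "mod_iso R ((glue U)\<lparr>carrier := a ` ?K\<rparr>) (dsum (glue V) Q)"
  using glue_submodule[OF U(1) aK] by metis
 have "mod_iso R (syzygy R M) (dsum (glue V) Q)" unfolding P(3) by (rule mod_iso_trans[OF iso VQ(4)])
 then have "mod_iso R (syzygy R M) (dsum (gluel V) Q)"
  by (rule mod_iso_trans[OF _ dsum_iso[OF gluel(2)[OF VQ(1)] mod_iso_refl]])
 then show thesis using that VQ by metis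
qed

definition glue_class :: "('i \<Rightarrow> ('d, 'd list) module set) \<Rightarrow> ('c, 'c list) module set" where
 "glue_class D = {M \<in> fg_modules R. \<exists>U. (\<forall>i. U i \<in> D i) \<and> mod_iso R M (glue U)}"

lemma glue_classI: "M \<in> fg_modules R \<Longrightarrow> (\<And>i. U i \<in> D i) \<Longrightarrow> mod_iso R M (glue U) \<Longrightarrow> M \<in> glue_class D"
 by (auto simp: glue_class_def)

lemma glue_classE:
 assumes "M \<in> glue_class D"
 obtains U where "M \<in> fg_modules R" "\<And>i. U i \<in> D i" "mod_iso R M (glue U)"
proof -
 obtain U where "M \<in> fg_modules R" "\<forall>i. U i \<in> D i" "mod_iso R M (glue U)" using assms by (auto simp: glue_class_def)
 then show thesis by (intro that[of U]) auto
qed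

lemma glue_class_add_closed:
 assumes D: "\<And>i. add_closed (S i) (D i)"
 shows "add_closed R (glue_class D)"
proof -
 have Dfg: "M \<in> fg_modules (S i)" if "M \<in> D i" for M i using D[of i] that by (auto simp: add_closed_def)
 have Dz: "zero_module \<in> D i" for i using D[of i] zero_module[OF S_ring, of i] by (auto simp: add_closed_def)
 show ?thesis unfolding add_closed_def
 proof (intro conjI ballI allI impI)
  show "glue_class D \<subseteq> fg_modules R" by (auto simp: glue_class_def)
  show "zero_modules R \<subseteq> glue_class D"
  proof
   fix Z assume Z: "Z \<in> zero_modules R"
   let ?U = "\<lambda>_. zero_module :: ('d, 'd list) module"
   have "mod_iso R Z (glue ?U)"
    using Z[unfolded zero_modules_iff]
    by (intro zero_modules_iso glue_module glue_zero zero_module_S) auto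
   then show "Z \<in> glue_class D" using Z Dz by (intro glue_classI[of _ ?U]) (simp_all add: zero_modules_def)
  qed
  fix M assume "M \<in> fg_modules R"
  fix N N' assume *: "N \<in> glue_class D" "N' \<in> glue_class D" "mod_iso R M (dsum N N')"
  obtain U where U: "N \<in> fg_modules R" "\<And>i. U i \<in> D i" "mod_iso R N (glue U)" using *(1) by (rule glue_classE) blast
  obtain U' where U': "N' \<in> fg_modules R" "\<And>i. U' i \<in> D i" "mod_iso R N' (glue U')" using *(2) by (rule glue_classE) blast
  have S: "fg_module (S i) (dsum (U i) (U' i))" for i
   by (rule fg_module_dsum[OF fg_modulesD[OF Dfg[OF U(2)]] fg_modulesD[OF Dfg[OF U'(2)]]])
  have Sm: "right_module (S i) (dsum (U i) (U' i))" for i by (rule fg_mod_rm[OF S])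
  let ?V = "\<lambda>i. list_copy (S i) (dsum (U i) (U' i))"
  have "?V i \<in> D i" for i
   using D[of i] U(2)[of i] U'(2)[of i] list_copy[OF S[of i]] unfolding add_closed_def by blast
  moreover have "mod_iso R M (glue ?V)"
  proof -
   have "mod_iso R M (dsum (glue U) (glue U'))" by (rule mod_iso_trans[OF *(3) dsum_iso[OF U(3) U'(3)]])
   also have "mod_iso R \<dots> (glue (\<lambda>i. dsum (U i) (U' i)))" by (rule mod_iso_sym[OF glue_dsum glue_module[OF Sm]])
   also have "mod_iso R \<dots> (glue ?V)" by (rule glue_cong[OF list_copy(2)[OF S] Sm])
   finally show ?thesis .
  qed
  ultimately show "M \<in> glue_class D" using \<open>M \<in> fg_modules R\<close> by (intro glue_classI[of M ?V]) auto
 next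
  fix M N assume M: "M \<in> glue_class D" and N: "dir_summand R N M"
  obtain U where U: "M \<in> fg_modules R" "\<And>i. U i \<in> D i" "mod_iso R M (glue U)" using M by (rule glue_classE) blast
  note Mm = fg_mods_rm[OF U(1)] and Nm = fg_mods_rm[OF dir_summand_fg[OF N]]
  obtain i p where ip: "i \<in> mod_hom R N M" "p \<in> mod_hom R M N" "\<And>x. x \<in> carrier N \<Longrightarrow> p (i x) = x"
   using dir_summand_obtain[OF N Mm] by metis
  obtain a b where ab: "a \<in> mod_hom R M (glue U)" "b \<in> mod_hom R (glue U) M" "\<And>x. x \<in> carrier M \<Longrightarrow> b (a x) = x"
   using mod_iso_obtain[OF U(3) Mm] by metis
  obtain V where V: "\<And>i. dir_summand (S i) (V i) (U i)" "mod_iso R N (glue V)"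
  proof (rule glue_summand[OF Dfg[OF U(2)] Nm mh_comp[OF ip(1) ab(1)] mh_comp[OF ab(2) ip(2)]])
   show "p (b (a (i n))) = n" if "n \<in> carrier N" for n
    using ip(3)[OF that] ab(3)[OF mh_closed[OF ip(1) that]] by simp
  qed blast
  have "V i \<in> D i" for i using D[of i] U(2)[of i] V(1)[of i] unfolding add_closed_def by blast
  then show "N \<in> glue_class D" using V(2) dir_summand_fg[OF N] by (intro glue_classI)
 qed
qed

lemma glue_class_zero_IT:
 assumes D: "\<And>i. zero_IT_subcategory (S i) (D i)"
 shows "zero_IT_subcategory R (glue_class D)"
proof -
 note Dz = zero_IT_subcategory_iff[OF S_fl, THEN iffD1, OF D]
 have Dc: "add_closed (S i) (D i)" and Do: "syzygy (S i) ` D i \<subseteq> D i"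
  and Di: "\<And>N N'. N \<in> D i \<Longrightarrow> N' \<in> D i \<Longrightarrow> K0_class (S i) (syzygy (S i) N) = K0_class (S i) (syzygy (S i) N') \<Longrightarrow>
   K0_class (S i) N = K0_class (S i) N'" for i
  using Dz[of i] by blast+
 have Dfg: "M \<in> fg_modules (S i)" if "M \<in> D i" for M i using Dc[of i] that by (auto simp: add_closed_def)
 have cls: "K0_class R N = K0_class R (gluel U)" if "N \<in> fg_modules R" "\<And>i. U i \<in> D i" "mod_iso R N (glue U)" for N U
  by (rule K0_class_iso[OF that(1) gluel(1)[OF Dfg[OF that(2)]] mod_iso_trans[OF that(3) gluel(2)[OF Dfg[OF that(2)]]]])
 show ?thesis unfolding zero_IT_subcategory_iff[OF R_fl]
 proof (intro conjI ballI impI glue_class_add_closed Dc)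
  show "syzygy R ` glue_class D \<subseteq> glue_class D"
  proof clarify
   fix M assume "M \<in> glue_class D"
   then obtain U where U: "M \<in> fg_modules R" "\<And>i. U i \<in> D i" "mod_iso R M (glue U)" by (rule glue_classE) blast
   have "syzygy (S i) (U i) \<in> D i" for i using Do U(2) by blast
   then show "syzygy R M \<in> glue_class D"
    using syzygy_glue[OF Dfg[OF U(2)] U(1,3)] syzygy_fg[OF R_fl U(1)] by (intro glue_classI)
  qed
  fix N N' assume "N \<in> glue_class D" "N' \<in> glue_class D" and eq: "K0_class R (syzygy R N) = K0_class R (syzygy R N')"
  then obtain U U' where U: "N \<in> fg_modules R" "\<And>i. U i \<in> D i" "mod_iso R N (glue U)"
   and U': "N' \<in> fg_modules R" "\<And>i. U' i \<in> D i" "mod_iso R N' (glue U')" by (elim glue_classE) blast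
  have "K0_class (S i) (U i) = K0_class (S i) (U' i)" for i
  proof (rule Di[OF U(2) U'(2)])
   obtain h where h: "\<And>M U. M \<in> fg_modules R \<Longrightarrow> (\<And>i. U i \<in> fg_modules (S i)) \<Longrightarrow> mod_iso R M (glue U) \<Longrightarrow>
    h (K0_class R M) = K0_class (S i) (U i)" using K0_Top[of i] by metis
   show "K0_class (S i) (syzygy (S i) (U i)) = K0_class (S i) (syzygy (S i) (U' i))"
    using h[OF syzygy_fg[OF R_fl U(1)] syzygy_fg[OF S_fl Dfg[OF U(2)]] syzygy_glue[OF Dfg[OF U(2)] U(1,3)]]
     h[OF syzygy_fg[OF R_fl U'(1)] syzygy_fg[OF S_fl Dfg[OF U'(2)]] syzygy_glue[OF Dfg[OF U'(2)] U'(1,3)]] eq by simp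
  qed
  then show "K0_class R N = K0_class R N'"
   unfolding cls[OF U] cls[OF U'] by (intro K0_glue_cong Dfg U(2) U'(2))
 qed
qed

lemma add_closure_dir_summand_mono:
 assumes "M \<in> add_closure R {V}" "dir_summand R V W"
 shows "M \<in> add_closure R {W}"
 using assms(1)
proof (induction rule: add_closure_induct)
 case (summand N Y)
 then show ?case using dir_summand_trans[OF _ assms(2)] by (intro add_closure_summand[of R N W]) auto
qed (auto intro: add_closure_zero add_closure_dsum)

lemma glue_add_closure:
 assumes V: "\<And>i. V i \<in> fg_modules (S i)" and U: "\<And>i. U i \<in> add_closure (S i) {V i}"
 shows "gluel U \<in> add_closure R {gluel V}"
proof -
 have Ufg: "U i \<in> fg_modules (S i)" for i using U by (rule add_closure_fg)
 have one: "gluel (only i M) \<in> add_closure R {gluel V}" if "M \<in> add_closure (S i) {V i}" for i M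
  using that
 proof (induction rule: add_closure_induct)
  case (zero Z)
  have Zfg: "Z \<in> fg_modules (S i)" using zero by (simp add: zero_modules_def)
  note Z = zero[unfolded zero_modules_iff]
  have z: "carrier (only i Z j) = {\<zero>\<^bsub>only i Z j\<^esub>}" for j using conjunct2[OF Z] zero_module_S(3) by (cases "j = i") simp_all
  note G = gluel[of "only i Z", OF only_fg[OF Zfg]]
  have "carrier (glue (only i Z)) = {\<zero>\<^bsub>glue (only i Z)\<^esub>}"
   by (rule glue_zero[OF z fg_mods_rm[OF only_fg[OF Zfg]]])
  then have "carrier (gluel (only i Z)) = {\<zero>\<^bsub>gluel (only i Z)\<^esub>}"
   using mod_iso_zero[OF G(3) fg_mods_rm[OF G(1)] glue_module[OF fg_mods_rm[OF only_fg[OF Zfg]]]] by blast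
  then have "gluel (only i Z) \<in> zero_modules R" using fg_mods_rm[OF G(1)] unfolding zero_modules_iff by blast
  then show ?case by (rule add_closure_zero)
 next
  case (summand N Y)
  then obtain N' where N': "N \<in> fg_modules (S i)" "N' \<in> fg_modules (S i)" "mod_iso (S i) (V i) (dsum N N')"
   by (auto simp: dir_summand_def)
  have VN: "(V(i := N')) j \<in> fg_modules (S j)" for j using V N' by simp
  have "mod_iso R (gluel V) (dsum (gluel (only i N)) (gluel (V(i := N'))))"
  proof (rule glue_dsum_family[OF V only_fg[OF N'(1)] VN])
   show "mod_iso (S j) (V j) (dsum (only i N j) ((V(i := N')) j))" for j
   proof (cases "j = i")
    case False
    then show ?thesis
     using mod_iso_sym[OF dsum_zero_left[OF fg_mods_rm[OF V] zero_module_S(2,3)]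
       dsum_module[OF zero_module_S(2) fg_mods_rm[OF V]]] by simp
   qed (use N'(3) in simp)
  qed
  then have "dir_summand R (gluel (only i N)) (gluel V)"
   by (rule dir_summandI[OF gluel(1)[of "only i N", OF only_fg[OF N'(1)]] fg_modulesD[OF gluel(1)[OF VN]]])
  then show ?case by (rule add_closure_summand) simp
 next
  case (dsum M N N')
  have z: "mod_iso (S j) zero_module (dsum zero_module zero_module)" for j
   by (rule zero_modules_iso) (auto simp: zero_module_S dsum_module)
  have "mod_iso R (gluel (only i M)) (dsum (gluel (only i N)) (gluel (only i N')))"
   using dsum(1-4) z by (intro glue_dsum_family only_fg) auto
  then show ?case by (rule add_closure_dsum[OF gluel(1)[of "only i M", OF only_fg[OF dsum(1)]] dsum.IH])
 qed
 have "gluel (\<lambda>j. if j \<in> A then U j else zero_module) \<in> add_closure R {gluel V}" if "finite A" for A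
  using that
 proof (induction A rule: finite_induct)
  case empty
  have "gluel (only undefined zero_module) \<in> add_closure R {gluel V}"
   by (rule one[OF add_closure_zero]) (simp add: zero_module[OF S_ring])
  then show ?case by (simp add: fun_upd_idem)
 next
  case (insert i A)
  let ?W = "\<lambda>j. if j \<in> insert i A then U j else zero_module"
  have W: "?W j \<in> fg_modules (S j)" for j using Ufg zero_module_S by simp
  have "?W(i := zero_module) = (\<lambda>j. if j \<in> A then U j else zero_module)" using insert.hyps by (auto simp: fun_eq_iff)
  then have "mod_iso R (gluel ?W) (dsum (gluel (only i (U i))) (gluel (\<lambda>j. if j \<in> A then U j else zero_module)))"
   using glue_split[of ?W i, OF W] by simp
  then show ?case by (rule add_closure_dsum[OF gluel(1)[of ?W, OF W] one[OF U] insert.IH])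
 qed
 from this[of UNIV] show ?thesis by simp
qed

lemma syzygy_pow_add_closure:
 assumes "Q \<in> add_closure R {T}"
 shows "(syzygy R ^^ n) Q \<in> add_closure R {(syzygy R ^^ n) T}"
 using assms
proof (induction rule: add_closure_induct)
 case (zero Z)
 have "(syzygy R ^^ n) Z \<in> zero_modules R"
 proof (induction n)
  case (Suc n)
  then show ?case using syzygy_projective[OF R_fl zero_projective[of "(syzygy R ^^ n) Z"]] by simp
 qed (use zero in simp)
 then show ?case by (rule add_closure_zero)
next
 case (summand N Y)
 then obtain N' where N': "N \<in> fg_modules R" "N' \<in> fg_modules R" "mod_iso R T (dsum N N')"
  by (auto simp: dir_summand_def)
 have "dir_summand R ((syzygy R ^^ n) N) ((syzygy R ^^ n) T)"
  by (rule dir_summandI[OF syzygy_pow_fg[OF R_fl N'(1)] fg_modulesD[OF syzygy_pow_fg[OF R_fl N'(2)]]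
     syzygy_pow_dsum[OF R_fl T_fg N']])
 then show ?case by (rule add_closure_summand) simp
next
 case (dsum M N N')
 show ?case
  by (rule add_closure_dsum[OF syzygy_pow_fg[OF R_fl dsum(1)] dsum.IH syzygy_pow_dsum[OF R_fl dsum(1-4)]])
qed

lemma ses_split: "right_module R M \<Longrightarrow> Z \<in> zero_modules R \<Longrightarrow> ses R Z M M"
proof -
 assume M: "right_module R M" and "Z \<in> zero_modules R"
 then have Z: "right_module R Z" "carrier Z = {\<zero>\<^sub>Z}" unfolding zero_modules_iff by blast+
 interpret M: right_module R M by (rule M)
 have "short_exact R Z M M (\<lambda>_. \<zero>\<^sub>M) (\<lambda>x. x)" unfolding short_exact_def
  by (intro conjI mod_homI) (auto simp: Z(2) a_kernel_def' M.act_zero)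
 then show ?thesis by (auto simp: ses_def)
qed

text \<open>The modules \<open>V i\<close> of the parts are glued, and the \<open>n\<close>-th syzygy of \<open>T\<close> is added to the result in
 order to absorb the semisimple summand of the first syzygy.\<close>

theorem syzygies_resolved_glue:
 assumes D: "\<And>i. add_closed (S i) (D i)" and res: "\<And>i. syzygies_resolved_by n (S i) (D i)"
 shows "syzygies_resolved_by (n + 1) R (glue_class D)"
proof -
 have "\<exists>V. \<forall>i. V i \<in> fg_modules (S i) \<and> (\<forall>M\<in>fg_modules (S i). \<exists>V0\<in>add_closure (S i) {V i}. \<exists>V1\<in>add_closure (S i) {V i}.
  \<exists>D0\<in>D i. \<exists>D1\<in>D i. ses (S i) (dsum V1 D1) (dsum V0 D0) ((syzygy (S i) ^^ n) M))"
  by (rule choice) (use res in \<open>unfold syzygies_resolved_by_def ses_def, blast\<close>)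
 then obtain V where V: "\<And>i. V i \<in> fg_modules (S i)"
  and Vres: "\<And>i M. M \<in> fg_modules (S i) \<Longrightarrow> \<exists>V0\<in>add_closure (S i) {V i}. \<exists>V1\<in>add_closure (S i) {V i}.
  \<exists>D0\<in>D i. \<exists>D1\<in>D i. ses (S i) (dsum V1 D1) (dsum V0 D0) ((syzygy (S i) ^^ n) M)" by blast
 have Dfg: "M \<in> fg_modules (S i)" if "M \<in> D i" for M i using D[of i] that by (auto simp: add_closed_def)
 let ?O = "\<lambda>M. (syzygy R ^^ n) M"
 let ?T = "?O T"
 have Tfg: "?T \<in> fg_modules R" by (rule syzygy_pow_fg[OF R_fl T_fg])
 let ?W = "list_copy R (dsum (gluel V) ?T)"
 note GV = gluel[OF V]
 have Wd: "fg_module R (dsum (gluel V) ?T)" by (rule fg_module_dsum[OF fg_modulesD[OF GV(1)] fg_modulesD[OF Tfg]])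
 note W = list_copy[OF Wd]
 have sV: "dir_summand R (gluel V) ?W" by (rule dir_summandI[OF GV(1) fg_modulesD[OF Tfg] W(3)])
 have sT: "dir_summand R ?T ?W"
  by (rule dir_summandI[OF Tfg fg_modulesD[OF GV(1)] mod_iso_trans[OF W(3) dsum_comm]])
 have "\<exists>V0\<in>add_closure R {?W}. \<exists>V1\<in>add_closure R {?W}. \<exists>D0\<in>glue_class D. \<exists>D1\<in>glue_class D.
  ses R (dsum V1 D1) (dsum V0 D0) ((syzygy R ^^ (n + 1)) M)" if M: "M \<in> fg_modules R" for M
 proof -
  obtain Y Q where Y: "\<And>i. Y i \<in> fg_modules (S i)" and Q: "Q \<in> fg_modules R" "killed Q"
   and iso: "mod_iso R (syzygy R M) (dsum (gluel Y) Q)"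
   using syzygy_decomposition[OF M] by metis
  have "\<exists>t. \<forall>i. fst t i \<in> add_closure (S i) {V i} \<and> fst (snd t) i \<in> add_closure (S i) {V i} \<and>
   fst (snd (snd t)) i \<in> D i \<and> snd (snd (snd t)) i \<in> D i \<and>
   ses (S i) (dsum (fst (snd t) i) (snd (snd (snd t)) i)) (dsum (fst t i) (fst (snd (snd t)) i)) ((syzygy (S i) ^^ n) (Y i))"
  proof -
   have "\<exists>t. \<forall>i. (case t i of (V0, V1, D0, D1) \<Rightarrow> V0 \<in> add_closure (S i) {V i} \<and> V1 \<in> add_closure (S i) {V i} \<and>
    D0 \<in> D i \<and> D1 \<in> D i \<and> ses (S i) (dsum V1 D1) (dsum V0 D0) ((syzygy (S i) ^^ n) (Y i)))"
    by (rule choice) (use Vres[OF Y] in \<open>simp add: split_paired_Ex, blast\<close>)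
   then obtain t where "\<And>i. (case t i of (V0, V1, D0, D1) \<Rightarrow> V0 \<in> add_closure (S i) {V i} \<and> V1 \<in> add_closure (S i) {V i} \<and>
    D0 \<in> D i \<and> D1 \<in> D i \<and> ses (S i) (dsum V1 D1) (dsum V0 D0) ((syzygy (S i) ^^ n) (Y i)))" by blast
   then show ?thesis
    by (intro exI[of _ "(\<lambda>i. fst (t i), \<lambda>i. fst (snd (t i)), \<lambda>i. fst (snd (snd (t i))), \<lambda>i. snd (snd (snd (t i))))"])
      (simp add: case_prod_unfold)
  qed
  then obtain V0 V1 D0 D1 where V0: "\<And>i. V0 i \<in> add_closure (S i) {V i}" and V1: "\<And>i. V1 i \<in> add_closure (S i) {V i}"
   and D0: "\<And>i. D0 i \<in> D i" and D1: "\<And>i. D1 i \<in> D i"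
   and s: "\<And>i. ses (S i) (dsum (V1 i) (D1 i)) (dsum (V0 i) (D0 i)) ((syzygy (S i) ^^ n) (Y i))" by metis
  note V0f = add_closure_fg[OF V0] and V1f = add_closure_fg[OF V1] and D0f = Dfg[OF D0] and D1f = Dfg[OF D1]
  note rm = fg_mods_rm
  have Yf: "(syzygy (S i) ^^ n) (Y i) \<in> fg_modules (S i)" for i by (rule syzygy_pow_fg[OF S_fl Y])
  have QT: "Q \<in> add_closure R {T}" by (rule add_T[OF Q(1)]) (use Q(2) in \<open>simp add: killed_def\<close>)
  have OQ: "?O Q \<in> add_closure R {?T}" by (rule syzygy_pow_add_closure[OF QT])
  have OQf: "?O Q \<in> fg_modules R" by (rule syzygy_pow_fg[OF R_fl Q(1)])
  let ?V0 = "list_copy R (dsum (gluel V0) (?O Q))"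
  have V0d: "fg_module R (dsum (gluel V0) (?O Q))"
   by (rule fg_module_dsum[OF fg_modulesD[OF gluel(1)[OF V0f]] fg_modulesD[OF OQf]])
  note V0l = list_copy[OF V0d]
  have V0m: "?V0 \<in> add_closure R {?W}"
   by (rule add_closure_dsum[OF V0l(1) add_closure_dir_summand_mono[OF glue_add_closure[OF V V0] sV]
      add_closure_dir_summand_mono[OF OQ sT] V0l(3)])
  have V1m: "gluel V1 \<in> add_closure R {?W}" by (rule add_closure_dir_summand_mono[OF glue_add_closure[OF V V1] sV])
  have D0m: "gluel D0 \<in> glue_class D" by (rule glue_classI[OF gluel(1)[OF D0f] D0 gluel(3)[OF D0f]])
  have D1m: "gluel D1 \<in> glue_class D" by (rule glue_classI[OF gluel(1)[OF D1f] D1 gluel(3)[OF D1f]])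
  have zz: "zero_module \<in> zero_modules R" by (rule zero_module[OF R_ring])
  note z = zz[unfolded zero_modules_iff]
  have m1: "right_module (S i) (dsum (V1 i) (D1 i))" "right_module (S i) (dsum (V0 i) (D0 i))" for i
   by (rule dsum_module[OF rm[OF V1f] rm[OF D1f]], rule dsum_module[OF rm[OF V0f] rm[OF D0f]])
  note gm = glue_module[OF m1(1)] glue_module[OF m1(2)] glue_module[OF rm[OF Yf]]
  have s1: "ses R (dsum (glue (\<lambda>i. dsum (V1 i) (D1 i))) zero_module) (dsum (glue (\<lambda>i. dsum (V0 i) (D0 i))) (?O Q))
   (dsum (glue (\<lambda>i. (syzygy (S i) ^^ n) (Y i))) (?O Q))"
   by (rule ses_dsum[OF glue_ses[OF s m1 rm[OF Yf]] ses_split[OF rm[OF OQf] zz]])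
  have "ses R (dsum (gluel V1) (gluel D1)) (dsum ?V0 (gluel D0)) ((syzygy R ^^ (n + 1)) M)"
  proof (rule ses_iso[OF s1])
   have "mod_iso R (dsum (glue (\<lambda>i. dsum (V1 i) (D1 i))) zero_module) (glue (\<lambda>i. dsum (V1 i) (D1 i)))"
    by (rule dsum_zero_right[OF gm(1) conjunct1[OF z] conjunct2[OF z]])
   also have "mod_iso R \<dots> (dsum (glue V1) (glue D1))" by (rule glue_dsum)
   also have "mod_iso R \<dots> (dsum (gluel V1) (gluel D1))" by (rule dsum_iso[OF gluel(2)[OF V1f] gluel(2)[OF D1f]])
   finally show "mod_iso R (dsum (glue (\<lambda>i. dsum (V1 i) (D1 i))) zero_module) (dsum (gluel V1) (gluel D1))" .
   have "mod_iso R (dsum (glue (\<lambda>i. dsum (V0 i) (D0 i))) (?O Q)) (dsum (dsum (gluel V0) (gluel D0)) (?O Q))"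
    by (rule dsum_iso[OF mod_iso_trans[OF glue_dsum dsum_iso[OF gluel(2)[OF V0f] gluel(2)[OF D0f]]] mod_iso_refl])
   also have "mod_iso R \<dots> (dsum (gluel V0) (dsum (gluel D0) (?O Q)))" by (rule dsum_assoc)
   also have "mod_iso R \<dots> (dsum (gluel V0) (dsum (?O Q) (gluel D0)))" by (rule dsum_iso[OF mod_iso_refl dsum_comm])
   also have "mod_iso R \<dots> (dsum (dsum (gluel V0) (?O Q)) (gluel D0))"
    by (rule mod_iso_sym[OF dsum_assoc dsum_module[OF dsum_module[OF rm[OF gluel(1)[OF V0f]] rm[OF OQf]] rm[OF gluel(1)[OF D0f]]]])
   also have "mod_iso R \<dots> (dsum ?V0 (gluel D0))" by (rule dsum_iso[OF V0l(2) mod_iso_refl])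
   finally show "mod_iso R (dsum (glue (\<lambda>i. dsum (V0 i) (D0 i))) (?O Q)) (dsum ?V0 (gluel D0))" .
   have Of: "?O (gluel Y) \<in> fg_modules R" by (rule syzygy_pow_fg[OF R_fl gluel(1)[OF Y]])
   have "mod_iso R (?O (syzygy R M)) (dsum (?O (gluel Y)) (?O Q))"
    by (rule syzygy_pow_dsum[OF R_fl syzygy_fg[OF R_fl M] gluel(1)[OF Y] Q(1) iso])
   also have "mod_iso R \<dots> (dsum (glue (\<lambda>i. (syzygy (S i) ^^ n) (Y i))) (?O Q))"
    by (rule dsum_iso[OF syzygy_pow_glue[OF Y gluel(1)[OF Y] gluel(3)[OF Y]] mod_iso_refl])
   finally have "mod_iso R (dsum (glue (\<lambda>i. (syzygy (S i) ^^ n) (Y i))) (?O Q)) (?O (syzygy R M))"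
    by (rule mod_iso_sym) (rule rm[OF syzygy_pow_fg[OF R_fl syzygy_fg[OF R_fl M]]])
   then show "mod_iso R (dsum (glue (\<lambda>i. (syzygy (S i) ^^ n) (Y i))) (?O Q)) ((syzygy R ^^ (n + 1)) M)"
    by (simp add: funpow_swap1)
   show "right_module R (dsum (glue (\<lambda>i. dsum (V1 i) (D1 i))) zero_module)" by (rule dsum_module[OF gm(1) conjunct1[OF z]])
   show "right_module R (dsum (glue (\<lambda>i. dsum (V0 i) (D0 i))) (?O Q))" by (rule dsum_module[OF gm(2) rm[OF OQf]])
   show "right_module R (dsum (glue (\<lambda>i. (syzygy (S i) ^^ n) (Y i))) (?O Q))" by (rule dsum_module[OF gm(3) rm[OF OQf]])
   show "right_module R ((syzygy R ^^ (n + 1)) M)" by (rule rm[OF syzygy_pow_fg[OF R_fl M]])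
  qed
  then show ?thesis using V0m V1m D0m D1m by blast
 qed
 then show ?thesis unfolding syzygies_resolved_by_def ses_def using W(1) by blast
qed

theorem n_LIT_glue:
 assumes "\<And>i. n_LIT n (S i)" shows "n_LIT (n + 1) R"
proof -
 have "\<exists>D. \<forall>i. zero_IT_subcategory (S i) (D i) \<and> syzygies_resolved_by n (S i) (D i)"
  by (rule choice) (use assms in \<open>unfold n_LIT_def, blast\<close>)
 then obtain D where D: "\<And>i. zero_IT_subcategory (S i) (D i)" "\<And>i. syzygies_resolved_by n (S i) (D i)" by blast
 have "add_closed (S i) (D i)" for i using zero_IT_subcategory_iff[OF S_fl] D(1) by blast
 from syzygies_resolved_glue[OF this D(2)] glue_class_zero_IT[OF D(1)] show ?thesis
  unfolding n_LIT_def by blast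
qed

lemma zero_modules_add_closed:
 assumes "ring A" shows "add_closed A (zero_modules A)"
 unfolding add_closed_def
proof (intro conjI ballI allI impI)
 show "zero_modules A \<subseteq> fg_modules A" by (auto simp: zero_modules_def)
 fix M N N' assume M: "M \<in> fg_modules A" "N \<in> zero_modules A" "N' \<in> zero_modules A" "mod_iso A M (dsum N N')"
 note N = M(2)[unfolded zero_modules_iff] and N' = M(3)[unfolded zero_modules_iff]
 have "carrier (dsum N N') = {\<zero>\<^bsub>dsum N N'\<^esub>}" using conjunct2[OF N] conjunct2[OF N'] by simp
 then have "carrier M = {\<zero>\<^sub>M}"
  using mod_iso_zero[OF M(4) fg_mods_rm[OF M(1)] dsum_module[OF conjunct1[OF N] conjunct1[OF N']]] by blast
 then show "M \<in> zero_modules A" using M(1) by (simp add: zero_modules_def)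
next
 fix M N assume M: "M \<in> zero_modules A" "dir_summand A N M"
 note Mz = M(1)[unfolded zero_modules_iff]
 obtain i p where ip: "i \<in> mod_hom A N M" "p \<in> mod_hom A M N" "\<And>x. x \<in> carrier N \<Longrightarrow> p (i x) = x"
  using dir_summand_obtain[OF M(2) conjunct1[OF Mz]] by metis
 note N = fg_mods_rm[OF dir_summand_fg[OF M(2)]]
 interpret N: right_module A N by (rule N)
 have "x = \<zero>\<^sub>N" if "x \<in> carrier N" for x
  using ip(3)[OF that] mh_closed[OF ip(1) that] conjunct2[OF Mz] mh_zero[OF conjunct1[OF Mz] N ip(2)] by simp
 then have "carrier N = {\<zero>\<^sub>N}" using N.zero_closed by blast
 then show "N \<in> zero_modules A" using dir_summand_fg[OF M(2)] by (simp add: zero_modules_def)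
qed simp

theorem n_Igusa_Todorov_glue:
 assumes "\<And>i. n_Igusa_Todorov n (S i)" shows "n_Igusa_Todorov (n + 1) R"
proof -
 have "glue_class (\<lambda>i. zero_modules (S i)) \<subseteq> zero_modules R"
 proof
  fix M assume "M \<in> glue_class (\<lambda>i. zero_modules (S i))"
  then obtain U where U: "M \<in> fg_modules R" "\<And>i. U i \<in> zero_modules (S i)" "mod_iso R M (glue U)" by (rule glue_classE) blast
  have Um: "right_module (S i) (U i)" and Uz: "carrier (U i) = {\<zero>\<^bsub>U i\<^esub>}" for i
   using U(2)[of i] unfolding zero_modules_iff by blast+
  have "carrier M = {\<zero>\<^sub>M}"
   using mod_iso_zero[OF U(3) fg_mods_rm[OF U(1)] glue_module[OF Um]] glue_zero[OF Uz Um] by blast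
  then show "M \<in> zero_modules R" using U(1) by (simp add: zero_modules_def)
 qed
 moreover have "zero_modules R \<subseteq> glue_class (\<lambda>i. zero_modules (S i))"
  using glue_class_add_closed[OF zero_modules_add_closed[OF S_ring]] unfolding add_closed_def by blast
 ultimately have "glue_class (\<lambda>i. zero_modules (S i)) = zero_modules R" by blast
 then show ?thesis
  using syzygies_resolved_glue[OF zero_modules_add_closed[OF S_ring], of n] assms
  unfolding n_Igusa_Todorov_def by simp
qed

end

section \<open>Algebras that are split modulo a nilpotent part\<close>

text \<open>The finite dimensional algebra \<open>R\<close> over the field \<open>'k\<close>, with scalars \<open>sc\<close>, is spanned by \<open>B\<close> and
 its unit is the sum of idempotents \<open>e v\<close>. Modulo \<open>rad\<close>, the right ideal of \<open>e v\<close> consists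
 of its scalar multiples, by \<open>t v r\<close>, so that \<open>R\<close> modulo \<open>rad\<close> is a product of copies of \<open>'k\<close>.\<close>

locale split_algebra = ring R for R :: "'a ring" (structure) +
 fixes sc :: "'k::field \<Rightarrow> 'a" and B rad :: "'a set" and E :: "'v set" and e :: "'v \<Rightarrow> 'a" and t :: "'v \<Rightarrow> 'a \<Rightarrow> 'k"
 assumes sc_closed: "sc c \<in> carrier R" and sc_one: "sc 1 = \<one>"
  and sc_add: "sc (c + d) = sc c \<oplus> sc d" and sc_mult: "sc (c * d) = sc c \<otimes> sc d"
  and fin_B: "finite B" and B_closed: "B \<subseteq> carrier R"
  and spanning: "B \<subseteq> L \<Longrightarrow> L \<subseteq> carrier R \<Longrightarrow> \<zero> \<in> L \<Longrightarrow> (\<And>r s. r \<in> L \<Longrightarrow> s \<in> L \<Longrightarrow> r \<oplus> s \<in> L) \<Longrightarrow>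
   (\<And>r c. r \<in> L \<Longrightarrow> r \<otimes> sc c \<in> L) \<Longrightarrow> L = carrier R"
  and fin_E: "finite E" and e_closed: "v \<in> E \<Longrightarrow> e v \<in> carrier R" and e_one: "finsum R e E = \<one>"
  and e_idem: "v \<in> E \<Longrightarrow> e v \<otimes> e v = e v"
  and e_corner: "v \<in> E \<Longrightarrow> r \<in> carrier R \<Longrightarrow> e v \<otimes> r \<ominus> e v \<otimes> sc (t v r) \<in> rad"
  and rad_submod: "submod R rad (reg R)"
begin

definition subspace :: "'m set \<Rightarrow> ('a, 'm) module \<Rightarrow> bool" where
 "subspace N M \<longleftrightarrow> N \<subseteq> carrier M \<and> \<zero>\<^sub>M \<in> N \<and> (\<forall>x\<in>N. \<forall>y\<in>N. x \<oplus>\<^sub>M y \<in> N) \<and> (\<forall>c. \<forall>x\<in>N. sc c \<odot>\<^sub>M x \<in> N)"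

lemma submod_subspace: "submod R N M \<Longrightarrow> right_module R M \<Longrightarrow> subspace N M"
 by (simp add: subspace_def right_module.submod_subset right_module.submod_zero right_module.submod_add
   right_module.submod_act sc_closed)

lemma sc_act:
 assumes "right_module R M" "x \<in> carrier M"
 shows "sc c \<odot>\<^sub>M x \<in> carrier M" "sc 1 \<odot>\<^sub>M x = x" "sc 0 \<odot>\<^sub>M x = \<zero>\<^sub>M"
  "sc (c + d) \<odot>\<^sub>M x = sc c \<odot>\<^sub>M x \<oplus>\<^sub>M sc d \<odot>\<^sub>M x" "sc d \<odot>\<^sub>M (sc c \<odot>\<^sub>M x) = sc (c * d) \<odot>\<^sub>M x"
  "sc (- c) \<odot>\<^sub>M x = \<ominus>\<^sub>M (sc c \<odot>\<^sub>M x)"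
proof -
 interpret M: right_module R M by fact
 show c: "sc c \<odot>\<^sub>M x \<in> carrier M" for c using assms by (simp add: M.act_closed sc_closed)
 show "sc 1 \<odot>\<^sub>M x = x" using assms by (simp add: sc_one M.act_one)
 show a: "sc (c + d) \<odot>\<^sub>M x = sc c \<odot>\<^sub>M x \<oplus>\<^sub>M sc d \<odot>\<^sub>M x" for c d
  using assms by (simp add: sc_add M.act_add_ring sc_closed)
 show z: "sc 0 \<odot>\<^sub>M x = \<zero>\<^sub>M" using a[of 0 0] c[of 0] by (simp add: M.add.l_cancel_one')
 show "sc d \<odot>\<^sub>M (sc c \<odot>\<^sub>M x) = sc (c * d) \<odot>\<^sub>M x" using assms by (simp add: sc_mult M.act_mult sc_closed)
 have "sc (- c) \<odot>\<^sub>M x \<oplus>\<^sub>M sc c \<odot>\<^sub>M x = \<zero>\<^sub>M" using a[of "- c" c] z by simp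
 then show "sc (- c) \<odot>\<^sub>M x = \<ominus>\<^sub>M (sc c \<odot>\<^sub>M x)" using c by (simp add: M.minus_equality)
qed

text \<open>The length of a subspace \<open>N\<close> grows by one in the extension \<open>L'\<close> of \<open>L\<close> by one vector if \<open>N\<close> is not
 contained in \<open>L\<close>. This is a dimension function, defined without bases.\<close>

lemma finite_subset_of_graded_subspace:
 assumes "right_module R M" "finite F" "F \<subseteq> carrier M"
 obtains L l where "subspace L M" "F \<subseteq> L"
  "\<And>N N'. subspace N M \<Longrightarrow> subspace N' M \<Longrightarrow> N \<subset> N' \<Longrightarrow> N' \<subseteq> L \<Longrightarrow> l N < (l N' :: nat)"
proof -
 interpret M: right_module R M by fact
 note sc = sc_act[OF assms(1)]
 have "\<exists>L l. subspace L M \<and> F \<subseteq> L \<and> (\<forall>N N'. subspace N M \<longrightarrow> subspace N' M \<longrightarrow> N \<subset> N' \<longrightarrow> N' \<subseteq> L \<longrightarrow> l N < (l N' :: nat))"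
  using assms(2,3)
 proof (induction F rule: finite_induct)
  case empty
  have "N = N'" if "subspace N M" "N' \<subseteq> {\<zero>\<^sub>M}" "N \<subset> N'" for N N' using that by (auto simp: subspace_def)
  then show ?case using submod_subspace[OF M.submod_zero_set assms(1)]
   by (intro exI[of _ "{\<zero>\<^sub>M}"] exI[of _ "\<lambda>_. 0"]) auto
 next
  case (insert x F)
  have x: "x \<in> carrier M" using insert.prems by simp
  obtain L l where L: "subspace L M" "F \<subseteq> L"
   and l: "\<And>N N'. subspace N M \<Longrightarrow> subspace N' M \<Longrightarrow> N \<subset> N' \<Longrightarrow> N' \<subseteq> L \<Longrightarrow> l N < (l N' :: nat)"
   using insert by (auto simp del: psubset_eq) blast
  have LM: "\<And>y. y \<in> L \<Longrightarrow> y \<in> carrier M" using L(1) by (auto simp: subspace_def)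
  let ?L = "{sc c \<odot>\<^sub>M x \<oplus>\<^sub>M y | c y. y \<in> L}"
  let ?l = "\<lambda>N. l (N \<inter> L) + (if N \<subseteq> L then 0 else 1)"
  have "subspace ?L M" unfolding subspace_def
  proof (intro conjI ballI allI)
   show "?L \<subseteq> carrier M" using sc(1)[OF x] LM by auto
   show "\<zero>\<^sub>M \<in> ?L" using sc(3)[OF x] L(1) by (auto simp: subspace_def intro!: exI[of _ 0] exI[of _ "\<zero>\<^sub>M"])
  next
   fix a b assume "a \<in> ?L" "b \<in> ?L"
   then obtain c y d z where ab: "a = sc c \<odot>\<^sub>M x \<oplus>\<^sub>M y" "y \<in> L" "b = sc d \<odot>\<^sub>M x \<oplus>\<^sub>M z" "z \<in> L" by auto
   then have "a \<oplus>\<^sub>M b = sc (c + d) \<odot>\<^sub>M x \<oplus>\<^sub>M (y \<oplus>\<^sub>M z)"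
    using x LM sc(1)[OF x] sc(4)[OF x] by (simp add: M.a_ac)
   moreover have "y \<oplus>\<^sub>M z \<in> L" using ab L(1) by (simp add: subspace_def)
   ultimately show "a \<oplus>\<^sub>M b \<in> ?L" by blast
  next
   fix d a assume "a \<in> ?L"
   then obtain c y where a: "a = sc c \<odot>\<^sub>M x \<oplus>\<^sub>M y" "y \<in> L" by auto
   then have "sc d \<odot>\<^sub>M a = sc (c * d) \<odot>\<^sub>M x \<oplus>\<^sub>M sc d \<odot>\<^sub>M y"
    using LM sc(1)[OF x] sc(5)[OF x] by (simp add: M.act_add_module sc_closed)
   moreover have "sc d \<odot>\<^sub>M y \<in> L" using a L(1) by (simp add: subspace_def)
   ultimately show "sc d \<odot>\<^sub>M a \<in> ?L" by blast
  qed
  moreover have "insert x F \<subseteq> ?L"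
  proof (intro insert_subsetI subsetI)
   show "x \<in> ?L" using sc(2)[OF x] x L(1) by (auto simp: subspace_def intro!: exI[of _ 1] exI[of _ "\<zero>\<^sub>M"])
   show "y \<in> ?L" if "y \<in> F" for y
    using that L(2) LM sc(3)[OF x] by (auto intro!: exI[of _ 0] exI[of _ y])
  qed
  moreover have "?l N < ?l N'" if N: "subspace N M" "subspace N' M" "N \<subset> N'" "N' \<subseteq> ?L" for N N'
  proof (cases "N \<inter> L = N' \<inter> L")
   case False
   have "l (N \<inter> L) < l (N' \<inter> L)"
    using N L(1) False by (intro l) (auto simp: subspace_def)
   then show ?thesis using N(3) by auto
  next
   case True
   then have N': "\<not> N' \<subseteq> L" using N(3) by blast
   have "N \<subseteq> L"
   proof (rule ccontr)
    assume "\<not> N \<subseteq> L"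
    then obtain n where n: "n \<in> N" "n \<notin> L" by blast
    then obtain c y where c: "n = sc c \<odot>\<^sub>M x \<oplus>\<^sub>M y" "y \<in> L" using N by blast
    have c0: "c \<noteq> 0" using c n(2) sc(3)[OF x] LM by auto
    have "n' \<in> N" if n': "n' \<in> N'" for n'
    proof -
     obtain d z where d: "n' = sc d \<odot>\<^sub>M x \<oplus>\<^sub>M z" "z \<in> L" using N n' by blast
     let ?q = "- (d / c)"
     have nM: "n \<in> carrier M" "n' \<in> carrier M" using c d LM sc(1)[OF x] by auto
     have qn: "sc ?q \<odot>\<^sub>M n = sc (- d) \<odot>\<^sub>M x \<oplus>\<^sub>M sc ?q \<odot>\<^sub>M y"
      using c c0 LM sc(1)[OF x] sc(5)[OF x] by (simp add: M.act_add_module sc_closed)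
     have qy: "sc ?q \<odot>\<^sub>M y \<in> L" using c L(1) by (simp add: subspace_def)
     have "n' \<oplus>\<^sub>M sc ?q \<odot>\<^sub>M n = (sc d \<odot>\<^sub>M x \<oplus>\<^sub>M sc (- d) \<odot>\<^sub>M x) \<oplus>\<^sub>M (z \<oplus>\<^sub>M sc ?q \<odot>\<^sub>M y)"
      unfolding qn using d LM qy sc(1)[OF x] by (simp add: M.a_ac)
     also have "\<dots> = z \<oplus>\<^sub>M sc ?q \<odot>\<^sub>M y" using sc(4)[OF x, of d "- d", symmetric] sc(3)[OF x] d LM qy by simp
     also have "\<dots> \<in> L" using d(2) qy L(1) by (simp add: subspace_def)
     finally have "n' \<oplus>\<^sub>M sc ?q \<odot>\<^sub>M n \<in> L" .
     moreover have "n' \<oplus>\<^sub>M sc ?q \<odot>\<^sub>M n \<in> N'" using subsetD[OF psubset_imp_subset[OF N(3)] n(1)] n' N(2) by (simp add: subspace_def)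
     ultimately have "n' \<oplus>\<^sub>M sc ?q \<odot>\<^sub>M n \<in> N" using True by blast
     then have "(n' \<oplus>\<^sub>M sc ?q \<odot>\<^sub>M n) \<oplus>\<^sub>M sc (- ?q) \<odot>\<^sub>M n \<in> N" using N(1) n(1) by (simp add: subspace_def)
     moreover have "(n' \<oplus>\<^sub>M sc ?q \<odot>\<^sub>M n) \<oplus>\<^sub>M sc (- ?q) \<odot>\<^sub>M n = n'"
      using nM sc(1)[OF nM(1)] sc(6)[OF nM(1), of ?q] by (simp add: M.a_assoc M.r_neg del: minus_minus)
     ultimately show ?thesis by simp
    qed
    then show False using N(3) by blast
   qed
   then show ?thesis using True N' by simp
  qed
  ultimately show ?case by (intro exI[of _ ?L] exI[of _ ?l]) blast
 qed
 then show thesis using that by metis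
qed

text \<open>A finitely generated module is the span of the products of the generators with the elements of \<open>B\<close>,
 so that its submodules are measured by dimension.\<close>

lemma finite_length: "fin_len_ring R"
 unfolding fin_len_ring_def
proof (intro conjI ballI)
 fix M assume M: "M \<in> fg_modules R"
 interpret M: right_module R M by (rule fg_mods_rm[OF M])
 obtain G where G: "finite G" "G \<subseteq> carrier M" "\<And>L. submod R L M \<Longrightarrow> G \<subseteq> L \<Longrightarrow> L = carrier M"
  using M by (auto simp: fg_modules_def fin_gen_def)
 let ?F = "(\<lambda>(b, g). b \<odot>\<^sub>M g) ` (B \<times> G)"
 obtain L l where L: "subspace L M" "?F \<subseteq> L"
  and l: "\<And>N N'. subspace N M \<Longrightarrow> subspace N' M \<Longrightarrow> N \<subset> N' \<Longrightarrow> N' \<subseteq> L \<Longrightarrow> l N < (l N' :: nat)"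
 proof (rule finite_subset_of_graded_subspace[OF M.right_module_axioms, of ?F])
  show "finite ?F" using fin_B G by simp
  show "?F \<subseteq> carrier M" using B_closed G by (auto simp: M.act_closed subset_eq)
 qed blast
 have RG: "r \<odot>\<^sub>M g \<in> L" if r: "r \<in> carrier R" and g: "g \<in> G" for r g
 proof -
  have gM: "g \<in> carrier M" using g G by blast
  have "{r \<in> carrier R. r \<odot>\<^sub>M g \<in> L} = carrier R"
   by (rule spanning) (use g gM L B_closed in \<open>auto simp: subspace_def M.zero_act M.act_add_ring M.act_mult sc_closed\<close>)
  then show ?thesis using r by blast
 qed
 have "{x \<in> L. \<forall>r\<in>carrier R. r \<odot>\<^sub>M x \<in> L} = carrier M"
 proof (rule G(3), rule M.submodI)
  show "G \<subseteq> {x \<in> L. \<forall>r\<in>carrier R. r \<odot>\<^sub>M x \<in> L}"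
  proof
   fix g assume g: "g \<in> G"
   have "g \<in> L" using RG[OF one_closed g] M.act_one[OF subsetD[OF G(2) g]] by simp
   then show "g \<in> {x \<in> L. \<forall>r\<in>carrier R. r \<odot>\<^sub>M x \<in> L}" using RG[OF _ g] by blast
  qed
 qed (use L(1) in \<open>auto simp: subspace_def M.act_zero M.act_add_module M.act_mult[symmetric] subset_eq\<close>)
 then have "carrier M \<subseteq> L" by blast
 then have "l N < l N'" if "submod R N M" "submod R N' M" "N \<subset> N'" for N N'
  using that l submod_subspace M.right_module_axioms M.submod_subset[OF that(2)] by (meson subset_trans)
 then show "fin_length R M" unfolding fin_length_def length_le_def by blast
qed (rule ring_axioms)

text \<open>In a module killed by \<open>rad\<close> the lines through the vectors of the form \<open>e v \<odot> x\<close> are submodules, and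
 these vectors generate.\<close>

lemma killed_line:
 assumes M: "right_module R M" "\<And>r x. r \<in> rad \<Longrightarrow> x \<in> carrier M \<Longrightarrow> r \<odot>\<^sub>M x = \<zero>\<^sub>M"
  and v: "v \<in> E" "x \<in> carrier M" "r \<in> carrier R"
 shows "r \<odot>\<^sub>M (e v \<odot>\<^sub>M x) = sc (t v r) \<odot>\<^sub>M (e v \<odot>\<^sub>M x)"
proof -
 interpret M: right_module R M by (rule M)
 let ?a = "e v \<otimes> r" and ?b = "e v \<otimes> sc (t v r)"
 have c: "?a \<in> carrier R" "?b \<in> carrier R" using v by (simp_all add: e_closed sc_closed)
 have "?a \<odot>\<^sub>M x = ((?a \<ominus> ?b) \<oplus> ?b) \<odot>\<^sub>M x" using c by (simp add: a_minus_def a_assoc l_neg)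
 also have "\<dots> = ?b \<odot>\<^sub>M x"
  using c v M(2)[OF e_corner[OF v(1,3)] v(2)] by (simp add: M.act_add_ring M.act_closed)
 finally show ?thesis using v by (simp add: M.act_mult e_closed sc_closed)
qed

lemma generated_by_corners:
 assumes M: "right_module R M" and N: "submod R N M" "x \<in> carrier M" "\<And>v. v \<in> E \<Longrightarrow> e v \<odot>\<^sub>M x \<in> N"
 shows "x \<in> N"
proof -
 interpret M: right_module R M by (rule M)
 have "finsum M (\<lambda>v. e v \<odot>\<^sub>M x) E \<in> N" by (rule M.submod_finsum[OF N(1) fin_E N(3)])
 moreover have "finsum M (\<lambda>v. e v \<odot>\<^sub>M x) E = x"
  using M.finsum_act[OF fin_E _ N(2), of e] N(2) by (simp add: e_one e_closed M.act_one)
 ultimately show ?thesis by simp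
qed

lemma line_submod:
 assumes M: "right_module R M" "\<And>r x. r \<in> rad \<Longrightarrow> x \<in> carrier M \<Longrightarrow> r \<odot>\<^sub>M x = \<zero>\<^sub>M"
  and v: "v \<in> E" "x \<in> carrier M" and L: "submod R L M"
 shows "submod R {l \<oplus>\<^sub>M sc c \<odot>\<^sub>M (e v \<odot>\<^sub>M x) | l c. l \<in> L} M" (is "submod R ?L' M")
proof -
 interpret M: right_module R M by (rule M)
 let ?y = "e v \<odot>\<^sub>M x"
 have y: "?y \<in> carrier M" using v by (simp add: M.act_closed e_closed)
 note sc = sc_act[OF M(1) y]
 note LM = subsetD[OF M.submod_subset[OF L]]
 show ?thesis
 proof (rule M.submodI)
  show "?L' \<subseteq> carrier M" using LM sc(1) by auto
  show "\<zero>\<^sub>M \<in> ?L'" using sc(3) M.submod_zero[OF L] by (auto intro!: exI[of _ "\<zero>\<^sub>M"] exI[of _ 0])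
 next
  fix a b assume "a \<in> ?L'" "b \<in> ?L'"
  then obtain l c l' d where ab: "a = l \<oplus>\<^sub>M sc c \<odot>\<^sub>M ?y" "l \<in> L" "b = l' \<oplus>\<^sub>M sc d \<odot>\<^sub>M ?y" "l' \<in> L" by auto
  then have "a \<oplus>\<^sub>M b = (l \<oplus>\<^sub>M l') \<oplus>\<^sub>M sc (c + d) \<odot>\<^sub>M ?y" using LM sc(1,4) by (simp add: M.a_ac)
  then show "a \<oplus>\<^sub>M b \<in> ?L'" using ab M.submod_add[OF L] by blast
 next
  fix r a assume r: "r \<in> carrier R" and "a \<in> ?L'"
  then obtain l c where a: "a = l \<oplus>\<^sub>M sc c \<odot>\<^sub>M ?y" "l \<in> L" by auto
  have "r \<odot>\<^sub>M (sc c \<odot>\<^sub>M ?y) = (sc c \<otimes> r) \<odot>\<^sub>M ?y" using r y by (simp add: M.act_mult sc_closed)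
  also have "\<dots> = sc (t v (sc c \<otimes> r)) \<odot>\<^sub>M ?y" using r by (intro killed_line M v) (simp_all add: sc_closed)
  finally have "r \<odot>\<^sub>M a = r \<odot>\<^sub>M l \<oplus>\<^sub>M sc (t v (sc c \<otimes> r)) \<odot>\<^sub>M ?y"
   using r a LM sc(1) by (simp add: M.act_add_module)
  then show "r \<odot>\<^sub>M a \<in> ?L'" using M.submod_act[OF L r a(2)] by blast
 qed
qed

text \<open>A submodule meeting \<open>K\<close> trivially that is maximal with this property is a complement, since any line
 outside the sum could be added to it.\<close>

lemma killed_complement:
 assumes M: "M \<in> fg_modules R" "\<And>r x. r \<in> rad \<Longrightarrow> x \<in> carrier M \<Longrightarrow> r \<odot>\<^sub>M x = \<zero>\<^sub>M"
  and K: "submod R K M"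
 shows "\<exists>L. submod R L M \<and> K \<inter> L = {\<zero>\<^sub>M} \<and> K <+>\<^sub>M L = carrier M"
proof -
 have Mm: "right_module R M" by (rule fg_mods_rm[OF M(1)])
 interpret M: right_module R M by (rule Mm)
 obtain n where "length_le R M n" using finite_length M(1) by (auto simp: fin_len_ring_def fin_length_def)
 then obtain l where n: "l (carrier M) \<le> n" and l: "\<And>N N'. submod R N M \<Longrightarrow> submod R N' M \<Longrightarrow> N \<subset> N' \<Longrightarrow> l N < (l N' :: nat)"
  by (auto simp: length_le_def)
 let ?P = "\<lambda>L. submod R L M \<and> K \<inter> L = {\<zero>\<^sub>M}"
 have "l L \<le> n" if "?P L" for L
  using l[OF _ M.submod_carrier, of L] that n M.submod_subset[of L] by (cases "L = carrier M") (simp_all add: psubset_eq)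
 moreover have "?P {\<zero>\<^sub>M}" using M.submod_zero_set M.submod_zero[OF K] by auto
 ultimately obtain L where L: "?P L" and max: "\<And>L'. ?P L' \<Longrightarrow> l L' \<le> l L"
  using ex_has_greatest_nat[of ?P "{\<zero>\<^sub>M}" l "n + 1"] by (auto simp: less_Suc_eq_le)
 note KL = M.submod_add_set[OF K conjunct1[OF L]]
 note KM = subsetD[OF M.submod_subset[OF K]] and LM = subsetD[OF M.submod_subset[OF conjunct1[OF L]]]
 have "x \<in> K <+>\<^sub>M L" if x: "x \<in> carrier M" for x
 proof (rule generated_by_corners[OF Mm KL x], rule ccontr)
  fix v assume v: "v \<in> E"
  let ?y = "e v \<odot>\<^sub>M x"
  assume yn: "?y \<notin> K <+>\<^sub>M L"
  have y: "?y \<in> carrier M" using v x by (simp add: M.act_closed e_closed)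
  note sc = sc_act[OF Mm y]
  let ?L = "{k \<oplus>\<^sub>M sc c \<odot>\<^sub>M ?y | k c. k \<in> L}"
  have L': "submod R ?L M" using L by (intro line_submod Mm M v x) auto
  have "z = \<zero>\<^sub>M" if z: "z \<in> K" "z \<in> ?L" for z
  proof -
   obtain k c where k: "z = k \<oplus>\<^sub>M sc c \<odot>\<^sub>M ?y" "k \<in> L" using z by blast
   have "c = 0"
   proof (rule ccontr)
    assume c: "c \<noteq> 0"
    have "sc c \<odot>\<^sub>M ?y = z \<oplus>\<^sub>M \<ominus>\<^sub>M k" using k LM sc(1) by (simp add: M.a_comm M.r_neg1)
    then have "sc c \<odot>\<^sub>M ?y \<in> K <+>\<^sub>M L" using z(1) k(2) M.submod_uminus L by (auto simp: set_add_def')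
    then have "sc (1 / c) \<odot>\<^sub>M (sc c \<odot>\<^sub>M ?y) \<in> K <+>\<^sub>M L" by (rule M.submod_act[OF KL sc_closed])
    then show False using yn c by (simp add: sc(5,2))
   qed
   then have "z \<in> L" using k LM by (simp add: sc(3))
   then show ?thesis using z L by blast
  qed
  then have "?P ?L" using L' M.submod_zero[OF K] M.submod_zero[OF L'] by blast
  moreover have "L \<subset> ?L"
  proof
   show "L \<subseteq> ?L"
   proof
    fix k assume "k \<in> L"
    then show "k \<in> ?L" using LM sc(3) by (intro CollectI exI[of _ k] exI[of _ 0]) simp
   qed
   have "?y \<in> ?L" using M.submod_zero[of L] L y sc(2) by (intro CollectI exI[of _ "\<zero>\<^sub>M"] exI[of _ 1]) auto
   moreover have "?y \<notin> L"
   proof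
    assume "?y \<in> L"
    then have "\<zero>\<^sub>M \<oplus>\<^sub>M ?y \<in> K <+>\<^sub>M L" using M.submod_zero[OF K] unfolding set_add_def' by blast
    then show False using yn y by simp
   qed
   ultimately show "L \<noteq> ?L" by blast
  qed
  ultimately show False using l[of L ?L] L max[of ?L] by (simp add: not_less[symmetric])
 qed
 then have "K <+>\<^sub>M L = carrier M" using M.submod_subset[OF KL] by blast
 then show ?thesis using L by blast
qed

text \<open>The quotient of the regular module by \<open>rad\<close> generates the killed modules: an indecomposable killed
 module is a line through a vector fixed by some \<open>e v\<close>, hence a retract of this quotient.\<close>

lemma killed_add:
 obtains T where "T \<in> fg_modules R"
  "\<And>M. M \<in> fg_modules R \<Longrightarrow> (\<And>r x. r \<in> rad \<Longrightarrow> x \<in> carrier M \<Longrightarrow> r \<odot>\<^sub>M x = \<zero>\<^sub>M) \<Longrightarrow> M \<in> add_closure R {T}"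
proof -
 interpret G: right_module R "reg R" by (rule reg_module[OF ring_axioms])
 have minus: "x \<ominus>\<^bsub>reg R\<^esub> y = x \<ominus> y" if "x \<in> carrier R" "y \<in> carrier R" for x y
  using G.minus_equality[of "\<ominus> y" y] that by (simp add: a_minus_def l_neg)
 let ?H = "quot_rep (reg R) rad" and ?Q = "quot_mod (reg R) rad"
 have H: "?H \<in> mod_hom R (reg R) ?Q" by (rule G.quot_rep_hom[OF rad_submod])
 have Q: "right_module R ?Q" by (rule G.quot_module[OF rad_submod])
 have "fg_module R ?Q" by (rule fg_module_surj[OF fg_module_reg[OF ring_axioms] Q H]) (simp add: quot_mod_def)
 note T = list_copy[OF this]
 let ?T = "list_copy R ?Q"
 obtain a b where ab: "a \<in> mod_hom R ?Q ?T" "b \<in> mod_hom R ?T ?Q" "\<And>x. x \<in> carrier ?Q \<Longrightarrow> b (a x) = x"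
  using mod_iso_obtain[OF T(2) Q] by metis
 have main: "M \<in> add_closure R {?T}" if M: "M \<in> fg_modules R" and k: "\<And>r x. r \<in> rad \<Longrightarrow> x \<in> carrier M \<Longrightarrow> r \<odot>\<^sub>M x = \<zero>\<^sub>M" for M
  using finite_length M k
 proof (induction rule: indecomposable_induct)
  case (zero Z)
  then show ?case by (intro add_closure_zero)
 next
  case (dsum M N N')
  note m = fg_mods_rm[OF dsum(1)] fg_mods_rm[OF dsum(2)] fg_mods_rm[OF dsum(3)]
  obtain f g where fg: "f \<in> mod_hom R M (dsum N N')" "g \<in> mod_hom R (dsum N N') M"
   "\<And>x. x \<in> carrier (dsum N N') \<Longrightarrow> f (g x) = x"
   using mod_iso_obtain[OF dsum(4) m(1)] by metis
  have k: "r \<odot>\<^bsub>dsum N N'\<^esub> z = \<zero>\<^bsub>dsum N N'\<^esub>" if "r \<in> rad" "z \<in> carrier (dsum N N')" for r z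
  proof -
   have r: "r \<in> carrier R" using that(1) G.submod_subset[OF rad_submod] by auto
   have "r \<odot>\<^bsub>dsum N N'\<^esub> z = f (r \<odot>\<^sub>M g z)"
    using mh_act[OF fg(1) r mh_closed[OF fg(2) that(2)]] fg(3)[OF that(2)] by simp
   then show ?thesis
    using dsum(7)[OF that(1) mh_closed[OF fg(2) that(2)]] mh_zero[OF m(1) dsum_module[OF m(2,3)] fg(1)] by simp
  qed
  have "N \<in> add_closure R {?T}"
   using k[of _ "(_, \<zero>\<^sub>N')"] right_module.add_rules(2)[OF m(3)] by (intro dsum(5)) auto
  moreover have "N' \<in> add_closure R {?T}"
   using k[of _ "(\<zero>\<^sub>N, _)"] right_module.add_rules(2)[OF m(2)] by (intro dsum(6)) auto
  ultimately show ?case by (rule add_closure_dsum[OF dsum(1) _ _ dsum(4)])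
 next
  case (indecomposable M)
  have M: "M \<in> fg_modules R" "M \<notin> zero_modules R" using indecomposable(1) by (auto simp: indecomposable_def)
  note Mm = fg_mods_rm[OF M(1)]
  interpret M: right_module R M by (rule Mm)
  have "carrier M \<noteq> {\<zero>\<^sub>M}" using M by (simp add: zero_modules_def)
  then obtain x0 where x0: "x0 \<in> carrier M" "x0 \<notin> {\<zero>\<^sub>M}" using M.zero_closed by blast
  then obtain v where v: "v \<in> E" "e v \<odot>\<^sub>M x0 \<notin> {\<zero>\<^sub>M}"
   using generated_by_corners[OF Mm M.submod_zero_set x0(1)] by blast
  let ?y = "e v \<odot>\<^sub>M x0"
  have y: "?y \<in> carrier M" using v x0 by (simp add: M.act_closed e_closed)
  note sc = sc_act[OF Mm y]
  let ?L = "{l \<oplus>\<^sub>M sc c \<odot>\<^sub>M ?y | l c. l \<in> {\<zero>\<^sub>M}}"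
  have L: "submod R ?L M" by (intro line_submod Mm indecomposable v x0 M.submod_zero_set)
  obtain L' where L': "submod R L' M" "?L \<inter> L' = {\<zero>\<^sub>M}" "?L <+>\<^sub>M L' = carrier M"
   using killed_complement[OF M(1) indecomposable(2) L] by blast
  obtain \<rho> where \<rho>: "\<rho> \<in> mod_hom R M (M\<lparr>carrier := ?L\<rparr>)" "\<And>x. x \<in> ?L \<Longrightarrow> \<rho> x = x" "\<And>x. x \<in> L' \<Longrightarrow> \<rho> x = \<zero>\<^sub>M"
   by (rule complement_retraction[OF Mm L L']) blast
  let ?K = "ker_mod M (M\<lparr>carrier := ?L\<rparr>) \<rho>"
  have "M\<lparr>carrier := N\<rparr> \<in> fg_modules R" if "submod R N M" for N
   by (rule fg_modulesI[OF fg_module_submod[OF finite_length fg_modulesD[OF M(1)] that]])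
  note fg = this[OF L] this[OF submod_kernel[OF Mm M.submod_module[OF L] \<rho>(1)]]
  have "mod_iso R M (dsum (M\<lparr>carrier := ?L\<rparr>) ?K)"
   by (rule retract_dsum[OF Mm M.submod_module[OF L] submod_inclusion[OF L Mm] \<rho>(1)]) (simp add: \<rho>(2))
  moreover have "?y \<in> ?L" using sc(2) y by (auto intro!: exI[of _ 1])
  then have "M\<lparr>carrier := ?L\<rparr> \<notin> zero_modules R" using v(2) by (auto simp: zero_modules_def)
  ultimately have "?K \<in> zero_modules R" using indecomposable(1) fg unfolding indecomposable_def by blast
  then have "x = \<zero>\<^sub>M" if "x \<in> L'" for x
   using \<rho>(3)[OF that] that M.submod_subset[OF L'(1)] by (auto simp: zero_modules_def a_kernel_def')
  then have "L' = {\<zero>\<^sub>M}" using M.submod_zero[OF L'(1)] by blast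
  then have line: "\<exists>c. m = sc c \<odot>\<^sub>M ?y" if "m \<in> carrier M" for m
  proof -
   from that have "m \<in> ?L <+>\<^sub>M L'" using L'(3) by simp
   then show ?thesis unfolding set_add_def' \<open>L' = {\<zero>\<^sub>M}\<close> using sc(1) by auto
  qed
  have unique: "c = d" if cd: "sc c \<odot>\<^sub>M ?y = sc d \<odot>\<^sub>M ?y" for c d
  proof (rule ccontr)
   assume "c \<noteq> d"
   have "sc (c + - d) \<odot>\<^sub>M ?y = \<zero>\<^sub>M" unfolding sc(4,6) cd using sc(1) by (simp add: M.r_neg)
   then have "sc (1 / (c - d)) \<odot>\<^sub>M (sc (c - d) \<odot>\<^sub>M ?y) = \<zero>\<^sub>M" by (simp add: M.act_zero sc_closed)
   then show False using \<open>c \<noteq> d\<close> v(2) by (simp add: sc(5,2))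
  qed
  define co where "co m = (SOME c. m = sc c \<odot>\<^sub>M ?y)" for m
  have co: "sc (co m) \<odot>\<^sub>M ?y = m" if "m \<in> carrier M" for m
   unfolding co_def using someI_ex[OF line[OF that]] by simp
  have co_eq: "co (sc c \<odot>\<^sub>M ?y) = c" for c using unique[OF co[OF sc(1)]] .
  have ev: "e v \<odot>\<^sub>M ?y = ?y" using v x0 by (simp add: M.act_mult[symmetric] e_closed e_idem)
  have evc: "e v \<otimes> sc c \<in> carrier R" for c using v by (simp add: e_closed sc_closed)
  have H_act: "?H r \<odot>\<^sub>M ?y = r \<odot>\<^sub>M ?y" and Hc: "?H r \<in> carrier R" if r: "r \<in> carrier R" for r
  proof -
   have q: "?H r \<in> carrier R" "?H r \<ominus> r \<in> rad" using G.quot_rep[OF rad_submod, of r] r by (simp_all add: minus)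
   have "?H r \<odot>\<^sub>M ?y = ((?H r \<ominus> r) \<oplus> r) \<odot>\<^sub>M ?y" using q r by (simp add: a_minus_def a_assoc l_neg)
   also have "\<dots> = r \<odot>\<^sub>M ?y"
    using q r y indecomposable(2)[OF q(2) y] by (simp add: M.act_add_ring M.act_closed)
   finally show "?H r \<odot>\<^sub>M ?y = r \<odot>\<^sub>M ?y" .
   show "?H r \<in> carrier R" by (rule q)
  qed
  have QE: "\<exists>r\<in>carrier R. z = ?H r" if "z \<in> carrier ?Q" for z using that by (auto simp: quot_mod_def)
  have "(\<lambda>z. z \<odot>\<^sub>M ?y) \<in> mod_hom R ?Q M"
  proof (rule mod_homI)
   fix z assume "z \<in> carrier ?Q"
   then obtain r where r: "r \<in> carrier R" "z = ?H r" using QE by blast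
   show "z \<odot>\<^sub>M ?y \<in> carrier M" using r y Hc by (simp add: M.act_closed)
   show "(s \<odot>\<^sub>?Q z) \<odot>\<^sub>M ?y = s \<odot>\<^sub>M (z \<odot>\<^sub>M ?y)" if s: "s \<in> carrier R" for s
    using mh_act[OF H s, of r, symmetric] r s y by (simp add: H_act M.act_mult[symmetric])
   fix w assume "w \<in> carrier ?Q"
   then obtain s where s: "s \<in> carrier R" "w = ?H s" using QE by blast
   show "(z \<oplus>\<^sub>?Q w) \<odot>\<^sub>M ?y = z \<odot>\<^sub>M ?y \<oplus>\<^sub>M w \<odot>\<^sub>M ?y"
    using mh_add[OF H, of r s, symmetric] r s y by (simp add: H_act M.act_add_ring)
  qed
  note p = mh_comp[OF ab(2) this]
  have "(\<lambda>m. ?H (e v \<otimes> sc (co m))) \<in> mod_hom R M ?Q"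
  proof (rule mod_homI)
   fix m assume m: "m \<in> carrier M"
   show "?H (e v \<otimes> sc (co m)) \<in> carrier ?Q" using mh_closed[OF H] evc by simp
   show "?H (e v \<otimes> sc (co (r \<odot>\<^sub>M m))) = r \<odot>\<^sub>?Q ?H (e v \<otimes> sc (co m))" if r: "r \<in> carrier R" for r
   proof -
    let ?r = "sc (co m) \<otimes> r"
    have rc: "?r \<in> carrier R" using r by (simp add: sc_closed)
    have "r \<odot>\<^sub>M m = ?r \<odot>\<^sub>M ?y" using co[OF m] r y by (simp add: M.act_mult sc_closed)
    also have "\<dots> = sc (t v ?r) \<odot>\<^sub>M ?y" by (rule killed_line[OF Mm indecomposable(2) v(1) x0(1) rc])
    finally have "co (r \<odot>\<^sub>M m) = t v ?r" by (simp add: co_eq)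
    moreover have "?H (e v \<otimes> ?r) = ?H (e v \<otimes> sc (t v ?r))"
     using G.quot_rep_eq_iff[OF rad_submod, of "e v \<otimes> ?r" "e v \<otimes> sc (t v ?r)"] e_corner[OF v(1) rc] evc rc v(1)
     by (simp add: e_closed minus)
    ultimately show ?thesis
     using mh_act[OF H r, of "e v \<otimes> sc (co m)"] r v(1) evc by (simp add: m_assoc e_closed sc_closed)
   qed
   fix m' assume m': "m' \<in> carrier M"
   have "m \<oplus>\<^sub>M m' = sc (co m + co m') \<odot>\<^sub>M ?y" using co[OF m] co[OF m'] by (simp add: sc(4))
   then have "co (m \<oplus>\<^sub>M m') = co m + co m'" by (simp add: co_eq)
   then show "?H (e v \<otimes> sc (co (m \<oplus>\<^sub>M m'))) = ?H (e v \<otimes> sc (co m)) \<oplus>\<^sub>?Q ?H (e v \<otimes> sc (co m'))"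
    using mh_add[OF H, of "e v \<otimes> sc (co m)" "e v \<otimes> sc (co m')"] evc v(1)
    by (simp add: sc_add r_distr e_closed sc_closed)
  qed
  note i = mh_comp[OF this ab(1)]
  have "b (a (?H (e v \<otimes> sc (co m)))) \<odot>\<^sub>M ?y = m" if m: "m \<in> carrier M" for m
  proof -
   have "?H (e v \<otimes> sc (co m)) \<in> carrier ?Q" using mh_closed[OF H] evc by simp
   then have "b (a (?H (e v \<otimes> sc (co m)))) \<odot>\<^sub>M ?y = (e v \<otimes> sc (co m)) \<odot>\<^sub>M ?y"
    using evc by (simp add: ab(3) H_act)
   also have "\<dots> = m" using v(1) y co[OF m] by (simp add: M.act_mult e_closed sc_closed ev)
   finally show ?thesis .
  qed
  then have "dir_summand R M ?T" by (intro dir_summand_retract[OF finite_length M(1) T(1) i p])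
  then show ?case by (rule add_closure_summand) simp
 qed
 show thesis using that[OF T(1) main] .
qed

end

section \<open>Bound quiver algebras as split algebras\<close>

abbreviation (input) "path_el \<equiv> Poly_Mapping.single"
abbreviation (input) "coef \<equiv> Poly_Mapping.lookup"

abbreviation path_mult ("_ \<bullet>\<^bsub>_\<^esub> _" [71, 0, 71] 70) where "f \<bullet>\<^bsub>Q\<^esub> g \<equiv> f \<otimes>\<^bsub>path_algebra Q\<^esub> g"

abbreviation (input) sub_path_mult ("_ \<bullet>\<^sub>_ _" [71, 1000, 71] 70) where "f \<bullet>\<^sub>Q g \<equiv> f \<bullet>\<^bsub>Q\<^esub> g"

lemma pa_simps [simp]:
 "f \<in> carrier (path_algebra Q) \<longleftrightarrow> Poly_Mapping.keys f \<subseteq> qpaths Q"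
 "\<zero>\<^bsub>path_algebra Q\<^esub> = 0" "f \<oplus>\<^bsub>path_algebra Q\<^esub> g = f + g"
 by (simp_all add: path_algebra_def)

lemma qpath_end_simps [simp]: "qpath_end Q (u, []) = u" "qpath_end Q (u, a # p) = qpath_end Q (head Q a, p)"
proof -
 have "pre_digraph.awalk_verts Q u p \<noteq> []" for u p by (cases p) (auto simp: pre_digraph.awalk_verts.simps)
 then show "qpath_end Q (u, []) = u" "qpath_end Q (u, a # p) = qpath_end Q (head Q a, p)"
  by (simp_all add: qpath_end_def pre_digraph.awalk_verts.simps)
qed

lemma qpaths_Nil: "(u, []) \<in> qpaths Q \<longleftrightarrow> u \<in> verts Q"
 by (auto simp: qpaths_def pre_digraph.awalk_def pre_digraph.cas.simps)

lemma qpaths_Cons: "wf_digraph Q \<Longrightarrow> (u, a # p) \<in> qpaths Q \<longleftrightarrow> a \<in> arcs Q \<and> tail Q a = u \<and> (head Q a, p) \<in> qpaths Q"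
 by (auto simp: qpaths_def wf_digraph.awalk_Cons_iff)

lemma qpaths_append:
 "wf_digraph Q \<Longrightarrow> (u, p @ q) \<in> qpaths Q \<longleftrightarrow> (u, p) \<in> qpaths Q \<and> (qpath_end Q (u, p), q) \<in> qpaths Q"
proof (induction p arbitrary: u)
 case Nil
 then show ?case by (cases q) (auto simp: qpaths_Nil qpaths_Cons wf_digraph.tail_in_verts)
qed (auto simp: qpaths_Cons)

lemma path_sum_mult: "finite V \<Longrightarrow> (\<Sum>v\<in>V. F v) \<bullet>\<^sub>Q x = (\<Sum>v\<in>V. F v \<bullet>\<^sub>Q x)"
 and path_mult_sum: "finite V \<Longrightarrow> x \<bullet>\<^sub>Q (\<Sum>v\<in>V. F v) = (\<Sum>v\<in>V. x \<bullet>\<^sub>Q F v)"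
 by (induction V rule: finite_induct) (simp_all add: path_algebra_zero path_algebra_distl path_algebra_distr)

lemma lookup_mult_trivial:
 "coef (f \<bullet>\<^sub>Q g) (v, []) = coef f (v, []) * coef (g :: ('v, 'e, 'k::field) qelem) (v, [])"
proof (induction f rule: path_algebra_induct)
 case (2 p c)
 show ?case
 proof (induction g rule: path_algebra_induct)
  case (2 q d)
  obtain u xs w ys where "p = (u, xs)" "q = (w, ys)" by (cases p; cases q)
  then show ?case by (auto simp: path_algebra_single path_term_def lookup_single when_def)
 qed (simp_all add: path_algebra_zero path_algebra_distr lookup_add distrib_left)
qed (simp_all add: path_algebra_zero path_algebra_distl lookup_add distrib_right)

definition scal :: "('v, 'e) quiver \<Rightarrow> 'k::field \<Rightarrow> ('v, 'e, 'k) qelem" where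
 "scal Q c = (\<Sum>v\<in>verts Q. path_el (v, []) c)"

lemma pa_induct [consumes 1, case_names zero single add]:
 assumes "f \<in> carrier (path_algebra Q)" "P 0" "\<And>p c. p \<in> qpaths Q \<Longrightarrow> P (path_el p c)"
  "\<And>a b. a \<in> carrier (path_algebra Q) \<Longrightarrow> b \<in> carrier (path_algebra Q) \<Longrightarrow> P a \<Longrightarrow> P b \<Longrightarrow> P (a + b)"
 shows "P f"
proof -
 have "f \<in> carrier (path_algebra Q) \<and> P f"
  by (rule path_algebra_induct[where f = f])
    (use assms in \<open>auto split: if_splits intro: subsetD[OF Poly_Mapping.keys_add, THEN UnE]\<close>)
 then show ?thesis by blast
qed

context
 fixes Q :: "('v, 'e) quiver"
 assumes Q: "fin_digraph Q"
begin

interpretation fin_digraph Q by (rule Q)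

lemma qpath_ends: "p \<in> qpaths Q \<Longrightarrow> fst p \<in> verts Q \<and> qpath_end Q p \<in> verts Q"
 by (auto simp: qpaths_def qpath_end_def dest: awalk_last_in_verts)

lemma scal_closed: "scal Q c \<in> carrier (path_algebra Q)"
 unfolding scal_def by (auto simp: qpaths_Nil dest!: subsetD[OF keys_sum] split: if_splits)

lemma scal_single:
 assumes "p \<in> qpaths Q"
 shows "scal Q c \<bullet>\<^sub>Q path_el p d = path_el p (c * d)"
  "path_el p d \<bullet>\<^sub>Q scal Q c = path_el p (d * c)"
 using qpath_ends[OF assms]
 by (simp_all add: scal_def path_sum_mult path_mult_sum path_algebra_single path_term_def)

lemma scal_central: "f \<in> carrier (path_algebra Q) \<Longrightarrow> scal Q c \<bullet>\<^sub>Q f = f \<bullet>\<^sub>Q scal Q c"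
 by (induction rule: pa_induct)
   (simp_all add: path_algebra_zero path_algebra_distl path_algebra_distr scal_single mult.commute)

lemma scal_add: "scal Q (c + d) = scal Q c + scal Q d" by (simp add: scal_def single_add sum.distrib)

lemma scal_mult: "scal Q c \<bullet>\<^sub>Q scal Q d = scal Q (c * d)"
 by (subst (2) scal_def) (simp add: path_mult_sum scal_single qpaths_Nil, simp add: scal_def)

lemma scal_one: "scal Q 1 = \<one>\<^bsub>path_algebra Q\<^esub>" by (simp add: scal_def path_algebra_def)

lemma lookup_scal: "coef (scal Q c) (v, []) = (if v \<in> verts Q then c else 0)"
 by (simp add: scal_def lookup_sum lookup_single when_def)

end

lemma path_minus:
 assumes "fin_digraph Q" "f \<in> carrier (path_algebra Q)" "g \<in> carrier (path_algebra Q)"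
 shows "f \<ominus>\<^bsub>path_algebra Q\<^esub> (g :: ('v, 'e, 'k::field) qelem) = f - g"
proof -
 interpret ring "path_algebra Q :: ('v, 'e, 'k) qelem ring" by (rule path_algebra_ring[OF assms(1)])
 have "\<ominus>\<^bsub>path_algebra Q\<^esub> g = - g" using assms by (intro minus_equality) auto
 then show ?thesis by (simp add: a_minus_def)
qed

definition quiver_coset where
 "quiver_coset Q I f = I +>\<^bsub>path_algebra Q\<^esub> f"

definition quiver_rep where
 "quiver_rep Q I x = (SOME f. f \<in> carrier (path_algebra Q) \<and> x = quiver_coset Q I f)"

locale bound_path_algebra =
 fixes Q :: "('v, 'e) quiver" and I :: "('v, 'e, 'k::field) qelem set"
 assumes fin: "fin_digraph Q" and I_ideal: "ideal I (path_algebra Q)"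
  and long_paths: "\<exists>m. \<forall>p\<in>qpaths Q. m \<le> length (snd p) \<longrightarrow> (\<forall>c. path_el p c \<in> I)"
  and lookup_I: "f \<in> I \<Longrightarrow> coef f (v, []) = 0"
begin

sublocale P: ring "path_algebra Q :: ('v, 'e, 'k) qelem ring" by (rule path_algebra_ring[OF fin])
sublocale I: ideal I "path_algebra Q" by (rule I_ideal)

abbreviation "cs \<equiv> quiver_coset Q I"
abbreviation "rp \<equiv> quiver_rep Q I"
abbreviation "PC \<equiv> carrier (path_algebra Q :: ('v, 'e, 'k) qelem ring)"
abbreviation "Rop \<equiv> op_ring (bound_quiver_algebra Q I)"

lemma PC_closed: "0 \<in> PC" "f \<in> PC \<Longrightarrow> g \<in> PC \<Longrightarrow> f + g \<in> PC" "f \<in> PC \<Longrightarrow> g \<in> PC \<Longrightarrow> f - g \<in> PC"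
 "f \<in> PC \<Longrightarrow> g \<in> PC \<Longrightarrow> f \<bullet>\<^sub>Q g \<in> PC"
 using P.zero_closed P.a_closed P.minus_closed P.m_closed path_minus[OF fin] unfolding pa_simps(2,3) by metis+

lemma I_closed: "0 \<in> I" "f \<in> I \<Longrightarrow> g \<in> I \<Longrightarrow> f + g \<in> I" "f \<in> I \<Longrightarrow> f \<in> PC"
 using I.zero_closed I.a_closed I.Icarr unfolding pa_simps(2,3) by metis+

lemma cos_eq_iff: "f \<in> PC \<Longrightarrow> g \<in> PC \<Longrightarrow> cs f = cs g \<longleftrightarrow> f - g \<in> I"
 unfolding quiver_coset_def using P.quotient_eq_iff_same_a_r_cos[OF I_ideal] path_minus[OF fin] by metis

lemma Rop_carrier: "x \<in> carrier Rop \<longleftrightarrow> (\<exists>f\<in>PC. x = cs f)"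
 unfolding op_ring_def bound_quiver_algebra_def quiver_coset_def by (auto simp: FactRing_def A_RCOSETS_def')

lemma cos_closed: "f \<in> PC \<Longrightarrow> cs f \<in> carrier Rop"
 unfolding Rop_carrier by blast

lemma cos_simps:
 "f \<in> PC \<Longrightarrow> g \<in> PC \<Longrightarrow> cs f \<oplus>\<^sub>Rop cs g = cs (f + g)"
 "f \<in> PC \<Longrightarrow> g \<in> PC \<Longrightarrow> cs f \<otimes>\<^sub>Rop cs g = cs (g \<bullet>\<^sub>Q f)"
 "\<zero>\<^sub>Rop = cs 0" "\<one>\<^sub>Rop = cs (scal Q 1)"
proof -
 note s = op_ring_def bound_quiver_algebra_def FactRing_def quiver_coset_def
 show "cs f \<oplus>\<^sub>Rop cs g = cs (f + g)" if "f \<in> PC" "g \<in> PC"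
  using I.a_rcos_sum[OF that] by (simp add: s)
 show "cs f \<otimes>\<^sub>Rop cs g = cs (g \<bullet>\<^sub>Q f)" if "f \<in> PC" "g \<in> PC"
  using I.rcoset_mult_add[OF that(2,1)] by (simp add: s)
 show "\<zero>\<^sub>Rop = cs 0"
  using I.a_rcos_const[OF I.zero_closed] by (simp add: s)
 show "\<one>\<^sub>Rop = cs (scal Q 1)" by (simp add: s scal_one[OF fin])
qed

lemma Rop_ring: "ring Rop"
proof -
 interpret B: ring "path_algebra Q Quot I" by (rule I.quotient_is_ring)
 have "abelian_group Rop"
  using B.abelian_group_axioms
  by (simp add: op_ring_def bound_quiver_algebra_def abelian_group_def abelian_monoid_def abelian_group_axioms_def)
 then show ?thesis
  by (intro ringI monoidI) (auto simp: op_ring_def bound_quiver_algebra_def B.m_assoc B.l_distr B.r_distr)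
qed

sublocale R: ring Rop by (rule Rop_ring)

lemma rep: "x \<in> carrier Rop \<Longrightarrow> rp x \<in> PC" "x \<in> carrier Rop \<Longrightarrow> cs (rp x) = x"
proof -
 have "rp x \<in> PC \<and> x = cs (rp x)" if "x \<in> carrier Rop"
  using that someI_ex[of "\<lambda>f. f \<in> PC \<and> x = cs f"] unfolding quiver_rep_def Rop_carrier by blast
 then show "x \<in> carrier Rop \<Longrightarrow> rp x \<in> PC" "x \<in> carrier Rop \<Longrightarrow> cs (rp x) = x" by auto
qed

lemma rep_cos: "f \<in> PC \<Longrightarrow> rp (cs f) - f \<in> I"
proof -
 assume f: "f \<in> PC"
 note r = rep[OF cos_closed[OF f]]
 show ?thesis using iffD1[OF cos_eq_iff[OF r(1) f] r(2)] .
qed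

lemma lookup_rep: "f \<in> PC \<Longrightarrow> coef (rp (cs f)) (v, []) = coef f (v, [])"
 using lookup_I[OF rep_cos, of f v] by (simp add: lookup_minus)

lemma cos_minus: "f \<in> PC \<Longrightarrow> g \<in> PC \<Longrightarrow> cs f \<ominus>\<^sub>Rop cs g = cs (f - g)"
proof -
 assume fg: "f \<in> PC" "g \<in> PC"
 have n: "- g \<in> PC" using PC_closed(1,3) fg(2) by (metis diff_0)
 have "\<ominus>\<^sub>Rop cs g = cs (- g)"
  using fg n by (intro R.minus_equality) (auto simp: cos_simps cos_closed simp del: pa_simps)
 then show ?thesis using fg n by (simp add: a_minus_def cos_simps del: pa_simps)
qed

lemma cos_finsum: "finite A \<Longrightarrow> (\<And>i. i \<in> A \<Longrightarrow> F i \<in> PC) \<Longrightarrow> finsum Rop (\<lambda>i. cs (F i)) A = cs (sum F A) \<and> sum F A \<in> PC"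
proof (induction A rule: finite_induct)
 case (insert a A)
 then show ?case by (simp add: R.finsum_insert cos_closed Pi_iff cos_simps PC_closed del: pa_simps)
qed (simp add: cos_simps PC_closed del: pa_simps)

definition radical where
 "radical = {cs f | f. f \<in> PC \<and> (\<forall>v. coef f (v, []) = 0)}"

lemma split_algebra:
 obtains B where "split_algebra Rop (\<lambda>c. cs (scal Q c)) B radical (verts Q)
  (\<lambda>v. cs (path_el (v, []) 1)) (\<lambda>v x. coef (rp x) (v, []))"
proof -
 interpret fin_digraph Q by (rule fin)
 obtain m where m: "\<And>p c. p \<in> qpaths Q \<Longrightarrow> m \<le> length (snd p) \<Longrightarrow> path_el p c \<in> I"
  using long_paths by blast
 let ?p = "{p \<in> qpaths Q. length (snd p) < m}" and ?e = "\<lambda>v. path_el (v, []) (1 :: 'k)"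
 let ?B = "(\<lambda>p. cs (path_el p 1)) ` ?p"
 have "?p \<subseteq> verts Q \<times> {xs. set xs \<subseteq> arcs Q \<and> length xs \<le> m}" by (auto simp: qpaths_def awalk_def)
 then have fin_p: "finite ?p" by (rule finite_subset) (simp add: finite_lists_length_le)
 have single: "p \<in> qpaths Q \<Longrightarrow> path_el p c \<in> PC" for p c by simp
 have e: "v \<in> verts Q \<Longrightarrow> ?e v \<in> PC" for v by (simp add: qpaths_Nil)
 have sc: "scal Q c \<in> PC" for c by (rule scal_closed[OF fin])
 note simps = cos_simps cos_minus cos_closed PC_closed sc e
 show thesis
 proof (rule that[of ?B], intro split_algebra.intro split_algebra_axioms.intro Rop_ring)
  fix L assume L: "?B \<subseteq> L" "L \<subseteq> carrier Rop" "\<zero>\<^sub>Rop \<in> L" "\<And>r s. r \<in> L \<Longrightarrow> s \<in> L \<Longrightarrow> r \<oplus>\<^sub>Rop s \<in> L"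
   "\<And>r c. r \<in> L \<Longrightarrow> r \<otimes>\<^sub>Rop cs (scal Q c) \<in> L"
  have "cs f \<in> L" if "f \<in> PC" for f
   using that
  proof (induction rule: pa_induct)
   case zero
   then show ?case using L(3) by (simp add: cos_simps)
  next
   case (single p c)
   show ?case
   proof (cases "length (snd p) < m")
    case True
    then have "cs (path_el p 1) \<otimes>\<^sub>Rop cs (scal Q c) \<in> L" using single L(1) by (intro L(5)) auto
    then show ?thesis using single sc[of c] by (simp add: cos_simps scal_single[OF fin])
   next
    case False
    then have "cs (path_el p c) = cs 0" using m[of p c] single cos_eq_iff[of _ 0] by simp
    then show ?thesis using L(3) by (simp add: cos_simps)
   qed
  next
   case (add a b)
   then show ?case using L(4)[of "cs a" "cs b"] by (simp add: cos_simps)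
  qed
  then show "L = carrier Rop" using L(2) by (auto simp: Rop_carrier)
 next
  show "finsum Rop (\<lambda>v. cs (?e v)) (verts Q) = \<one>\<^sub>Rop"
   using cos_finsum[of "verts Q" ?e] e by (simp add: cos_simps scal_def del: pa_simps)
 next
  fix v r assume v: "v \<in> verts Q" and "r \<in> carrier Rop"
  then obtain f where f: "f \<in> PC" "r = cs f" unfolding Rop_carrier by blast
  let ?t = "scal Q (coef f (v, []))"
  have "cs (?e v) \<otimes>\<^sub>Rop r \<ominus>\<^sub>Rop cs (?e v) \<otimes>\<^sub>Rop cs ?t = cs (f \<bullet>\<^sub>Q ?e v - ?t \<bullet>\<^sub>Q ?e v)"
   using f e[OF v] sc by (simp add: cos_simps cos_minus PC_closed del: pa_simps)
  moreover have "coef (f \<bullet>\<^sub>Q ?e v - ?t \<bullet>\<^sub>Q ?e v) (w, []) = 0" for w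
   using v by (auto simp: lookup_minus lookup_mult_trivial lookup_scal[OF fin] lookup_single when_def)
  moreover have "f \<bullet>\<^sub>Q ?e v - ?t \<bullet>\<^sub>Q ?e v \<in> PC" using f e[OF v] sc by (intro PC_closed)
  ultimately show "cs (?e v) \<otimes>\<^sub>Rop r \<ominus>\<^sub>Rop cs (?e v) \<otimes>\<^sub>Rop cs (scal Q (coef (rp r) (v, []))) \<in> radical"
   unfolding radical_def f(2) lookup_rep[OF f(1)] by auto
 next
  interpret G: right_module Rop "reg Rop" by (rule reg_module[OF Rop_ring])
  show "submod Rop radical (reg Rop)"
  proof (rule G.submodI)
   show "radical \<subseteq> carrier (reg Rop)" by (auto simp: radical_def cos_closed simp del: pa_simps)
   show "\<zero>\<^bsub>reg Rop\<^esub> \<in> radical" unfolding radical_def by (auto simp: cos_simps intro!: exI[of _ 0])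
  next
   fix x y assume "x \<in> radical" "y \<in> radical"
   then obtain f g where "x = cs f" "y = cs g" "f \<in> PC" "g \<in> PC" "\<forall>v. coef f (v, []) = 0"
    "\<forall>v. coef g (v, []) = 0" unfolding radical_def by blast
   then show "x \<oplus>\<^bsub>reg Rop\<^esub> y \<in> radical" unfolding radical_def
    by (auto simp: cos_simps PC_closed lookup_add simp del: pa_simps intro!: exI[of _ "f + g"])
  next
   fix r x assume "r \<in> carrier Rop" "x \<in> radical"
   then obtain f g where "x = cs f" "r = cs g" "f \<in> PC" "g \<in> PC" "\<forall>v. coef f (v, []) = 0"
    unfolding radical_def Rop_carrier by blast
   then show "r \<odot>\<^bsub>reg Rop\<^esub> x \<in> radical" unfolding radical_def
    by (auto simp: cos_simps PC_closed lookup_mult_trivial simp del: pa_simps intro!: exI[of _ "g \<bullet>\<^sub>Q f"])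
  qed
 qed (use fin_p sc e single finite_verts in \<open>auto simp: cos_simps cos_closed scal_add[OF fin] scal_mult[OF fin]
   path_algebra_single path_term_def mult.commute[of _ "_ :: 'k"] simp del: pa_simps\<close>)
qed

end

text \<open>Admissibility enters only here: the ideal contains all sufficiently long paths and consists of
 combinations of nontrivial paths.\<close>

lemma bound_quiver_bound_path_algebra:
 fixes I :: "('v, 'e, 'k::field) qelem set"
 assumes "bound_quiver Q I" shows "bound_path_algebra Q I"
proof -
 let ?P = "path_algebra Q :: ('v, 'e, 'k) qelem ring" and ?J = "arrow_ideal Q :: ('v, 'e, 'k) qelem set"
 have fin: "fin_digraph Q" and I: "ideal I ?P" using assms by (auto simp: bound_quiver_def admissible_def)
 obtain m :: nat where m: "?J [^]\<^bsub>ideals_set ?P\<^esub> m \<subseteq> I" "I \<subseteq> ?J [^]\<^bsub>ideals_set ?P\<^esub> (2::nat)"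
  using assms by (auto simp: bound_quiver_def admissible_def)
 interpret fin_digraph Q by (rule fin)
 interpret P: ring ?P by (rule path_algebra_ring[OF fin])
 have arrows: "arrow Q ` arcs Q \<subseteq> carrier ?P"
  by (auto simp: arrow_def qpaths_Cons[OF wf_digraph] qpaths_Nil)
 interpret J: ideal ?J ?P unfolding arrow_ideal_def by (rule P.genideal_ideal[OF arrows])
 have pow_Suc: "?J [^]\<^bsub>ideals_set ?P\<^esub> Suc n = ideal_prod ?P (?J [^]\<^bsub>ideals_set ?P\<^esub> n) ?J" for n
  by (simp add: ideals_set_def nat_pow_def)
 have pow0: "?J [^]\<^bsub>ideals_set ?P\<^esub> (0::nat) = carrier ?P" by (simp add: ideals_set_def nat_pow_def)
 have long: "path_el p c \<in> ?J [^]\<^bsub>ideals_set ?P\<^esub> n" if "p \<in> qpaths Q" "length (snd p) = n" for p n c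
  using that
 proof (induction n arbitrary: p)
  case 0
  then show ?case unfolding pow0 by simp
 next
  case (Suc n)
  obtain u xs a where p: "p = (u, xs @ [a])" "length xs = n"
   using Suc.prems(2) by (cases p; cases "snd p" rule: rev_cases) auto
  have q: "(u, xs) \<in> qpaths Q" "a \<in> arcs Q" "qpath_end Q (u, xs) = tail Q a"
   using Suc.prems(1) p by (auto simp: qpaths_append[OF wf_digraph] qpaths_Cons[OF wf_digraph])
  have "path_el (u, xs) c \<otimes>\<^sub>?P arrow Q a \<in> ideal_prod ?P (?J [^]\<^bsub>ideals_set ?P\<^esub> n) ?J"
   using Suc.IH[OF q(1)] p(2) q(2) P.genideal_self[OF arrows] by (intro ideal_prod.prod) (auto simp: arrow_ideal_def)
  then show ?case unfolding pow_Suc using q(3) by (simp add: arrow_def path_algebra_single path_term_def p(1))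
 qed
 have "path_el p c \<in> I" if p: "p \<in> qpaths Q" "m \<le> length (snd p)" for p c
 proof -
  obtain u xs where u: "p = (u, xs)" by (cases p)
  have q: "(u, take m xs) \<in> qpaths Q" "(qpath_end Q (u, take m xs), drop m xs) \<in> qpaths Q"
   using p(1) qpaths_append[OF wf_digraph, of u "take m xs" "drop m xs"] by (auto simp: u)
  have "path_el (u, take m xs) c \<in> I" using long[OF q(1), of m c] m(1) p(2) u by auto
  then have "path_el (u, take m xs) c \<otimes>\<^sub>?P path_el (qpath_end Q (u, take m xs), drop m xs) 1 \<in> I"
   using q(2) by (intro ideal.I_r_closed[OF I]) simp_all
  then show ?thesis by (simp add: path_algebra_single path_term_def u)
 qed
 moreover have "coef f (v, []) = 0" if f: "f \<in> I" for f v
 proof -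
  let ?T = "{f \<in> carrier ?P. \<forall>v. coef f (v, []) = 0}"
  have "ideal ?T ?P"
  proof (rule idealI[OF P.ring_axioms])
   show "subgroup ?T (add_monoid ?P)"
   proof (rule P.add.subgroupI)
    show "\<ominus>\<^sub>?P a \<in> ?T" if "a \<in> ?T" for a
     using that path_minus[OF fin, of 0 a] by (simp add: a_minus_def)
   next
    fix a b assume "a \<in> ?T" "b \<in> ?T"
    then show "a \<oplus>\<^sub>?P b \<in> ?T" using P.a_closed[of a b] by (auto simp: lookup_add)
   qed (auto intro!: exI[of _ 0])
  qed (auto simp: lookup_mult_trivial simp del: pa_simps(1))
  then have JT: "?J \<subseteq> ?T" unfolding arrow_ideal_def
   using arrows by (intro P.genideal_minimal) (auto simp: arrow_def lookup_single)
  have J: "ideal_prod ?P I' ?J \<subseteq> ?J" if "I' \<subseteq> carrier ?P" for I'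
  proof
   fix x assume "x \<in> ideal_prod ?P I' ?J"
   then show "x \<in> ?J" using that
    by induction (auto intro: J.I_l_closed J.a_closed simp del: pa_simps)
  qed
  have "ideal_prod ?P (carrier ?P) ?J \<subseteq> carrier ?P"
  proof
   fix x assume "x \<in> ideal_prod ?P (carrier ?P) ?J"
   then show "x \<in> carrier ?P" by induction (auto intro: J.Icarr P.m_closed P.a_closed simp del: pa_simps)
  qed
  from J[OF this] have "I \<subseteq> ?J" using m(2) unfolding numeral_2_eq_2 pow_Suc pow0 by (rule subset_trans[rotated])
  then show ?thesis using f JT by auto
 qed
 ultimately show ?thesis by (intro bound_path_algebra.intro fin I) blast+
qed

section \<open>Gluing quivers along arrows\<close>

definition transport :: "('p \<Rightarrow> 'q option) \<Rightarrow> ('p \<Rightarrow>\<^sub>0 'k::field) \<Rightarrow> ('q \<Rightarrow>\<^sub>0 'k)" where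
 "transport \<theta> f = (\<Sum>p\<in>Poly_Mapping.keys f. case \<theta> p of None \<Rightarrow> 0 | Some q \<Rightarrow> path_el q (coef f p))"

lemma transport_single: "transport \<theta> (path_el p c) = (case \<theta> p of None \<Rightarrow> 0 | Some q \<Rightarrow> path_el q c)"
 by (simp add: transport_def split: option.split)

lemma transport_zero: "transport \<theta> 0 = 0" by (simp add: transport_def)

lemma transport_add: "transport \<theta> (f + g) = transport \<theta> f + transport \<theta> g"
proof -
 have sup: "transport \<theta> h = (\<Sum>p\<in>S. case \<theta> p of None \<Rightarrow> 0 | Some q \<Rightarrow> path_el q (coef h p))"
  if "finite S" "Poly_Mapping.keys h \<subseteq> S" for h S
  unfolding transport_def using that
  by (intro sum.mono_neutral_left) (auto simp: not_in_keys_iff_lookup_eq_zero split: option.split)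
 let ?S = "Poly_Mapping.keys f \<union> Poly_Mapping.keys g"
 show ?thesis using Poly_Mapping.keys_add[of f g]
  by (subst (1 2 3) sup[of ?S])
    (auto simp: sum.distrib[symmetric] lookup_add single_add split: option.split intro!: sum.cong)
qed

lemma transport_minus: "transport \<theta> (f - g) = transport \<theta> f - transport \<theta> g"
 using transport_add[of \<theta> "f - g" g] by simp

lemma transport_closed:
 assumes "\<And>p q. \<theta> p = Some q \<Longrightarrow> q \<in> qpaths Q" shows "transport \<theta> f \<in> carrier (path_algebra Q)"
proof (induction f rule: path_algebra_induct)
 case (2 p c)
 then show ?case using assms by (auto simp: transport_single split: option.split if_splits)
next
 case (3 a b)
 then show ?case using Poly_Mapping.keys_add[of "transport \<theta> a" "transport \<theta> b"] by (auto simp: transport_add)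
qed (simp add: transport_zero)

locale glued_quivers =
 fixes Q :: "'i::finite \<Rightarrow> ('v, 'e) quiver" and I :: "'i \<Rightarrow> ('v, 'e, 'k::field) qelem set"
  and G :: "('v, 'e) quiver" and IG :: "('v, 'e, 'k) qelem set" and \<Gamma> :: "'e set"
 assumes part: "bound_path_algebra (Q i) (I i)" and glued: "bound_path_algebra G IG"
  and verts_G: "verts G = (\<Union>i. verts (Q i))" and disjoint: "i \<noteq> j \<Longrightarrow> verts (Q i) \<inter> verts (Q j) = {}"
  and arcs_G: "arcs G = (\<Union>i. arcs (Q i)) \<union> \<Gamma>" and arcs_disjoint: "arcs (Q i) \<inter> \<Gamma> = {}"
  and ends: "a \<in> arcs (Q i) \<Longrightarrow> tail G a = tail (Q i) a \<and> head G a = head (Q i) a"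
  and relations: "IG = Idl\<^bsub>path_algebra G\<^esub> ((\<Union>i. I i) \<union> {arrow G a \<bullet>\<^sub>G arrow G k | a k. a \<in> arcs G \<and> k \<in> \<Gamma>})"
begin

sublocale A: bound_path_algebra "Q i" "I i" for i by (rule part)
sublocale C: bound_path_algebra G IG by (rule glued)
interpretation GQ: fin_digraph G by (rule C.fin)
interpretation AQ: fin_digraph "Q i" for i by (rule A.fin)

definition component :: "'e \<Rightarrow> 'i" where
 "component k = (SOME i. head G k \<in> verts (Q i))"

abbreviation "\<sigma> \<equiv> component"
abbreviation "PQ i \<equiv> carrier (path_algebra (Q i) :: ('v, 'e, 'k) qelem ring)"

lemma verts_eqI: "v \<in> verts (Q i) \<Longrightarrow> v \<in> verts (Q j) \<Longrightarrow> i = j"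
 using disjoint[of i j] by blast

lemma head_component: "k \<in> \<Gamma> \<Longrightarrow> head G k \<in> verts (Q (\<sigma> k))"
proof -
 assume "k \<in> \<Gamma>"
 then have "head G k \<in> verts G" using arcs_G by (intro GQ.head_in_verts) blast
 then show ?thesis unfolding component_def verts_G by (intro someI_ex[of "\<lambda>i. head G k \<in> verts (Q i)"]) blast
qed

lemma fin_\<Gamma>: "finite \<Gamma>" using GQ.finite_arcs arcs_G by (simp add: finite_Un)

lemma subpath: "(u, p) \<in> qpaths (Q i) \<Longrightarrow> (u, p) \<in> qpaths G \<and> qpath_end (Q i) (u, p) = qpath_end G (u, p)"
proof (induction p arbitrary: u)
 case (Cons a p)
 then have a: "a \<in> arcs (Q i)" "tail (Q i) a = u" "(head (Q i) a, p) \<in> qpaths (Q i)"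
  by (auto simp: qpaths_Cons[OF AQ.wf_digraph])
 then show ?case using Cons.IH[OF a(3)] ends[OF a(1)] arcs_G by (auto simp: qpaths_Cons[OF GQ.wf_digraph])
qed (auto simp: qpaths_Nil verts_G)

lemma subpath': "p \<in> qpaths (Q i) \<Longrightarrow> p \<in> qpaths G" "p \<in> qpaths (Q i) \<Longrightarrow> qpath_end (Q i) p = qpath_end G p"
 using subpath[of "fst p" "snd p" i] by simp_all

lemma subpath_append: "(u, p @ q) \<in> qpaths (Q i) \<longleftrightarrow> (u, p) \<in> qpaths (Q i) \<and> (qpath_end G (u, p), q) \<in> qpaths (Q i)"
 using qpaths_append[OF AQ.wf_digraph, of u p q i] subpath[of u p i] by auto

lemma subpath_Cons: "(u, a # p) \<in> qpaths (Q i) \<longleftrightarrow> a \<in> arcs (Q i) \<and> tail G a = u \<and> (head G a, p) \<in> qpaths (Q i)"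
 using ends[of a i] by (auto simp: qpaths_Cons[OF AQ.wf_digraph])

lemma subpath_eqI: "(u, p) \<in> qpaths (Q i) \<Longrightarrow> (u, q) \<in> qpaths (Q j) \<Longrightarrow> i = j"
 using qpath_ends[OF A.fin, of "(u, p)" i] qpath_ends[OF A.fin, of "(u, q)" j] by (auto intro: verts_eqI)

lemma PQ_G: "f \<in> PQ i \<Longrightarrow> f \<in> C.PC" using subpath' by auto

lemma mult_sub: "f \<in> PQ i \<Longrightarrow> f \<bullet>\<^bsub>Q i\<^esub> g = f \<bullet>\<^sub>G g"
 unfolding path_algebra_mult_sup[OF finite_keys finite_keys order_refl order_refl]
 by (intro sum.cong refl) (auto simp: path_term_def subpath')

lemma scal_sub: "scal (Q i) (c :: 'k) \<bullet>\<^sub>G g = scal (Q i) c \<bullet>\<^bsub>Q i\<^esub> g"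
 using mult_sub[OF scal_closed[OF A.fin]] by simp

lemma PQ_mult: "f \<in> PQ i \<Longrightarrow> g \<in> PQ i \<Longrightarrow> f \<bullet>\<^sub>G g \<in> PQ i"
 using A.PC_closed(4)[of f i g] mult_sub[of f i g] by simp

lemma path_mult_off:
 assumes "f \<in> PQ i" "g \<in> PQ j" "i \<noteq> j" shows "f \<bullet>\<^sub>G g = 0"
 using assms(1)
proof (induction rule: pa_induct)
 case (single p c)
 show ?case using assms(2)
 proof (induction rule: pa_induct)
  case (single q d)
  have "qpath_end G p \<in> verts (Q i)" using qpath_ends[OF A.fin \<open>p \<in> _\<close>] subpath'(2)[OF \<open>p \<in> _\<close>] by simp
  then have "qpath_end G p \<noteq> fst q" using qpath_ends[OF A.fin single] assms(3) verts_eqI by auto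
  then show ?case by (simp add: path_algebra_single path_term_def)
 qed (simp_all add: path_algebra_zero path_algebra_distr)
qed (simp_all add: path_algebra_zero path_algebra_distl)

subsection \<open>The projections, the trace and the stripping of a connecting arrow\<close>

definition pr :: "'i \<Rightarrow> ('v, 'e, 'k) qelem \<Rightarrow> ('v, 'e, 'k) qelem" where
 "pr i = transport (\<lambda>p. if p \<in> qpaths (Q i) then Some p else None)"

definition strip :: "'e \<Rightarrow> ('v, 'e, 'k) qelem \<Rightarrow> ('v, 'e, 'k) qelem" where
 "strip k = transport (\<lambda>p. case snd p of [] \<Rightarrow> None | a # xs \<Rightarrow>
  if a = k \<and> k \<in> \<Gamma> \<and> fst p = tail G k \<and> (head G k, xs) \<in> qpaths (Q (\<sigma> k)) then Some (head G k, xs) else None)"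

definition trace :: "'e \<Rightarrow> ('v, 'e, 'k) qelem \<Rightarrow> ('v, 'e, 'k) qelem" where
 "trace k f = (if k \<in> \<Gamma> then scal (Q (\<sigma> k)) (coef f (tail G k, [])) else 0)"

lemma trans_add: "pr i (f + g) = pr i f + pr i g" "strip k (f + g) = strip k f + strip k g" "trace k (f + g) = trace k f + trace k g"
 "pr i (f - g) = pr i f - pr i g" "strip k (f - g) = strip k f - strip k g" "pr i 0 = 0" "strip k 0 = 0" "trace k 0 = 0"
 by (simp_all add: pr_def strip_def trace_def transport_add transport_minus transport_zero lookup_add scal_add[OF A.fin])
   (simp add: scal_def)

lemma trans_single:
 "pr i (path_el p c) = (if p \<in> qpaths (Q i) then path_el p c else 0)"
 "strip k (path_el (u, []) c) = 0"
 "strip k (path_el (u, a # xs) c) = (if a = k \<and> k \<in> \<Gamma> \<and> u = tail G k \<and> (head G k, xs) \<in> qpaths (Q (\<sigma> k))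
  then path_el (head G k, xs) c else 0)"
 by (simp_all add: pr_def strip_def transport_single)

lemma trans_closed: "pr i f \<in> PQ i" "strip k f \<in> PQ (\<sigma> k)" "trace k f \<in> PQ (\<sigma> k)"
proof -
 show "pr i f \<in> PQ i" "strip k f \<in> PQ (\<sigma> k)"
  unfolding pr_def strip_def by (intro transport_closed; auto split: if_splits list.splits)+
 show "trace k f \<in> PQ (\<sigma> k)" unfolding trace_def using scal_closed[OF A.fin] by auto
qed

lemma pr_PQ: "f \<in> PQ j \<Longrightarrow> pr i f = (if i = j then f else 0)"
proof (induction rule: pa_induct)
 case (single p c)
 then have "p \<in> qpaths (Q i) \<longleftrightarrow> i = j" using subpath_eqI[of "fst p" "snd p" i "snd p" j] by auto
 then show ?case by (simp add: trans_single)
qed (auto simp: trans_add)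

lemma strip_PQ: "f \<in> PQ j \<Longrightarrow> strip k f = 0"
proof (induction rule: pa_induct)
 case (single p c)
 then show ?case using arcs_disjoint[of j]
  by (cases p; cases "snd p") (auto simp: trans_single subpath_Cons)
qed (auto simp: trans_add)

lemma trace_mult: "trace k (f \<bullet>\<^sub>G g) = trace k f \<bullet>\<^sub>G trace k g"
 by (simp add: trace_def lookup_mult_trivial scal_sub scal_mult[OF A.fin] path_algebra_zero)

lemma pr_mult: "f \<in> C.PC \<Longrightarrow> pr i (f \<bullet>\<^sub>G g) = pr i f \<bullet>\<^sub>G pr i g"
proof (induction rule: pa_induct)
 case (single p c)
 show ?case
 proof (induction g rule: path_algebra_induct)
  case (2 q d)
  obtain u xs w ys where "p = (u, xs)" "q = (w, ys)" by (cases p; cases q)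
  then show ?case
   by (auto simp: path_algebra_single path_term_def trans_single subpath_append path_algebra_zero trans_add)
 qed (simp_all add: path_algebra_zero path_algebra_distr trans_add)
qed (simp_all add: path_algebra_zero path_algebra_distl trans_add)

lemma strip_mult:
 assumes f: "f \<in> C.PC" and g: "g \<in> C.PC"
 shows "strip k (f \<bullet>\<^sub>G g) = trace k f \<bullet>\<^sub>G strip k g + strip k f \<bullet>\<^sub>G pr (\<sigma> k) g"
 using f
proof (induction rule: pa_induct)
 case (single p c)
 show ?case using g
 proof (induction rule: pa_induct)
  case (single q d)
  obtain u xs w ys where pq: "p = (u, xs)" "q = (w, ys)" by (cases p; cases q)
  have sc: "trace k (path_el (v, []) c) \<bullet>\<^sub>G path_el z d =
   (if k \<in> \<Gamma> \<and> v = tail G k then path_el z (c * d) else 0)" if "z \<in> qpaths (Q (\<sigma> k))" for v z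
   using scal_single(1)[OF A.fin that, of c d] scal_single(1)[OF A.fin that, of 0 d]
   by (auto simp: trace_def lookup_single when_def scal_sub path_algebra_zero)
  show ?case
  proof (cases xs)
   case Nil
   then show ?thesis
    by (cases ys) (auto simp: pq path_algebra_single path_term_def trans_single trans_add path_algebra_zero sc)
  next
   case (Cons a zs)
   have "trace k (path_el p c) = 0" by (simp add: trace_def lookup_single pq Cons scal_def)
   then show ?thesis using single
    by (auto simp: pq Cons path_algebra_single path_term_def trans_single trans_add path_algebra_zero subpath_append)
  qed
 qed (simp_all add: path_algebra_zero path_algebra_distr trans_add add.left_commute add.assoc)
qed (simp_all add: path_algebra_zero path_algebra_distl trans_add add.left_commute add.assoc)

subsection \<open>The maps respect the relations\<close>

lemma arrow_closed: "a \<in> arcs G \<Longrightarrow> arrow G a \<in> C.PC"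
 by (simp add: arrow_def qpaths_Cons[OF GQ.wf_digraph] qpaths_Nil)

lemma generators_closed: "(\<Union>i. I i) \<union> {arrow G a \<bullet>\<^sub>G arrow G k | a k. a \<in> arcs G \<and> k \<in> \<Gamma>} \<subseteq> C.PC"
 using A.I_closed(3) PQ_G arrow_closed C.PC_closed(4) arcs_G by blast

lemma IG_I: "f \<in> I i \<Longrightarrow> f \<in> IG" and IG_arrows: "a \<in> arcs G \<Longrightarrow> k \<in> \<Gamma> \<Longrightarrow> arrow G a \<bullet>\<^sub>G arrow G k \<in> IG"
 using C.P.genideal_self[OF generators_closed] relations by blast+

text \<open>The elements on which the projections and the stripping maps take values in the given ideals and the
 trivial coefficients vanish form an ideal, and it contains the generators of \<open>IG\<close>.\<close>

lemma ideal_maps: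
 assumes "f \<in> IG" shows "pr i f \<in> I i" "strip k f \<in> I (\<sigma> k)"
proof -
 let ?N = "{f \<in> C.PC. (\<forall>i. pr i f \<in> I i) \<and> (\<forall>k. strip k f \<in> I (\<sigma> k)) \<and> (\<forall>k. trace k f = 0)}"
 have mult: "f \<bullet>\<^sub>G g \<in> I i" "g \<bullet>\<^sub>G f \<in> I i" if "f \<in> I i" "g \<in> PQ i" for f g i
  using A.I.I_l_closed[OF that] A.I.I_r_closed[OF that] mult_sub that A.I_closed(3) by metis+
 have "ideal ?N (path_algebra G)"
 proof (rule idealI[OF C.P.ring_axioms])
  show "subgroup ?N (add_monoid (path_algebra G))"
  proof (rule C.P.add.subgroupI)
   show "?N \<noteq> {}" using A.I_closed(1) C.PC_closed(1) by (auto simp: trans_add intro!: exI[of _ 0])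
  next
   fix f g assume "f \<in> ?N" "g \<in> ?N"
   then show "f \<oplus>\<^bsub>path_algebra G\<^esub> g \<in> ?N"
    using C.PC_closed(2) A.I_closed(2) by (auto simp: trans_add simp del: pa_simps(1))
  next
   fix f assume f: "f \<in> ?N"
   have m: "\<ominus>\<^bsub>path_algebra G\<^esub> f = 0 - f" using path_minus[OF C.fin, of 0 f] f C.PC_closed(1) by (simp add: a_minus_def)
   have "0 - h \<in> I i" if "h \<in> I i" for h i
    using A.I.a_inv_closed[OF that] path_minus[OF A.fin, of 0 i h] A.I_closed(3)[OF that] by (simp add: a_minus_def)
   moreover have "trace k (0 - f) = 0" for k using trans_add(3)[of k "0 - f" f] f by (simp add: trans_add)
   ultimately show "\<ominus>\<^bsub>path_algebra G\<^esub> f \<in> ?N"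
    unfolding m using f C.PC_closed(1,3) by (simp add: trans_add(4-8) del: pa_simps diff_0)
  qed (auto simp del: pa_simps)
 next
  fix f g assume "f \<in> ?N" "g \<in> C.PC"
  then show "g \<bullet>\<^sub>G f \<in> ?N" "f \<bullet>\<^sub>G g \<in> ?N"
   using C.PC_closed(4) mult trans_closed A.I_closed(1,2)
   by (auto simp: pr_mult strip_mult trace_mult path_algebra_zero simp del: pa_simps)
 qed
 moreover have "(\<Union>i. I i) \<subseteq> ?N"
 proof
  fix f assume "f \<in> (\<Union>i. I i)"
  then obtain j where f: "f \<in> I j" by blast
  then have "f \<in> PQ j" by (rule A.I_closed)
  from PQ_G[OF this] pr_PQ[OF this] strip_PQ[OF this] show "f \<in> ?N" using A.I_closed(1) A.lookup_I[OF f] f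
   by (simp add: trace_def scal_def del: pa_simps)
 qed
 moreover have "{arrow G a \<bullet>\<^sub>G arrow G k | a k. a \<in> arcs G \<and> k \<in> \<Gamma>} \<subseteq> ?N"
 proof
  fix f :: "('v, 'e, 'k) qelem"
  assume "f \<in> {arrow G a \<bullet>\<^sub>G arrow G k | a k. a \<in> arcs G \<and> k \<in> \<Gamma>}"
  then obtain a k where ak: "f = arrow G a \<bullet>\<^sub>G arrow G k" "a \<in> arcs G" "k \<in> \<Gamma>" by blast
  have "(u, [k]) \<notin> qpaths (Q i)" "(u, [a, k]) \<notin> qpaths (Q i)" for u i
   using ak(3) arcs_disjoint[of i] by (auto simp: subpath_Cons)
  then have "pr i f = 0" "strip l f = 0" "trace l f = 0" for i l
   unfolding ak(1) by (auto simp: arrow_def path_algebra_single path_term_def trans_single trans_add trace_def lookup_single scal_def)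
  moreover have "f \<in> C.PC" using generators_closed ak by blast
  ultimately show "f \<in> ?N" using A.I_closed(1) by simp
 qed
 ultimately have "IG \<subseteq> ?N" unfolding relations by (intro C.P.genideal_minimal Un_least)
 then show "pr i f \<in> I i" "strip k f \<in> I (\<sigma> k)" using assms by auto
qed

subsection \<open>The decomposition of the glued algebra\<close>

text \<open>Reading a path from its end: an arrow in front of a path that starts with a connecting arrow produces
 a relation, and an arrow in front of a path of \<open>Q i\<close> belongs to \<open>Q i\<close> or is connecting.\<close>

lemma glued_paths:
 assumes "(u, xs) \<in> qpaths G"
 shows "(\<exists>i. (u, xs) \<in> qpaths (Q i)) \<or> (\<exists>k ys. xs = k # ys \<and> k \<in> \<Gamma> \<and> u = tail G k \<and> (head G k, ys) \<in> qpaths (Q (\<sigma> k))) \<or>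
  (\<forall>c. path_el (u, xs) c \<in> IG)"
 using assms
proof (induction xs arbitrary: u)
 case Nil
 then show ?case by (auto simp: qpaths_Nil verts_G)
next
 case (Cons a ys)
 have a: "a \<in> arcs G" "tail G a = u" and ys: "(head G a, ys) \<in> qpaths G"
  using Cons.prems by (auto simp: qpaths_Cons[OF GQ.wf_digraph])
 consider i where "(head G a, ys) \<in> qpaths (Q i)"
  | k zs where "ys = k # zs" "k \<in> \<Gamma>" "head G a = tail G k" "(head G k, zs) \<in> qpaths (Q (\<sigma> k))"
  | "\<forall>c. path_el (head G a, ys) c \<in> IG"
  using Cons.IH[OF ys] by blast
 then show ?case
 proof cases
  case 1
  then have v: "head G a \<in> verts (Q i)" using qpath_ends[OF A.fin 1] by simp
  show ?thesis
  proof (cases "a \<in> \<Gamma>")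
   case True
   then have "\<sigma> a = i" using head_component v verts_eqI by blast
   then show ?thesis using True 1 a by blast
  next
   case False
   then obtain j where j: "a \<in> arcs (Q j)" using a arcs_G by blast
   then have "head G a \<in> verts (Q j)" using ends[OF j] AQ.head_in_verts by simp
   then have "j = i" using v verts_eqI by blast
   then show ?thesis using 1 j a by (auto simp: subpath_Cons)
  qed
 next
  case 2
  have "path_el (u, a # ys) c = (arrow G a \<bullet>\<^sub>G arrow G k) \<bullet>\<^sub>G path_el (head G k, zs) c" for c
   using 2 a by (simp add: arrow_def path_algebra_single path_term_def)
  moreover have "path_el (head G k, zs) c \<in> C.PC" for c using 2 subpath' by simp
  ultimately show ?thesis using C.I.I_r_closed[OF IG_arrows[OF a(1) 2(2)]] by metis
 next
  case 3
  have "path_el (u, a # ys) c = arrow G a \<bullet>\<^sub>G path_el (head G a, ys) c" for c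
   using a by (simp add: arrow_def path_algebra_single path_term_def)
  then show ?thesis using 3 C.I.I_l_closed[OF _ arrow_closed[OF a(1)]] by metis
 qed
qed

lemma decompose:
 assumes "f \<in> C.PC"
 shows "f - ((\<Sum>i\<in>UNIV. pr i f) + (\<Sum>k\<in>\<Gamma>. arrow G k \<bullet>\<^sub>G strip k f)) \<in> IG"
 using assms
proof (induction rule: pa_induct)
 case zero
 show ?case using C.I_closed(1) by (simp add: trans_add path_algebra_zero)
next
 case (add a b)
 show ?case using C.I_closed(2)[OF add(3,4)]
  by (simp add: trans_add path_algebra_distr sum.distrib algebra_simps)
next
 case (single p c)
 obtain u xs where p: "p = (u, xs)" by (cases p)
 let ?f = "path_el p c"
 consider i where "(u, xs) \<in> qpaths (Q i)"
  | k ys where "xs = k # ys" "k \<in> \<Gamma>" "u = tail G k" "(head G k, ys) \<in> qpaths (Q (\<sigma> k))"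
  | "?f \<in> IG" "\<And>i. (u, xs) \<notin> qpaths (Q i)" "\<And>k. strip k ?f = 0"
 proof -
  assume *: "\<And>i. (u, xs) \<in> qpaths (Q i) \<Longrightarrow> thesis"
   "\<And>k ys. xs = k # ys \<Longrightarrow> k \<in> \<Gamma> \<Longrightarrow> u = tail G k \<Longrightarrow> (head G k, ys) \<in> qpaths (Q (\<sigma> k)) \<Longrightarrow> thesis"
   "?f \<in> IG \<Longrightarrow> (\<And>i. (u, xs) \<notin> qpaths (Q i)) \<Longrightarrow> (\<And>k. strip k ?f = 0) \<Longrightarrow> thesis"
  show thesis
  proof (rule ccontr)
   assume n: "\<not> thesis"
   have "strip k ?f = 0" for k using *(2)[of k "tl xs"] n by (cases xs) (auto simp: p trans_single)
   then show False using *(1,2,3) n glued_paths[of u xs] single p by blast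
  qed
 qed
 then show ?case
 proof cases
  case 1
  then have "?f \<in> PQ i" by (simp add: p)
  then show ?thesis using C.I_closed(1) by (simp add: pr_PQ strip_PQ path_algebra_zero del: pa_simps)
 next
  case 2
  have "pr i ?f = 0" for i using 2 arcs_disjoint[of i] by (auto simp: p trans_single subpath_Cons)
  moreover have "arrow G l \<bullet>\<^sub>G strip l ?f = (if l = k then ?f else 0)" for l
   using 2 by (auto simp: p trans_single arrow_def path_algebra_single path_term_def path_algebra_zero)
  ultimately show ?thesis using C.I_closed(1) 2(2) fin_\<Gamma> by (simp add: sum.delta)
 next
  case 3
  then have "pr i ?f = 0" for i by (simp add: p trans_single)
  then show ?thesis using 3 by (simp add: path_algebra_zero)
 qed
qed

definition conn :: "'e \<Rightarrow> ('v, 'e, 'k) qelem" where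
 "conn k = (if k \<in> \<Gamma> then arrow G k else 0)"

definition unit_at :: "'e \<Rightarrow> ('v, 'e, 'k) qelem" where
 "unit_at k = (if k \<in> \<Gamma> then path_el (head G k, []) 1 else 0)"

lemma conn_closed: "conn k \<in> C.PC" and unit_at_closed: "unit_at k \<in> PQ (\<sigma> k)"
 using arrow_closed arcs_G head_component[of k] C.PC_closed(1) by (auto simp: conn_def unit_at_def qpaths_Nil)

text \<open>An arrow followed by a connecting arrow is a relation, so only the trivial path at its tail survives
 to the left of a connecting arrow.\<close>

lemma mult_conn:
 assumes "f \<in> C.PC" shows "f \<bullet>\<^sub>G conn k - conn k \<bullet>\<^sub>G trace k f \<in> IG"
proof (cases "k \<in> \<Gamma>")
 case True
 have ar: "arrow G k \<bullet>\<^sub>G scal (Q (\<sigma> k)) c = path_el (tail G k, [k]) c" for c :: 'k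
  using head_component[OF True]
  by (simp add: arrow_def scal_def path_mult_sum path_algebra_single path_term_def)
 show ?thesis using assms
 proof (induction rule: pa_induct)
  case zero
  then show ?case using C.I_closed(1) by (simp add: trans_add path_algebra_zero)
 next
  case (add a b)
  show ?case using C.I_closed(2)[OF add(3,4)]
   by (simp add: trans_add path_algebra_distr path_algebra_distl algebra_simps)
 next
  case (single p c)
  obtain u xs where p: "p = (u, xs)" by (cases p)
  show ?case
  proof (cases xs rule: rev_cases)
   case Nil
   then have "path_el p c \<bullet>\<^sub>G conn k - conn k \<bullet>\<^sub>G trace k (path_el p c) = 0"
    using True by (auto simp: conn_def trace_def ar p lookup_single when_def)
     (simp_all add: arrow_def path_algebra_single path_term_def)
   then show ?thesis using C.I_closed(1) by simp
  next
   case (snoc ys a)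
   have q: "(u, ys) \<in> qpaths G" "a \<in> arcs G" "qpath_end G (u, ys) = tail G a"
    using single p snoc by (auto simp: qpaths_append[OF GQ.wf_digraph] qpaths_Cons[OF GQ.wf_digraph])
   have "path_el p c = path_el (u, ys) c \<bullet>\<^sub>G arrow G a"
    using q by (simp add: p snoc arrow_def path_algebra_single path_term_def)
   then have "path_el p c \<bullet>\<^sub>G conn k = path_el (u, ys) c \<bullet>\<^sub>G (arrow G a \<bullet>\<^sub>G arrow G k)"
    using True by (simp add: conn_def path_algebra_assoc)
   moreover have "path_el (u, ys) c \<in> C.PC" using q by simp
   moreover have "trace k (path_el p c) = 0"
    by (simp add: trace_def lookup_single p snoc scal_def)
   ultimately show ?thesis using C.I.I_l_closed[OF IG_arrows[OF q(2) True]] by (simp add: path_algebra_zero)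
  qed
 qed
qed (use C.I_closed(1) in \<open>simp add: conn_def trace_def path_algebra_zero\<close>)

end

context glued_quivers
begin

abbreviation "R \<equiv> op_ring (bound_quiver_algebra G IG)"
abbreviation "S i \<equiv> op_ring (bound_quiver_algebra (Q i) (I i))"

definition Pi where "Pi i x = quiver_coset (Q i) (I i) (pr i (quiver_rep G IG x))"
definition Iota where "Iota i y = quiver_coset G IG (quiver_rep (Q i) (I i) y)"
definition Strip where "Strip k x = quiver_coset (Q (\<sigma> k)) (I (\<sigma> k)) (strip k (quiver_rep G IG x))"
definition Trace where "Trace k x = quiver_coset (Q (\<sigma> k)) (I (\<sigma> k)) (trace k (quiver_rep G IG x))"

lemma Pi_cos: "f \<in> C.PC \<Longrightarrow> Pi i (C.cs f) = A.cs i (pr i f)"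
 and Strip_cos: "f \<in> C.PC \<Longrightarrow> Strip k (C.cs f) = A.cs (\<sigma> k) (strip k f)"
 and Trace_cos: "f \<in> C.PC \<Longrightarrow> Trace k (C.cs f) = A.cs (\<sigma> k) (trace k f)"
proof -
 assume f: "f \<in> C.PC"
 show "Pi i (C.cs f) = A.cs i (pr i f)" "Strip k (C.cs f) = A.cs (\<sigma> k) (strip k f)"
  using ideal_maps[OF C.rep_cos[OF f]] trans_closed unfolding Pi_def Strip_def
  by (simp_all add: A.cos_eq_iff trans_add del: pa_simps)
 show "Trace k (C.cs f) = A.cs (\<sigma> k) (trace k f)" by (simp add: Trace_def trace_def C.lookup_rep[OF f])
qed

lemma Iota_cos: "f \<in> PQ i \<Longrightarrow> Iota i (A.cs i f) = C.cs f"
proof -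
 assume f: "f \<in> PQ i"
 note r = A.rep(1)[OF A.cos_closed[OF f]]
 show ?thesis unfolding Iota_def C.cos_eq_iff[OF PQ_G[OF r] PQ_G[OF f]] by (rule IG_I[OF A.rep_cos[OF f]])
qed

lemma S_mult: "f \<in> PQ i \<Longrightarrow> g \<in> PQ i \<Longrightarrow> A.cs i f \<otimes>\<^bsub>S i\<^esub> A.cs i g = A.cs i (g \<bullet>\<^sub>G f)"
 by (simp add: A.cos_simps(2) mult_sub del: pa_simps)

lemma unit_at_strip: "unit_at k \<bullet>\<^sub>G strip k f = strip k f"
proof (induction f rule: path_algebra_induct)
 case (2 p c)
 then show ?case
  by (cases p; cases "snd p")
    (auto simp: trans_single unit_at_def path_algebra_single path_term_def path_algebra_zero)
qed (simp_all add: trans_add path_algebra_zero path_algebra_distr)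

text \<open>Multiplication in the opposite algebra is reversed, so the connecting arrow, which comes first in a
 path, becomes the right factor \<open>\<beta> k\<close> of the decomposition.\<close>

theorem glued_rings_interpretation:
 obtains T where "glued_rings R S Pi Iota \<Gamma> component (\<lambda>k. C.cs (conn k)) (\<lambda>k. A.cs (\<sigma> k) (unit_at k)) Trace Strip C.radical T"
proof -
 have S_fl: "fin_len_ring (S i)" for i
 proof -
  obtain B where "split_algebra (S i) (\<lambda>c. A.cs i (scal (Q i) c)) B (A.radical i) (verts (Q i))
   (\<lambda>v. A.cs i (path_el (v, []) 1)) (\<lambda>v x. coef (A.rp i x) (v, []))"
   by (rule A.split_algebra)
  then show ?thesis by (rule split_algebra.finite_length)
 qed
 obtain B where B: "split_algebra R (\<lambda>c. C.cs (scal G c)) B C.radical (verts G)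
   (\<lambda>v. C.cs (path_el (v, []) 1)) (\<lambda>v x. coef (C.rp x) (v, []))"
  by (rule C.split_algebra)
 note R_fl = split_algebra.finite_length[OF B]
 obtain T where T: "T \<in> fg_modules R" "\<And>M. M \<in> fg_modules R \<Longrightarrow> (\<And>r x. r \<in> C.radical \<Longrightarrow> x \<in> carrier M \<Longrightarrow> r \<odot>\<^sub>M x = \<zero>\<^sub>M) \<Longrightarrow>
  M \<in> add_closure R {T}"
  using split_algebra.killed_add[OF B] by metis
 have sc: "scal G c \<in> C.PC" "scal (Q i) c \<in> PQ i" for c :: 'k and i
  by (rule scal_closed[OF C.fin], rule scal_closed[OF A.fin])
 note cs = C.cos_simps C.cos_closed A.cos_simps(1,3,4) A.cos_closed Pi_cos Strip_cos Trace_cos Iota_cos S_mult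
  trans_closed trans_add C.PC_closed A.PC_closed(1-3) PQ_mult sc conn_closed unit_at_closed
  trans_closed[THEN PQ_G] sc(2)[THEN PQ_G] unit_at_closed[THEN PQ_G]
 note [simp del] = pa_simps
 have RE: "\<exists>f\<in>C.PC. r = C.cs f" if "r \<in> carrier R" for r using that by (simp only: C.Rop_carrier)
 have SE: "\<exists>f\<in>PQ i. r = A.cs i f" if "r \<in> carrier (S i)" for r i using that by (simp only: A.Rop_carrier)
 have one: "pr i (scal G 1) = scal (Q i) 1" "strip k (scal G 1) = 0" "trace k (scal G 1) = (if k \<in> \<Gamma> then scal (Q (\<sigma> k)) 1 else 0)" for i k
 proof -
  interpret fin_digraph G by (rule C.fin)
  have s: "pr i (\<Sum>v\<in>V. path_el (v, []) c) = (\<Sum>v\<in>V. if v \<in> verts (Q i) then path_el (v, []) c else 0)"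
   "strip k (\<Sum>v\<in>V. path_el (v, []) c) = 0" if "finite V" for V and c :: 'k
   using that by (induction V rule: finite_induct) (simp_all add: trans_add trans_single qpaths_Nil)
  show "pr i (scal G 1) = scal (Q i) 1" "strip k (scal G 1) = 0"
   unfolding scal_def s[OF finite_verts]
   by (rule sum.mono_neutral_cong_right[OF finite_verts]; auto simp: verts_G) (rule refl)
  show "trace k (scal G 1) = (if k \<in> \<Gamma> then scal (Q (\<sigma> k)) 1 else 0)"
   using arcs_G tail_in_verts[of k] by (auto simp: trace_def lookup_scal[OF C.fin])
 qed
 have trace_PQ0: "trace k (conn l) = 0" "pr i (conn l) = 0" "strip k (conn l) = (if k = l then unit_at l else 0)" for k l i
  using arcs_disjoint[of i] head_component[of l]
  by (auto simp: trace_def conn_def arrow_def lookup_single scal_def trans_single trans_add subpath_Cons unit_at_def qpaths_Nil)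
 have beta_mult: "C.cs (conn k) \<otimes>\<^sub>R C.cs f = Iota (\<sigma> k) (Trace k (C.cs f)) \<otimes>\<^sub>R C.cs (conn k)" if "f \<in> C.PC" for f k
  using mult_conn[OF that, of k] that by (simp add: cs C.cos_eq_iff)
 have "glued_rings R S Pi Iota \<Gamma> component (\<lambda>k. C.cs (conn k)) (\<lambda>k. A.cs (\<sigma> k) (unit_at k)) Trace Strip C.radical T"
 proof (intro glued_rings.intro R_fl S_fl T fin_\<Gamma>)
  show "Pi i \<in> ring_hom R (S i)" for i
  proof (rule ring_hom_memI)
   fix x y assume xy: "x \<in> carrier R" "y \<in> carrier R"
   obtain f where f: "f \<in> C.PC" "x = C.cs f" using RE[OF xy(1)] by blast
   obtain g where g: "g \<in> C.PC" "y = C.cs g" using RE[OF xy(2)] by blast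
   show "Pi i x \<in> carrier (S i)" "Pi i (x \<otimes>\<^sub>R y) = Pi i x \<otimes>\<^bsub>S i\<^esub> Pi i y" "Pi i (x \<oplus>\<^sub>R y) = Pi i x \<oplus>\<^bsub>S i\<^esub> Pi i y"
    using f g by (simp_all add: cs pr_mult)
  qed (simp add: cs one)
 next
  fix i a assume "a \<in> carrier (S i)"
  then obtain f where f: "f \<in> PQ i" "a = A.cs i f" using SE by blast
  note fC = PQ_G[OF f(1)]
  show "Iota i a \<in> carrier R" using f fC by (simp add: cs)
  show "Strip k (Iota i a) = \<zero>\<^bsub>S (\<sigma> k)\<^esub>" for k using f fC by (simp add: cs strip_PQ)
  show "Pi j (Iota i a) = (if j = i then a else \<zero>\<^bsub>S j\<^esub>)" for j using f fC by (simp add: cs pr_PQ)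
  show "Iota i a \<otimes>\<^sub>R Iota j b = \<zero>\<^sub>R" if ij: "i \<noteq> j" and b: "b \<in> carrier (S j)" for j b
  proof -
   obtain g where "g \<in> PQ j" "b = A.cs j g" using SE[OF b] by blast
   then show ?thesis using f fC ij path_mult_off[of g j f i] PQ_G[of g j] by (simp add: cs)
  qed
  fix b assume "b \<in> carrier (S i)"
  then obtain g where g: "g \<in> PQ i" "b = A.cs i g" using SE by blast
  then show "Iota i (a \<oplus>\<^bsub>S i\<^esub> b) = Iota i a \<oplus>\<^sub>R Iota i b" "Iota i (a \<otimes>\<^bsub>S i\<^esub> b) = Iota i a \<otimes>\<^sub>R Iota i b"
   using f fC A.PC_closed(2)[of f i g] PQ_G[OF g(1)] by (simp_all add: cs)
 next
  have "finsum R (\<lambda>i. C.cs (scal (Q i) 1)) UNIV = C.cs (\<Sum>i\<in>UNIV. scal (Q i) 1)"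
   using C.cos_finsum[of UNIV "\<lambda>i. scal (Q i) 1"] PQ_G[OF sc(2)] by simp
  moreover have "(\<Sum>i\<in>UNIV. scal (Q i) (1::'k)) = scal G 1"
   unfolding scal_def verts_G using A.fin disjoint
   by (intro sum.UNION_disjoint[symmetric]) (auto simp: fin_digraph_def fin_digraph_axioms_def)
  ultimately show "finsum R (\<lambda>i. Iota i \<one>\<^bsub>S i\<^esub>) UNIV = \<one>\<^sub>R" by (simp add: cs)
 next
  fix k
  show "C.cs (conn k) \<in> carrier R" "A.cs (\<sigma> k) (unit_at k) \<in> carrier (S (\<sigma> k))" by (simp_all add: cs)
  have "unit_at k \<bullet>\<^sub>G unit_at k = unit_at k" by (simp add: unit_at_def path_algebra_single path_term_def path_algebra_zero)
  then show "A.cs (\<sigma> k) (unit_at k) \<otimes>\<^bsub>S (\<sigma> k)\<^esub> A.cs (\<sigma> k) (unit_at k) = A.cs (\<sigma> k) (unit_at k)" by (simp add: cs)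
  have "conn k \<bullet>\<^sub>G unit_at k = conn k" by (simp add: conn_def arrow_def unit_at_def path_algebra_single path_term_def path_algebra_zero)
  then show "Iota (\<sigma> k) (A.cs (\<sigma> k) (unit_at k)) \<otimes>\<^sub>R C.cs (conn k) = C.cs (conn k)" by (simp add: cs)
  show "A.cs (\<sigma> k) (unit_at k) = \<zero>\<^bsub>S (\<sigma> k)\<^esub>" if "k \<notin> \<Gamma>" using that by (simp add: unit_at_def cs)
  have "trace k (scal G 1) \<bullet>\<^sub>G unit_at k = unit_at k"
   using scal_single(1)[OF A.fin, of "(head G k, [])" "\<sigma> k" 1 1] unit_at_closed[of k]
   by (simp add: one unit_at_def scal_sub path_algebra_zero pa_simps(1) split: if_splits)
  then show "A.cs (\<sigma> k) (unit_at k) \<otimes>\<^bsub>S (\<sigma> k)\<^esub> Trace k \<one>\<^sub>R = A.cs (\<sigma> k) (unit_at k)" by (simp add: cs)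
  show "Strip k \<one>\<^sub>R = \<zero>\<^bsub>S (\<sigma> k)\<^esub>" by (simp add: cs one)
  show "Pi i (C.cs (conn k)) = \<zero>\<^bsub>S i\<^esub>" "Trace l (C.cs (conn k)) = \<zero>\<^bsub>S (\<sigma> l)\<^esub>"
   "Strip l (C.cs (conn k)) = (if l = k then A.cs (\<sigma> k) (unit_at k) else \<zero>\<^bsub>S (\<sigma> l)\<^esub>)" for i l
   by (simp_all add: cs trace_PQ0)
  fix r assume "r \<in> carrier R"
  then obtain f where f: "f \<in> C.PC" "r = C.cs f" using RE by blast
  show "Trace k r \<in> carrier (S (\<sigma> k))" "Strip k r \<in> carrier (S (\<sigma> k))" using f by (simp_all add: cs)
  show "Trace k r \<otimes>\<^bsub>S (\<sigma> k)\<^esub> A.cs (\<sigma> k) (unit_at k) = A.cs (\<sigma> k) (unit_at k) \<otimes>\<^bsub>S (\<sigma> k)\<^esub> Trace k r"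
  proof -
   have "trace k f \<bullet>\<^bsub>Q (\<sigma> k)\<^esub> unit_at k = unit_at k \<bullet>\<^bsub>Q (\<sigma> k)\<^esub> trace k f"
    by (simp add: trace_def scal_central[OF A.fin unit_at_closed] path_algebra_zero)
   then show ?thesis using f by (simp add: Trace_cos A.cos_simps(2) trans_closed unit_at_closed)
  qed
  show "Strip k r \<otimes>\<^bsub>S (\<sigma> k)\<^esub> A.cs (\<sigma> k) (unit_at k) = Strip k r" using f by (simp add: cs unit_at_strip)
  show "C.cs (conn k) \<otimes>\<^sub>R r = Iota (\<sigma> k) (Trace k r) \<otimes>\<^sub>R C.cs (conn k)" using f beta_mult by simp
  fix s assume "s \<in> carrier R"
  then obtain g where g: "g \<in> C.PC" "s = C.cs g" using RE by blast
  show "Trace k (r \<oplus>\<^sub>R s) = Trace k r \<oplus>\<^bsub>S (\<sigma> k)\<^esub> Trace k s" "Strip k (r \<oplus>\<^sub>R s) = Strip k r \<oplus>\<^bsub>S (\<sigma> k)\<^esub> Strip k s"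
   "Trace k (r \<otimes>\<^sub>R s) = Trace k r \<otimes>\<^bsub>S (\<sigma> k)\<^esub> Trace k s"
   using f g by (simp_all add: cs trace_mult)
  show "Strip k (r \<otimes>\<^sub>R s) = Strip k r \<otimes>\<^bsub>S (\<sigma> k)\<^esub> Trace k s \<oplus>\<^bsub>S (\<sigma> k)\<^esub> Pi (\<sigma> k) r \<otimes>\<^bsub>S (\<sigma> k)\<^esub> Strip k s"
   using f g by (simp add: cs strip_mult)
 next
  fix r assume "r \<in> carrier R"
  then obtain f where f: "f \<in> C.PC" "r = C.cs f" using RE by blast
  have a: "finsum R (\<lambda>i. Iota i (Pi i r)) UNIV = C.cs (\<Sum>i\<in>UNIV. pr i f)" "(\<Sum>i\<in>UNIV. pr i f) \<in> C.PC"
   using C.cos_finsum[of UNIV "\<lambda>i. pr i f"] PQ_G[OF trans_closed(1)] f by (simp_all add: cs)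
  have "finsum R (\<lambda>k. Iota (\<sigma> k) (Strip k r) \<otimes>\<^sub>R C.cs (conn k)) \<Gamma> = finsum R (\<lambda>k. C.cs (conn k \<bullet>\<^sub>G strip k f)) \<Gamma>"
   using f by (intro C.R.finsum_cong') (auto simp: cs)
  then have b: "finsum R (\<lambda>k. Iota (\<sigma> k) (Strip k r) \<otimes>\<^sub>R C.cs (conn k)) \<Gamma> = C.cs (\<Sum>k\<in>\<Gamma>. conn k \<bullet>\<^sub>G strip k f)"
   "(\<Sum>k\<in>\<Gamma>. conn k \<bullet>\<^sub>G strip k f) \<in> C.PC"
   using C.cos_finsum[OF fin_\<Gamma>, of "\<lambda>k. conn k \<bullet>\<^sub>G strip k f"] by (simp_all add: cs)
  have "(\<Sum>k\<in>\<Gamma>. conn k \<bullet>\<^sub>G strip k f) = (\<Sum>k\<in>\<Gamma>. arrow G k \<bullet>\<^sub>G strip k f)" by (simp add: conn_def)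
  then show "r = finsum R (\<lambda>i. Iota i (Pi i r)) UNIV \<oplus>\<^sub>R finsum R (\<lambda>k. Iota (\<sigma> k) (Strip k r) \<otimes>\<^sub>R C.cs (conn k)) \<Gamma>"
   unfolding a(1) b(1) unfolding f(2) using decompose[OF f(1)] a(2) b(2) f(1) by (simp add: cs C.cos_eq_iff)
 next
  show rad: "C.radical \<subseteq> carrier R" by (auto simp: C.radical_def cs)
  fix r k assume "r \<in> C.radical"
  then obtain f where f: "f \<in> C.PC" "r = C.cs f" "\<And>v. coef f (v, []) = 0" unfolding C.radical_def by blast
  have "trace k f = 0" by (simp add: trace_def f(3) scal_def)
  then show "C.cs (conn k) \<otimes>\<^sub>R r = \<zero>\<^sub>R" using f beta_mult[OF f(1), of k] by (simp add: cs path_algebra_zero)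
 qed (rule split_algebra.killed_complement[OF B]; assumption)
 then show thesis by (rule that)
qed

end

lemma genideal_eqI:
 assumes "ring R" "A \<subseteq> carrier R" "B \<subseteq> carrier R" "A \<subseteq> Idl\<^bsub>R\<^esub> B" "B \<subseteq> Idl\<^bsub>R\<^esub> A"
 shows "Idl\<^bsub>R\<^esub> A = Idl\<^bsub>R\<^esub> B"
proof -
 interpret ring R by fact
 show ?thesis using genideal_minimal[OF genideal_ideal] assms by blast
qed

theorem proposition3p6:
  fixes Q\<^sub>A Q\<^sub>B Q\<^sub>C :: "('v, 'e) quiver"
    and I\<^sub>A I\<^sub>B I\<^sub>C :: "('v, 'e, 'k::field) qelem set"
    and J :: "'j set" and K :: "'l set"
    and \<alpha> :: "'j \<Rightarrow> 'e" and \<beta> :: "'l \<Rightarrow> 'e"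
    and n :: nat
  assumes "bound_quiver Q\<^sub>A I\<^sub>A" "bound_quiver Q\<^sub>B I\<^sub>B" "bound_quiver Q\<^sub>C I\<^sub>C"
    and vertices: "verts Q\<^sub>C = verts Q\<^sub>A \<union> verts Q\<^sub>B" "verts Q\<^sub>A \<inter> verts Q\<^sub>B = {}"
    and arrows: "arcs Q\<^sub>C = arcs Q\<^sub>A \<union> arcs Q\<^sub>B \<union> \<alpha> ` J \<union> \<beta> ` K"
      "arcs Q\<^sub>A \<inter> arcs Q\<^sub>B = {}"
      "(arcs Q\<^sub>A \<union> arcs Q\<^sub>B) \<inter> (\<alpha> ` J \<union> \<beta> ` K) = {}"
      "\<alpha> ` J \<inter> \<beta> ` K = {}"
      "inj_on \<alpha> J" "inj_on \<beta> K"
    and subquivers: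
      "\<And>a. a \<in> arcs Q\<^sub>A \<Longrightarrow> tail Q\<^sub>C a = tail Q\<^sub>A a \<and> head Q\<^sub>C a = head Q\<^sub>A a"
      "\<And>b. b \<in> arcs Q\<^sub>B \<Longrightarrow> tail Q\<^sub>C b = tail Q\<^sub>B b \<and> head Q\<^sub>C b = head Q\<^sub>B b"
    and connecting_arrows:
      "\<And>j. j \<in> J \<Longrightarrow> tail Q\<^sub>C (\<alpha> j) \<in> verts Q\<^sub>A \<and> head Q\<^sub>C (\<alpha> j) \<in> verts Q\<^sub>B"
      "\<And>k. k \<in> K \<Longrightarrow> tail Q\<^sub>C (\<beta> k) \<in> verts Q\<^sub>B \<and> head Q\<^sub>C (\<beta> k) \<in> verts Q\<^sub>A"
    and relations: "I\<^sub>C = Idl\<^bsub>path_algebra Q\<^sub>C\<^esub> (I\<^sub>A \<union> I\<^sub>B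
      \<union> {arrow Q\<^sub>C a \<otimes>\<^bsub>path_algebra Q\<^sub>C\<^esub> arrow Q\<^sub>C (\<alpha> j) | a j. a \<in> arcs Q\<^sub>A \<and> j \<in> J}
      \<union> {arrow Q\<^sub>C b \<otimes>\<^bsub>path_algebra Q\<^sub>C\<^esub> arrow Q\<^sub>C (\<beta> k) | b k. b \<in> arcs Q\<^sub>B \<and> k \<in> K}
      \<union> {arrow Q\<^sub>C (\<alpha> j) \<otimes>\<^bsub>path_algebra Q\<^sub>C\<^esub> arrow Q\<^sub>C (\<beta> k) | j k. j \<in> J \<and> k \<in> K}
      \<union> {arrow Q\<^sub>C (\<beta> k) \<otimes>\<^bsub>path_algebra Q\<^sub>C\<^esub> arrow Q\<^sub>C (\<alpha> j) | j k. j \<in> J \<and> k \<in> K})"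
  shows "(n_Igusa_Todorov n (op_ring (bound_quiver_algebra Q\<^sub>A I\<^sub>A)) \<and>
          n_Igusa_Todorov n (op_ring (bound_quiver_algebra Q\<^sub>B I\<^sub>B)) \<longrightarrow>
          n_Igusa_Todorov (n + 1) (op_ring (bound_quiver_algebra Q\<^sub>C I\<^sub>C)))
       \<and> (n_LIT n (op_ring (bound_quiver_algebra Q\<^sub>A I\<^sub>A)) \<and>
          n_LIT n (op_ring (bound_quiver_algebra Q\<^sub>B I\<^sub>B)) \<longrightarrow>
          n_LIT (n + 1) (op_ring (bound_quiver_algebra Q\<^sub>C I\<^sub>C)))"
proof -
 define Q where "Q i = (if i then Q\<^sub>A else Q\<^sub>B)" for i
 define I where "I i = (if i then I\<^sub>A else I\<^sub>B)" for i
 let ?\<Gamma> = "\<alpha> ` J \<union> \<beta> ` K" and ?P = "path_algebra Q\<^sub>C :: ('v, 'e, 'k) qelem ring"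
 note bpa = assms(1-3)[THEN bound_quiver_bound_path_algebra]
 interpret QA: bound_path_algebra Q\<^sub>A I\<^sub>A by (rule bpa)
 interpret QB: bound_path_algebra Q\<^sub>B I\<^sub>B by (rule bpa)
 interpret QC: bound_path_algebra Q\<^sub>C I\<^sub>C by (rule bpa)
 interpret AQ: fin_digraph Q\<^sub>A by (rule QA.fin)
 interpret BQ: fin_digraph Q\<^sub>B by (rule QB.fin)
 interpret CQ: fin_digraph Q\<^sub>C by (rule QC.fin)
 let ?gens = "I\<^sub>A \<union> I\<^sub>B
   \<union> {arrow Q\<^sub>C a \<otimes>\<^sub>?P arrow Q\<^sub>C (\<alpha> j) | a j. a \<in> arcs Q\<^sub>A \<and> j \<in> J}
   \<union> {arrow Q\<^sub>C b \<otimes>\<^sub>?P arrow Q\<^sub>C (\<beta> k) | b k. b \<in> arcs Q\<^sub>B \<and> k \<in> K}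
   \<union> {arrow Q\<^sub>C (\<alpha> j) \<otimes>\<^sub>?P arrow Q\<^sub>C (\<beta> k) | j k. j \<in> J \<and> k \<in> K}
   \<union> {arrow Q\<^sub>C (\<beta> k) \<otimes>\<^sub>?P arrow Q\<^sub>C (\<alpha> j) | j k. j \<in> J \<and> k \<in> K}"
 let ?gens' = "(\<Union>i. I i) \<union> {arrow Q\<^sub>C a \<otimes>\<^sub>?P arrow Q\<^sub>C k | a k. a \<in> arcs Q\<^sub>C \<and> k \<in> ?\<Gamma>}"
 have UN: "(\<Union>i. I i) = I\<^sub>A \<union> I\<^sub>B" by (auto simp: I_def split: if_splits)
 have path_C: "(u, p) \<in> qpaths Q\<^sub>C" if "(u, p) \<in> qpaths Q\<^sub>A \<or> (u, p) \<in> qpaths Q\<^sub>B" for u p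
  using that
 proof (induction p arbitrary: u)
  case (Cons a p)
  then show ?case using subquivers arrows(1)
   by (auto simp: qpaths_Cons[OF AQ.wf_digraph] qpaths_Cons[OF BQ.wf_digraph] qpaths_Cons[OF CQ.wf_digraph])
 qed (auto simp: qpaths_Nil vertices)
 have "I\<^sub>A \<union> I\<^sub>B \<subseteq> carrier ?P"
  using QA.I_closed(3) QB.I_closed(3) path_C by (auto simp: subset_eq)
 moreover have arrow_C: "arrow Q\<^sub>C a \<in> carrier ?P" if "a \<in> arcs Q\<^sub>C" for a
  using that by (simp add: arrow_def qpaths_Cons[OF CQ.wf_digraph] qpaths_Nil)
 ultimately have gens'_C: "?gens' \<subseteq> carrier ?P" using arrows(1) unfolding UN by (auto simp del: pa_simps)
 have gens_gens': "?gens \<subseteq> ?gens'" unfolding UN using arrows(1) by blast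
 then have gens_C: "?gens \<subseteq> carrier ?P" using gens'_C by (rule subset_trans)
 have zero: "arrow Q\<^sub>C a \<otimes>\<^sub>?P arrow Q\<^sub>C b = \<zero>\<^sub>?P" if "head Q\<^sub>C a \<noteq> tail Q\<^sub>C b" for a b
  using that by (simp add: arrow_def path_algebra_single path_term_def)
 have "arrow Q\<^sub>C a \<otimes>\<^sub>?P arrow Q\<^sub>C k \<in> ?gens \<union> {\<zero>\<^sub>?P}" if a: "a \<in> arcs Q\<^sub>C" and k: "k \<in> ?\<Gamma>" for a k
 proof (cases "head Q\<^sub>C a = tail Q\<^sub>C k")
  case True
  \<comment> \<open>a composable pair ending in a connecting arrow is one of the listed ones, as the start of this arrow
   determines the kind of the first arrow\<close>
  have h: "head Q\<^sub>C a \<in> verts Q\<^sub>A" if "a \<in> arcs Q\<^sub>A" using that subquivers(1) AQ.head_in_verts by simp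
  have h': "head Q\<^sub>C a \<in> verts Q\<^sub>B" if "a \<in> arcs Q\<^sub>B" using that subquivers(2) BQ.head_in_verts by simp
  show ?thesis using k
  proof
   assume "k \<in> \<alpha> ` J"
   then obtain j where j: "j \<in> J" "k = \<alpha> j" by blast
   then have "head Q\<^sub>C a \<notin> verts Q\<^sub>B" using True connecting_arrows(1)[of j] vertices(2) by auto
   then have "a \<notin> arcs Q\<^sub>B" "a \<notin> \<alpha> ` J" using h' connecting_arrows(1) by auto
   then have "a \<in> arcs Q\<^sub>A \<or> a \<in> \<beta> ` K" using a arrows(1) by simp
   then show ?thesis using j by blast
  next
   assume "k \<in> \<beta> ` K"
   then obtain j where j: "j \<in> K" "k = \<beta> j" by blast
   then have "head Q\<^sub>C a \<notin> verts Q\<^sub>A" using True connecting_arrows(2)[of j] vertices(2) by auto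
   then have "a \<notin> arcs Q\<^sub>A" "a \<notin> \<beta> ` K" using h connecting_arrows(2) by auto
   then have "a \<in> arcs Q\<^sub>B \<or> a \<in> \<alpha> ` J" using a arrows(1) by simp
   then show ?thesis using j by blast
  qed
 qed (simp add: zero)
 then have gens'_gens: "?gens' \<subseteq> ?gens \<union> {\<zero>\<^sub>?P}" unfolding UN by blast
 have "\<zero>\<^sub>?P \<in> Idl\<^bsub>?P\<^esub> ?gens"
  by (rule additive_subgroup.zero_closed[OF ideal.axioms(1)[OF QC.P.genideal_ideal[OF gens_C]]])
 then have "{\<zero>\<^sub>?P} \<subseteq> Idl\<^bsub>?P\<^esub> ?gens" by simp
 from subset_trans[OF gens'_gens Un_least[OF QC.P.genideal_self[OF gens_C] this]]
 have "Idl\<^bsub>?P\<^esub> ?gens = Idl\<^bsub>?P\<^esub> ?gens'"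
  by (rule genideal_eqI[OF QC.P.ring_axioms gens_C gens'_C subset_trans[OF gens_gens' QC.P.genideal_self[OF gens'_C]]])
 then have IC: "I\<^sub>C = Idl\<^bsub>?P\<^esub> ?gens'" unfolding relations .
 interpret g: glued_quivers Q I Q\<^sub>C I\<^sub>C ?\<Gamma>
 proof (rule glued_quivers.intro)
  show "bound_path_algebra (Q i) (I i)" for i using bpa by (simp add: Q_def I_def)
  show "verts Q\<^sub>C = (\<Union>i. verts (Q i))" by (simp add: vertices(1) Q_def UNIV_bool Un_commute)
  show "verts (Q i) \<inter> verts (Q j) = {}" if "i \<noteq> j" for i j using that vertices(2) by (auto simp: Q_def)
  show "arcs Q\<^sub>C = (\<Union>i. arcs (Q i)) \<union> ?\<Gamma>" by (simp add: arrows(1) Q_def UNIV_bool Un_ac)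
  show "arcs (Q i) \<inter> ?\<Gamma> = {}" for i using arrows(3) by (auto simp: Q_def)
  show "tail Q\<^sub>C a = tail (Q i) a \<and> head Q\<^sub>C a = head (Q i) a" if "a \<in> arcs (Q i)" for a i
   using that subquivers(1)[of a] subquivers(2)[of a] by (cases i) (simp_all add: Q_def)
 qed (rule bpa IC)+
 obtain T where "glued_rings (op_ring (bound_quiver_algebra Q\<^sub>C I\<^sub>C)) (\<lambda>i. op_ring (bound_quiver_algebra (Q i) (I i)))
  g.Pi g.Iota ?\<Gamma> g.component (\<lambda>k. QC.cs (g.conn k)) (\<lambda>k. quiver_coset (Q (g.component k)) (I (g.component k)) (g.unit_at k)) g.Trace g.Strip QC.radical T"
  by (rule g.glued_rings_interpretation)
 then interpret glued: glued_rings "op_ring (bound_quiver_algebra Q\<^sub>C I\<^sub>C)" "\<lambda>i. op_ring (bound_quiver_algebra (Q i) (I i))"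
  g.Pi g.Iota ?\<Gamma> g.component "\<lambda>k. QC.cs (g.conn k)" "\<lambda>k. quiver_coset (Q (g.component k)) (I (g.component k)) (g.unit_at k)" g.Trace g.Strip QC.radical T .
 show ?thesis
  using glued.n_Igusa_Todorov_glue[of n] glued.n_LIT_glue[of n] by (auto simp: Q_def I_def)
qed

end
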